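(* Let $u\in\widetilde H^{s}(\Omega)$ and let $\widetilde u_h\in\mathbb{V}_h$ satisfy the local Galerkin orthogonality relation $$(u-\widetilde u_h, v_h)_s=0\qquad \forall\, v_h\in\mathbb{V}_h(B_R),$$ where $B_R=B(x_0,R)\subset\Omega$. If $16\,h_R\le R$, then there exists a constant $C$, depending on the shape-regularity constant $\sigma$ (and on the fixed quantities $d$ and $s$), such that for any $v_h\in\mathbb{V}_h$, $$\begin{aligned} |u-\widetilde u_h|^2_{H^s(B_{R/2})}\le\ & C\,|u-v_h|^2_{H^s(B_R)}+\frac{C}{R^{2s}}\|u-v_h\|_{L^2(B_{R})}^2 +C R^{d+2s}\left(\int_{B_R^c}\frac{|u(x)-v_h(x)|}{|x-x_0|^{d+2s}}\,dx\right)^2\\ &+\frac{C}{R^{2s}}\|u-\widetilde u_h\|_{L^2(B_{R})}^2 +C R^{d+2s}\left(\int_{B_R^c}\frac{|u(x)-\widetilde u_h(x)|}{|x-x_0|^{d+2s}}\,dx\right)^2 . \end{aligned}$$ The constant $C$ does not depend on $u$, $\widetilde u_h$, $v_h$, $x_0$, $R$, or the mesh (other than through $\sigma$).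
   Context: Fix $d\ge 1$, $s\in(0,1)$ and a bounded domain $\Omega\subset\mathbb{R}^d$. Spaces and forms. For $v,w\in H^s(\mathbb{R}^d)$, $$(v,w)_s:=\frac{C_{d,s}}2\int_{\mathbb{R}^d}\int_{\mathbb{R}^d}\frac{(v(x)-v(y))(w(x)-w(y))}{|x-y|^{d+2s}}\,dy\,dx,\qquad C_{d,s}=\frac{2^{2s}s\,\Gamma(s+\frac d2)}{\pi^{d/2}\Gamma(1-s)}.$$ $\widetilde H^s(\Omega):=\{v\in H^s(\mathbb{R}^d):\operatorname{supp} v\subset\overline\Omega\}$. For a subdomain $D\subset\mathbb{R}^d$, $|v|_{H^s(D)}^2:=\int_D\int_D\frac{|v(x)-v(y)|^2}{|x-y|^{d+2s}}\,dy\,dx$ (multiplicative constants depending only on $d,s$ are omitted). Meshes. $\{\mathcal T_h\}_{h>0}$ is a family of triangulations (in the usual finite element sense) of $\Omega$, i.e. partitions of $\Omega$ into closed simplices $T$; $h_T=\operatorname{diam}(T)$, $\rho_T$ is the diameter of the largest ball contained in $T$, $h=\max_T h_T$. The family is shape-regular: $\sigma:=\sup_{h>0}\max_{T\in\mathcal T_h}h_T/\rho_T<\infty$. No quasi-uniformity is assumed. $\mathbb{V}_h$ is the space of continuous functions that are affine on each $T\in\mathcal T_h$ and vanish on $\partial\Omega$ (extended by zero to $\mathbb{R}^d$). Local objects. $x_0\in\Omega$, $R>0$, $B_R:=B(x_0,R)\subset\Omega$, $B_{R/2}:=B(x_0,R/2)$, $B_R^c:=\mathbb{R}^d\setminus B_R$.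 $\Lambda_R:=\{T\in\mathcal T_h: T\cap B_R\ne\emptyset\}$ and $h_R:=\max_{T\in\Lambda_R}h_T$. $\mathbb{V}_h(B_R):=\mathbb{V}_h\cap H^1_0(B_R)$ (functions of $\mathbb{V}_h$ vanishing outside $B_R$). *)

theory Defs
  imports "HOL-Analysis.Analysis"
begin

text \<open>
  The dimension \<open>d\<close> is \<open>DIM('a)\<close>, which is always at least 1.
  Squared norms and seminorms take values in \<^typ>\<open>ennreal\<close>, so that no junk value can
  stand for a divergent integral. The kernels below are quotients with denominator 0 on the
  diagonal, where they evaluate to 0; the diagonal is a null set.
\<close>

section \<open>Fractional Sobolev spaces\<close>

definition L2_norm_sq :: "'a::euclidean_space set \<Rightarrow> ('a \<Rightarrow> real) \<Rightarrow> ennreal" where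
  "L2_norm_sq D v = (\<integral>\<^sup>+x\<in>D. ennreal ((v x)\<^sup>2) \<partial>lebesgue)"

definition Hs_seminorm_sq :: "real \<Rightarrow> 'a::euclidean_space set \<Rightarrow> ('a \<Rightarrow> real) \<Rightarrow> ennreal" where
  "Hs_seminorm_sq s D v =
     (\<integral>\<^sup>+x\<in>D. (\<integral>\<^sup>+y\<in>D. ennreal (\<bar>v x - v y\<bar>\<^sup>2 / norm (x - y) powr (real DIM('a) + 2 * s))
        \<partial>lebesgue) \<partial>lebesgue)"

definition Hs_space :: "real \<Rightarrow> ('a::euclidean_space \<Rightarrow> real) set" where
  "Hs_space s = {v \<in> borel_measurable lebesgue. L2_norm_sq UNIV v < \<infinity> \<and> Hs_seminorm_sq s UNIV v < \<infinity>}"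

text \<open>The support of an a.e.-equivalence class: the complement of the largest open set on which
  the function vanishes almost everywhere.\<close>

definition ess_supp :: "('a::euclidean_space \<Rightarrow> real) \<Rightarrow> 'a set" where
  "ess_supp v = - \<Union>{U. open U \<and> (AE x in lebesgue. x \<in> U \<longrightarrow> v x = 0)}"

definition Hs_tilde :: "real \<Rightarrow> 'a::euclidean_space set \<Rightarrow> ('a \<Rightarrow> real) set" where
  "Hs_tilde s \<Omega> = {v \<in> Hs_space s. ess_supp v \<subseteq> closure \<Omega>}"

definition frac_const :: "'a::euclidean_space itself \<Rightarrow> real \<Rightarrow> real" where
  "frac_const _ s =
     2 powr (2 * s) * s * Gamma (s + real DIM('a) / 2) / (pi powr (real DIM('a) / 2) * Gamma (1 - s))"

text \<open>For \<open>v\<close> and \<open>w\<close> in \<^term>\<open>Hs_space s\<close> the double integral converges absolutely.\<close>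

definition Hs_form :: "real \<Rightarrow> ('a::euclidean_space \<Rightarrow> real) \<Rightarrow> ('a \<Rightarrow> real) \<Rightarrow> real" where
  "Hs_form s v w = frac_const TYPE('a) s / 2 *
     (LINT x|lebesgue. LINT y|lebesgue.
        (v x - v y) * (w x - w y) / norm (x - y) powr (real DIM('a) + 2 * s))"

section \<open>Meshes and finite element spaces\<close>

text \<open>The library predicate \<^const>\<open>triangulation\<close> says that the set is finite, consists of
  simplices, and that any two of them meet in a (possibly empty) common face.\<close>

definition mesh :: "'a::euclidean_space set \<Rightarrow> 'a set set \<Rightarrow> bool" where
  "mesh \<Omega> Th \<longleftrightarrow> triangulation Th \<and> (\<forall>T\<in>Th. int DIM('a) simplex T) \<and> \<Union>Th = closure \<Omega>"

definition inball_diameter :: "'a::euclidean_space set \<Rightarrow> real" where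
  "inball_diameter T = Sup {diameter (cball c r) |c r. cball c r \<subseteq> T}"

text \<open>A family of meshes is given by the set of its members. The supremum is taken in
  \<^typ>\<open>ereal\<close>; the family is shape-regular iff it is finite.\<close>

definition shape_const :: "'a::euclidean_space set set set \<Rightarrow> ereal" where
  "shape_const \<T> = (SUP Th\<in>\<T>. SUP T\<in>Th. ereal (diameter T / inball_diameter T))"

definition fe_space :: "'a::euclidean_space set \<Rightarrow> 'a set set \<Rightarrow> ('a \<Rightarrow> real) set" where
  "fe_space \<Omega> Th = {v. continuous_on (closure \<Omega>) v
     \<and> (\<forall>T\<in>Th. \<exists>a c. \<forall>x\<in>T. v x = a \<bullet> x + c)
     \<and> (\<forall>x\<in>frontier \<Omega>. v x = 0) \<and> (\<forall>x. x \<notin> closure \<Omega> \<longrightarrow> v x = 0)}"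

definition fe_space_local ::
    "'a::euclidean_space set \<Rightarrow> 'a set set \<Rightarrow> 'a set \<Rightarrow> ('a \<Rightarrow> real) set" where
  "fe_space_local \<Omega> Th B = {v \<in> fe_space \<Omega> Th. \<forall>x. x \<notin> B \<longrightarrow> v x = 0}"

definition local_mesh_size :: "'a::euclidean_space set set \<Rightarrow> 'a set \<Rightarrow> real" where
  "local_mesh_size Th B = Max (diameter ` {T \<in> Th. T \<inter> B \<noteq> {}})"

end

theory Submission imports Defs begin

text \<open>
  For a function \<open>v\<close> write \<open>\<delta>v(x,y) = v x - v y\<close>. Put \<open>f
  = u - vh\<close> and \<open>w = uh - vh\<close>, so that \<open>u - uh = f - w\<close>. The
  energy of \<open>f\<close> is one of the terms allowed on the right, hence everything reduces
  to bounding the energy of the discrete function \<open>w\<close> on the half ball. This is a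
  Caccioppoli argument: one tests the orthogonality relation with a discrete function
  \<open>\<phi>\<close> supported in the ball of radius \<open>7/8 R\<close> for which
  \<open>\<delta>w \<delta>\<phi>\<close> is bounded below by half of an energy density
  \<open>e\<close> that controls \<open>w\<close> on the half ball, up to a small remainder.
  The predicate \<open>good_test\<close> lists what \<open>\<phi>\<close> has to satisfy.

  Given such a \<open>\<phi>\<close>, the rest is the same in all dimensions
  (\<open>galerkin_energy_bound\<close>, \<open>local_energy_estimate\<close>). The double
  integral of \<open>\<delta>(u - uh) \<delta>\<phi>\<close> against the kernel vanishes. On
  the pairs of points in the ball \<open>B1\<close> of radius \<open>15/16 R\<close> one
  inserts \<open>\<delta>(u - uh) = \<delta>f - \<delta>w\<close> and absorbs \<open>\<delta>f
  \<delta>\<phi>\<close> by Young's inequality. All other pairs that contribute join the ball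
  of radius \<open>7/8 R\<close> to the complement of \<open>B1\<close>. Their distance is at
  least \<open>R/16\<close>, so there the kernel is integrable and only masses appear; for a
  second point outside the ball of radius \<open>R\<close> the kernel is comparable to its
  value at the centre, which produces the tail (\<open>cross_bound\<close>,
  \<open>tail_pairing\<close>).

  The difficulty is to find \<open>\<phi>\<close>, because \<open>\<eta>\<^sup>2 w\<close> with
  a cutoff \<open>\<eta>\<close> is not discrete and the mesh need not be quasi-uniform. In
  dimension at least two \<open>\<phi>\<close> is the nodal interpolant of
  \<open>\<eta>\<^sup>2 w\<close>, and \<open>e\<close> is the squared difference of the
  interpolant of \<open>\<eta> w\<close> (\<open>good_test_multi\<close>). An algebraic
  identity expresses the defect \<open>\<delta>w \<delta>\<phi> - e\<close> through products of
  hat function differences and differences of nodal values of \<open>\<eta>\<close>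
  (\<open>weighted_square_identity\<close>). These products are at most a multiple of \<open>|x
  - y| / R\<close>, because elements with a common vertex have comparable diameters
  (\<open>star_comparable\<close>): a punctured ball is connected, so one can walk around a
  vertex through elements that share a further point, and shape regularity bounds both the
  length of the walk and the growth of the diameters along it.

  In dimension one shape regularity says nothing about neighbouring elements, and hat functions
  may have very different slopes on their two sides. There \<open>w\<close> is cut off sharply
  instead. Between two nodes \<open>zl\<close> and \<open>zr\<close> one subtracts the affine
  function with the same values as \<open>w\<close> at these nodes, and extends the difference
  by zero; the result is again discrete. The error comes from the pairs that straddle
  \<open>zl\<close> or \<open>zr\<close>, and for a fixed node it need not be controlled by the
  energy uniformly in the mesh. Averaged over a suitable probability measure on the nodes it
  can (\<open>cut_err_bound\<close>), so \<open>\<phi>\<close> is the average of the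
  truncations (\<open>good_test_line\<close>).
\<close>

section \<open>Double integrals against the fractional kernel\<close>

lemma sigma_finite_lebesgue: "sigma_finite_measure (lebesgue :: 'a::euclidean_space measure)"
proof -
  obtain A :: "'a set set" where A: "countable A" "A \<subseteq> sets lborel" "\<Union>A = space lborel"
      "\<And>a. a \<in> A \<Longrightarrow> emeasure lborel a \<noteq> \<infinity>"
    using lborel.sigma_finite_countable by metis
  show ?thesis
    by (rule sigma_finite_measure.intro, rule exI[of _ A]) (use A in \<open>auto simp: emeasure_completion\<close>)
qed

interpretation leb: sigma_finite_measure "lebesgue :: 'a::euclidean_space measure"
  by (rule sigma_finite_lebesgue)

interpretation leb2: pair_sigma_finite
  "lebesgue :: 'a::euclidean_space measure" "lebesgue :: 'a measure" ..

abbreviation leb_pair :: "('a::euclidean_space \<times> 'a) measure" where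
  "leb_pair \<equiv> lebesgue \<Otimes>\<^sub>M lebesgue"

lemma borel_measurable_leb_pair_fst [measurable]:
  "(\<lambda>p. fst p) \<in> borel_measurable (leb_pair :: ('a::euclidean_space \<times> 'a) measure)"
proof -
  have "(\<lambda>x. x) \<circ> fst \<in> borel_measurable (leb_pair :: ('a \<times> 'a) measure)"
    by (rule measurable_comp[where N=lebesgue]) (auto intro: measurable_completion)
  then show ?thesis by (simp add: o_def)
qed

lemma borel_measurable_leb_pair_snd [measurable]:
  "(\<lambda>p. snd p) \<in> borel_measurable (leb_pair :: ('a::euclidean_space \<times> 'a) measure)"
proof -
  have "(\<lambda>x. x) \<circ> snd \<in> borel_measurable (leb_pair :: ('a \<times> 'a) measure)"
    by (rule measurable_comp[where N=lebesgue]) (auto intro: measurable_completion)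
  then show ?thesis by (simp add: o_def)
qed

definition kern :: "real \<Rightarrow> 'a::euclidean_space \<Rightarrow> 'a \<Rightarrow> real" where
  "kern s x y = 1 / norm (x - y) powr (real DIM('a) + 2 * s)"

lemma kern_nonneg [simp]: "0 \<le> kern s x y"
  by (simp add: kern_def)

lemma kern_commute: "kern s x y = kern s y x"
  by (simp add: kern_def norm_minus_commute)

lemma kern_measurable [measurable]:
  "(\<lambda>p. kern s (fst p) (snd p)) \<in> borel_measurable (leb_pair :: ('a::euclidean_space \<times> 'a) measure)"
  unfolding kern_def by measurable

lemma kern_measurable1 [measurable]:
  "(\<lambda>y. kern s x y) \<in> borel_measurable (lebesgue :: 'a::euclidean_space measure)"
proof -
  have "(\<lambda>y::'a. kern s x y) \<in> borel_measurable borel"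
    unfolding kern_def by measurable
  then show ?thesis by (intro measurable_completion) simp
qed

lemma kern_le:
  fixes x y :: "'a::euclidean_space"
  assumes "0 < s" "0 < c" "0 < r" "r \<le> c * norm (x - y)"
  shows "kern s x y \<le> c powr (real DIM('a) + 2 * s) * r powr - (real DIM('a) + 2 * s)"
proof -
  let ?p = "real DIM('a) + 2 * s"
  have p: "0 < ?p" using assms by (simp add: add_pos_pos)
  have n: "r / c \<le> norm (x - y)" "0 < r / c"
    using assms by (auto simp: field_simps)
  then have "(r / c) powr ?p \<le> norm (x - y) powr ?p"
    using p by (intro powr_mono2) auto
  moreover have pp: "0 < (r/c) powr ?p" using assms by simp
  ultimately have "kern s x y \<le> 1 / (r / c) powr ?p"
    unfolding kern_def using pp
    by (intro divide_left_mono mult_pos_pos) (linarith | simp)+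
  also have "\<dots> = c powr ?p * r powr - ?p"
    using assms by (subst powr_minus) (simp add: powr_divide field_simps)
  finally show ?thesis .
qed

lemma emeasure_lebesgue_ball:
  "0 \<le> r \<Longrightarrow> emeasure lebesgue (ball (c::'a::euclidean_space) r) = ennreal (unit_ball_vol (DIM('a)) * r ^ DIM('a))"
  by (simp add: emeasure_ball)

lemma term_le_suminf: "f n \<le> suminf (f :: nat \<Rightarrow> ennreal)"
  using sum_le_suminf[of f "{n}"] by simp

text \<open>
  The complement of the ball is split into dyadic annuli; on each the kernel is at most its
  value at the inner radius, and the resulting bounds form a geometric series of ratio \<open>2
  powr - (2 * s)\<close>.
\<close>

lemma kern_far_integral:
  assumes s: "0 < s"
  shows "\<exists>C>0. \<forall>(x::'a::euclidean_space) r. 0 < r \<longrightarrow>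
    (\<integral>\<^sup>+y\<in>- ball x r. ennreal (kern s x y) \<partial>lebesgue) \<le> ennreal (C * r powr - (2 * s))"
proof -
  let ?d = "DIM('a)" let ?p = "real ?d + 2 * s"
  let ?w = "unit_ball_vol (real ?d)"
  define q where "q = (2::real) powr - (2 * s)"
  have q: "0 < q" "q < 1"
    using s by (auto simp: q_def powr_less_one)
  define C where "C = ?w * 2 ^ ?d * (1 / (1 - q))"
  have w: "0 < ?w" by simp
  have C: "0 < C" using q w unfolding C_def by (simp)
  have "(\<integral>\<^sup>+y\<in>- ball x r. ennreal (kern s x y) \<partial>lebesgue) \<le> ennreal (C * r powr - (2 * s))"
    if r: "0 < r" for x :: 'a and r
  proof -
    let ?f = "\<lambda>n y. ennreal ((2^n * r) powr - ?p) * indicator (ball x (2^Suc n * r)) y"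
    have meas: "?f n \<in> borel_measurable lebesgue" for n
      by (intro borel_measurable_times_ennreal borel_measurable_indicator borel_measurable_const) simp
    have pt: "ennreal (kern s x y) * indicator (- ball x r) y \<le> (\<Sum>n. ?f n y)" for y
    proof (cases "y \<in> - ball x r")
      case True
      then have yr: "r \<le> norm (x - y)" by (simp add: dist_norm)
      define n where "n = nat \<lfloor>log 2 (norm (x - y) / r)\<rfloor>"
      have l0: "0 \<le> log 2 (norm (x - y) / r)" using yr r by (subst zero_le_log_cancel_iff) (auto simp: field_simps)
      have "real n \<le> log 2 (norm (x - y) / r)" "log 2 (norm (x - y) / r) < real (Suc n)"
        unfolding n_def using l0 by linarith+
      moreover have npos: "0 < norm (x - y) / r" using yr r by (intro divide_pos_pos) linarith+
      ultimately have "2 powr real n \<le> norm (x - y) / r" "norm (x - y) / r < 2 powr real (Suc n)"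
        using le_log_iff[OF _ npos, of 2 "real n"] log_less_iff[OF _ npos, of 2 "real (Suc n)"]
        by (simp_all only: one_less_numeral_iff semiring_norm simp_thms)
      then have n1: "2^n * r \<le> norm (x - y)" and n2: "norm (x - y) < 2^Suc n * r"
        using r by (auto simp: powr_realpow field_simps simp del: power_Suc of_nat_Suc)
      have "kern s x y \<le> 1 powr ?p * (2^n * r) powr - ?p"
        by (rule kern_le) (use s r n1 in auto)
      then have "ennreal (kern s x y) * indicator (- ball x r) y \<le> ?f n y"
        using n2 True by (auto simp: dist_norm intro!: ennreal_leI)
      also have "?f n y \<le> (\<Sum>n. ?f n y)"
        by (rule term_le_suminf[of "\<lambda>n. ?f n y" n])
      finally show ?thesis .
    qed simp
    have "(\<integral>\<^sup>+y\<in>- ball x r. ennreal (kern s x y) \<partial>lebesgue) \<le> (\<integral>\<^sup>+y. (\<Sum>n. ?f n y) \<partial>lebesgue)"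
      by (rule nn_integral_mono) (rule pt)
    also have "\<dots> = (\<Sum>n. \<integral>\<^sup>+y. ?f n y \<partial>lebesgue)"
      by (rule nn_integral_suminf[OF meas])
    also have "\<dots> = (\<Sum>n. ennreal ((?w * 2^?d * r powr - (2 * s)) * q ^ n))"
    proof (rule suminf_cong)
      fix n
      have "(2^n * r) powr - ?p * (?w * (2^Suc n * r)^?d) = ?w * 2^?d * ((2^n*r) powr - ?p * (2^n * r)^?d)"
        by (simp add: power_mult_distrib algebra_simps)
      also have "(2^n*r) powr - ?p * (2^n * r)^?d = (2^n*r) powr - ?p * (2^n * r) powr ?d"
        using r by (simp add: powr_realpow)
      also have "\<dots> = (2^n * r) powr - (2 * s)"
        using r by (simp add: powr_add[symmetric])
      also have "\<dots> = q^n * r powr - (2 * s)"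
        using r by (simp add: powr_mult q_def powr_realpow[symmetric] powr_powr mult.commute del: powr_realpow)
      finally have "(2^n * r) powr - ?p * (?w * (2^Suc n * r)^?d) = (?w * 2^?d * r powr - (2 * s)) * q ^ n"
        by (simp add: algebra_simps)
      note eq = this
      have "(\<integral>\<^sup>+y. ?f n y \<partial>lebesgue) = ennreal ((2^n * r) powr - ?p) * emeasure lebesgue (ball x (2^Suc n * r))"
        by (rule nn_integral_cmult_indicator) simp
      also have "emeasure lebesgue (ball x (2^Suc n * r)) = ennreal (?w * (2^Suc n * r)^?d)"
        by (rule emeasure_lebesgue_ball) (use r in simp)
      also have "ennreal ((2^n * r) powr - ?p) * \<dots> = ennreal (((2^n * r) powr - ?p) * (?w * (2^Suc n * r)^?d))"
        by (rule ennreal_mult[symmetric]) (use r in auto)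
      finally show "(\<integral>\<^sup>+y. ?f n y \<partial>lebesgue) = ennreal ((?w * 2^?d * r powr - (2 * s)) * q ^ n)"
        by (simp only: eq)
    qed
    also have "\<dots> = ennreal (\<Sum>n. (?w * 2^?d * r powr - (2 * s)) * q ^ n)"
      by (rule suminf_ennreal2) (use q in \<open>auto intro!: summable_mult summable_geometric\<close>)
    also have "(\<Sum>n. (?w * 2^?d * r powr - (2 * s)) * q ^ n) = C * r powr - (2 * s)"
      using q by (subst suminf_mult) (auto simp: suminf_geometric C_def)
    finally show ?thesis .
  qed
  then show ?thesis using C by blast
qed

text \<open>
  The same dyadic decomposition, now towards the singularity: the factor \<open>(norm (x -
  y))\<^sup>2\<close> turns the ratio of the series into \<open>2 powr - (2 - 2 * s)\<close>,
  and \<open>s < 1\<close> makes it converge.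
\<close>

lemma kern_near_integral:
  assumes s: "0 < s" "s < 1"
  shows "\<exists>C>0. \<forall>(x::'a::euclidean_space) r. 0 < r \<longrightarrow>
    (\<integral>\<^sup>+y\<in>ball x r. ennreal ((norm (x - y))\<^sup>2 * kern s x y) \<partial>lebesgue) \<le> ennreal (C * r powr (2 - 2 * s))"
proof -
  let ?d = "DIM('a)" let ?p = "real ?d + 2 * s"
  let ?w = "unit_ball_vol (real ?d)"
  define q where "q = (2::real) powr - (2 - 2 * s)"
  have q: "0 < q" "q < 1"
    using s by (auto simp: q_def powr_less_one)
  define C where "C = ?w * 2 powr ?p * (1 / (1 - q))"
  have w: "0 < ?w" by simp
  have C: "0 < C" using q w unfolding C_def by (simp)
  have "(\<integral>\<^sup>+y\<in>ball x r. ennreal ((norm (x - y))\<^sup>2 * kern s x y) \<partial>lebesgue) \<le> ennreal (C * r powr (2 - 2 * s))"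
    if r: "0 < r" for x :: 'a and r
  proof -
    let ?f = "\<lambda>n y. ennreal ((r / 2^n)\<^sup>2 * (2 powr ?p * (r / 2^n) powr - ?p)) * indicator (ball x (r / 2^n)) y"
    have meas: "?f n \<in> borel_measurable lebesgue" for n
      by (intro borel_measurable_times_ennreal borel_measurable_indicator borel_measurable_const) simp
    have pt: "ennreal ((norm (x - y))\<^sup>2 * kern s x y) * indicator (ball x r) y \<le> (\<Sum>n. ?f n y)" for y
    proof (cases "y \<in> ball x r \<and> y \<noteq> x")
      case True
      then have yr: "norm (x - y) < r" "0 < norm (x - y)" by (auto simp: dist_norm)
      let ?l = "log 2 (r / norm (x - y))"
      define n where "n = nat (\<lceil>?l\<rceil> - 1)"
      have l0: "0 < ?l" using yr r by simp
      have "1 \<le> \<lceil>?l\<rceil>" using l0 by linarith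
      then have "real n < ?l" "?l \<le> real (Suc n)"
        unfolding n_def using l0 by linarith+
      then have "2 powr real n < r / norm (x - y)" "r / norm (x - y) \<le> 2 powr real (Suc n)"
        using yr r by (auto simp: less_log_iff log_le_iff)
      then have n1: "norm (x - y) < r / 2^n" and n2: "r / 2^n \<le> 2 * norm (x - y)"
        using r yr by (auto simp: powr_realpow field_simps  simp del: of_nat_Suc)
      have "kern s x y \<le> 2 powr ?p * (r / 2^n) powr - ?p"
        by (rule kern_le) (use s r n2 in auto)
      then have "(norm (x - y))\<^sup>2 * kern s x y \<le> (r / 2^n)\<^sup>2 * (2 powr ?p * (r / 2^n) powr - ?p)"
        using n1 by (intro mult_mono power_mono) auto
      then have "ennreal ((norm (x - y))\<^sup>2 * kern s x y) * indicator (ball x r) y \<le> ?f n y"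
        using n1 True by (auto simp: dist_norm intro!: ennreal_leI)
      also have "?f n y \<le> (\<Sum>n. ?f n y)"
        by (rule term_le_suminf[of "\<lambda>n. ?f n y" n])
      finally show ?thesis .
    qed auto
    have "(\<integral>\<^sup>+y\<in>ball x r. ennreal ((norm (x - y))\<^sup>2 * kern s x y) \<partial>lebesgue) \<le> (\<integral>\<^sup>+y. (\<Sum>n. ?f n y) \<partial>lebesgue)"
      by (rule nn_integral_mono) (rule pt)
    also have "\<dots> = (\<Sum>n. \<integral>\<^sup>+y. ?f n y \<partial>lebesgue)"
      by (rule nn_integral_suminf[OF meas])
    also have "\<dots> = (\<Sum>n. ennreal ((?w * 2 powr ?p * r powr (2 - 2 * s)) * q ^ n))"
    proof (rule suminf_cong)
      fix n
      have "(r / 2^n)\<^sup>2 * (2 powr ?p * (r / 2^n) powr - ?p) * (?w * (r / 2^n)^?d)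
          = ?w * 2 powr ?p * ((r / 2^n) powr 2 * (r/2^n) powr - ?p * (r / 2^n) powr ?d)"
        using r by (simp add: powr_realpow)
      also have "(r / 2^n) powr 2 * (r/2^n) powr - ?p * (r / 2^n) powr ?d = (r / 2^n) powr (2 - 2 * s)"
        using r by (simp add:  powr_add[symmetric] del: powr_numeral)
      also have "\<dots> = q^n * r powr (2 - 2 * s)"
      proof -
        have "r / 2^n = 2 powr - real n * r"
          by (simp add: powr_minus powr_realpow field_simps)
        then have "(r / 2^n) powr (2 - 2 * s) = (2 powr - real n) powr (2 - 2 * s) * r powr (2 - 2 * s)"
          by (simp only: powr_mult)
        also have "(2 powr - real n) powr (2 - 2 * s) = q ^ n"
          unfolding q_def by (simp add: powr_powr powr_power algebra_simps)
        finally show ?thesis .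
      qed
      finally have "(r / 2^n)\<^sup>2 * (2 powr ?p * (r / 2^n) powr - ?p) * (?w * (r / 2^n)^?d) = (?w * 2 powr ?p * r powr (2 - 2 * s)) * q ^ n"
        by (simp add: algebra_simps)
      note eq = this
      have "(\<integral>\<^sup>+y. ?f n y \<partial>lebesgue) = ennreal ((r / 2^n)\<^sup>2 * (2 powr ?p * (r / 2^n) powr - ?p)) * emeasure lebesgue (ball x (r / 2^n))"
        by (rule nn_integral_cmult_indicator) simp
      also have "emeasure lebesgue (ball x (r / 2^n)) = ennreal (?w * (r / 2^n)^?d)"
        by (rule emeasure_lebesgue_ball) (use r in simp)
      also have "ennreal ((r / 2^n)\<^sup>2 * (2 powr ?p * (r / 2^n) powr - ?p)) * \<dots> = ennreal (((r / 2^n)\<^sup>2 * (2 powr ?p * (r / 2^n) powr - ?p)) * (?w * (r / 2^n)^?d))"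
        by (rule ennreal_mult[symmetric]) (use r in auto)
      finally show "(\<integral>\<^sup>+y. ?f n y \<partial>lebesgue) = ennreal ((?w * 2 powr ?p * r powr (2 - 2 * s)) * q ^ n)"
        by (simp only: eq)
    qed
    also have "\<dots> = ennreal (\<Sum>n. (?w * 2 powr ?p * r powr (2 - 2 * s)) * q ^ n)"
      by (rule suminf_ennreal2) (use q in \<open>auto intro!: summable_mult summable_geometric\<close>)
    also have "(\<Sum>n. (?w * 2 powr ?p * r powr (2 - 2 * s)) * q ^ n) = C * r powr (2 - 2 * s)"
      using q by (subst suminf_mult) (auto simp: suminf_geometric C_def)
    finally show ?thesis .
  qed
  then show ?thesis using C by blast
qed


abbreviation pair_measurable :: "('a::euclidean_space \<Rightarrow> 'a \<Rightarrow> real) \<Rightarrow> bool" where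
  "pair_measurable g \<equiv> (\<lambda>p. g (fst p) (snd p)) \<in> borel_measurable leb_pair"

lemma pair_measurable_fst: "v \<in> borel_measurable lebesgue \<Longrightarrow> pair_measurable (\<lambda>x y. v x)"
  by (rule measurable_compose[OF measurable_fst])

lemma pair_measurable_snd: "v \<in> borel_measurable lebesgue \<Longrightarrow> pair_measurable (\<lambda>x y. v y)"
  by (rule measurable_compose[OF measurable_snd])

text \<open>
  All energies, remainders and cross terms are instances of this integral of a function of two
  points over a set of pairs. Working with sets of pairs rather than iterated integrals makes
  it possible to split, swap and sum regions.
\<close>

definition kint :: "real \<Rightarrow> ('a::euclidean_space \<times> 'a) set \<Rightarrow> ('a \<Rightarrow> 'a \<Rightarrow> real) \<Rightarrow> ennreal" where
  "kint s U g = (\<integral>\<^sup>+p\<in>U. ennreal (g (fst p) (snd p) * kern s (fst p) (snd p)) \<partial>leb_pair)"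

lemma kint_mono:
  assumes "\<And>x y. (x, y) \<in> U \<Longrightarrow> (x, y) \<in> V \<and> g x y \<le> h x y"
  shows "kint s U g \<le> kint s V h"
  unfolding kint_def
  by (rule nn_integral_mono)
    (use assms in \<open>auto simp: indicator_def intro!: ennreal_leI mult_right_mono\<close>)

lemma kint_add:
  assumes "pair_measurable g" "pair_measurable h" "U \<in> sets leb_pair"
    and "\<And>x y. (x, y) \<in> U \<Longrightarrow> 0 \<le> g x y" "\<And>x y. (x, y) \<in> U \<Longrightarrow> 0 \<le> h x y"
  shows "kint s U (\<lambda>x y. g x y + h x y) = kint s U g + kint s U h"
proof -
  note [measurable] = assms(1-3)
  have "kint s U (\<lambda>x y. g x y + h x y) = (\<integral>\<^sup>+p. ennreal (g (fst p) (snd p) * kern s (fst p) (snd p)) * indicator U p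
      + ennreal (h (fst p) (snd p) * kern s (fst p) (snd p)) * indicator U p \<partial>leb_pair)"
    unfolding kint_def using assms(4,5)
    by (intro nn_integral_cong) (auto simp: indicator_def distrib_right simp del: ennreal_plus intro!: ennreal_plus)
  also have "\<dots> = kint s U g + kint s U h"
    unfolding kint_def by (rule nn_integral_add) measurable
  finally show ?thesis .
qed

lemma kint_cmult:
  assumes "pair_measurable g" "U \<in> sets leb_pair" "0 \<le> c"
  shows "kint s U (\<lambda>x y. c * g x y) = ennreal c * kint s U g"
proof -
  note [measurable] = assms(1,2)
  have "kint s U (\<lambda>x y. c * g x y) = (\<integral>\<^sup>+p. ennreal c * (ennreal (g (fst p) (snd p) * kern s (fst p) (snd p)) * indicator U p) \<partial>leb_pair)"
    unfolding kint_def using assms(3)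
    by (intro nn_integral_cong) (auto simp: indicator_def ennreal_mult'[symmetric] mult.assoc)
  also have "\<dots> = ennreal c * kint s U g"
    unfolding kint_def by (rule nn_integral_cmult) measurable
  finally show ?thesis .
qed

lemma kint_sum:
  assumes "finite I" "\<And>i. i \<in> I \<Longrightarrow> pair_measurable (g i)" "U \<in> sets leb_pair"
    and "\<And>i x y. i \<in> I \<Longrightarrow> (x, y) \<in> U \<Longrightarrow> 0 \<le> g i x y"
  shows "kint s U (\<lambda>x y. \<Sum>i\<in>I. g i x y) = (\<Sum>i\<in>I. kint s U (g i))"
  using assms(1,2,4)
proof (induction I rule: finite_induct)
  case empty
  then show ?case by (simp add: kint_def)
next
  case (insert i I)
  have m: "pair_measurable (\<lambda>x y. \<Sum>i\<in>I. g i x y)"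
    by (rule borel_measurable_sum) (use insert in auto)
  have "kint s U (\<lambda>x y. \<Sum>i\<in>insert i I. g i x y) = kint s U (\<lambda>x y. g i x y + (\<Sum>i\<in>I. g i x y))"
    using insert by simp
  also have "\<dots> = kint s U (g i) + kint s U (\<lambda>x y. \<Sum>i\<in>I. g i x y)"
    using insert m assms(3) by (intro kint_add sum_nonneg) auto
  finally show ?case using insert by simp
qed

lemma kint_fst:
  assumes "pair_measurable g" "A \<in> sets lebesgue" "B \<in> sets lebesgue"
  shows "kint s (A \<times> B) g = (\<integral>\<^sup>+x\<in>A. (\<integral>\<^sup>+y\<in>B. ennreal (g x y * kern s x y) \<partial>lebesgue) \<partial>lebesgue)"
proof -
  note [measurable] = assms
  have "kint s (A \<times> B) g = (\<integral>\<^sup>+x. \<integral>\<^sup>+y. ennreal (g x y * kern s x y) * indicator (A \<times> B) (x, y) \<partial>lebesgue \<partial>lebesgue)"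
    unfolding kint_def by (subst leb.nn_integral_fst[symmetric]) (auto)
  also have "\<dots> = (\<integral>\<^sup>+x\<in>A. (\<integral>\<^sup>+y\<in>B. ennreal (g x y * kern s x y) \<partial>lebesgue) \<partial>lebesgue)"
    by (intro nn_integral_cong) (auto simp: indicator_def)
  finally show ?thesis .
qed

lemma Hs_seminorm_sq_kint:
  assumes "v \<in> borel_measurable lebesgue" "D \<in> sets lebesgue"
  shows "Hs_seminorm_sq s D v = kint s (D \<times> D) (\<lambda>x y. (v x - v y)\<^sup>2)"
proof -
  have "pair_measurable (\<lambda>x y. (v x - v y)\<^sup>2)"
    using pair_measurable_fst[OF assms(1)] pair_measurable_snd[OF assms(1)] by measurable
  then show ?thesis
    using assms(2) by (simp add: kint_fst Hs_seminorm_sq_def kern_def)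
qed

text \<open>
  Integrating out the second variable first: this reduces a double integral to a single one
  whenever the dependence on the second point has a uniformly bounded integral against the
  kernel.
\<close>

lemma kint_weight_fst:
  assumes a: "a \<in> borel_measurable lebesgue" "\<And>x. 0 \<le> a x" and A: "A \<in> sets lebesgue"
    and h: "pair_measurable h" "\<And>x y. 0 \<le> h x y"
    and K: "\<And>x. (\<integral>\<^sup>+y. ennreal (h x y * kern s x y) \<partial>lebesgue) \<le> K"
    and U: "\<And>x y. (x, y) \<in> U \<Longrightarrow> x \<in> A \<and> g x y \<le> a x * h x y"
  shows "kint s U g \<le> K * (\<integral>\<^sup>+x\<in>A. ennreal (a x) \<partial>lebesgue)"
proof -
  note [measurable] = a(1) A h(1) pair_measurable_fst[OF a(1)]
  have "kint s U g \<le> kint s (A \<times> UNIV) (\<lambda>x y. a x * h x y)"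
    by (rule kint_mono) (use U in auto)
  also have "\<dots> = (\<integral>\<^sup>+x\<in>A. (\<integral>\<^sup>+y\<in>UNIV. ennreal (a x * h x y * kern s x y) \<partial>lebesgue) \<partial>lebesgue)"
    by (rule kint_fst) auto
  also have "\<dots> \<le> (\<integral>\<^sup>+x. K * (ennreal (a x) * indicator A x) \<partial>lebesgue)"
  proof (rule nn_integral_mono)
    fix x
    have m: "(\<lambda>y. h x y * kern s x y) \<in> borel_measurable lebesgue"
      using measurable_compose[OF measurable_Pair1'[of x lebesgue lebesgue],
          where g="\<lambda>p. h (fst p) (snd p) * kern s (fst p) (snd p)"] by simp
    have "(\<integral>\<^sup>+y\<in>UNIV. ennreal (a x * h x y * kern s x y) \<partial>lebesgue)
        = (\<integral>\<^sup>+y. ennreal (a x) * ennreal (h x y * kern s x y) \<partial>lebesgue)"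
      using a(2) by (intro nn_integral_cong) (auto simp: ennreal_mult'[symmetric] mult.assoc)
    also have "\<dots> = ennreal (a x) * (\<integral>\<^sup>+y. ennreal (h x y * kern s x y) \<partial>lebesgue)"
      by (rule nn_integral_cmult) (use m in measurable)
    also have "\<dots> \<le> ennreal (a x) * K"
      by (rule mult_left_mono[OF K]) simp
    finally have "(\<integral>\<^sup>+y\<in>UNIV. ennreal (a x * h x y * kern s x y) \<partial>lebesgue) \<le> ennreal (a x) * K" .
    then show "(\<integral>\<^sup>+y\<in>UNIV. ennreal (a x * h x y * kern s x y) \<partial>lebesgue) * indicator A x
        \<le> K * (ennreal (a x) * indicator A x)"
      by (auto simp: indicator_def mult.commute)
  qed
  also have "\<dots> = K * (\<integral>\<^sup>+x\<in>A. ennreal (a x) \<partial>lebesgue)"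
    by (rule nn_integral_cmult) measurable
  finally show ?thesis .
qed

lemma kint_swap:
  assumes "pair_measurable g" "U \<in> sets leb_pair"
  shows "kint s U g = kint s ((\<lambda>p. (snd p, fst p)) -` U) (\<lambda>x y. g y x)"
proof -
  note [measurable] = assms
  have "(\<lambda>p. ennreal (g (fst p) (snd p) * kern s (fst p) (snd p)) * indicator U p) \<in> borel_measurable leb_pair"
    by measurable
  from measurable_compose[OF measurable_Pair[OF measurable_snd measurable_fst] this]
  have m: "(\<lambda>p. ennreal (g (snd p) (fst p) * kern s (snd p) (fst p)) * indicator U (snd p, fst p)) \<in> borel_measurable leb_pair"
    by simp
  have "kint s U g = (\<integral>\<^sup>+x. \<integral>\<^sup>+y. ennreal (g x y * kern s x y) * indicator U (x, y) \<partial>lebesgue \<partial>lebesgue)"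
    unfolding kint_def by (subst leb.nn_integral_fst[symmetric]) auto
  also have "\<dots> = (\<integral>\<^sup>+p. ennreal (g (snd p) (fst p) * kern s (snd p) (fst p)) * indicator U (snd p, fst p) \<partial>leb_pair)"
    by (subst leb2.nn_integral_snd[symmetric]) (use m in auto)
  also have "\<dots> = kint s ((\<lambda>p. (snd p, fst p)) -` U) (\<lambda>x y. g y x)"
    unfolding kint_def by (intro nn_integral_cong) (auto simp: indicator_def kern_commute)
  finally show ?thesis .
qed


text \<open>
  The two constants below are names for the constants whose existence has just been shown; only
  that they depend on nothing but the dimension and \<open>s\<close> matters.
\<close>

definition far_C :: "'a::euclidean_space itself \<Rightarrow> real \<Rightarrow> real" where
  "far_C _ s = (SOME C. 0 < C \<and> (\<forall>(x::'a) r. 0 < r \<longrightarrow>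
    (\<integral>\<^sup>+y\<in>- ball x r. ennreal (kern s x y) \<partial>lebesgue) \<le> ennreal (C * r powr - (2 * s))))"

definition near_C :: "'a::euclidean_space itself \<Rightarrow> real \<Rightarrow> real" where
  "near_C _ s = (SOME C. 0 < C \<and> (\<forall>(x::'a) r. 0 < r \<longrightarrow>
    (\<integral>\<^sup>+y\<in>ball x r. ennreal ((norm (x - y))\<^sup>2 * kern s x y) \<partial>lebesgue) \<le> ennreal (C * r powr (2 - 2 * s))))"

lemma far_C:
  assumes "0 < s"
  shows far_C_pos: "0 < far_C TYPE('a::euclidean_space) s"
    and far_C_le: "0 < r \<Longrightarrow> (\<integral>\<^sup>+y\<in>- ball (x::'a) r. ennreal (kern s x y) \<partial>lebesgue) \<le> ennreal (far_C TYPE('a) s * r powr - (2 * s))"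
  using someI_ex[OF kern_far_integral[OF assms, where 'a='a]] by (auto simp: far_C_def)

lemma near_C:
  assumes "0 < s" "s < 1"
  shows near_C_pos: "0 < near_C TYPE('a::euclidean_space) s"
    and near_C_le: "0 < r \<Longrightarrow> (\<integral>\<^sup>+y\<in>ball (x::'a) r. ennreal ((norm (x - y))\<^sup>2 * kern s x y) \<partial>lebesgue) \<le> ennreal (near_C TYPE('a) s * r powr (2 - 2 * s))"
  using someI_ex[OF kern_near_integral[OF assms, where 'a='a]] by (auto simp: near_C_def)

lemma kint_near_fst:
  fixes a :: "'a::euclidean_space \<Rightarrow> real"
  assumes s: "0 < s" "s < 1" and a: "a \<in> borel_measurable lebesgue" "\<And>x. 0 \<le> a x" and A: "A \<in> sets lebesgue"
    and r: "0 < r" and U: "\<And>x y. (x, y) \<in> U \<Longrightarrow> x \<in> A \<and> norm (x - y) < r \<and> g x y \<le> a x * (norm (x - y))\<^sup>2"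
  shows "kint s U g \<le> ennreal (near_C TYPE('a) s * r powr (2 - 2 * s)) * (\<integral>\<^sup>+x\<in>A. ennreal (a x) \<partial>lebesgue)"
proof (rule kint_weight_fst[OF a A])
  let ?h = "\<lambda>x y. (norm (x - y :: 'a))\<^sup>2 * indicator {..<r} (norm (x - y))"
  show "pair_measurable ?h" by measurable
  show "0 \<le> ?h x y" for x y by simp
  show "(x, y) \<in> U \<Longrightarrow> x \<in> A \<and> g x y \<le> a x * ?h x y" for x y
    using U[of x y] by auto
  show "(\<integral>\<^sup>+y. ennreal (?h x y * kern s x y) \<partial>lebesgue) \<le> ennreal (near_C TYPE('a) s * r powr (2 - 2 * s))" for x
  proof -
    have "(\<integral>\<^sup>+y. ennreal (?h x y * kern s x y) \<partial>lebesgue) = (\<integral>\<^sup>+y\<in>ball x r. ennreal ((norm (x - y))\<^sup>2 * kern s x y) \<partial>lebesgue)"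
      by (intro nn_integral_cong) (auto simp: indicator_def dist_norm)
    then show ?thesis using near_C_le[OF s r, of x] by simp
  qed
qed

lemma kint_near_snd:
  fixes a :: "'a::euclidean_space \<Rightarrow> real"
  assumes s: "0 < s" "s < 1" and a: "a \<in> borel_measurable lebesgue" "\<And>x. 0 \<le> a x" and A: "A \<in> sets lebesgue"
    and r: "0 < r" and U: "\<And>x y. (x, y) \<in> U \<Longrightarrow> y \<in> A \<and> norm (x - y) < r \<and> g x y \<le> a y * (norm (x - y))\<^sup>2"
  shows "kint s U g \<le> ennreal (near_C TYPE('a) s * r powr (2 - 2 * s)) * (\<integral>\<^sup>+x\<in>A. ennreal (a x) \<partial>lebesgue)"
proof -
  let ?h = "\<lambda>x y. a y * ((norm (x - y :: 'a))\<^sup>2 * indicator {..<r} (norm (x - y)))"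
  have m: "pair_measurable ?h"
    by (intro borel_measurable_times pair_measurable_snd[OF a(1)]) measurable
  have AU: "UNIV \<times> A \<in> sets leb_pair"
    by (rule pair_measureI) (use A in auto)
  have "kint s U g \<le> kint s (UNIV \<times> A) ?h"
    by (rule kint_mono) (use U in auto)
  also have "\<dots> = kint s ((\<lambda>p. (snd p, fst p)) -` (UNIV \<times> A)) (\<lambda>x y. ?h y x)"
    by (rule kint_swap[OF m AU])
  also have "\<dots> = kint s {p. fst p \<in> A \<and> norm (fst p - snd p) < r} (\<lambda>x y. a x * (norm (x - y))\<^sup>2)"
    unfolding kint_def by (intro nn_integral_cong) (auto simp: indicator_def norm_minus_commute)
  also have "\<dots> \<le> ennreal (near_C TYPE('a) s * r powr (2 - 2 * s)) * (\<integral>\<^sup>+x\<in>A. ennreal (a x) \<partial>lebesgue)"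
    by (rule kint_near_fst[OF s a A r]) auto
  finally show ?thesis .
qed

lemma kint_far_fst:
  fixes a :: "'a::euclidean_space \<Rightarrow> real"
  assumes s: "0 < s" and a: "a \<in> borel_measurable lebesgue" "\<And>x. 0 \<le> a x" and A: "A \<in> sets lebesgue"
    and r: "0 < r" and U: "\<And>x y. (x, y) \<in> U \<Longrightarrow> x \<in> A \<and> r \<le> norm (x - y) \<and> g x y \<le> a x"
  shows "kint s U g \<le> ennreal (far_C TYPE('a) s * r powr - (2 * s)) * (\<integral>\<^sup>+x\<in>A. ennreal (a x) \<partial>lebesgue)"
proof (rule kint_weight_fst[OF a A])
  let ?h = "\<lambda>x y. indicator {r..} (norm (x - y :: 'a)) :: real"
  show "pair_measurable ?h" by measurable
  show "0 \<le> ?h x y" for x y by simp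
  show "(x, y) \<in> U \<Longrightarrow> x \<in> A \<and> g x y \<le> a x * ?h x y" for x y
    using U[of x y] by auto
  show "(\<integral>\<^sup>+y. ennreal (?h x y * kern s x y) \<partial>lebesgue) \<le> ennreal (far_C TYPE('a) s * r powr - (2 * s))" for x
  proof -
    have "(\<integral>\<^sup>+y. ennreal (?h x y * kern s x y) \<partial>lebesgue) = (\<integral>\<^sup>+y\<in>- ball x r. ennreal (kern s x y) \<partial>lebesgue)"
      by (intro nn_integral_cong) (auto simp: indicator_def dist_norm)
    then show ?thesis using far_C_le[OF s r, of x] by simp
  qed
qed

section \<open>Barycentric coordinates and inscribed balls of simplices\<close>

definition verts :: "'a::euclidean_space set \<Rightarrow> 'a set" where
  "verts T = {v. v extreme_point_of T}"

lemma simplex_verts: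
  assumes "n simplex T"
  shows verts_independent: "\<not> affine_dependent (verts T)"
    and card_verts: "int (card (verts T)) = n + 1"
    and simplex_eq_hull: "T = convex hull (verts T)"
    and finite_verts: "finite (verts T)"
proof -
  obtain C where C: "\<not> affine_dependent C" "int (card C) = n + 1" "T = convex hull C"
    using assms unfolding simplex_def by auto
  have "verts T = C"
    using extreme_point_of_convex_hull_affine_independent[OF C(1)] C(3) by (auto simp: verts_def)
  then show "\<not> affine_dependent (verts T)" "int (card (verts T)) = n + 1" "T = convex hull (verts T)" "finite (verts T)"
    using C aff_independent_finite[OF C(1)] by auto
qed

lemma verts_subset: "verts T \<subseteq> T"
  by (auto simp: verts_def extreme_point_of_def)

lemma affine_combination:
  fixes a :: "'a::euclidean_space"
  assumes "finite S" "sum u S = (1::real)"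
  shows "a \<bullet> (\<Sum>j\<in>S. u j *\<^sub>R j) + c = (\<Sum>j\<in>S. u j * (a \<bullet> j + c))"
  using assms by (simp add: inner_sum_right distrib_left sum.distrib sum_distrib_right[symmetric])

definition bary :: "'a::euclidean_space set \<Rightarrow> 'a \<Rightarrow> 'a \<Rightarrow> real" where
  "bary T i = (SOME f. (\<exists>a c. \<forall>x. f x = a \<bullet> x + c) \<and> (\<forall>j\<in>verts T. f j = (if j = i then 1 else 0)))"

text \<open>
  The vertices of a simplex are affinely independent, so some linear functional equals
  \<open>-1\<close> on all differences \<open>j - i\<close>.
\<close>

lemma bary_exists:
  assumes "n simplex T"
  shows "\<exists>f. (\<exists>a c. \<forall>x. f x = a \<bullet> x + c) \<and> (\<forall>j\<in>verts T. f j = (if j = i then 1 else 0 :: real))"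
proof (cases "i \<in> verts T")
  case False
  then show ?thesis
    by (intro exI[of _ "\<lambda>_. 0"] conjI exI[of _ 0]) auto
next
  case True
  let ?B = "(\<lambda>x. - i + x) ` (verts T - {i})"
  have "independent ?B"
    using verts_independent[OF assms] affine_dependent_iff_dependent2[OF True] by simp
  then obtain g where g: "linear g" "\<forall>x\<in>?B. g x = (-1 :: real)"
    using linear_independent_extend[of ?B "\<lambda>_. -1"] by blast
  define a where "a = adjoint g 1"
  have ga: "g x = a \<bullet> x" for x
    using adjoint_works[OF g(1), of x 1] by (simp add: a_def inner_commute)
  have "a \<bullet> j + (1 - a \<bullet> i) = (if j = i then 1 else 0)" if "j \<in> verts T" for j
  proof (cases "j = i")
    case False
    then have "g (- i + j) = -1" using g(2) that by auto
    then have "a \<bullet> j - a \<bullet> i = -1" by (simp add: ga inner_diff_right)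
    then show ?thesis using False by simp
  qed simp
  then show ?thesis
    by (intro exI[of _ "\<lambda>x. a \<bullet> x + (1 - a \<bullet> i)"]) auto
qed

lemma bary:
  assumes "n simplex T"
  shows bary_affine: "\<exists>a c. \<forall>x. bary T i x = a \<bullet> x + c"
    and bary_vert: "j \<in> verts T \<Longrightarrow> bary T i j = (if j = i then 1 else 0)"
  using someI_ex[OF bary_exists[OF assms, of i]] by (auto simp: bary_def)

lemma bary_combination:
  assumes "n simplex T" "S \<subseteq> verts T" "sum u S = 1"
  shows "bary T i (\<Sum>j\<in>S. u j *\<^sub>R j) = (if i \<in> S then u i else 0)"
proof -
  have fin: "finite S" using finite_verts[OF assms(1)] assms(2) finite_subset by blast
  obtain a c where ac: "\<And>x. bary T i x = a \<bullet> x + c" using bary_affine[OF assms(1)] by blast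
  have "bary T i (\<Sum>j\<in>S. u j *\<^sub>R j) = (\<Sum>j\<in>S. u j * bary T i j)"
    unfolding ac by (rule affine_combination[OF fin assms(3)])
  also have "\<dots> = (\<Sum>j\<in>S. if j = i then u j else 0)"
    by (rule sum.cong) (use bary_vert[OF assms(1)] assms(2) in auto)
  finally show ?thesis using fin by simp
qed

lemma bary_point:
  assumes "n simplex T" "x \<in> T"
  shows bary_nonneg: "0 \<le> bary T i x"
    and bary_notin: "i \<notin> verts T \<Longrightarrow> bary T i x = 0"
    and bary_sum: "(\<Sum>j\<in>verts T. bary T j x) = 1"
    and bary_repr: "x = (\<Sum>j\<in>verts T. bary T j x *\<^sub>R j)"
proof -
  have "x \<in> convex hull (verts T)" using assms simplex_eq_hull by blast
  then obtain u where u: "\<forall>j\<in>verts T. 0 \<le> u j" "sum u (verts T) = 1" "(\<Sum>j\<in>verts T. u j *\<^sub>R j) = x"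
    using convex_hull_finite[OF finite_verts[OF assms(1)]] by auto
  have b: "bary T i x = (if i \<in> verts T then u i else 0)" for i
    using bary_combination[OF assms(1) subset_refl u(2)] u(3) by simp
  show "0 \<le> bary T i x" "i \<notin> verts T \<Longrightarrow> bary T i x = 0" using b u by auto
  show "(\<Sum>j\<in>verts T. bary T j x) = 1" "x = (\<Sum>j\<in>verts T. bary T j x *\<^sub>R j)" using b u by auto
qed

lemma affine_on_simplex:
  assumes "n simplex T" "x \<in> T" "\<And>y. y \<in> T \<Longrightarrow> f y = a \<bullet> y + (c::real)"
  shows "f x = (\<Sum>j\<in>verts T. bary T j x * f j)"
proof -
  have "f x = a \<bullet> (\<Sum>j\<in>verts T. bary T j x *\<^sub>R j) + c"
    using assms bary_repr[OF assms(1,2)] by metis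
  also have "\<dots> = (\<Sum>j\<in>verts T. bary T j x * (a \<bullet> j + c))"
    by (rule affine_combination) (use finite_verts bary_sum assms in auto)
  also have "\<dots> = (\<Sum>j\<in>verts T. bary T j x * f j)"
    by (rule sum.cong) (use assms(3) verts_subset[of T] in auto)
  finally show ?thesis .
qed

text \<open>
  Across an inscribed ball an affine function varies by the diameter of the ball times the norm
  of its gradient. Applied to barycentric coordinates, whose values lie in
  \<open>[0,1]\<close>, this is the inverse estimate for their gradients.
\<close>

lemma inball_diameter_bound:
  fixes T :: "'a::euclidean_space set"
  assumes a: "\<And>x. x \<in> T \<Longrightarrow> \<bar>a \<bullet> x + c\<bar> \<le> 1 \<and> 0 \<le> a \<bullet> x + c"
  shows "norm a * inball_diameter T \<le> 1"
proof (cases "a = 0")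
  case False
  have "Sup {diameter (cball c r) |c r. cball c r \<subseteq> T} \<le> 1 / norm a"
  proof (rule cSup_least)
    have "cball 0 (-1) \<subseteq> T" by simp
    then show "{diameter (cball c r) |c r. cball c r \<subseteq> T} \<noteq> {}" by blast
  next
    fix D assume "D \<in> {diameter (cball c r) |c r. cball c r \<subseteq> T}"
    then obtain q r where D: "D = diameter (cball q r)" "cball q r \<subseteq> T" by auto
    show "D \<le> 1 / norm a"
    proof (cases "r < 0")
      case True then show ?thesis by (simp add: D)
    next
      case r: False
      let ?e = "(r / norm a) *\<^sub>R a"
      have "norm ?e = r" using False r by simp
      then have "q + ?e \<in> T" "q - ?e \<in> T" using D(2) by (auto simp: dist_norm subset_iff)
      then have "(a \<bullet> (q + ?e) + c) - (a \<bullet> (q - ?e) + c) \<le> 1"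
        using a[of "q + ?e"] a[of "q - ?e"] by linarith
      then have "2 * (a \<bullet> ?e) \<le> 1" by (simp add: inner_right_distrib inner_diff_right)
      also have "a \<bullet> ?e = r * norm a"
        using False by (simp add: dot_square_norm power2_eq_square)
      finally show ?thesis using r False by (simp add: D diameter_cball field_simps)
    qed
  qed
  then show ?thesis using False by (simp add: inball_diameter_def field_simps)
qed simp

lemma inball_diameter_set:
  fixes T :: "'a::euclidean_space set"
  assumes "bounded T"
  shows "bdd_above {diameter (cball c r) |c r. cball c r \<subseteq> T}"
    and "0 \<in> {diameter (cball c r) |c r. cball c r \<subseteq> T}"
    and "D \<in> {diameter (cball c r) |c r. cball c r \<subseteq> T} \<Longrightarrow> D \<le> diameter T"
proof -
  have le: "D \<le> diameter T" if "D \<in> {diameter (cball c r) |c r. cball c r \<subseteq> T}" for D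
    using that diameter_subset[OF _ assms] by blast
  then show "bdd_above {diameter (cball c r) |c r. cball c r \<subseteq> T}"
    by (rule bdd_aboveI)
  have "cball (0::'a) (-1) \<subseteq> T" "diameter (cball (0::'a) (-1)) = 0" by simp_all
  then show "0 \<in> {diameter (cball c r) |c r. cball c r \<subseteq> T}"
    by (metis (mono_tags, lifting) mem_Collect_eq)
  show "D \<in> {diameter (cball c r) |c r. cball c r \<subseteq> T} \<Longrightarrow> D \<le> diameter T"
    by (rule le)
qed

lemma inball_diameter_upper:
  fixes T :: "'a::euclidean_space set"
  assumes "bounded T" "cball q r \<subseteq> T" "0 \<le> r"
  shows "2 * r \<le> inball_diameter T"
proof -
  have "diameter (cball q r) \<le> inball_diameter T"
    unfolding inball_diameter_def
  proof (rule cSup_upper[OF _ inball_diameter_set(1)[OF assms(1)]])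
    show "diameter (cball q r) \<in> {diameter (cball c r) |c r. cball c r \<subseteq> T}"
      using assms(2) by (intro CollectI exI conjI) (rule refl)
  qed
  then show ?thesis using assms by (simp add: diameter_cball)
qed

lemma inball_diameter_nonneg:
  fixes T :: "'a::euclidean_space set"
  assumes "bounded T" shows "0 \<le> inball_diameter T"
  unfolding inball_diameter_def
  by (rule cSup_upper[OF inball_diameter_set(2)[OF assms] inball_diameter_set(1)[OF assms]])

lemma inball_diameter_le_diameter:
  fixes T :: "'a::euclidean_space set"
  assumes "bounded T" shows "inball_diameter T \<le> diameter T"
  unfolding inball_diameter_def
proof (rule cSup_least)
  show "{diameter (cball c r) |c r. cball c r \<subseteq> T} \<noteq> {}"
    using inball_diameter_set(2)[OF assms] by (metis empty_iff)
qed (rule inball_diameter_set(3)[OF assms])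

lemma inball_diameter_ball:
  assumes "r < inball_diameter T" "0 < r"
  shows "\<exists>q. cball q (r / 2) \<subseteq> T"
proof -
  have "{diameter (cball c r) |c r. cball c r \<subseteq> T} \<noteq> {}"
  proof -
    have "cball 0 (-1) \<subseteq> T" by simp
    then show ?thesis by blast
  qed
  then obtain D where "D \<in> {diameter (cball c r) |c r. cball c r \<subseteq> T}" "r < D"
    using assms unfolding inball_diameter_def by (metis (lifting) less_cSupE)
  then obtain q r' where q: "cball q r' \<subseteq> T" "r < diameter (cball q r')" by auto
  then have "r / 2 \<le> r'" using assms by (simp add: diameter_cball split: if_splits)
  then show ?thesis using q by (meson subset_cball subset_trans)
qed

lemma simplex_interior:
  assumes "int DIM('a) simplex (T :: 'a::euclidean_space set)"
  shows "interior T \<noteq> {}"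
proof -
  have "aff_dim T = int DIM('a)" using aff_dim_simplex[OF assms] .
  then have "interior T = rel_interior T" "T \<noteq> {}"
    using interior_rel_interior_gen[of T] by auto
  then show ?thesis
    using rel_interior_eq_empty[OF convex_simplex[OF assms]] by simp
qed

lemma inball_diameter_pos:
  assumes "int DIM('a) simplex (T :: 'a::euclidean_space set)"
  shows "0 < inball_diameter T"
proof -
  obtain q where "q \<in> interior T" using simplex_interior[OF assms] by auto
  then obtain e where "0 < e" "cball q e \<subseteq> T" using mem_interior_cball by blast
  then show ?thesis
    using inball_diameter_upper[OF compact_imp_bounded[OF compact_simplex[OF assms]], of q e] by linarith
qed

lemma bary_lipschitz:
  fixes T :: "'a::euclidean_space set"
  assumes T: "n simplex T"
  shows "\<bar>bary T i x - bary T i y\<bar> * inball_diameter T \<le> norm (x - y)"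
proof -
  obtain a c where ac: "\<And>x. bary T i x = a \<bullet> x + c" using bary_affine[OF T] by blast
  have "bary T i x \<le> 1" if "x \<in> T" for x
  proof (cases "i \<in> verts T")
    case True
    then have "bary T i x \<le> (\<Sum>j\<in>verts T. bary T j x)"
      by (intro member_le_sum) (use bary_nonneg[OF T that] finite_verts[OF T] in auto)
    then show ?thesis using bary_sum[OF T that] by simp
  qed (use bary_notin[OF T that] in simp)
  then have "norm a * inball_diameter T \<le> 1"
    by (intro inball_diameter_bound[where c=c]) (metis ac bary_nonneg[OF T] abs_of_nonneg)
  then have "norm (x - y) * (norm a * inball_diameter T) \<le> norm (x - y)"
    by (simp add: mult_left_le)
  moreover have "\<bar>bary T i x - bary T i y\<bar> \<le> norm a * norm (x - y)"
    using Cauchy_Schwarz_ineq2[of a "x - y"] by (simp add: ac inner_diff_right)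
  moreover have "0 \<le> inball_diameter T"
    by (rule inball_diameter_nonneg[OF compact_imp_bounded[OF compact_simplex[OF T]]])
  ultimately show ?thesis
    by (smt (verit) mult.assoc mult.commute mult_right_mono)
qed


section \<open>Hat functions and nodal interpolation\<close>

locale fe_mesh =
  fixes \<Omega> :: "'a::euclidean_space set" and Th :: "'a set set"
  assumes mesh: "mesh \<Omega> Th" and open_dom: "open \<Omega>"
begin

lemma simplex: "T \<in> Th \<Longrightarrow> int DIM('a) simplex T"
  and finite_mesh: "finite Th"
  and Union_mesh: "\<Union>Th = closure \<Omega>"
  and face: "T \<in> Th \<Longrightarrow> T' \<in> Th \<Longrightarrow> (T \<inter> T') face_of T"
  using mesh unfolding mesh_def triangulation_def by auto

lemma compact_elem: "T \<in> Th \<Longrightarrow> compact T"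
  and convex_elem: "T \<in> Th \<Longrightarrow> convex T"
  and closed_elem: "T \<in> Th \<Longrightarrow> closed T"
  and bounded_elem: "T \<in> Th \<Longrightarrow> bounded T"
  using simplex compact_simplex convex_simplex closed_simplex compact_imp_bounded by blast+

lemma card_verts_elem: "T \<in> Th \<Longrightarrow> card (verts T) = Suc DIM('a)"
  using card_verts[OF simplex] by fastforce

text \<open>
  Two elements meet in a common face, and a face of a simplex is spanned by a subset of its
  vertices. This conformity of the mesh is why barycentric coordinates of neighbouring elements
  fit together.
\<close>

lemma inter_hull:
  assumes "T \<in> Th" "T' \<in> Th"
  obtains C where "C \<subseteq> verts T" "C \<subseteq> verts T'" "T \<inter> T' = convex hull C"
proof -
  obtain C where C: "C \<subseteq> verts T" "T \<inter> T' = convex hull C"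
    using face[OF assms] face_of_convex_hull_affine_independent[OF verts_independent[OF simplex[OF assms(1)]]]
      simplex_eq_hull[OF simplex[OF assms(1)]] by metis
  obtain C' where C': "C' \<subseteq> verts T'" "T' \<inter> T = convex hull C'"
    using face[OF assms(2,1)] face_of_convex_hull_affine_independent[OF verts_independent[OF simplex[OF assms(2)]]]
      simplex_eq_hull[OF simplex[OF assms(2)]] by metis
  have "\<not> affine_dependent C" "\<not> affine_dependent C'"
    using C C' verts_independent[OF simplex] assms affine_independent_subset by blast+
  then have "C = C'"
    using C C' extreme_point_of_convex_hull_affine_independent
    by (metis Int_commute subsetI subset_antisym)
  then show ?thesis using that C C' by auto
qed

lemma bary_agree:
  assumes "T \<in> Th" "T' \<in> Th" "x \<in> T" "x \<in> T'"
  shows "bary T i x = bary T' i x"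
proof -
  obtain C where C: "C \<subseteq> verts T" "C \<subseteq> verts T'" "T \<inter> T' = convex hull C"
    using inter_hull[OF assms(1,2)] .
  have "finite C" using C(1) finite_verts[OF simplex[OF assms(1)]] finite_subset by blast
  have "x \<in> convex hull C" using assms C(3) by blast
  then have "\<exists>u. sum u C = 1 \<and> (\<Sum>j\<in>C. u j *\<^sub>R j) = x"
    unfolding convex_hull_finite[OF \<open>finite C\<close>] by blast
  then obtain u where u: "sum u C = 1" "(\<Sum>j\<in>C. u j *\<^sub>R j) = x"
    by blast
  show ?thesis
    using bary_combination[OF simplex[OF assms(1)] C(1) u(1), of i]
      bary_combination[OF simplex[OF assms(2)] C(2) u(1), of i] unfolding u(2) by metis
qed

lemma verts_inter:
  assumes "T \<in> Th" "T' \<in> Th" "i \<in> verts T" "i \<in> T'"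
  shows "i \<in> verts T'"
proof -
  have i: "i \<in> T" using assms verts_subset by blast
  show ?thesis
  proof (rule ccontr)
    assume "i \<notin> verts T'"
    then have "bary T' i i = 0" using bary_notin[OF simplex[OF assms(2)]] assms by blast
    then show False
      using bary_agree[OF assms(1,2) i assms(4), of i] bary_vert[OF simplex[OF assms(1)] assms(3), of i] by simp
  qed
qed

text \<open>
  By \<open>bary_agree\<close> the value does not depend on the element that is chosen.
\<close>

definition hat :: "'a \<Rightarrow> 'a \<Rightarrow> real" where
  "hat i x = (if \<exists>T\<in>Th. x \<in> T then bary (SOME T. T \<in> Th \<and> x \<in> T) i x else 0)"

lemma hat_eq: "T \<in> Th \<Longrightarrow> x \<in> T \<Longrightarrow> hat i x = bary T i x"
proof -
  assume T: "T \<in> Th" "x \<in> T"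
  then have "\<exists>T. T \<in> Th \<and> x \<in> T" by blast
  from someI_ex[OF this] have "bary (SOME T. T \<in> Th \<and> x \<in> T) i x = bary T i x"
    using bary_agree T by blast
  then show ?thesis using T by (auto simp: hat_def)
qed

definition nodes :: "'a set" where "nodes = (\<Union>T\<in>Th. verts T)"

lemma finite_nodes: "finite nodes"
  unfolding nodes_def using finite_mesh finite_verts simplex by blast

lemma verts_nodes: "T \<in> Th \<Longrightarrow> verts T \<subseteq> nodes"
  by (auto simp: nodes_def)

lemma node_vert: "i \<in> nodes \<Longrightarrow> T \<in> Th \<Longrightarrow> i \<in> T \<Longrightarrow> i \<in> verts T"
  using verts_inter unfolding nodes_def by blast

lemma hat_elem:
  assumes "T \<in> Th" "x \<in> T"
  shows hat_nonneg: "0 \<le> hat i x"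
    and hat_notin: "i \<notin> verts T \<Longrightarrow> hat i x = 0"
    and hat_sum: "(\<Sum>j\<in>verts T. hat j x) = 1"
  using bary_nonneg[OF simplex[OF assms(1)] assms(2), of i] bary_notin[OF simplex[OF assms(1)] assms(2), of i]
    bary_sum[OF simplex[OF assms(1)] assms(2)] bary_repr[OF simplex[OF assms(1)] assms(2)]
  by (simp_all add: hat_eq[OF assms])

lemma hat_le_one:
  assumes "T \<in> Th" "x \<in> T"
  shows "hat i x \<le> 1"
proof (cases "i \<in> verts T")
  case True
  then have "hat i x \<le> (\<Sum>j\<in>verts T. hat j x)"
    by (intro member_le_sum) (use hat_nonneg[OF assms] finite_verts[OF simplex[OF assms(1)]] in auto)
  then show ?thesis using hat_sum[OF assms] by simp
qed (use hat_notin[OF assms] in simp)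

lemma hat_sum_nodes:
  assumes "T \<in> Th" "x \<in> T" "verts T \<subseteq> S" "finite S"
  shows "(\<Sum>j\<in>S. hat j x * g j) = (\<Sum>j\<in>verts T. hat j x * g j)"
  using assms hat_notin[OF assms(1,2)] by (intro sum.mono_neutral_right) auto

definition interp :: "('a \<Rightarrow> real) \<Rightarrow> 'a \<Rightarrow> real" where
  "interp g x = (\<Sum>i\<in>nodes. hat i x * g i)"

lemma interp_elem:
  "T \<in> Th \<Longrightarrow> x \<in> T \<Longrightarrow> interp g x = (\<Sum>i\<in>verts T. hat i x * g i)"
  unfolding interp_def by (rule hat_sum_nodes[OF _ _ verts_nodes finite_nodes])

lemma interp_affine:
  assumes "T \<in> Th"
  shows "\<exists>a c. \<forall>x\<in>T. interp g x = a \<bullet> x + c"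
proof -
  have "\<forall>i. \<exists>a c. \<forall>x. bary T i x = a \<bullet> x + c"
    using bary_affine[OF simplex[OF assms]] by blast
  then obtain a c where ac: "\<And>i x. bary T i x = a i \<bullet> x + c i" by metis
  have "interp g x = (\<Sum>i\<in>verts T. g i *\<^sub>R a i) \<bullet> x + (\<Sum>i\<in>verts T. g i * c i)" if "x \<in> T" for x
    using that by (simp add: interp_elem[OF assms that] hat_eq[OF assms that] ac inner_sum_left
        sum.distrib[symmetric] algebra_simps)
  then show ?thesis by blast
qed

lemma interp_outside: "x \<notin> closure \<Omega> \<Longrightarrow> interp g x = 0"
  using Union_mesh by (auto simp: interp_def hat_def)

lemma continuous_pieces:
  assumes "\<And>T. T \<in> Th \<Longrightarrow> \<exists>a c. \<forall>x\<in>T. v x = a \<bullet> x + (c::real)"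
  shows "continuous_on (closure \<Omega>) v"
proof -
  have "continuous_on (\<Union>T\<in>Th. T) v"
  proof (rule continuous_on_closed_Union[OF finite_mesh closed_elem])
    fix T assume "T \<in> Th"
    then obtain a c where "\<forall>x\<in>T. v x = a \<bullet> x + c" using assms by blast
    then show "continuous_on T v"
      by (subst continuous_on_cong[OF refl, of _ v "\<lambda>x. a \<bullet> x + c"]) (auto intro!: continuous_intros)
  qed
  then show ?thesis using Union_mesh by simp
qed

lemma interp_fe_space:
  assumes "\<And>x. x \<in> frontier \<Omega> \<Longrightarrow> interp g x = 0"
  shows "interp g \<in> fe_space \<Omega> Th"
  using assms interp_affine continuous_pieces[OF interp_affine] interp_outside
  by (auto simp: fe_space_def)

lemma fe_eval:
  assumes "w \<in> fe_space \<Omega> Th" "T \<in> Th" "x \<in> T"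
  shows "w x = (\<Sum>i\<in>verts T. hat i x * w i)"
proof -
  obtain a c where "\<And>y. y \<in> T \<Longrightarrow> w y = a \<bullet> y + c" using assms by (auto simp: fe_space_def)
  from affine_on_simplex[OF simplex[OF assms(2)] assms(3), where f=w, OF this] show ?thesis
    by (simp add: hat_eq[OF assms(2,3)])
qed

lemma fe_interp:
  assumes "w \<in> fe_space \<Omega> Th"
  shows "interp w = w"
proof
  fix x
  show "interp w x = w x"
  proof (cases "x \<in> closure \<Omega>")
    case True
    then obtain T where "T \<in> Th" "x \<in> T" using Union_mesh by blast
    then show ?thesis using fe_eval[OF assms] interp_elem by simp
  qed (use interp_outside assms in \<open>auto simp: fe_space_def\<close>)
qed

text \<open>
  The segment is parametrised by the unit interval, which is covered by the finitely many
  closed preimages of the pieces.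
\<close>

lemma lipschitz_pieces:
  fixes v :: "'a \<Rightarrow> real"
  assumes "finite I" "\<And>i. i \<in> I \<Longrightarrow> closed (U i)"
    and lip: "\<And>i x y. i \<in> I \<Longrightarrow> x \<in> U i \<Longrightarrow> y \<in> U i \<Longrightarrow> \<bar>v x - v y\<bar> \<le> L * norm (x - y)"
    and L: "0 \<le> L" and seg: "closed_segment x y \<subseteq> (\<Union>i\<in>I. U i)"
  shows "\<bar>v x - v y\<bar> \<le> L * norm (x - y)"
proof -
  let ?p = "\<lambda>t::real. x + t *\<^sub>R (y - x)"
  have "(L * norm (x - y))-lipschitz_on {0..1} (\<lambda>t. v (?p t))"
  proof (rule lipschitz_on_closed_Union[where I=I and U="\<lambda>i. {t. ?p t \<in> U i}"])
    fix i assume i: "i \<in> I"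
    show "(L * norm (x - y))-lipschitz_on {t. ?p t \<in> U i} (\<lambda>t. v (?p t))"
    proof (rule lipschitz_onI)
      fix t u assume "t \<in> {t. ?p t \<in> U i}" "u \<in> {t. ?p t \<in> U i}"
      then have "\<bar>v (?p t) - v (?p u)\<bar> \<le> L * norm (?p t - ?p u)" by (intro lip[OF i]) simp_all
      also have "?p t - ?p u = (t - u) *\<^sub>R (y - x)" by (simp add: algebra_simps)
      finally show "dist (v (?p t)) (v (?p u)) \<le> L * norm (x - y) * dist t u"
        by (simp add: dist_real_def norm_minus_commute mult_ac)
    qed (use L in simp)
    have "closed (?p -` U i)"
      by (rule closed_vimage) (use assms(2)[OF i] in \<open>auto intro!: continuous_intros\<close>)
    then show "closed {t. ?p t \<in> U i}" by (simp add: vimage_def)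
  next
    show "{0..1} \<subseteq> (\<Union>i\<in>I. {t. ?p t \<in> U i})"
    proof
      fix t :: real assume "t \<in> {0..1}"
      then have "?p t \<in> closed_segment x y"
        unfolding in_segment by (intro exI[of _ t]) (simp add: algebra_simps)
      then show "t \<in> (\<Union>i\<in>I. {t. ?p t \<in> U i})" using seg by blast
    qed
  next
    show "finite I" by (rule assms(1))
    show "0 \<le> L * norm (x - y)" using L by simp
  qed
  from lipschitz_onD[OF this, of 0 1] show ?thesis
    by (simp add: dist_real_def abs_minus_commute)
qed

text \<open>
  Finite element functions are Lipschitz on the whole space, since they are piecewise affine on
  the closed domain and vanish outside. This makes their global energy finite.
\<close>

lemma fe_lipschitz:
  assumes v: "v \<in> fe_space \<Omega> Th"
  shows "\<exists>L\<ge>0. \<forall>x y. \<bar>v x - v y\<bar> \<le> L * norm (x - y)"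
proof -
  have "\<forall>T\<in>Th. \<exists>a c. \<forall>x\<in>T. v x = a \<bullet> x + c" using v by (simp add: fe_space_def)
  then obtain a c where ac: "\<And>T x. T \<in> Th \<Longrightarrow> x \<in> T \<Longrightarrow> v x = a T \<bullet> x + c T" by metis
  define L where "L = (\<Sum>T\<in>Th. norm (a T))"
  have L: "0 \<le> L" unfolding L_def by (simp add: sum_nonneg)
  have aL: "norm (a T) \<le> L" if "T \<in> Th" for T
    unfolding L_def by (rule member_le_sum) (use that finite_mesh in auto)
  have out: "v x = 0" if "x \<notin> \<Omega>" for x
    using v that open_dom by (auto simp: fe_space_def frontier_def interior_open)
  have "\<bar>v x - v y\<bar> \<le> L * norm (x - y)" for x y
  proof (rule lipschitz_pieces[where I="insert (- \<Omega>) Th" and U=id])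
    fix T x y assume T: "T \<in> insert (- \<Omega>) Th" "x \<in> id T" "y \<in> id T"
    show "\<bar>v x - v y\<bar> \<le> L * norm (x - y)"
    proof (cases "T \<in> Th")
      case True
      then have "\<bar>v x - v y\<bar> \<le> norm (a T) * norm (x - y)"
        using ac[OF True] T Cauchy_Schwarz_ineq2[of "a T" "x - y"] by (simp add: inner_diff_right)
      also have "\<dots> \<le> L * norm (x - y)" by (rule mult_right_mono[OF aL[OF True]]) simp
      finally show ?thesis .
    next
      case False
      then show ?thesis using T out L by auto
    qed
  next
    show "closed_segment x y \<subseteq> (\<Union>i\<in>insert (- \<Omega>) Th. id i)"
      using Union_mesh closure_subset[of \<Omega>] by auto
  qed (use finite_mesh closed_elem open_dom L in auto)
  then show ?thesis using L by blast
qed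

end

section \<open>Nodal values and the mass of a discrete function\<close>

text \<open>
  Shrink \<open>T\<close> by the factor \<open>1/4\<close> towards the point \<open>p\<close>
  where \<open>\<bar>g\<bar>\<close> is largest. On the shrunken copy
  \<open>\<bar>g\<bar>\<close> still is at least half its maximum, and the volume has dropped
  by \<open>4 ^ DIM('a)\<close> only. Hence nodal values are controlled by the
  \<open>L\<^sup>2\<close> norm on the element, with a constant that is independent of its
  shape.
\<close>

lemma affine_L2_lower:
  fixes T :: "'a::euclidean_space set"
  assumes T: "convex T" "compact T" and p: "p \<in> T"
    and g: "\<And>x. x \<in> T \<Longrightarrow> g x = a \<bullet> x + c" and max: "\<And>x. x \<in> T \<Longrightarrow> \<bar>g x\<bar> \<le> \<bar>g p\<bar>"
  shows "ennreal ((g p)\<^sup>2) * emeasure lebesgue T \<le> ennreal (4 ^ Suc DIM('a)) * (\<integral>\<^sup>+x\<in>T. ennreal ((g x)\<^sup>2) \<partial>lebesgue)"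
proof -
  define S where "S = (\<lambda>x. (1/4) *\<^sub>R x + (3/4) *\<^sub>R p) ` T"
  have S: "x \<in> T \<and> (g p)\<^sup>2 / 4 \<le> (g x)\<^sup>2" if "x \<in> S" for x
  proof -
    have "\<exists>y\<in>T. x = (1/4) *\<^sub>R y + (3/4) *\<^sub>R p" using that unfolding S_def image_iff .
    then obtain y where y: "y \<in> T" "x = (1/4) *\<^sub>R y + (3/4) *\<^sub>R p" by blast
    then have x: "x \<in> T" using convexD[OF T(1) y(1) p, of "1/4" "3/4"] by simp
    have "g x = (1/4) * g y + (3/4) * g p"
      using g[OF x] g[OF y(1)] g[OF p] y by (simp add: inner_add_right field_simps)
    then have "\<bar>g p\<bar> / 2 \<le> \<bar>g x\<bar>" using max[OF y(1)] by linarith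
    then have "(\<bar>g p\<bar> / 2)\<^sup>2 \<le> \<bar>g x\<bar>\<^sup>2" by (rule power_mono) simp
    then show ?thesis using x by (simp add: power_divide)
  qed
  have "compact S" unfolding S_def
    by (intro compact_continuous_image T(2) continuous_intros)
  then have mS: "S \<in> sets lebesgue" by (simp add: borel_compact)
  have eS: "emeasure lebesgue S = ennreal ((1/4) ^ DIM('a)) * emeasure lebesgue T"
    unfolding S_def using emeasure_lebesgue_affine[of "1/4" "(3/4) *\<^sub>R p" T] by simp
  have "ennreal (4 ^ DIM('a)) * emeasure lebesgue S = ennreal (4 ^ DIM('a) * (1/4) ^ DIM('a)) * emeasure lebesgue T"
    unfolding eS by (subst ennreal_mult) (simp_all only: mult.assoc, simp_all)
  also have "4 ^ DIM('a) * (1/4 :: real) ^ DIM('a) = 1"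
    by (simp only: power_mult_distrib[symmetric]) simp
  finally have "emeasure lebesgue T = ennreal (4 ^ DIM('a)) * emeasure lebesgue S" by simp
  then have "ennreal ((g p)\<^sup>2) * emeasure lebesgue T = ennreal (4 ^ Suc DIM('a)) * (ennreal ((g p)\<^sup>2 / 4) * emeasure lebesgue S)"
  proof -
    have "(g p)\<^sup>2 * 4 ^ DIM('a) = 4 ^ Suc DIM('a) * ((g p)\<^sup>2 / 4)" by simp
    then have "ennreal ((g p)\<^sup>2) * ennreal (4 ^ DIM('a)) = ennreal (4 ^ Suc DIM('a)) * ennreal ((g p)\<^sup>2 / 4)"
      by (simp only: ennreal_mult[symmetric] zero_le_power2 zero_le_power zero_le_numeral zero_le_divide_iff simp_thms)
    with \<open>emeasure lebesgue T = _\<close> show ?thesis by (simp only: mult.assoc[symmetric])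
  qed
  also have "ennreal ((g p)\<^sup>2 / 4) * emeasure lebesgue S = (\<integral>\<^sup>+x. ennreal ((g p)\<^sup>2 / 4) * indicator S x \<partial>lebesgue)"
    using mS by (simp add: nn_integral_cmult_indicator)
  also have "\<dots> \<le> (\<integral>\<^sup>+x\<in>T. ennreal ((g x)\<^sup>2) \<partial>lebesgue)"
    by (rule nn_integral_mono) (use S in \<open>auto simp: indicator_def intro!: ennreal_leI\<close>)
  finally show ?thesis by (simp add: mult_left_mono)
qed

context fe_mesh begin

lemma elem_sets: "T \<in> Th \<Longrightarrow> T \<in> sets lebesgue"
  using compact_elem by (simp add: borel_compact)

lemma elem_inter_negligible:
  assumes "T \<in> Th" "T' \<in> Th" "T \<noteq> T'"
  shows "negligible (T \<inter> T')"
proof -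
  have "aff_dim (T \<inter> T') < int DIM('a)"
  proof (cases "T \<inter> T' = T")
    case False
    then show ?thesis
      using face_of_aff_dim_lt[OF convex_elem[OF assms(1)] face[OF assms(1,2)]] aff_dim_simplex[OF simplex[OF assms(1)]] by simp
  next
    case True
    then have "T face_of T'" using face[OF assms(2,1)] by (simp add: Int_commute)
    then show ?thesis
      using face_of_aff_dim_lt[OF convex_elem[OF assms(2)]] assms(3) True aff_dim_simplex[OF simplex[OF assms(2)]] by simp
  qed
  then have "interior (T \<inter> T') = {}" using low_dim_interior[of "T \<inter> T'"] by linarith
  then show ?thesis
    using negligible_convex_interior[of "T \<inter> T'"] convex_elem assms by (simp add: convex_Int)
qed

lemma sum_elem_integral_le:
  assumes F: "F \<subseteq> Th" and A: "\<And>T. T \<in> F \<Longrightarrow> T \<subseteq> A"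
    and f: "f \<in> borel_measurable lebesgue"
  shows "(\<Sum>T\<in>F. \<integral>\<^sup>+x\<in>T. f x \<partial>lebesgue) \<le> (\<integral>\<^sup>+x\<in>A. f x \<partial>lebesgue)"
proof -
  have fin: "finite F" using F finite_mesh finite_subset by blast
  define N where "N = (\<Union>T\<in>F. \<Union>T'\<in>F - {T}. T \<inter> T')"
  have "negligible N" unfolding N_def
    using fin F elem_inter_negligible by (intro negligible_Union) blast+
  then have N: "N \<in> null_sets lebesgue" by (simp add: negligible_iff_null_sets)
  have "(\<Sum>T\<in>F. \<integral>\<^sup>+x\<in>T. f x \<partial>lebesgue) = (\<integral>\<^sup>+x. (\<Sum>T\<in>F. f x * indicator T x) \<partial>lebesgue)"
    by (rule nn_integral_sum[symmetric])
      (use f F elem_sets in \<open>auto intro!: borel_measurable_times_ennreal borel_measurable_indicator\<close>)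
  also have "\<dots> \<le> (\<integral>\<^sup>+x\<in>A. f x \<partial>lebesgue)"
  proof (rule nn_integral_mono_AE)
    show "AE x in lebesgue. (\<Sum>T\<in>F. f x * indicator T x) \<le> f x * indicator A x"
    proof (rule AE_I'[OF N], rule subsetI, rule ccontr)
      fix x assume x: "x \<in> {x \<in> space lebesgue. \<not> (\<Sum>T\<in>F. f x * indicator T x) \<le> f x * indicator A x}" "x \<notin> N"
      show False
      proof (cases "\<exists>T\<in>F. x \<in> T")
        case True
        then obtain T where T: "T \<in> F" "x \<in> T" by blast
        have "x \<notin> T'" if "T' \<in> F" "T' \<noteq> T" for T'
          using that T x(2) unfolding N_def by blast
        then have "f x * indicator T' x = (if T' = T then f x else 0)" if "T' \<in> F" for T'
          using that T by (cases "T' = T") auto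
        then have "(\<Sum>T'\<in>F. f x * indicator T' x) = (\<Sum>T'\<in>F. if T' = T then f x else 0)"
          by (rule sum.cong[OF refl])
        also have "\<dots> = f x" using T fin by simp
        finally show False using x(1) A[OF T(1)] T(2) by auto
      next
        case False
        then have "(\<Sum>T\<in>F. f x * indicator T x) = 0" by (intro sum.neutral) auto
        then show False using x by simp
      qed
    qed
  qed
  finally show ?thesis .
qed

definition elem_max :: "('a \<Rightarrow> real) \<Rightarrow> 'a set \<Rightarrow> real" where
  "elem_max w T = Max ((\<lambda>i. \<bar>w i\<bar>) ` verts T)"

lemma verts_nonempty: "T \<in> Th \<Longrightarrow> verts T \<noteq> {}"
  using card_verts_elem by fastforce

lemma elem_max_vert:
  assumes "T \<in> Th" "i \<in> verts T" shows "\<bar>w i\<bar> \<le> elem_max w T"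
  unfolding elem_max_def by (rule Max_ge) (use assms finite_verts[OF simplex] in auto)

lemma elem_max_attained:
  assumes "T \<in> Th" obtains p where "p \<in> verts T" "elem_max w T = \<bar>w p\<bar>"
proof -
  have "elem_max w T \<in> (\<lambda>i. \<bar>w i\<bar>) ` verts T"
    unfolding elem_max_def by (rule Max_in) (use assms finite_verts[OF simplex] verts_nonempty in auto)
  then show ?thesis using that by blast
qed

lemma elem_max_ge:
  assumes "w \<in> fe_space \<Omega> Th" "T \<in> Th" "x \<in> T" shows "\<bar>w x\<bar> \<le> elem_max w T"
proof -
  have "\<bar>w x\<bar> \<le> (\<Sum>i\<in>verts T. \<bar>hat i x * w i\<bar>)"
    unfolding fe_eval[OF assms] by (rule sum_abs)
  also have "\<dots> \<le> (\<Sum>i\<in>verts T. hat i x * elem_max w T)"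
    using elem_max_vert[OF assms(2)] hat_nonneg[OF assms(2,3)]
    by (intro sum_mono) (auto simp: abs_mult intro!: mult_left_mono)
  also have "\<dots> = elem_max w T"
    using hat_sum[OF assms(2,3)] by (simp add: sum_distrib_right[symmetric])
  finally show ?thesis .
qed

lemma elem_max_L2:
  assumes "w \<in> fe_space \<Omega> Th" "T \<in> Th"
  shows "ennreal ((elem_max w T)\<^sup>2) * emeasure lebesgue T \<le> ennreal (4 ^ Suc DIM('a)) * (\<integral>\<^sup>+x\<in>T. ennreal ((w x)\<^sup>2) \<partial>lebesgue)"
proof -
  obtain p where p: "p \<in> verts T" "elem_max w T = \<bar>w p\<bar>" using elem_max_attained[OF assms(2)] .
  obtain a c where "\<And>x. x \<in> T \<Longrightarrow> w x = a \<bullet> x + c" using assms by (auto simp: fe_space_def)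
  then have "ennreal ((w p)\<^sup>2) * emeasure lebesgue T \<le> ennreal (4 ^ Suc DIM('a)) * (\<integral>\<^sup>+x\<in>T. ennreal ((w x)\<^sup>2) \<partial>lebesgue)"
    by (intro affine_L2_lower[where a=a and c=c])
      (use assms convex_elem compact_elem p verts_subset[of T] elem_max_ge[OF assms] in auto)
  then show ?thesis by (simp add: p(2))
qed

lemma fe_borel: "w \<in> fe_space \<Omega> Th \<Longrightarrow> w \<in> borel_measurable borel"
proof -
  assume w: "w \<in> fe_space \<Omega> Th"
  then obtain L where L: "0 \<le> L" "\<And>x y. \<bar>w x - w y\<bar> \<le> L * norm (x - y)" using fe_lipschitz by blast
  have "L-lipschitz_on UNIV w"
    by (rule lipschitz_onI) (use L in \<open>auto simp: dist_norm\<close>)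
  then have "continuous_on UNIV w" by (rule lipschitz_on_continuous_on)
  then show ?thesis by (rule borel_measurable_continuous_onI)
qed

lemma fe_measurable: "w \<in> fe_space \<Omega> Th \<Longrightarrow> w \<in> borel_measurable lebesgue"
  using fe_borel by (simp add: measurable_completion)

end

section \<open>Vertex stars of a shape-regular mesh\<close>

locale local_mesh = fe_mesh +
  fixes x0 :: 'a and R \<sigma> :: real
  assumes R: "0 < R" and ball_sub: "ball x0 R \<subseteq> \<Omega>"
    and shape: "\<And>T. T \<in> Th \<Longrightarrow> diameter T \<le> \<sigma> * inball_diameter T"
    and small: "\<And>T. T \<in> Th \<Longrightarrow> T \<inter> ball x0 R \<noteq> {} \<Longrightarrow> 16 * diameter T \<le> R"
begin

lemma inball_pos: "T \<in> Th \<Longrightarrow> 0 < inball_diameter T"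
  using inball_diameter_pos[OF simplex] .

lemma diameter_pos: "T \<in> Th \<Longrightarrow> 0 < diameter T"
  using inball_pos inball_diameter_le_diameter[OF bounded_elem] by fastforce

lemma sigma_ge_1: "1 \<le> \<sigma>"
proof -
  have "x0 \<in> closure \<Omega>" using ball_sub R closure_subset by force
  then obtain T where T: "T \<in> Th" using Union_mesh by blast
  have "inball_diameter T \<le> \<sigma> * inball_diameter T"
    using shape[OF T] inball_diameter_le_diameter[OF bounded_elem[OF T]] by linarith
  then show ?thesis using inball_pos[OF T] by simp
qed

lemma elem_cover: "x \<in> ball x0 R \<Longrightarrow> \<exists>T\<in>Th. x \<in> T"
  using ball_sub Union_mesh closure_subset by blast

lemma elem_dist: "T \<in> Th \<Longrightarrow> x \<in> T \<Longrightarrow> y \<in> T \<Longrightarrow> norm (x - y) \<le> diameter T"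
  using diameter_bounded_bound[OF bounded_elem] by (simp add: dist_norm)

lemma elem_near:
  assumes "T \<in> Th" "x \<in> T" "y \<in> T" "norm (x - x0) < r" "r \<le> R"
  shows "norm (y - x0) < r + R / 16"
proof -
  have "x \<in> ball x0 R" using assms by (simp add: dist_norm norm_minus_commute)
  then have "16 * diameter T \<le> R" using small[OF assms(1)] assms(2) by blast
  moreover have "norm (y - x0) \<le> norm (y - x) + norm (x - x0)"
    using norm_triangle_ineq[of "y - x" "x - x0"] by simp
  ultimately show ?thesis using elem_dist[OF assms(1,3,2)] assms(4) by linarith
qed

lemma hat_lipschitz_elem:
  assumes "T \<in> Th" "x \<in> T" "y \<in> T"
  shows "\<bar>hat i x - hat i y\<bar> \<le> \<sigma> / diameter T * norm (x - y)"
proof -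
  have "\<bar>hat i x - hat i y\<bar> * inball_diameter T \<le> norm (x - y)"
    using bary_lipschitz[OF simplex[OF assms(1)]] by (simp add: hat_eq[OF assms(1)] assms)
  then have "\<bar>hat i x - hat i y\<bar> * (\<sigma> * inball_diameter T) \<le> \<sigma> * norm (x - y)"
    using mult_left_mono[of _ "norm (x - y)" \<sigma>] sigma_ge_1 by (simp add: mult_ac)
  moreover have "\<bar>hat i x - hat i y\<bar> * diameter T \<le> \<bar>hat i x - hat i y\<bar> * (\<sigma> * inball_diameter T)"
    by (intro mult_left_mono shape assms) simp
  ultimately have "\<bar>hat i x - hat i y\<bar> * diameter T \<le> \<sigma> * norm (x - y)" by linarith
  then show ?thesis using diameter_pos[OF assms(1)] by (simp add: field_simps)
qed

lemma interp_local:
  assumes g: "\<And>i. i \<in> nodes \<Longrightarrow> 13 / 16 * R \<le> norm (i - x0) \<Longrightarrow> g i = 0"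
  shows interp_local_zero: "\<And>x. x \<notin> ball x0 (7 / 8 * R) \<Longrightarrow> interp g x = 0"
    and interp_local_mem: "interp g \<in> fe_space_local \<Omega> Th (ball x0 R)"
proof -
  have zero: "interp g x = 0" if x: "x \<notin> ball x0 (7 / 8 * R)" for x
  proof (cases "x \<in> closure \<Omega>")
    case True
    then obtain T where T: "T \<in> Th" "x \<in> T" using Union_mesh by blast
    have "g i = 0" if i: "i \<in> verts T" for i
    proof (rule g)
      show "i \<in> nodes" using i verts_nodes[OF T(1)] by blast
      show "13 / 16 * R \<le> norm (i - x0)"
      proof (rule ccontr)
        assume "\<not> 13 / 16 * R \<le> norm (i - x0)"
        then have "norm (x - x0) < 13 / 16 * R + R / 16"
          using R by (intro elem_near[OF T(1) _ T(2), of i]) (use verts_subset i in auto)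
        then show False using x by (simp add: dist_norm norm_minus_commute)
      qed
    qed
    then show ?thesis by (simp add: interp_elem[OF T])
  qed (rule interp_outside)
  then show "\<And>x. x \<notin> ball x0 (7 / 8 * R) \<Longrightarrow> interp g x = 0" .
  have sub: "ball x0 (7 / 8 * R) \<subseteq> ball x0 R" using R by (intro subset_ball) simp
  have "interp g \<in> fe_space \<Omega> Th"
  proof (rule interp_fe_space)
    fix x assume "x \<in> frontier \<Omega>"
    then have "x \<notin> \<Omega>" using open_dom by (simp add: frontier_def interior_open)
    then show "interp g x = 0" using zero sub ball_sub by blast
  qed
  then show "interp g \<in> fe_space_local \<Omega> Th (ball x0 R)"
    using zero sub unfolding fe_space_local_def by blast
qed

text \<open>
  On the elements inside the ball this is a measurable majorant of \<open>w\<^sup>2\<close>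
  that even dominates all nodal values of the element. On the common faces, a null set, several
  elements add up.
\<close>

definition max_sq :: "('a \<Rightarrow> real) \<Rightarrow> 'a \<Rightarrow> real" where
  "max_sq w x = (\<Sum>T\<in>{T\<in>Th. T \<subseteq> ball x0 R}. (elem_max w T)\<^sup>2 * indicator T x)"

lemma max_sq_nonneg: "0 \<le> max_sq w x"
  by (simp add: max_sq_def sum_nonneg)

lemma max_sq_measurable: "max_sq w \<in> borel_measurable lebesgue"
  unfolding max_sq_def using elem_sets
  by (intro borel_measurable_sum borel_measurable_times borel_measurable_const borel_measurable_indicator) auto

lemma max_sq_ge:
  assumes "T \<in> Th" "T \<subseteq> ball x0 R" "x \<in> T"
  shows "(elem_max w T)\<^sup>2 \<le> max_sq w x"
proof -
  have "(elem_max w T)\<^sup>2 * indicator T x \<le> max_sq w x"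
    unfolding max_sq_def by (rule member_le_sum) (use assms finite_mesh in auto)
  then show ?thesis using assms by simp
qed

lemma max_sq_integral:
  assumes w: "w \<in> fe_space \<Omega> Th"
  shows "(\<integral>\<^sup>+x. ennreal (max_sq w x) \<partial>lebesgue) \<le> ennreal (4 ^ Suc DIM('a)) * L2_norm_sq (ball x0 R) w"
proof -
  let ?F = "{T\<in>Th. T \<subseteq> ball x0 R}"
  have "(\<integral>\<^sup>+x. ennreal (max_sq w x) \<partial>lebesgue) = (\<integral>\<^sup>+x. (\<Sum>T\<in>?F. ennreal ((elem_max w T)\<^sup>2) * indicator T x) \<partial>lebesgue)"
    by (intro nn_integral_cong) (simp add: max_sq_def sum_ennreal[symmetric] ennreal_mult' ennreal_indicator)
  also have "\<dots> = (\<Sum>T\<in>?F. \<integral>\<^sup>+x. ennreal ((elem_max w T)\<^sup>2) * indicator T x \<partial>lebesgue)"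
    by (rule nn_integral_sum) (use elem_sets in \<open>auto intro!: borel_measurable_times_ennreal borel_measurable_indicator\<close>)
  also have "\<dots> = (\<Sum>T\<in>?F. ennreal ((elem_max w T)\<^sup>2) * emeasure lebesgue T)"
    by (intro sum.cong refl nn_integral_cmult_indicator) (use elem_sets in auto)
  also have "\<dots> \<le> (\<Sum>T\<in>?F. ennreal (4 ^ Suc DIM('a)) * (\<integral>\<^sup>+x\<in>T. ennreal ((w x)\<^sup>2) \<partial>lebesgue))"
    by (intro sum_mono elem_max_L2[OF w]) auto
  also have "\<dots> = ennreal (4 ^ Suc DIM('a)) * (\<Sum>T\<in>?F. \<integral>\<^sup>+x\<in>T. ennreal ((w x)\<^sup>2) \<partial>lebesgue)"
    by (simp only: sum_distrib_left)
  also have "(\<Sum>T\<in>?F. \<integral>\<^sup>+x\<in>T. ennreal ((w x)\<^sup>2) \<partial>lebesgue) \<le> L2_norm_sq (ball x0 R) w"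
    unfolding L2_norm_sq_def using fe_measurable[OF w] by (intro sum_elem_integral_le) auto
  finally show ?thesis by (simp add: mult_left_mono)
qed


definition star :: "'a \<Rightarrow> 'a set set" where "star i = {T\<in>Th. i \<in> T}"

lemma finite_star: "finite (star i)"
  using finite_mesh by (simp add: star_def)

text \<open>
  The common face of \<open>T\<close> and \<open>T'\<close> is spanned by common vertices, so
  it has a vertex \<open>j\<close> other than \<open>i\<close>. Between \<open>i\<close> and
  \<open>j\<close>, whose distance is at most the diameter of \<open>T'\<close>, a barycentric
  coordinate of \<open>T\<close> drops from 1 to 0, while its slope is at most the inverse of
  the inscribed ball's diameter.
\<close>

lemma edge_comparable:
  assumes "T \<in> Th" "T' \<in> Th" "i \<in> verts T" "i \<in> T'" "z \<in> T" "z \<in> T'" "z \<noteq> i"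
  shows "diameter T \<le> \<sigma> * diameter T'"
proof -
  obtain C where C: "C \<subseteq> verts T" "C \<subseteq> verts T'" "T \<inter> T' = convex hull C"
    using inter_hull[OF assms(1,2)] .
  have "\<not> C \<subseteq> {i}"
  proof
    assume "C \<subseteq> {i}"
    then have "convex hull C \<subseteq> convex hull {i}" by (rule hull_mono)
    then have "convex hull C \<subseteq> {i}" by simp
    then show False using C(3) assms by blast
  qed
  then obtain j where j: "j \<in> C" "j \<noteq> i" by blast
  then have jT: "j \<in> verts T" "j \<in> T'" using C verts_subset by blast+
  have "bary T i i - bary T i j = 1"
    using bary_vert[OF simplex[OF assms(1)], of _ i] assms(3) jT j by simp
  then have "inball_diameter T \<le> norm (i - j)"
    using bary_lipschitz[OF simplex[OF assms(1)], of i i j] by simp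
  also have "\<dots> \<le> diameter T'" by (rule elem_dist[OF assms(2,4) jT(2)])
  finally have "\<sigma> * inball_diameter T \<le> \<sigma> * diameter T'" using sigma_ge_1 by simp
  then show ?thesis using shape[OF assms(1)] by linarith
qed

text \<open>
  This is where the dimension enters: close to an interior node the star covers a ball, and the
  ball remains connected when the node is removed. So the two closed sets covered by
  \<open>A\<close> and by the rest of the star must meet in another point.
\<close>

lemma star_connected:
  assumes dim: "2 \<le> DIM('a)" and i: "i \<in> nodes" "i \<in> \<Omega>"
    and A: "A \<subseteq> star i" "A \<noteq> {}" "A \<noteq> star i"
  obtains T T' z where "T \<in> A" "T' \<in> star i - A" "z \<in> T" "z \<in> T'" "z \<noteq> i"
proof (rule ccontr)
  assume neg: "\<not> thesis"
  define U where "U = \<Omega> - \<Union>(Th - star i)"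
  have "closed (\<Union>(Th - star i))" using finite_mesh closed_elem by (intro closed_Union) auto
  then have "open U" using open_dom by (auto simp: U_def intro: open_Diff)
  moreover have "i \<in> U" using i by (auto simp: U_def star_def)
  ultimately obtain r where r: "0 < r" "ball i r \<subseteq> U" using openE by blast
  define B where "B = ball i r - {i}"
  have con: "connected B" unfolding B_def by (rule connected_punctured_ball[OF dim])
  have meets: "T \<inter> B \<noteq> {}" if T: "T \<in> star i" for T
  proof -
    have iT: "i \<in> T" "T \<in> Th" using T by (auto simp: star_def)
    have "\<not> verts T \<subseteq> {i}"
    proof
      assume "verts T \<subseteq> {i}"
      then have "card (verts T) \<le> 1" using card_mono[of "{i}"] by fastforce
      then show False using card_verts_elem[OF iT(2)] dim by simp
    qed
    then obtain j where j: "j \<in> verts T" "j \<noteq> i" by blast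
    then have jT: "j \<in> T" using verts_subset by blast
    define t where "t = min 1 (r / (2 * norm (j - i)))"
    have n: "0 < norm (j - i)" using j by simp
    have t: "0 < t" "t \<le> 1" "t * norm (j - i) < r"
    proof -
      show "0 < t" "t \<le> 1" using r n by (auto simp: t_def)
      have "t * norm (j - i) \<le> r / (2 * norm (j - i)) * norm (j - i)"
        by (intro mult_right_mono) (auto simp: t_def)
      also have "\<dots> = r / 2" using n by simp
      finally show "t * norm (j - i) < r" using r by simp
    qed
    have "(1 - t) *\<^sub>R i + t *\<^sub>R j \<in> T"
      using convexD[OF convex_elem[OF iT(2)] iT(1) jT, of "1 - t" t] t by simp
    moreover have "(1 - t) *\<^sub>R i + t *\<^sub>R j = i + t *\<^sub>R (j - i)" by (simp add: algebra_simps)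
    moreover have "i + t *\<^sub>R (j - i) \<in> B"
      using t j by (auto simp: B_def dist_norm)
    ultimately show ?thesis by auto
  qed
  have sub: "B \<subseteq> \<Union>A \<union> \<Union>(star i - A)"
  proof
    fix x assume "x \<in> B"
    then have "x \<in> U" using r by (auto simp: B_def)
    moreover then obtain T where "T \<in> Th" "x \<in> T" using Union_mesh closure_subset[of \<Omega>] unfolding U_def by blast
    ultimately show "x \<in> \<Union>A \<union> \<Union>(star i - A)" by (auto simp: U_def)
  qed
  have clo: "closed (\<Union>A)" "closed (\<Union>(star i - A))"
    using A(1) finite_star[of i] finite_subset closed_elem
    by (auto intro!: closed_Union simp: star_def)
  have disj: "\<Union>A \<inter> \<Union>(star i - A) \<inter> B = {}"
    using neg that by (auto simp: B_def)
  have ne: "\<Union>A \<inter> B \<noteq> {}" "\<Union>(star i - A) \<inter> B \<noteq> {}"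
    using A meets by blast+
  show False
    using con clo sub disj ne unfolding connected_closed by blast
qed

text \<open>
  Growing a set of elements from \<open>T0\<close> one by one, each new element sharing a point
  other than \<open>i\<close> with an old one, costs a factor \<open>\<sigma>\<close> per step.
\<close>

lemma star_chain:
  assumes dim: "2 \<le> DIM('a)" and i: "i \<in> nodes" "i \<in> \<Omega>" and T0: "T0 \<in> star i"
    and k: "k < card (star i)"
  shows "\<exists>A\<subseteq>star i. T0 \<in> A \<and> card A = Suc k \<and> (\<forall>T\<in>A. diameter T \<le> \<sigma> ^ k * diameter T0)"
  using k
proof (induction k)
  case 0
  then show ?case using T0 by (intro exI[of _ "{T0}"]) auto
next
  case (Suc k)
  then obtain A where A: "A \<subseteq> star i" "T0 \<in> A" "card A = Suc k" "\<And>T. T \<in> A \<Longrightarrow> diameter T \<le> \<sigma> ^ k * diameter T0"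
    by auto
  have "A \<noteq> star i" "A \<noteq> {}" using A Suc by auto
  then obtain T T' z where T: "T \<in> A" "T' \<in> star i - A" "z \<in> T" "z \<in> T'" "z \<noteq> i"
    using star_connected[OF dim i A(1)] by metis
  have Th: "T \<in> Th" "T' \<in> Th" "i \<in> T" "i \<in> T'" using T A by (auto simp: star_def)
  have "diameter T' \<le> \<sigma> * diameter T"
    using edge_comparable[OF Th(2,1) node_vert[OF i(1) Th(2,4)] Th(3) T(4,3,5)] .
  also have "\<dots> \<le> \<sigma> * (\<sigma> ^ k * diameter T0)"
    using A(4)[OF T(1)] sigma_ge_1 by (intro mult_left_mono) auto
  finally have T': "diameter T' \<le> \<sigma> ^ Suc k * diameter T0" by simp
  have up: "\<sigma> ^ k * diameter T0 \<le> \<sigma> ^ Suc k * diameter T0"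
    using sigma_ge_1 diameter_pos T0 by (intro mult_right_mono power_increasing) (auto simp: star_def less_imp_le)
  have "finite A" using A(1) finite_star finite_subset by blast
  then show ?case
    using A T T' order_trans[OF A(4) up] by (intro exI[of _ "insert T' A"]) auto
qed

text \<open>
  Packing: scaled towards \<open>i\<close> to the size of the smallest element, every element
  of the star contains a ball whose radius is a fixed fraction of that size. These balls are
  disjoint and lie in one ball around \<open>i\<close>.
\<close>

lemma star_card: "real (card (star i)) \<le> (4 * \<sigma>) ^ DIM('a)"
proof (cases "star i = {}")
  case True
  then show ?thesis using sigma_ge_1 by simp
next
  case False
  define r where "r = Min (diameter ` star i)"
  have rle: "r \<le> diameter T" if "T \<in> star i" for T
    unfolding r_def using that finite_star by auto
  have "r \<in> diameter ` star i" unfolding r_def using False finite_star by (intro Min_in) auto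
  then have r: "0 < r" using diameter_pos by (auto simp: star_def)
  define e where "e = r / (4 * \<sigma>)"
  have e: "0 < e" using r sigma_ge_1 by (simp add: e_def)
  have "\<exists>q. ball q e \<subseteq> T \<inter> cball i r" if T: "T \<in> star i" for T
  proof -
    have Th: "T \<in> Th" "i \<in> T" using T by (auto simp: star_def)
    \<comment> \<open>Half the radius is given away because the supremum in the definition of the inball
        diameter need not be attained.\<close>
    obtain q where q: "cball q (inball_diameter T / 2 / 2) \<subseteq> T"
      using inball_diameter_ball[of "inball_diameter T / 2" T] inball_pos[OF Th(1)] by auto
    define t where "t = r / diameter T"
    have t: "0 < t" "t \<le> 1" using r rle[OF T] diameter_pos[OF Th(1)] by (auto simp: t_def)
    have et: "e \<le> t * (inball_diameter T / 4)"
    proof -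
      have "r * diameter T \<le> r * (\<sigma> * inball_diameter T)"
        using shape[OF Th(1)] r by (intro mult_left_mono) auto
      then show ?thesis using diameter_pos[OF Th(1)] sigma_ge_1 by (simp add: e_def t_def field_simps)
    qed
    have "ball (i + t *\<^sub>R (q - i)) e \<subseteq> T \<inter> cball i r"
    proof
      fix y assume y: "y \<in> ball (i + t *\<^sub>R (q - i)) e"
      define y' where "y' = i + (1 / t) *\<^sub>R (y - i)"
      have yy: "y = (1 - t) *\<^sub>R i + t *\<^sub>R y'" "y - i = t *\<^sub>R (y' - i)"
        using t by (simp_all add: y'_def algebra_simps)
      have "q - y' = (1 / t) *\<^sub>R ((i + t *\<^sub>R (q - i)) - y)"
        using t by (simp add: y'_def algebra_simps)
      then have "norm (q - y') = (1 / t) * norm ((i + t *\<^sub>R (q - i)) - y)"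
        using t by (simp only: norm_scaleR) simp
      also have "\<dots> \<le> (1 / t) * e" using y t by (intro mult_left_mono) (auto simp: dist_norm)
      also have "\<dots> \<le> inball_diameter T / 4" using et t by (simp add: field_simps)
      finally have y'T: "y' \<in> T" using q by (auto simp: dist_norm subset_iff)
      then have "y \<in> T"
        unfolding yy(1) using convexD[OF convex_elem[OF Th(1)] Th(2) y'T, of "1 - t" t] t by simp
      moreover have "norm (y - i) \<le> t * diameter T"
        unfolding yy(2) using elem_dist[OF Th(1) y'T Th(2)] t by (simp add: mult_left_mono)
      then have "norm (y - i) \<le> r" using diameter_pos[OF Th(1)] by (simp add: t_def)
      ultimately show "y \<in> T \<inter> cball i r" by (simp add: dist_norm norm_minus_commute)
    qed
    then show ?thesis by blast
  qed
  then obtain q where q: "\<And>T. T \<in> star i \<Longrightarrow> ball (q T) e \<subseteq> T \<inter> cball i r" by metis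
  have dis: "disjoint_family_on (\<lambda>T. ball (q T) e) (star i)"
  proof (unfold disjoint_family_on_def, intro ballI impI)
    fix T T' assume T: "T \<in> star i" "T' \<in> star i" "T \<noteq> T'"
    have "negligible (ball (q T) e \<inter> ball (q T') e)"
      by (rule negligible_subset[OF elem_inter_negligible[of T T']]) (use T q in \<open>auto simp: star_def\<close>)
    then show "ball (q T) e \<inter> ball (q T') e = {}"
      using open_not_negligible by (metis open_Int open_ball)
  qed
  let ?w = "unit_ball_vol (real DIM('a))"
  have "(\<Sum>T\<in>star i. emeasure lebesgue (ball (q T) e)) = emeasure lebesgue (\<Union>T\<in>star i. ball (q T) e)"
    by (rule sum_emeasure) (use dis finite_star in auto)
  also have "\<dots> \<le> emeasure lebesgue (cball i r)"
    by (rule emeasure_mono) (use q in auto)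
  also have "\<dots> = ennreal (?w * r ^ DIM('a))"
    using r by (simp add: emeasure_cball)
  finally have le: "(\<Sum>T\<in>star i. emeasure lebesgue (ball (q T) e)) \<le> ennreal (?w * r ^ DIM('a))" .
  have "(\<Sum>T\<in>star i. emeasure lebesgue (ball (q T) e)) = (\<Sum>T\<in>star i. ennreal (?w * e ^ DIM('a)))"
    by (intro sum.cong refl emeasure_lebesgue_ball) (use e in simp)
  also have "\<dots> = ennreal (\<Sum>T\<in>star i. ?w * e ^ DIM('a))"
    by (rule sum_ennreal) (use e in simp)
  finally have "ennreal (real (card (star i)) * (?w * e ^ DIM('a))) \<le> ennreal (?w * r ^ DIM('a))"
    using le by simp
  then have "real (card (star i)) * (?w * e ^ DIM('a)) \<le> ?w * r ^ DIM('a)"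
    using r by (subst (asm) ennreal_le_iff) auto
  also have "r = 4 * \<sigma> * e" using sigma_ge_1 by (simp add: e_def)
  finally have "(?w * e ^ DIM('a)) * real (card (star i)) \<le> (?w * e ^ DIM('a)) * (4 * \<sigma>) ^ DIM('a)"
    by (simp add: power_mult_distrib mult_ac)
  then show ?thesis using e by (simp add: mult_le_cancel_left)
qed

text \<open>
  The walk around a node has at most as many steps as there are elements in the star.
\<close>

definition star_ratio :: real where "star_ratio = \<sigma> ^ nat \<lceil>(4 * \<sigma>) ^ DIM('a)\<rceil>"

lemma star_ratio_ge_1: "1 \<le> star_ratio"
  using sigma_ge_1 by (simp add: star_ratio_def)

lemma star_comparable:
  assumes dim: "2 \<le> DIM('a)" and i: "i \<in> nodes" "i \<in> \<Omega>" and T: "T \<in> Th" "i \<in> T" "T' \<in> Th" "i \<in> T'"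
  shows "diameter T \<le> star_ratio * diameter T'"
proof -
  have st: "T \<in> star i" "T' \<in> star i" using T by (auto simp: star_def)
  then have c: "0 < card (star i)" using finite_star card_gt_0_iff by blast
  then obtain A where A: "A \<subseteq> star i" "card A = card (star i)"
    "\<And>T. T \<in> A \<Longrightarrow> diameter T \<le> \<sigma> ^ (card (star i) - 1) * diameter T'"
    using star_chain[OF dim i st(2), of "card (star i) - 1"] by auto
  then have "A = star i" using finite_star card_subset_eq by blast
  then have "diameter T \<le> \<sigma> ^ (card (star i) - 1) * diameter T'" using A(3) st by blast
  also have "\<sigma> ^ (card (star i) - 1) \<le> star_ratio"
    unfolding star_ratio_def
  proof (rule power_increasing[OF _ sigma_ge_1])
    have "real (card (star i)) \<le> real_of_int \<lceil>(4 * \<sigma>) ^ DIM('a)\<rceil>" using star_card[of i] by linarith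
    then show "card (star i) - 1 \<le> nat \<lceil>(4 * \<sigma>) ^ DIM('a)\<rceil>" by linarith
  qed
  finally show ?thesis using diameter_pos[OF T(3)] by (simp add: mult_right_mono)
qed

lemma hat_lipschitz:
  assumes dim: "2 \<le> DIM('a)" and i: "i \<in> nodes" "i \<in> ball x0 R" and T: "T \<in> Th" "i \<in> T"
    and xy: "x \<in> ball x0 R" "y \<in> ball x0 R"
  shows "\<bar>hat i x - hat i y\<bar> \<le> \<sigma> * star_ratio / diameter T * norm (x - y)"
proof (rule lipschitz_pieces[where I=Th and U=id])
  fix T' x y assume T': "T' \<in> Th" "x \<in> id T'" "y \<in> id T'"
  show "\<bar>hat i x - hat i y\<bar> \<le> \<sigma> * star_ratio / diameter T * norm (x - y)"
  proof (cases "i \<in> T'")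
    case True
    have "\<bar>hat i x - hat i y\<bar> \<le> \<sigma> / diameter T' * norm (x - y)"
      using hat_lipschitz_elem[OF T'(1)] T' by simp
    also have "\<sigma> / diameter T' \<le> \<sigma> * star_ratio / diameter T"
    proof -
      have "\<sigma> * diameter T \<le> \<sigma> * (star_ratio * diameter T')"
        using star_comparable[OF dim i(1) _ T T'(1) True] i ball_sub sigma_ge_1 by (intro mult_left_mono) auto
      then show ?thesis using diameter_pos[OF T'(1)] diameter_pos[OF T(1)] by (simp add: field_simps)
    qed
    finally show ?thesis by (simp add: mult_right_mono)
  next
    case False
    then have "i \<notin> verts T'" using verts_subset by blast
    then show ?thesis using hat_notin[OF T'(1)] T' sigma_ge_1 star_ratio_ge_1 diameter_pos[OF T(1)] by simp
  qed
next
  have "closed_segment x y \<subseteq> ball x0 R" using xy by (intro closed_segment_subset) auto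
  then show "closed_segment x y \<subseteq> (\<Union>T\<in>Th. id T)" using elem_cover by fastforce
qed (use finite_mesh closed_elem sigma_ge_1 star_ratio_ge_1 diameter_pos[OF T(1)] in auto)

end

section \<open>Requirements on the discrete test function\<close>

lemma powr_scale_bound:
  assumes "0 < s" "s < 1" "0 < (R::real)"
  shows "(2 * R) powr (2 - 2 * s) / R\<^sup>2 \<le> 4 * R powr - (2 * s)"
proof -
  have "(2 * R) powr (2 - 2 * s) = 2 powr (2 - 2 * s) * R powr (2 - 2 * s)"
    using assms by (simp add: powr_mult)
  also have "R powr (2 - 2 * s) = R powr 2 * R powr - (2 * s)"
    by (simp only: powr_add[symmetric]) simp
  also have "R powr 2 = R\<^sup>2" using assms by simp
  finally have "(2 * R) powr (2 - 2 * s) / R\<^sup>2 = 2 powr (2 - 2 * s) * R powr - (2 * s)"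
    using assms by simp
  also have "2 powr (2 - 2 * s) \<le> (2::real) powr 2" using assms by (intro powr_mono) auto
  finally show ?thesis by (simp add: mult_right_mono)
qed

text \<open>
  The remainder terms of a nodal cutoff have the form \<open>(a x + a y) * |x - y|\<^sup>2 /
  R\<^sup>2\<close>. The square of the distance cancels the singularity, so only the mass of
  \<open>a\<close> with the scaling factor \<open>R powr - (2 * s)\<close> is left.
\<close>

lemma kint_lipschitz_weight:
  fixes a :: "'a::euclidean_space \<Rightarrow> real"
  assumes s: "0 < s" "s < 1" and R: "0 < R" and a: "a \<in> borel_measurable lebesgue" "\<And>x. 0 \<le> a x"
    and U: "\<And>x y. (x, y) \<in> U \<Longrightarrow> x \<in> A \<and> y \<in> A \<and> norm (x - y) < 2 * R \<and> g x y \<le> (a x + a y) * (norm (x - y))\<^sup>2 / R\<^sup>2"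
    and A: "A \<in> sets lebesgue"
  shows "kint s U g \<le> ennreal (8 * near_C TYPE('a) s * R powr - (2 * s)) * (\<integral>\<^sup>+x\<in>A. ennreal (a x) \<partial>lebesgue)"
proof -
  let ?V = "{p. fst p \<in> A \<and> snd p \<in> A \<and> norm (fst p - snd p) < 2 * R}"
  let ?b = "\<lambda>x. a x / R\<^sup>2"
  let ?I = "\<integral>\<^sup>+x\<in>A. ennreal (?b x) \<partial>lebesgue"
  let ?c = "ennreal (near_C TYPE('a) s * (2 * R) powr (2 - 2 * s))"
  have b: "?b \<in> borel_measurable lebesgue" "0 \<le> ?b x" for x using a by auto
  have mA: "(\<lambda>p. fst p) -` A \<inter> space leb_pair \<in> sets leb_pair" "(\<lambda>p. snd p) -` A \<inter> space leb_pair \<in> sets leb_pair"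
    using A measurable_sets[OF measurable_fst] measurable_sets[OF measurable_snd] by auto
  have "{p \<in> space leb_pair. norm (fst p - snd p :: 'a) < 2 * R} \<in> sets leb_pair" by measurable
  with mA have "(((\<lambda>p. fst p) -` A \<inter> space leb_pair) \<inter> ((\<lambda>p. snd p) -` A \<inter> space leb_pair)) \<inter> {p \<in> space leb_pair. norm (fst p - snd p :: 'a) < 2 * R} \<in> sets leb_pair"
    by blast
  moreover have "(((\<lambda>p. fst p) -` A \<inter> space leb_pair) \<inter> ((\<lambda>p. snd p) -` A \<inter> space leb_pair)) \<inter> {p \<in> space leb_pair. norm (fst p - snd p :: 'a) < 2 * R} = ?V"
    by (auto simp: space_pair_measure)
  ultimately have V: "?V \<in> sets leb_pair" by simp
  have n: "pair_measurable (\<lambda>x y :: 'a. (norm (x - y))\<^sup>2)" by measurable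
  have "kint s U g \<le> kint s ?V (\<lambda>x y. ?b x * (norm (x - y))\<^sup>2 + ?b y * (norm (x - y))\<^sup>2)"
  proof (rule kint_mono)
    fix x y assume "(x, y) \<in> U"
    moreover have "(a x + a y) * (norm (x - y))\<^sup>2 / R\<^sup>2 = ?b x * (norm (x - y))\<^sup>2 + ?b y * (norm (x - y))\<^sup>2"
      by (simp add: add_divide_distrib distrib_right)
    ultimately show "(x, y) \<in> ?V \<and> g x y \<le> ?b x * (norm (x - y))\<^sup>2 + ?b y * (norm (x - y))\<^sup>2"
      using U[of x y] by simp
  qed
  also have "\<dots> = kint s ?V (\<lambda>x y. ?b x * (norm (x - y))\<^sup>2) + kint s ?V (\<lambda>x y. ?b y * (norm (x - y))\<^sup>2)"
    by (rule kint_add[OF borel_measurable_times[OF pair_measurable_fst[OF b(1)] n]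
          borel_measurable_times[OF pair_measurable_snd[OF b(1)] n] V])
      (intro mult_nonneg_nonneg b(2) zero_le_power2)+
  also have "\<dots> \<le> ?c * ?I + ?c * ?I"
    using R by (intro add_mono kint_near_fst[OF s b A] kint_near_snd[OF s b A]) auto
  also have "?I = ennreal (1 / R\<^sup>2) * (\<integral>\<^sup>+x\<in>A. ennreal (a x) \<partial>lebesgue)"
  proof -
    have "?I = (\<integral>\<^sup>+x. ennreal (1 / R\<^sup>2) * (ennreal (a x) * indicator A x) \<partial>lebesgue)"
      using a(2) by (intro nn_integral_cong) (auto simp: indicator_def ennreal_mult'[symmetric])
    also have "\<dots> = ennreal (1 / R\<^sup>2) * (\<integral>\<^sup>+x\<in>A. ennreal (a x) \<partial>lebesgue)"
      by (rule nn_integral_cmult) (use a A in \<open>auto intro!: borel_measurable_times_ennreal borel_measurable_indicator\<close>)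
    finally show ?thesis .
  qed
  also have "?c * (ennreal (1 / R\<^sup>2) * (\<integral>\<^sup>+x\<in>A. ennreal (a x) \<partial>lebesgue)) + ?c * (ennreal (1 / R\<^sup>2) * (\<integral>\<^sup>+x\<in>A. ennreal (a x) \<partial>lebesgue))
      = ennreal (2 * (near_C TYPE('a) s * ((2 * R) powr (2 - 2 * s) / R\<^sup>2))) * (\<integral>\<^sup>+x\<in>A. ennreal (a x) \<partial>lebesgue)"
  proof -
    have p: "0 \<le> near_C TYPE('a) s * (2 * R) powr (2 - 2 * s)" using near_C_pos[OF s, where 'a='a] by simp
    have "2 * (near_C TYPE('a) s * ((2 * R) powr (2 - 2 * s) / R\<^sup>2)) = near_C TYPE('a) s * (2 * R) powr (2 - 2 * s) * (1 / R\<^sup>2) + near_C TYPE('a) s * (2 * R) powr (2 - 2 * s) * (1 / R\<^sup>2)"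
      by simp
    also have "ennreal \<dots> = ennreal (near_C TYPE('a) s * (2 * R) powr (2 - 2 * s) * (1 / R\<^sup>2)) + ennreal (near_C TYPE('a) s * (2 * R) powr (2 - 2 * s) * (1 / R\<^sup>2))"
      by (rule ennreal_plus) (use p in auto)
    also have "ennreal (near_C TYPE('a) s * (2 * R) powr (2 - 2 * s) * (1 / R\<^sup>2)) = ?c * ennreal (1 / R\<^sup>2)"
      by (rule ennreal_mult[OF p]) simp
    finally show ?thesis by (simp only: distrib_right mult.assoc)
  qed
  also have "\<dots> \<le> ennreal (8 * near_C TYPE('a) s * R powr - (2 * s)) * (\<integral>\<^sup>+x\<in>A. ennreal (a x) \<partial>lebesgue)"
  proof (intro mult_right_mono ennreal_leI)
    have "near_C TYPE('a) s * ((2 * R) powr (2 - 2 * s) / R\<^sup>2) \<le> near_C TYPE('a) s * (4 * R powr - (2 * s))"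
      using powr_scale_bound[OF s R] near_C_pos[OF s, where 'a='a] by (intro mult_left_mono) auto
    then show "2 * (near_C TYPE('a) s * ((2 * R) powr (2 - 2 * s) / R\<^sup>2)) \<le> 8 * near_C TYPE('a) s * R powr - (2 * s)"
      by simp
  qed simp
  finally show ?thesis .
qed

lemma pair_measurable_diff_sq:
  assumes "v \<in> borel_measurable lebesgue"
  shows "pair_measurable (\<lambda>x y. (v x - v y)\<^sup>2)"
  using pair_measurable_fst[OF assms] pair_measurable_snd[OF assms] by measurable

text \<open>
  With \<open>a i = D i * w i\<close>, where \<open>D i\<close> is the difference of the hat
  function of \<open>i\<close> at two points, the three sums are the differences of the
  interpolants of \<open>w\<close>, \<open>\<eta>\<^sup>2 w\<close> and \<open>\<eta>
  w\<close>. For the true products instead of interpolants the corresponding defect is \<open>w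
  x * w y * (\<eta> x - \<eta> y)\<^sup>2\<close>.
\<close>

lemma weighted_square_identity:
  fixes a \<eta> :: "'i \<Rightarrow> real"
  shows "2 * ((\<Sum>i\<in>S. a i) * (\<Sum>i\<in>S. a i * (\<eta> i)\<^sup>2) - (\<Sum>i\<in>S. a i * \<eta> i)\<^sup>2) = (\<Sum>i\<in>S. \<Sum>j\<in>S. a i * a j * (\<eta> i - \<eta> j)\<^sup>2)"
proof -
  have "(\<Sum>i\<in>S. \<Sum>j\<in>S. a i * a j * (\<eta> i - \<eta> j)\<^sup>2)
      = (\<Sum>i\<in>S. \<Sum>j\<in>S. (a i * (\<eta> i)\<^sup>2) * a j) + (\<Sum>i\<in>S. \<Sum>j\<in>S. a i * (a j * (\<eta> j)\<^sup>2)) - 2 * (\<Sum>i\<in>S. \<Sum>j\<in>S. (a i * \<eta> i) * (a j * \<eta> j))"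
    by (simp add: sum.distrib[symmetric] sum_subtractf[symmetric] sum_distrib_left power2_eq_square algebra_simps)
  also have "\<dots> = (\<Sum>i\<in>S. a i * (\<eta> i)\<^sup>2) * (\<Sum>i\<in>S. a i) + (\<Sum>i\<in>S. a i) * (\<Sum>i\<in>S. a i * (\<eta> i)\<^sup>2) - 2 * ((\<Sum>i\<in>S. a i * \<eta> i) * (\<Sum>i\<in>S. a i * \<eta> i))"
    by (simp only: sum_product)
  finally show ?thesis by (simp add: power2_eq_square algebra_simps)
qed

lemma kint_Un_le:
  assumes "pair_measurable g" "U \<in> sets leb_pair" "V \<in> sets leb_pair"
  shows "kint s (U \<union> V) g \<le> kint s U g + kint s V g"
proof -
  note [measurable] = assms
  have "kint s (U \<union> V) g \<le> (\<integral>\<^sup>+p. ennreal (g (fst p) (snd p) * kern s (fst p) (snd p)) * indicator U p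
      + ennreal (g (fst p) (snd p) * kern s (fst p) (snd p)) * indicator V p \<partial>leb_pair)"
    unfolding kint_def by (rule nn_integral_mono) (auto simp: indicator_def)
  also have "\<dots> = kint s U g + kint s V g"
    unfolding kint_def by (rule nn_integral_add) measurable
  finally show ?thesis .
qed

context fe_mesh begin

lemma compact_closure: "compact (closure \<Omega>)"
  unfolding Union_mesh[symmetric] using finite_mesh compact_elem by (intro compact_Union) auto

text \<open>
  Pairs that are close contribute a Lipschitz bound, remote pairs a bound by the maximum; in
  both cases one point has to lie in the closed domain, which has finite measure.
\<close>

lemma fe_energy_global:
  assumes s: "0 < s" "s < 1" and v: "v \<in> fe_space \<Omega> Th"
  shows "kint s UNIV (\<lambda>x y. (v x - v y)\<^sup>2) < \<infinity>"
proof -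
  let ?K = "closure \<Omega>" and ?g = "\<lambda>x y. (v x - v y)\<^sup>2"
  obtain L where L: "0 \<le> L" "\<And>x y. \<bar>v x - v y\<bar> \<le> L * norm (x - y)" using fe_lipschitz[OF v] by blast
  have cont: "continuous_on ?K v" and out: "\<And>x. x \<notin> ?K \<Longrightarrow> v x = 0" using v by (auto simp: fe_space_def)
  have "compact (v ` ?K)" by (rule compact_continuous_image[OF cont compact_closure])
  then obtain B where B: "\<And>x. x \<in> ?K \<Longrightarrow> \<bar>v x\<bar> \<le> B"
    using compact_imp_bounded[THEN bounded_pos[THEN iffD1]] by (metis imageI real_norm_def)
  have B': "\<bar>v x\<bar> \<le> \<bar>B\<bar>" for x using B[of x] out[of x] by (cases "x \<in> ?K") auto
  have K: "?K \<in> sets lebesgue" using compact_closure by (simp add: borel_compact)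
  have gm: "pair_measurable ?g" by (rule pair_measurable_diff_sq[OF fe_measurable[OF v]])
  have eK: "emeasure lebesgue ?K < \<infinity>"
    using emeasure_compact_finite[OF compact_closure] by simp
  have KU: "?K \<times> UNIV \<in> sets leb_pair" "UNIV \<times> ?K \<in> sets leb_pair" "(- ?K) \<times> (- ?K) \<in> sets leb_pair"
    using K by (auto intro!: pair_measureI)
  have "{p \<in> space leb_pair. norm (fst p - snd p :: 'a) < 1} \<in> sets leb_pair" by measurable
  then have N: "{p. norm (fst p - snd p :: 'a) < 1} \<in> sets leb_pair" by (simp add: space_pair_measure)
  let ?V1 = "(?K \<times> UNIV) \<inter> {p. norm (fst p - snd p) < 1}" and ?V2 = "(?K \<times> UNIV) - {p. norm (fst p - snd p) < 1}"
  have V: "?V1 \<in> sets leb_pair" "?V2 \<in> sets leb_pair" using KU N by auto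
  have k1: "kint s ?V1 ?g < \<infinity>"
  proof -
    have sq: "(v x - v y)\<^sup>2 \<le> L\<^sup>2 * (norm (x - y))\<^sup>2" for x y
      using power_mono[OF L(2)[of x y], of 2] by (simp add: power_mult_distrib)
    have "kint s ?V1 ?g \<le> ennreal (near_C TYPE('a) s * 1 powr (2 - 2 * s)) * (\<integral>\<^sup>+x\<in>?K. ennreal (L\<^sup>2) \<partial>lebesgue)"
      by (rule kint_near_fst[OF s _ _ K]) (use sq in auto)
    also have "(\<integral>\<^sup>+x\<in>?K. ennreal (L\<^sup>2) \<partial>lebesgue) = ennreal (L\<^sup>2) * emeasure lebesgue ?K"
      by (rule nn_integral_cmult_indicator[OF K])
    also have "ennreal (near_C TYPE('a) s * 1 powr (2 - 2 * s)) * \<dots> < \<infinity>"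
      using eK by (simp add: ennreal_mult_less_top)
    finally show ?thesis .
  qed
  have k2: "kint s ?V2 ?g < \<infinity>"
  proof -
    have sq: "(v x - v y)\<^sup>2 \<le> (2 * \<bar>B\<bar>)\<^sup>2" for x y
    proof -
      have "\<bar>v x - v y\<bar> \<le> 2 * \<bar>B\<bar>" using B'[of x] B'[of y] by linarith
      from power_mono[OF this, of 2] show ?thesis by simp
    qed
    have "kint s ?V2 ?g \<le> ennreal (far_C TYPE('a) s * 1 powr - (2 * s)) * (\<integral>\<^sup>+x\<in>?K. ennreal ((2 * \<bar>B\<bar>)\<^sup>2) \<partial>lebesgue)"
      by (rule kint_far_fst[OF s(1) _ _ K]) (use sq in auto)
    also have "(\<integral>\<^sup>+x\<in>?K. ennreal ((2 * \<bar>B\<bar>)\<^sup>2) \<partial>lebesgue) = ennreal ((2 * \<bar>B\<bar>)\<^sup>2) * emeasure lebesgue ?K"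
      by (rule nn_integral_cmult_indicator[OF K])
    also have "ennreal (far_C TYPE('a) s * 1 powr - (2 * s)) * \<dots> < \<infinity>"
      using eK by (simp add: ennreal_mult_less_top)
    finally show ?thesis .
  qed
  have "kint s (?K \<times> UNIV) ?g \<le> kint s ?V1 ?g + kint s ?V2 ?g"
    using kint_Un_le[OF gm V] by (simp add: Int_Diff_Un)
  then have kK: "kint s (?K \<times> UNIV) ?g < \<infinity>" using k1 k2 by (auto intro: le_less_trans)
  have kK': "kint s (UNIV \<times> ?K) ?g = kint s (?K \<times> UNIV) ?g"
  proof -
    have "kint s (UNIV \<times> ?K) ?g = kint s ((\<lambda>p. (snd p, fst p)) -` (UNIV \<times> ?K)) (\<lambda>x y. ?g y x)"
      by (rule kint_swap[OF gm KU(2)])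
    also have "(\<lambda>p. (snd p, fst p)) -` (UNIV \<times> ?K) = ?K \<times> UNIV" by auto
    finally show ?thesis by (simp add: power2_commute)
  qed
  have k0: "kint s ((- ?K) \<times> (- ?K)) ?g = 0"
  proof -
    have "kint s ((- ?K) \<times> (- ?K)) ?g \<le> kint s ((- ?K) \<times> (- ?K)) (\<lambda>x y. 0)"
      by (rule kint_mono) (use out in auto)
    then show ?thesis by (simp add: kint_def)
  qed
  have "(UNIV :: ('a \<times> 'a) set) = (?K \<times> UNIV \<union> UNIV \<times> ?K) \<union> ((- ?K) \<times> (- ?K))" by auto
  then have "kint s UNIV ?g \<le> kint s (?K \<times> UNIV \<union> UNIV \<times> ?K) ?g + kint s ((- ?K) \<times> (- ?K)) ?g"
    using kint_Un_le[OF gm sets.Un[OF KU(1,2)] KU(3), of s] by simp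
  also have "\<dots> \<le> (kint s (?K \<times> UNIV) ?g + kint s (UNIV \<times> ?K) ?g) + kint s ((- ?K) \<times> (- ?K)) ?g"
    by (rule add_right_mono[OF kint_Un_le[OF gm KU(1,2)]])
  also have "\<dots> < \<infinity>" using kK kK' k0 by simp
  finally show ?thesis .
qed

end

context local_mesh begin

text \<open>
  The test functions vanish outside the ball of radius \<open>7/8 R\<close>, elements have
  diameter at most \<open>R/16\<close>. The intermediate ball \<open>B1\<close> leaves a gap of
  \<open>R/16\<close> on both sides: its elements lie in the ball of radius \<open>R\<close>,
  and the support of a test function is away from the complement of \<open>B1\<close>.
\<close>

definition B1 :: "'a set" where "B1 = ball x0 (15 / 16 * R)"

abbreviation BB :: "('a \<times> 'a) set" where "BB \<equiv> B1 \<times> B1"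

definition mass :: "real \<Rightarrow> ('a \<Rightarrow> real) \<Rightarrow> ennreal" where
  "mass s w = ennreal (R powr - (2 * s)) * L2_norm_sq (ball x0 R) w"

text \<open>
  The function \<open>\<phi>\<close> is the test function, \<open>e\<close> the energy density
  that it controls and \<open>rem\<close> the error. The factor \<open>1/8\<close> in the bound
  of \<open>rem\<close> is small enough for absorption into the \<open>1/2\<close> in front of
  \<open>e\<close>. The finiteness of the energy is listed because absorption subtracts it from
  both sides.
\<close>

definition good_test :: "real \<Rightarrow> real \<Rightarrow> ('a \<Rightarrow> real) \<Rightarrow> bool" where
  "good_test s C w \<longleftrightarrow> (\<exists>\<phi> e rem. \<phi> \<in> fe_space_local \<Omega> Th (ball x0 R) \<and> (\<forall>x. x \<notin> ball x0 (7 / 8 * R) \<longrightarrow> \<phi> x = 0) \<and>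
     pair_measurable e \<and> pair_measurable rem \<and> (\<forall>x y. 0 \<le> e x y) \<and> (\<forall>x y. 0 \<le> rem x y) \<and>
     (\<forall>x\<in>B1. \<forall>y\<in>B1. e x y / 2 \<le> (w x - w y) * (\<phi> x - \<phi> y) + rem x y) \<and>
     kint s BB rem \<le> ennreal (1 / 8) * kint s BB e + ennreal C * mass s w \<and>
     kint s BB (\<lambda>x y. (\<phi> x - \<phi> y)\<^sup>2) \<le> ennreal C * (kint s BB e + mass s w) \<and>
     Hs_seminorm_sq s (ball x0 (R / 2)) w \<le> ennreal C * (kint s BB e + mass s w) \<and>
     L2_norm_sq UNIV \<phi> \<le> ennreal C * L2_norm_sq (ball x0 R) w \<and>
     kint s BB e < \<infinity>)"

lemma B1_sets: "B1 \<in> sets lebesgue" "BB \<in> sets leb_pair"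
  by (auto simp: B1_def)

lemma B1_dist: "x \<in> B1 \<Longrightarrow> y \<in> B1 \<Longrightarrow> norm (x - y) < 2 * R"
  using R norm_triangle_ineq4[of "x - x0" "y - x0"] by (simp add: B1_def dist_norm norm_minus_commute)

lemma B1_sub: "B1 \<subseteq> ball x0 R"
  unfolding B1_def using R by (intro subset_ball) simp

lemma B1_elem: "x \<in> B1 \<Longrightarrow> T \<in> Th \<Longrightarrow> x \<in> T \<Longrightarrow> T \<subseteq> ball x0 R"
  using elem_near[of T x _ "15 / 16 * R"] R by (fastforce simp: B1_def dist_norm norm_minus_commute)

lemma fe_energy_finite:
  assumes "0 < s" "s < 1" "v \<in> fe_space \<Omega> Th"
  shows "kint s BB (\<lambda>x y. (v x - v y)\<^sup>2) < \<infinity>"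
  by (rule le_less_trans[OF kint_mono fe_energy_global[OF assms]]) auto

lemma kint_max_sq:
  assumes s: "0 < s" "s < 1" and w: "w \<in> fe_space \<Omega> Th" and K: "0 \<le> K"
    and g: "\<And>x y. x \<in> B1 \<Longrightarrow> y \<in> B1 \<Longrightarrow> g x y \<le> K * (max_sq w x + max_sq w y) * (norm (x - y))\<^sup>2 / R\<^sup>2"
  shows "kint s BB g \<le> ennreal (8 * near_C TYPE('a) s * 4 ^ Suc DIM('a) * K) * mass s w"
proof -
  have "kint s BB g \<le> ennreal (8 * near_C TYPE('a) s * R powr - (2 * s)) * (\<integral>\<^sup>+x\<in>B1. ennreal (K * max_sq w x) \<partial>lebesgue)"
    by (rule kint_lipschitz_weight[OF s R])
      (use g max_sq_nonneg max_sq_measurable K B1_dist B1_sets in \<open>auto simp: distrib_left\<close>)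
  also have "(\<integral>\<^sup>+x\<in>B1. ennreal (K * max_sq w x) \<partial>lebesgue) \<le> (\<integral>\<^sup>+x. ennreal K * ennreal (max_sq w x) \<partial>lebesgue)"
    by (rule nn_integral_mono) (auto simp: indicator_def ennreal_mult' K)
  also have "\<dots> = ennreal K * (\<integral>\<^sup>+x. ennreal (max_sq w x) \<partial>lebesgue)"
    by (rule nn_integral_cmult) (use max_sq_measurable in measurable)
  also have "\<dots> \<le> ennreal K * (ennreal (4 ^ Suc DIM('a)) * L2_norm_sq (ball x0 R) w)"
    by (intro mult_left_mono max_sq_integral[OF w]) simp
  also have "ennreal (8 * near_C TYPE('a) s * R powr - (2 * s)) * (ennreal K * (ennreal (4 ^ Suc DIM('a)) * L2_norm_sq (ball x0 R) w))
      = ennreal (8 * near_C TYPE('a) s * 4 ^ Suc DIM('a) * K) * mass s w"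
  proof -
    have n: "0 \<le> near_C TYPE('a) s" using near_C_pos[OF s, where 'a='a] by simp
    have "ennreal (8 * near_C TYPE('a) s * R powr - (2 * s)) * ennreal K * ennreal (4 ^ Suc DIM('a))
        = ennreal ((8 * near_C TYPE('a) s * R powr - (2 * s)) * K * 4 ^ Suc DIM('a))"
      using n K by (simp only: ennreal_mult[symmetric] mult_nonneg_nonneg powr_ge_zero zero_le_numeral zero_le_power)
    also have "(8 * near_C TYPE('a) s * R powr - (2 * s)) * K * 4 ^ Suc DIM('a) = (8 * near_C TYPE('a) s * 4 ^ Suc DIM('a) * K) * R powr - (2 * s)"
      by simp
    also have "ennreal \<dots> = ennreal (8 * near_C TYPE('a) s * 4 ^ Suc DIM('a) * K) * ennreal (R powr - (2 * s))"
      using n K by (intro ennreal_mult) auto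
    finally have eq: "ennreal (8 * near_C TYPE('a) s * R powr - (2 * s)) * ennreal K * ennreal (4 ^ Suc DIM('a))
        = ennreal (8 * near_C TYPE('a) s * 4 ^ Suc DIM('a) * K) * ennreal (R powr - (2 * s))" .
    show ?thesis unfolding mass_def mult.assoc[symmetric] eq ..
  qed
  finally show ?thesis by (simp add: mult_left_mono)
qed

section \<open>The nodal cutoff in dimension at least two\<close>

text \<open>
  The first two summands come from pairs of points that are far apart compared with their
  elements, the last one from close pairs (see \<open>hat_times_weight_ordered\<close>).
\<close>

definition Ceta :: real where
  "Ceta = 8 + 32 * (real DIM('a) + 1) * \<sigma> * star_ratio + 24 * \<sigma> * star_ratio\<^sup>2"

lemma Ceta_ge: "4 \<le> Ceta"
  using sigma_ge_1 star_ratio_ge_1 by (simp add: Ceta_def)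

lemma hat_diff_le_one:
  assumes "T \<in> Th" "x \<in> T" "T' \<in> Th" "y \<in> T'"
  shows "\<bar>hat i x - hat i y\<bar> \<le> 1"
  using hat_nonneg[OF assms(1,2), of i] hat_le_one[OF assms(1,2), of i]
    hat_nonneg[OF assms(3,4), of i] hat_le_one[OF assms(3,4), of i] by linarith

lemma elem_node:
  assumes "x \<in> B1" "T \<in> Th" "x \<in> T" "i \<in> verts T"
  shows "i \<in> nodes" "i \<in> ball x0 R" "i \<in> T"
  using assms verts_nodes[OF assms(2)] verts_subset[of T] B1_elem[OF assms(1-3)] by auto

text \<open>
  Some barycentric coordinate of \<open>x\<close> in \<open>T\<close> is at least \<open>1 / (d
  + 1)\<close>. Points this close to \<open>x\<close> still see the hat function of that
  vertex, so the element of \<open>y\<close> belongs to the same star.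
\<close>

lemma near_elems_comparable:
  assumes dim: "2 \<le> DIM('a)" and x: "x \<in> B1" "T \<in> Th" "x \<in> T" and y: "y \<in> B1" "T' \<in> Th" "y \<in> T'"
    and near: "norm (x - y) * (2 * (real DIM('a) + 1) * \<sigma> * star_ratio) < diameter T"
  shows "diameter T \<le> star_ratio * diameter T'" "diameter T' \<le> star_ratio * diameter T"
proof -
  let ?n = "real DIM('a) + 1"
  have "\<exists>i\<in>verts T. 1 / ?n \<le> hat i x"
  proof (rule ccontr)
    assume "\<not> ?thesis"
    then have "(\<Sum>i\<in>verts T. hat i x) < (\<Sum>i\<in>verts T. 1 / ?n)"
      using finite_verts[OF simplex[OF x(2)]] verts_nonempty[OF x(2)] by (intro sum_strict_mono) auto
    then show False using hat_sum[OF x(2,3)] card_verts_elem[OF x(2)] by (simp add: field_simps)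
  qed
  then obtain i where i: "i \<in> verts T" "1 / ?n \<le> hat i x" by blast
  note iT = elem_node[OF x i(1)]
  have "\<bar>hat i x - hat i y\<bar> \<le> \<sigma> * star_ratio / diameter T * norm (x - y)"
    using hat_lipschitz[OF dim iT(1,2) x(2) iT(3)] x y B1_sub by blast
  also have "\<dots> < 1 / ?n"
  proof -
    have "\<sigma> * star_ratio * norm (x - y) * ?n * 2 = norm (x - y) * (2 * ?n * \<sigma> * star_ratio)" by algebra
    then have "\<sigma> * star_ratio * norm (x - y) * ?n * 2 < diameter T" using near by (simp only:)
    moreover have "0 \<le> \<sigma> * star_ratio * norm (x - y) * ?n" using sigma_ge_1 star_ratio_ge_1 by simp
    ultimately have "\<sigma> * star_ratio * norm (x - y) * ?n < diameter T" by linarith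
    then show ?thesis using diameter_pos[OF x(2)] by (simp add: divide_simps mult_ac)
  qed
  finally have "hat i y \<noteq> 0" using i(2) by auto
  then have "i \<in> verts T'" using hat_notin[OF y(2,3)] by blast
  then have iT': "i \<in> T'" using verts_subset by blast
  have "i \<in> \<Omega>" using iT ball_sub by blast
  then show "diameter T \<le> star_ratio * diameter T'" "diameter T' \<le> star_ratio * diameter T"
    using star_comparable[OF dim iT(1)] x(2) y(2) iT(3) iT' by blast+
qed

text \<open>
  If \<open>x\<close> and \<open>y\<close> are far apart compared with the larger element, the
  hat difference is at most 1 and the difference of \<open>\<eta>\<close> is of order \<open>|x
  - y| / R\<close>. If they are close, the elements are comparable, the hat function has slope
  of order \<open>1 / diameter T\<close> and \<open>\<eta>\<close> varies by at most order
  \<open>diameter T / R\<close> between the nodes. In both cases the element size cancels.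
\<close>

lemma hat_times_weight_ordered:
  assumes dim: "2 \<le> DIM('a)" and x: "x \<in> B1" "T \<in> Th" "x \<in> T" and y: "y \<in> B1" "T' \<in> Th" "y \<in> T'"
    and i: "i \<in> verts T \<union> verts T'" and j: "j \<in> verts T \<union> verts T'"
    and eta: "\<bar>\<eta> i - \<eta> j\<bar> \<le> 4 / R * norm (i - j)"
    and le: "diameter T' \<le> diameter T"
  shows "\<bar>hat i x - hat i y\<bar> * \<bar>\<eta> i - \<eta> j\<bar> \<le> Ceta * norm (x - y) / R"
proof -
  let ?n = "real DIM('a) + 1" and ?h = "diameter T" and ?h' = "diameter T'" and ?D = "\<bar>hat i x - hat i y\<bar>"
  have h: "0 < ?h" "0 < ?h'" using diameter_pos x y by auto
  have sQ: "1 \<le> \<sigma>" "1 \<le> star_ratio" "1 \<le> \<sigma> * star_ratio"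
    using sigma_ge_1 star_ratio_ge_1 mult_mono[of 1 \<sigma> 1 star_ratio] by auto
  have to_x: "norm (k - x) \<le> ?h + ?h' + norm (x - y) \<and> (k \<in> verts T \<longrightarrow> norm (k - x) \<le> ?h) \<and> (k \<in> verts T' \<longrightarrow> norm (k - x) \<le> ?h' + norm (x - y))"
    if k: "k \<in> verts T \<union> verts T'" for k
  proof -
    have 1: "norm (k - x) \<le> ?h" if "k \<in> verts T"
      using elem_dist[OF x(2) _ x(3)] that verts_subset by blast
    have 2: "norm (k - x) \<le> ?h' + norm (x - y)" if "k \<in> verts T'"
    proof -
      have "norm (k - y) \<le> ?h'" using elem_dist[OF y(2) _ y(3)] that verts_subset by blast
      moreover have "norm (k - x) \<le> norm (k - y) + norm (y - x)" using norm_triangle_ineq[of "k - y" "y - x"] by simp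
      ultimately show ?thesis by (simp add: norm_minus_commute)
    qed
    have "norm (k - x) \<le> ?h + ?h' + norm (x - y)"
      using 1 2 k h norm_ge_zero[of "x - y"] by (cases "k \<in> verts T") (auto simp del: norm_ge_zero)
    then show ?thesis using 1 2 by blast
  qed
  have "norm (i - j) \<le> norm (i - x) + norm (j - x)" using norm_triangle_ineq4[of "i - x" "j - x"] by simp
  also have "\<dots> \<le> 2 * ?h + 2 * ?h' + norm (x - y) * 2" using to_x[OF i] to_x[OF j] by linarith
  also have "\<dots> \<le> 4 * ?h + norm (x - y) * 2" using le by simp
  finally have ij: "norm (i - j) \<le> 4 * ?h + 2 * norm (x - y)" by simp
  have e1: "\<bar>\<eta> i - \<eta> j\<bar> \<le> 4 / R * (4 * ?h + 2 * norm (x - y))"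
    by (rule order_trans[OF eta]) (use ij R in \<open>intro mult_left_mono; simp\<close>)
  show ?thesis
  proof (cases "norm (x - y) * (2 * ?n * \<sigma> * star_ratio) < ?h")
    case False
    have D: "?D \<le> 1" by (rule hat_diff_le_one[OF x(2,3) y(2,3)])
    have "?D * \<bar>\<eta> i - \<eta> j\<bar> \<le> 1 * (4 / R * (4 * ?h + 2 * norm (x - y)))"
      using D e1 by (intro mult_mono) auto
    also have "\<dots> \<le> 4 / R * (4 * (norm (x - y) * (2 * ?n * \<sigma> * star_ratio)) + 2 * norm (x - y))"
      using False R by (simp add: divide_right_mono)
    also have "\<dots> = (8 + 32 * ?n * \<sigma> * star_ratio) * norm (x - y) / R" by (simp add: algebra_simps add_divide_distrib)
    also have "\<dots> \<le> Ceta * norm (x - y) / R"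
      using sQ R by (intro divide_right_mono mult_right_mono) (auto simp: Ceta_def)
    finally show ?thesis .
  next
    case True
    note comp = near_elems_comparable[OF dim x y True]
    have "norm (x - y) * 1 \<le> norm (x - y) * (2 * ?n * \<sigma> * star_ratio)"
    proof (rule mult_left_mono)
      have "1 * 1 \<le> (2 * ?n) * (\<sigma> * star_ratio)" using sQ by (intro mult_mono) auto
      then show "1 \<le> 2 * ?n * \<sigma> * star_ratio" by (simp only: mult.assoc mult_1)
    qed simp
    then have "norm (x - y) \<le> ?h" using True by simp
    then have e2: "\<bar>\<eta> i - \<eta> j\<bar> \<le> 24 * ?h / R"
      using e1 R by (simp add: field_simps)
    have D: "?D \<le> \<sigma> * star_ratio\<^sup>2 / ?h * norm (x - y)"
    proof (cases "i \<in> verts T")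
      case True
      note iT = elem_node[OF x True]
      have "?D \<le> \<sigma> * star_ratio / ?h * norm (x - y)"
        using hat_lipschitz[OF dim iT(1,2) x(2) iT(3)] x y B1_sub by blast
      also have "\<dots> \<le> \<sigma> * star_ratio\<^sup>2 / ?h * norm (x - y)"
        using sQ h by (intro mult_right_mono divide_right_mono mult_left_mono) (auto simp: power2_eq_square)
      finally show ?thesis .
    next
      case False
      then have "i \<in> verts T'" using i by blast
      note iT = elem_node[OF y this]
      have "?D \<le> \<sigma> * star_ratio / ?h' * norm (x - y)"
        using hat_lipschitz[OF dim iT(1,2) y(2) iT(3)] x y B1_sub by blast
      also have "\<sigma> * star_ratio / ?h' \<le> \<sigma> * star_ratio\<^sup>2 / ?h"
      proof -
        have "\<sigma> * star_ratio * ?h \<le> \<sigma> * star_ratio * (star_ratio * ?h')" using comp(1) sQ by (intro mult_left_mono) auto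
        then show ?thesis using h by (simp add: field_simps power2_eq_square)
      qed
      finally show ?thesis by (simp add: mult_right_mono)
    qed
    have "?D * \<bar>\<eta> i - \<eta> j\<bar> \<le> (\<sigma> * star_ratio\<^sup>2 / ?h * norm (x - y)) * (24 * ?h / R)"
      using D e2 sQ h by (intro mult_mono) auto
    also have "\<dots> = 24 * \<sigma> * star_ratio\<^sup>2 * norm (x - y) / R" using h by simp
    also have "\<dots> \<le> Ceta * norm (x - y) / R"
      using sQ R by (intro divide_right_mono mult_right_mono) (auto simp: Ceta_def)
    finally show ?thesis .
  qed
qed

lemma hat_times_weight:
  assumes dim: "2 \<le> DIM('a)" and x: "x \<in> B1" "T \<in> Th" "x \<in> T" and y: "y \<in> B1" "T' \<in> Th" "y \<in> T'"
    and i: "i \<in> verts T \<union> verts T'" and j: "j \<in> verts T \<union> verts T'"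
    and eta: "\<bar>\<eta> i - \<eta> j\<bar> \<le> 4 / R * norm (i - j)"
  shows "\<bar>hat i x - hat i y\<bar> * \<bar>\<eta> i - \<eta> j\<bar> \<le> Ceta * norm (x - y) / R"
proof (cases "diameter T' \<le> diameter T")
  case True
  show ?thesis by (rule hat_times_weight_ordered[OF dim x y i j eta True])
next
  case False
  have "\<bar>hat i y - hat i x\<bar> * \<bar>\<eta> i - \<eta> j\<bar> \<le> Ceta * norm (y - x) / R"
    by (rule hat_times_weight_ordered[OF dim y x _ _ eta]) (use i j False in auto)
  then show ?thesis by (simp add: norm_minus_commute abs_minus_commute)
qed


text \<open>
  Equal to 1 up to radius \<open>9/16 R\<close>, so on every element that meets the half ball,
  and equal to 0 from radius \<open>13/16 R\<close> on, so that the elements around its support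
  lie in the ball of radius \<open>7/8 R\<close>.
\<close>

definition cutoff :: "'a \<Rightarrow> real" where
  "cutoff x = max 0 (min 1 (13 / 4 - 4 * norm (x - x0) / R))"

lemma cutoff_bounds: "0 \<le> cutoff x" "cutoff x \<le> 1"
  by (auto simp: cutoff_def)

lemma cutoff_lipschitz: "\<bar>cutoff x - cutoff y\<bar> \<le> 4 / R * norm (x - y)"
proof -
  have "\<bar>cutoff x - cutoff y\<bar> \<le> \<bar>4 * norm (x - x0) / R - 4 * norm (y - x0) / R\<bar>"
    by (auto simp: cutoff_def)
  also have "4 * norm (x - x0) / R - 4 * norm (y - x0) / R = 4 / R * (norm (x - x0) - norm (y - x0))"
    by (simp add: diff_divide_distrib right_diff_distrib)
  also have "\<bar>\<dots>\<bar> = 4 / R * \<bar>norm (x - x0) - norm (y - x0)\<bar>"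
    unfolding abs_mult using R by simp
  also have "\<dots> \<le> 4 / R * norm (x - y)"
    using norm_triangle_ineq3[of "x - x0" "y - x0"] R by (intro mult_left_mono) auto
  finally show ?thesis .
qed

lemma interp_diff:
  assumes "T \<in> Th" "x \<in> T" "T' \<in> Th" "y \<in> T'"
  shows "interp g x - interp g y = (\<Sum>i\<in>verts T \<union> verts T'. (hat i x - hat i y) * g i)"
proof -
  have fin: "finite (verts T \<union> verts T')" using finite_verts[OF simplex] assms by auto
  have "interp g x = (\<Sum>i\<in>verts T \<union> verts T'. hat i x * g i)"
    unfolding interp_elem[OF assms(1,2)] by (rule hat_sum_nodes[symmetric, OF assms(1,2) _ fin]) auto
  moreover have "interp g y = (\<Sum>i\<in>verts T \<union> verts T'. hat i y * g i)"
    unfolding interp_elem[OF assms(3,4)] by (rule hat_sum_nodes[symmetric, OF assms(3,4) _ fin]) auto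
  ultimately show ?thesis by (simp add: sum_subtractf left_diff_distrib)
qed

definition Crem :: real where "Crem = (2 * (real DIM('a) + 1))\<^sup>2 * Ceta\<^sup>2"

text \<open>
  Both estimates write all differences at \<open>x\<close> and \<open>y\<close> as sums over
  the at most \<open>2 (d + 1)\<close> vertices of the two elements, and bound each defect term
  by \<open>hat_times_weight\<close>. The first one uses
  \<open>weighted_square_identity\<close>; the second compares \<open>\<delta>\<phi>\<close>
  with \<open>\<eta> j * \<delta>v\<close> for one vertex \<open>j\<close>.
\<close>

lemma nodal_cutoff_bounds:
  assumes dim: "2 \<le> DIM('a)" and w: "w \<in> fe_space \<Omega> Th" and x: "x \<in> B1" and y: "y \<in> B1"
  defines "v \<equiv> interp (\<lambda>i. cutoff i * w i)" and "\<phi> \<equiv> interp (\<lambda>i. (cutoff i)\<^sup>2 * w i)"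
    and "m \<equiv> Crem * (max_sq w x + max_sq w y) * (norm (x - y))\<^sup>2 / R\<^sup>2"
  shows "(v x - v y)\<^sup>2 \<le> (w x - w y) * (\<phi> x - \<phi> y) + m"
    and "(\<phi> x - \<phi> y)\<^sup>2 \<le> 2 * (v x - v y)\<^sup>2 + 2 * m"
proof -
  obtain T where T: "T \<in> Th" "x \<in> T" using elem_cover x B1_sub by blast
  obtain T' where T': "T' \<in> Th" "y \<in> T'" using elem_cover y B1_sub by blast
  define S where "S = verts T \<union> verts T'"
  have fin: "finite S" using finite_verts[OF simplex] T T' by (auto simp: S_def)
  have cS: "real (card S) \<le> 2 * (real DIM('a) + 1)"
    using card_Un_le[of "verts T" "verts T'"] card_verts_elem[OF T(1)] card_verts_elem[OF T'(1)] by (simp add: S_def)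
  have Sne: "S \<noteq> {}" using verts_nonempty[OF T(1)] by (simp add: S_def)
  define D where "D i = hat i x - hat i y" for i
  define k where "k = Ceta * norm (x - y) / R"
  have k0: "0 \<le> k" using Ceta_ge R by (simp add: k_def)
  have D: "\<bar>D i\<bar> * \<bar>cutoff i - cutoff j\<bar> \<le> k" if "i \<in> S" "j \<in> S" for i j
    unfolding D_def k_def using hat_times_weight[where \<eta>=cutoff, OF dim x T y T' _ _ cutoff_lipschitz] that by (simp add: S_def)
  define M where "M = sqrt (max_sq w x + max_sq w y)"
  have M0: "0 \<le> M" and M2: "M\<^sup>2 = max_sq w x + max_sq w y" using max_sq_nonneg by (auto simp: M_def)
  have wM: "\<bar>w i\<bar> \<le> M" if i: "i \<in> S" for i
  proof -
    have "(elem_max w T)\<^sup>2 \<le> max_sq w x" "(elem_max w T')\<^sup>2 \<le> max_sq w y"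
      using max_sq_ge[OF T(1) B1_elem[OF x T] T(2)] max_sq_ge[OF T'(1) B1_elem[OF y T'] T'(2)] by auto
    then have "elem_max w T \<le> M" "elem_max w T' \<le> M"
      using max_sq_nonneg[of w x] max_sq_nonneg[of w y] unfolding M_def by (auto intro!: real_le_rsqrt)
    then show ?thesis using elem_max_vert[OF T(1), of i w] elem_max_vert[OF T'(1), of i w] i by (auto simp: S_def)
  qed
  have dw: "w x - w y = (\<Sum>i\<in>S. D i * w i)"
    using interp_diff[OF T T', of w] fe_interp[OF w] by (simp add: S_def D_def)
  have dv: "v x - v y = (\<Sum>i\<in>S. (D i * w i) * cutoff i)"
    using interp_diff[OF T T', of "\<lambda>i. cutoff i * w i"] by (simp add: S_def D_def v_def mult_ac)
  have dp: "\<phi> x - \<phi> y = (\<Sum>i\<in>S. (D i * w i) * (cutoff i)\<^sup>2)"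
    using interp_diff[OF T T', of "\<lambda>i. (cutoff i)\<^sup>2 * w i"] by (simp add: S_def D_def \<phi>_def mult_ac)
  have m: "m = (2 * (real DIM('a) + 1))\<^sup>2 * k\<^sup>2 * M\<^sup>2"
    unfolding m_def M2 Crem_def k_def by (simp add: power_mult_distrib power_divide mult_ac)
  have c2: "(real (card S))\<^sup>2 \<le> (2 * (real DIM('a) + 1))\<^sup>2" using cS by (intro power_mono) auto
  have "(\<Sum>i\<in>S. \<Sum>j\<in>S. (D i * w i) * (D j * w j) * (cutoff i - cutoff j)\<^sup>2) \<ge> (\<Sum>i\<in>S. \<Sum>j\<in>S. - (k\<^sup>2 * M\<^sup>2))"
  proof (intro sum_mono)
    fix i j assume ij: "i \<in> S" "j \<in> S"
    have "\<bar>(D i * w i) * (D j * w j) * (cutoff i - cutoff j)\<^sup>2\<bar>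
        = (\<bar>D i\<bar> * \<bar>cutoff i - cutoff j\<bar>) * (\<bar>D j\<bar> * \<bar>cutoff j - cutoff i\<bar>) * (\<bar>w i\<bar> * \<bar>w j\<bar>)"
      by (simp add: abs_mult power2_eq_square abs_minus_commute mult_ac)
    also have "\<dots> \<le> (k * k) * (M * M)"
      using D[OF ij] D[OF ij(2,1)] wM[OF ij(1)] wM[OF ij(2)] k0 M0 by (intro mult_mono) auto
    finally show "- (k\<^sup>2 * M\<^sup>2) \<le> (D i * w i) * (D j * w j) * (cutoff i - cutoff j)\<^sup>2"
      by (simp add: power2_eq_square)
  qed
  also have "(\<Sum>i\<in>S. \<Sum>j\<in>S. - (k\<^sup>2 * M\<^sup>2)) = - ((real (card S))\<^sup>2 * (k\<^sup>2 * M\<^sup>2))"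
    by (simp add: power2_eq_square)
  finally have low: "2 * ((w x - w y) * (\<phi> x - \<phi> y) - (v x - v y)\<^sup>2) \<ge> - ((real (card S))\<^sup>2 * (k\<^sup>2 * M\<^sup>2))"
    using weighted_square_identity[where S=S and a="\<lambda>i. D i * w i" and \<eta>=cutoff] by (simp add: dw dv dp)
  have cm: "(real (card S))\<^sup>2 * (k\<^sup>2 * M\<^sup>2) \<le> m"
    unfolding m mult.assoc using c2 by (intro mult_right_mono) auto
  have m0: "0 \<le> m" unfolding m by simp
  show "(v x - v y)\<^sup>2 \<le> (w x - w y) * (\<phi> x - \<phi> y) + m"
  proof -
    have "b \<le> a + m" if "- c \<le> 2 * (a - b)" "c \<le> m" for a b c :: real using that m0 by argo
    from this[OF low cm] show ?thesis .
  qed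
  obtain j where j: "j \<in> S" using Sne by blast
  have "(\<phi> x - \<phi> y) - cutoff j * (v x - v y) = (\<Sum>i\<in>S. D i * (cutoff i - cutoff j) * (cutoff i * w i))"
    unfolding dp dv by (simp add: sum_distrib_left sum_subtractf[symmetric] algebra_simps power2_eq_square)
  also have "\<bar>\<dots>\<bar> \<le> (\<Sum>i\<in>S. k * M)"
  proof (rule order_trans[OF sum_abs sum_mono])
    fix i assume i: "i \<in> S"
    have "\<bar>cutoff i\<bar> * \<bar>w i\<bar> \<le> 1 * M" using cutoff_bounds[of i] wM[OF i] by (intro mult_mono) auto
    then show "\<bar>D i * (cutoff i - cutoff j) * (cutoff i * w i)\<bar> \<le> k * M"
      using D[OF i j] k0 unfolding abs_mult by (intro mult_mono) auto
  qed
  finally have "\<bar>(\<phi> x - \<phi> y) - cutoff j * (v x - v y)\<bar> \<le> real (card S) * (k * M)" by simp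
  from power_mono[OF this, of 2] have "((\<phi> x - \<phi> y) - cutoff j * (v x - v y))\<^sup>2 \<le> (real (card S))\<^sup>2 * (k\<^sup>2 * M\<^sup>2)"
    by (simp add: power_mult_distrib)
  then have 1: "((\<phi> x - \<phi> y) - cutoff j * (v x - v y))\<^sup>2 \<le> m" using cm by linarith
  have "(cutoff j)\<^sup>2 \<le> 1" using cutoff_bounds[of j] by (simp add: power_le_one)
  then have 2: "(cutoff j * (v x - v y))\<^sup>2 \<le> (v x - v y)\<^sup>2"
    unfolding power_mult_distrib by (intro mult_left_le_one_le) auto
  have "(\<phi> x - \<phi> y)\<^sup>2 \<le> 2 * ((\<phi> x - \<phi> y) - cutoff j * (v x - v y))\<^sup>2 + 2 * (cutoff j * (v x - v y))\<^sup>2"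
    using sum_squares_ge_zero[of "(\<phi> x - \<phi> y) - 2 * (cutoff j * (v x - v y))" 0]
    by (simp add: power2_eq_square algebra_simps)
  then show "(\<phi> x - \<phi> y)\<^sup>2 \<le> 2 * (v x - v y)\<^sup>2 + 2 * m" using 1 2 by linarith
qed

definition Cmulti :: "real \<Rightarrow> real" where
  "Cmulti s = 2 + 2 * (8 * near_C TYPE('a) s * 4 ^ Suc DIM('a) * Crem) + 4 ^ Suc DIM('a)"

lemma fe_local_fe: "v \<in> fe_space_local \<Omega> Th B \<Longrightarrow> v \<in> fe_space \<Omega> Th"
  by (simp add: fe_space_local_def)

text \<open>
  On the half ball the interpolant of \<open>\<eta> w\<close> is \<open>w\<close> itself, hence
  its energy there controls that of \<open>w\<close>.
\<close>

lemma good_test_multi: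
  assumes s: "0 < s" "s < 1" and dim: "2 \<le> DIM('a)" and w: "w \<in> fe_space \<Omega> Th"
  shows "good_test s (Cmulti s) w"
proof -
  define v where "v = interp (\<lambda>i. cutoff i * w i)"
  define \<phi> where "\<phi> = interp (\<lambda>i. (cutoff i)\<^sup>2 * w i)"
  define e where "e x y = (v x - v y)\<^sup>2" for x y
  define rem where "rem x y = Crem * (max_sq w x + max_sq w y) * (norm (x - y))\<^sup>2 / R\<^sup>2" for x y
  have cz: "cutoff i = 0" if "13 / 16 * R \<le> norm (i - x0)" for i
    using that R by (simp add: cutoff_def field_simps)
  have c1: "cutoff i = 1" if "norm (i - x0) \<le> 9 / 16 * R" for i
    using that R by (simp add: cutoff_def field_simps)
  have v: "v \<in> fe_space_local \<Omega> Th (ball x0 R)"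
    unfolding v_def by (rule interp_local_mem) (simp add: cz)
  have \<phi>: "\<phi> \<in> fe_space_local \<Omega> Th (ball x0 R)" "\<And>x. x \<notin> ball x0 (7 / 8 * R) \<Longrightarrow> \<phi> x = 0"
    unfolding \<phi>_def by (rule interp_local_mem interp_local_zero; simp add: cz)+
  note vm = fe_measurable[OF fe_local_fe[OF v]] and \<phi>m = fe_measurable[OF fe_local_fe[OF \<phi>(1)]]
  have Crem0: "0 \<le> Crem" by (simp add: Crem_def)
  have e_m: "pair_measurable e" unfolding e_def by (rule pair_measurable_diff_sq[OF vm])
  have rem_m: "pair_measurable rem"
    unfolding rem_def
    using pair_measurable_fst[OF max_sq_measurable, of w] pair_measurable_snd[OF max_sq_measurable, of w] by measurable
  have e0: "0 \<le> e x y" and rem0: "0 \<le> rem x y" for x y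
    using max_sq_nonneg Crem0 by (auto simp: e_def rem_def)
  have b1: "e x y \<le> (w x - w y) * (\<phi> x - \<phi> y) + rem x y" "(\<phi> x - \<phi> y)\<^sup>2 \<le> 2 * e x y + 2 * rem x y"
    if "x \<in> B1" "y \<in> B1" for x y
    using nodal_cutoff_bounds[OF dim w that] by (simp_all add: e_def rem_def v_def \<phi>_def)
  let ?K = "8 * near_C TYPE('a) s * 4 ^ Suc DIM('a) * Crem"
  have K0: "0 \<le> ?K" using near_C_pos[OF s, where 'a='a] Crem0 by simp
  have rem_le: "kint s BB rem \<le> ennreal ?K * mass s w"
    by (rule kint_max_sq[OF s w Crem0]) (simp add: rem_def)
  have C: "2 \<le> Cmulti s" "2 * ?K \<le> Cmulti s" "?K \<le> Cmulti s" "4 ^ Suc DIM('a) \<le> Cmulti s"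
    using K0 unfolding Cmulti_def by (auto simp: add_nonneg_nonneg)
  have 1: "kint s BB rem \<le> ennreal (1 / 8) * kint s BB e + ennreal (Cmulti s) * mass s w"
  proof -
    have "kint s BB rem \<le> ennreal (Cmulti s) * mass s w"
      by (rule order_trans[OF rem_le]) (intro mult_right_mono ennreal_leI C zero_le)
    then show ?thesis by (simp add: add_increasing)
  qed
  have 2: "kint s BB (\<lambda>x y. (\<phi> x - \<phi> y)\<^sup>2) \<le> ennreal (Cmulti s) * (kint s BB e + mass s w)"
  proof -
    have "kint s BB (\<lambda>x y. (\<phi> x - \<phi> y)\<^sup>2) \<le> kint s BB (\<lambda>x y. 2 * e x y + 2 * rem x y)"
      by (rule kint_mono) (use b1 in auto)
    also have "\<dots> = ennreal 2 * kint s BB e + ennreal 2 * kint s BB rem"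
      using e_m rem_m e0 rem0 B1_sets(2)
      by (subst kint_add) (auto intro!: borel_measurable_times simp: kint_cmult)
    also have "\<dots> \<le> ennreal (Cmulti s) * kint s BB e + ennreal 2 * (ennreal ?K * mass s w)"
      by (intro add_mono mult_right_mono mult_left_mono ennreal_leI C rem_le zero_le)
    also have "ennreal 2 * (ennreal ?K * mass s w) = ennreal (2 * ?K) * mass s w"
      using K0 by (simp only: mult.assoc[symmetric] ennreal_mult[symmetric] zero_le_numeral)
    also have "\<dots> \<le> ennreal (Cmulti s) * mass s w"
      by (intro mult_right_mono ennreal_leI C zero_le)
    finally show ?thesis by (simp add: distrib_left add_left_mono)
  qed
  have 3: "Hs_seminorm_sq s (ball x0 (R / 2)) w \<le> ennreal (Cmulti s) * (kint s BB e + mass s w)"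
  proof -
    have vw: "v x = w x" if x: "x \<in> ball x0 (R / 2)" for x
    proof -
      have xR: "x \<in> ball x0 R" using x R by simp
      obtain T where T: "T \<in> Th" "x \<in> T" using elem_cover[OF xR] by blast
      have "cutoff i = 1" if "i \<in> verts T" for i
      proof (rule c1)
        have "norm (i - x0) < R / 2 + R / 16"
          by (rule elem_near[OF T(1) T(2)]) (use that verts_subset x R in \<open>auto simp: dist_norm norm_minus_commute\<close>)
        then show "norm (i - x0) \<le> 9 / 16 * R" by simp
      qed
      then show ?thesis unfolding v_def using interp_elem[OF T] fe_eval[OF w T] by simp
    qed
    have "Hs_seminorm_sq s (ball x0 (R / 2)) w = kint s (ball x0 (R / 2) \<times> ball x0 (R / 2)) (\<lambda>x y. (w x - w y)\<^sup>2)"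
      by (rule Hs_seminorm_sq_kint[OF fe_measurable[OF w]]) simp
    also have "\<dots> \<le> kint s BB e"
      by (rule kint_mono) (use vw R in \<open>auto simp: e_def B1_def\<close>)
    also have "\<dots> \<le> ennreal 1 * (kint s BB e + mass s w)" by simp
    also have "\<dots> \<le> ennreal (Cmulti s) * (kint s BB e + mass s w)"
      using C by (intro mult_right_mono ennreal_leI zero_le) auto
    finally show ?thesis .
  qed
  have 4: "L2_norm_sq UNIV \<phi> \<le> ennreal (Cmulti s) * L2_norm_sq (ball x0 R) w"
  proof -
    have "(\<phi> x)\<^sup>2 \<le> max_sq w x" for x
    proof (cases "x \<in> ball x0 (7 / 8 * R)")
      case True
      then have xB: "x \<in> B1" using R by (simp add: B1_def)
      then obtain T where T: "T \<in> Th" "x \<in> T" using elem_cover B1_sub by blast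
      have "\<bar>\<phi> x\<bar> \<le> (\<Sum>i\<in>verts T. \<bar>hat i x * ((cutoff i)\<^sup>2 * w i)\<bar>)"
        unfolding \<phi>_def interp_elem[OF T] by (rule sum_abs)
      also have "\<dots> \<le> (\<Sum>i\<in>verts T. hat i x * elem_max w T)"
      proof (rule sum_mono)
        fix i assume i: "i \<in> verts T"
        have "(cutoff i)\<^sup>2 * \<bar>w i\<bar> \<le> 1 * elem_max w T"
          using cutoff_bounds[of i] elem_max_vert[OF T(1) i, of w] by (intro mult_mono) (auto simp: power_le_one)
        then show "\<bar>hat i x * ((cutoff i)\<^sup>2 * w i)\<bar> \<le> hat i x * elem_max w T"
          using hat_nonneg[OF T, of i] by (simp add: abs_mult mult_left_mono)
      qed
      also have "\<dots> = elem_max w T"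
        using hat_sum[OF T] by (simp add: sum_distrib_right[symmetric])
      finally have "\<bar>\<phi> x\<bar>\<^sup>2 \<le> (elem_max w T)\<^sup>2" by (intro power_mono) auto
      then show ?thesis using max_sq_ge[OF T(1) B1_elem[OF xB T] T(2), of w] by simp
    next
      case False then show ?thesis using \<phi>(2) max_sq_nonneg by simp
    qed
    then have "L2_norm_sq UNIV \<phi> \<le> (\<integral>\<^sup>+x. ennreal (max_sq w x) \<partial>lebesgue)"
      unfolding L2_norm_sq_def by (intro nn_integral_mono) (auto intro: ennreal_leI)
    also have "\<dots> \<le> ennreal (4 ^ Suc DIM('a)) * L2_norm_sq (ball x0 R) w" by (rule max_sq_integral[OF w])
    also have "\<dots> \<le> ennreal (Cmulti s) * L2_norm_sq (ball x0 R) w"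
      by (intro mult_right_mono ennreal_leI C zero_le)
    finally show ?thesis .
  qed
  have 5: "kint s BB e < \<infinity>"
    unfolding e_def by (rule fe_energy_finite[OF s fe_local_fe[OF v]])
  have 6: "\<forall>x\<in>B1. \<forall>y\<in>B1. e x y / 2 \<le> (w x - w y) * (\<phi> x - \<phi> y) + rem x y"
  proof (intro ballI)
    fix x y assume "x \<in> B1" "y \<in> B1"
    then show "e x y / 2 \<le> (w x - w y) * (\<phi> x - \<phi> y) + rem x y" using b1(1) e0[of x y] by fastforce
  qed
  show ?thesis
    unfolding good_test_def
    by (rule exI[of _ \<phi>], rule exI[of _ e], rule exI[of _ rem]) (use \<phi> e_m rem_m e0 rem0 1 2 3 4 5 6 in blast)
qed

end

section \<open>Meshes of a line\<close>

text \<open>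
  The ambient space is an abstract one-dimensional Euclidean space; the unit vector
  \<open>b\<close> orients it. With \<open>- b\<close> in place of \<open>b\<close> every
  statement about the left end of the ball becomes one about its right end.
\<close>

locale mesh_line = local_mesh +
  fixes b :: 'a
  assumes dim1: "DIM('a) = 1" and b: "norm b = 1"
begin

definition coord :: "'a \<Rightarrow> real" where "coord x = (x - x0) \<bullet> b"
definition pt :: "real \<Rightarrow> 'a" where "pt r = x0 + r *\<^sub>R b"

lemma bb: "b \<bullet> b = 1"
  using b by (simp add: dot_square_norm)

lemma line_repr: "x = (x \<bullet> b) *\<^sub>R b"
proof -
  obtain e where e: "Basis = {e :: 'a}" using dim1 card_1_singletonE by blast
  have r: "y = (y \<bullet> e) *\<^sub>R e" for y :: 'a
    using euclidean_representation[of y] by (simp add: e)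
  have ee: "e \<bullet> e = 1" using inner_same_Basis[of e] by (simp add: e)
  have be: "(b \<bullet> e) * (b \<bullet> e) = 1"
    using bb r[of b] ee by (metis inner_scaleR_left inner_scaleR_right mult.right_neutral)
  have "x \<bullet> b = (x \<bullet> e) * (b \<bullet> e)"
    using r[of x] r[of b] by (metis inner_commute inner_scaleR_left)
  then have "(x \<bullet> b) *\<^sub>R b = ((x \<bullet> e) * (b \<bullet> e)) *\<^sub>R ((b \<bullet> e) *\<^sub>R e)"
    using r[of b] by simp
  also have "\<dots> = (x \<bullet> e) *\<^sub>R e" using be by (simp add: mult.assoc)
  finally show ?thesis using r[of x] by simp
qed

lemma pt_coord [simp]: "pt (coord x) = x"
  using line_repr[of "x - x0"] by (simp add: pt_def coord_def)

lemma coord_pt [simp]: "coord (pt r) = r"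
  by (simp add: pt_def coord_def bb)

lemma coord_eq_iff: "coord x = coord y \<longleftrightarrow> x = y"
  by (metis pt_coord)

lemma norm_coord: "norm (x - y) = \<bar>coord x - coord y\<bar>"
proof -
  have "x - y = ((x - y) \<bullet> b) *\<^sub>R b" by (rule line_repr)
  then have "norm (x - y) = \<bar>(x - y) \<bullet> b\<bar>" using b by (metis norm_scaleR mult.right_neutral)
  then show ?thesis by (simp add: coord_def inner_diff_left)
qed

lemma coord_x0: "coord x0 = 0" by (simp add: coord_def)

lemma mem_ball_coord: "x \<in> ball x0 r \<longleftrightarrow> \<bar>coord x\<bar> < r"
  using norm_coord[of x x0] by (simp add: dist_norm norm_minus_commute coord_x0)

lemma coord_continuous: "continuous_on UNIV coord"
  unfolding coord_def by (intro continuous_intros)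

lemma coord_measurable [measurable]: "coord \<in> borel_measurable lebesgue"
  using borel_measurable_continuous_onI[OF coord_continuous] by (simp add: measurable_completion)

definition seg :: "real \<Rightarrow> real \<Rightarrow> 'a set" where "seg p q = {x. p \<le> coord x \<and> coord x \<le> q}"

lemma seg_cball: "seg p q = cball (pt ((p + q) / 2)) ((q - p) / 2)"
  by (auto simp: seg_def dist_norm norm_coord abs_if field_simps split: if_splits)

lemma seg_sets: "seg p q \<in> sets lebesgue"
  by (simp add: seg_cball)

lemma seg_convex: "convex (seg p q)" and seg_compact: "compact (seg p q)"
  by (simp_all add: seg_cball)

lemma emeasure_seg: "p \<le> q \<Longrightarrow> emeasure lebesgue (seg p q) = ennreal (q - p)"
  by (simp add: seg_cball emeasure_cball dim1)

definition lo :: "'a set \<Rightarrow> real" where "lo T = Min (coord ` verts T)"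
definition hi :: "'a set \<Rightarrow> real" where "hi T = Max (coord ` verts T)"

lemma elem_seg:
  assumes T: "T \<in> Th"
  shows elem_eq_seg: "T = seg (lo T) (hi T)" and lo_less_hi: "lo T < hi T"
    and verts_lo_hi: "verts T = {pt (lo T), pt (hi T)}" and diameter_elem: "diameter T = hi T - lo T"
proof -
  have "card (verts T) = 2" using card_verts_elem[OF T] dim1 by simp
  then obtain i j where ij: "verts T = {i, j}" "i \<noteq> j" by (auto simp: card_2_iff)
  then have "coord i \<noteq> coord j" by (simp add: coord_eq_iff)
  then have lh: "lo T = min (coord i) (coord j)" "hi T = max (coord i) (coord j)" "lo T < hi T"
    by (auto simp: lo_def hi_def ij)
  then show less: "lo T < hi T" by simp
  show v: "verts T = {pt (lo T), pt (hi T)}"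
    using ij lh by (auto simp: min_def max_def)
  define l h where "l = lo T" and "h = hi T"
  have hull: "T = closed_segment (pt l) (pt h)"
    using simplex_eq_hull[OF simplex[OF T]] v by (simp add: segment_convex_hull l_def h_def)
  have lh': "l < h" using less by (simp add: l_def h_def)
  have eq: "T = seg l h"
  proof
    have "closed_segment (pt l) (pt h) \<subseteq> seg l h"
      by (rule closed_segment_subset[OF _ _ seg_convex]) (use lh' in \<open>auto simp: seg_def\<close>)
    then show "T \<subseteq> seg l h" using hull by simp
    show "seg l h \<subseteq> T"
    proof
      fix x assume x: "x \<in> seg l h"
      define u where "u = (coord x - l) / (h - l)"
      have u: "0 \<le> u" "u \<le> 1" "coord x = l + u * (h - l)"
        using x lh' by (auto simp: u_def seg_def)
      have "x = pt (l + u * (h - l))" using u(3) pt_coord[of x] by simp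
      also have "\<dots> = (1 - u) *\<^sub>R pt l + u *\<^sub>R pt h"
        by (simp add: pt_def algebra_simps)
      finally show "x \<in> T" using hull u by (auto simp: in_segment)
    qed
  qed
  then show "T = seg (lo T) (hi T)" unfolding l_def h_def .
  have "diameter T = h - l"
    unfolding eq using lh' by (simp add: seg_cball diameter_cball)
  then show "diameter T = hi T - lo T" by (simp add: l_def h_def)
qed

lemma mem_elem: "T \<in> Th \<Longrightarrow> x \<in> T \<longleftrightarrow> lo T \<le> coord x \<and> coord x \<le> hi T"
  using elem_eq_seg by (auto simp: seg_def)

lemma emeasure_elem: "T \<in> Th \<Longrightarrow> emeasure lebesgue T = ennreal (diameter T)"
  using emeasure_seg[of "lo T" "hi T"] elem_eq_seg[of T] lo_less_hi[of T] diameter_elem[of T] by simp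

lemma node_in_elem:
  assumes "T \<in> Th" "pt z \<in> nodes" "lo T \<le> z" "z \<le> hi T"
  shows "z = lo T \<or> z = hi T"
proof -
  have "pt z \<in> verts T" using node_vert[OF assms(2,1)] mem_elem[OF assms(1)] assms by simp
  then show ?thesis using verts_lo_hi[OF assms(1)] by (metis coord_pt insertE singletonD)
qed

lemma elem_nodes: "T \<in> Th \<Longrightarrow> pt (lo T) \<in> nodes" "T \<in> Th \<Longrightarrow> pt (hi T) \<in> nodes"
  using verts_lo_hi verts_nodes by blast+

lemma elem_order:
  assumes "T \<in> Th" "T' \<in> Th" "T \<noteq> T'"
  shows "hi T \<le> lo T' \<or> hi T' \<le> lo T"
proof (rule ccontr)
  assume "\<not> ?thesis"
  then have l: "max (lo T) (lo T') < min (hi T) (hi T')"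
    using lo_less_hi assms by auto
  have "seg (max (lo T) (lo T')) (min (hi T) (hi T')) \<subseteq> T \<inter> T'"
    using mem_elem assms by (auto simp: seg_def)
  then have "negligible (seg (max (lo T) (lo T')) (min (hi T) (hi T')))"
    using elem_inter_negligible[OF assms] negligible_subset by blast
  then have "emeasure lebesgue (seg (max (lo T) (lo T')) (min (hi T) (hi T'))) = 0"
    by (simp add: negligible_iff_null_sets null_sets_def)
  then have "ennreal (min (hi T) (hi T') - max (lo T) (lo T')) = 0"
    using emeasure_seg[OF less_imp_le[OF l]] by metis
  then show False using l by (simp add: ennreal_eq_0_iff)
qed

lemma sum_diameter_le:
  assumes "F \<subseteq> Th" "\<And>T. T \<in> F \<Longrightarrow> T \<subseteq> seg p q" "p \<le> q"
  shows "(\<Sum>T\<in>F. diameter T) \<le> q - p"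
proof -
  have "(\<Sum>T\<in>F. \<integral>\<^sup>+x\<in>T. 1 \<partial>lebesgue) \<le> (\<integral>\<^sup>+x\<in>seg p q. 1 \<partial>lebesgue)"
    by (rule sum_elem_integral_le) (use assms in auto)
  also have "\<dots> = ennreal (q - p)"
    by (simp only: mult_1 nn_integral_indicator[OF seg_sets] emeasure_seg[OF assms(3)])
  also have "(\<Sum>T\<in>F. \<integral>\<^sup>+x\<in>T. 1 \<partial>lebesgue) = (\<Sum>T\<in>F. ennreal (diameter T))"
  proof (rule sum.cong[OF refl])
    fix T assume "T \<in> F"
    then have "T \<in> Th" using assms by blast
    then show "(\<integral>\<^sup>+x\<in>T. 1 \<partial>lebesgue) = ennreal (diameter T)"
      by (simp only: mult_1 nn_integral_indicator[OF elem_sets] emeasure_elem)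
  qed
  also have "\<dots> = ennreal (\<Sum>T\<in>F. diameter T)"
    by (rule sum_ennreal) (use assms(1) diameter_pos less_imp_le in blast)
  finally show ?thesis using assms(3) by simp
qed

section \<open>Averaging over cut points\<close>

text \<open>
  Elements of the left zone that keep their distance from large elements: no element on their
  left is more than 64 times longer than the distance of the right ends. Without this
  condition, the total length of the elements crossed when moving left from an element could
  not be bounded by the distance (see \<open>cum_step\<close>).
\<close>

definition adm :: "'a set set" where
  "adm = {T\<in>Th. - 13 / 16 * R \<le> lo T \<and> hi T \<le> - 9 / 16 * R \<and>
     (\<forall>T'\<in>Th. T' \<inter> ball x0 R \<noteq> {} \<longrightarrow> hi T' \<le> lo T \<longrightarrow> diameter T' \<le> 64 * (hi T - hi T'))}"

lemma adm: 
  assumes "T \<in> adm"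
  shows adm_Th: "T \<in> Th" and adm_lo: "- 13 / 16 * R \<le> lo T" and adm_hi: "hi T \<le> - 9 / 16 * R"
    and adm_gap: "T' \<in> Th \<Longrightarrow> T' \<inter> ball x0 R \<noteq> {} \<Longrightarrow> hi T' \<le> lo T \<Longrightarrow> diameter T' \<le> 64 * (hi T - hi T')"
  using assms by (auto simp: adm_def)

lemma finite_adm: "finite adm"
  using finite_mesh by (simp add: adm_def)

definition len :: real where "len = (\<Sum>T\<in>adm. diameter T)"

text \<open>
  A covering argument: every point of an element that is not admissible lies to the right of
  some element \<open>T'\<close> within the distance \<open>diameter T' / 64\<close>. Such
  short intervals have total length at most \<open>2 R / 64\<close>, so of the middle part of
  the left zone, which has length \<open>R / 8\<close>, the admissible elements cover at least
  \<open>R / 8 - R / 32\<close>.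
\<close>

lemma len_ge: "R / 16 \<le> len"
proof -
  let ?F = "{T\<in>Th. T \<subseteq> seg (-R) R}"
  let ?Z = "seg (- 12 / 16 * R) (- 10 / 16 * R)"
  let ?J = "\<lambda>T. seg (hi T) (hi T + diameter T / 64)"
  have cover: "?Z \<subseteq> (\<Union>T\<in>adm. T) \<union> (\<Union>T\<in>?F. ?J T)"
  proof
    fix x assume x: "x \<in> ?Z"
    then have xR: "x \<in> ball x0 R" unfolding mem_ball_coord using R by (auto simp: seg_def)
    then obtain T where T: "T \<in> Th" "x \<in> T" using elem_cover by blast
    have "T \<inter> ball x0 R \<noteq> {}" using xR T(2) by blast
    then have sm: "16 * (hi T - lo T) \<le> R" using small[OF T(1)] diameter_elem[OF T(1)] by simp
    have xT: "lo T \<le> coord x" "coord x \<le> hi T" using mem_elem[OF T(1)] T(2) by auto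
    have z: "- 13 / 16 * R \<le> lo T" "hi T \<le> - 9 / 16 * R"
      using x sm xT by (auto simp: seg_def)
    show "x \<in> (\<Union>T\<in>adm. T) \<union> (\<Union>T\<in>?F. ?J T)"
    proof (cases "T \<in> adm")
      case False
      then obtain T' where T': "T' \<in> Th" "T' \<inter> ball x0 R \<noteq> {}" "hi T' \<le> lo T" "64 * (hi T - hi T') < diameter T'"
        using z T(1) unfolding adm_def by force
      have sm': "16 * (hi T' - lo T') \<le> R" using small[OF T'(1,2)] diameter_elem[OF T'(1)] by simp
      have "T' \<subseteq> seg (-R) R"
      proof
        fix y assume "y \<in> T'"
        then have "lo T' \<le> coord y" "coord y \<le> hi T'" using mem_elem[OF T'(1)] by auto
        then show "y \<in> seg (-R) R"
          using T'(3,4) sm' z xT R lo_less_hi[OF T(1)] diameter_elem[OF T'(1)] by (auto simp: seg_def)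
      qed
      moreover have "x \<in> ?J T'"
        using T'(3,4) xT by (auto simp: seg_def)
      ultimately show ?thesis using T'(1) by blast
    qed (use T in blast)
  qed
  have d0: "0 \<le> diameter T" if "T \<in> Th" for T using diameter_pos[OF that] by simp
  have finF: "finite ?F" using finite_mesh by simp
  have admS: "T \<in> sets lebesgue" if "T \<in> adm" for T using elem_sets[OF adm_Th[OF that]] .
  have mA: "(\<Union>T\<in>adm. T) \<in> sets lebesgue" by (rule sets.finite_UN[OF finite_adm admS])
  have mJ: "(\<Union>T\<in>?F. ?J T) \<in> sets lebesgue" by (rule sets.finite_UN[OF finF seg_sets])
  have "ennreal (R / 8) = emeasure lebesgue ?Z"
    using R emeasure_seg[of "- 12 / 16 * R" "- 10 / 16 * R"] by simp
  also have "\<dots> \<le> emeasure lebesgue ((\<Union>T\<in>adm. T) \<union> (\<Union>T\<in>?F. ?J T))"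
    by (rule emeasure_mono[OF cover sets.Un[OF mA mJ]])
  also have "\<dots> \<le> emeasure lebesgue (\<Union>T\<in>adm. T) + emeasure lebesgue (\<Union>T\<in>?F. ?J T)"
    by (rule emeasure_subadditive[OF mA mJ])
  also have "\<dots> \<le> (\<Sum>T\<in>adm. emeasure lebesgue T) + (\<Sum>T\<in>?F. emeasure lebesgue (?J T))"
    by (intro add_mono emeasure_subadditive_finite finite_adm finF image_subsetI admS seg_sets)
  also have "(\<Sum>T\<in>adm. emeasure lebesgue T) = (\<Sum>T\<in>adm. ennreal (diameter T))"
    by (rule sum.cong[OF refl]) (rule emeasure_elem[OF adm_Th])
  also have "(\<Sum>T\<in>?F. emeasure lebesgue (?J T)) = (\<Sum>T\<in>?F. ennreal (diameter T / 64))"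
  proof (rule sum.cong[OF refl])
    fix T assume "T \<in> ?F"
    then show "emeasure lebesgue (?J T) = ennreal (diameter T / 64)"
      using emeasure_seg[of "hi T" "hi T + diameter T / 64"] d0 by simp
  qed
  also have "(\<Sum>T\<in>adm. ennreal (diameter T)) + (\<Sum>T\<in>?F. ennreal (diameter T / 64)) = ennreal (len + (\<Sum>T\<in>?F. diameter T / 64))"
  proof -
    have "(\<Sum>T\<in>adm. ennreal (diameter T)) = ennreal len"
      unfolding len_def by (rule sum_ennreal) (use adm_Th d0 in auto)
    moreover have "(\<Sum>T\<in>?F. ennreal (diameter T / 64)) = ennreal (\<Sum>T\<in>?F. diameter T / 64)"
      by (rule sum_ennreal) (use d0 in auto)
    moreover have "0 \<le> len" "0 \<le> (\<Sum>T\<in>?F. diameter T / 64)"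
      using d0 adm_Th by (auto simp: len_def intro!: sum_nonneg)
    ultimately show ?thesis by simp
  qed
  finally have "R / 8 \<le> len + (\<Sum>T\<in>?F. diameter T / 64)"
    using d0 adm_Th by (subst (asm) ennreal_le_iff) (auto simp: len_def intro!: add_nonneg_nonneg sum_nonneg)
  also have "(\<Sum>T\<in>?F. diameter T / 64) = (\<Sum>T\<in>?F. diameter T) / 64" by (simp add: sum_divide_distrib)
  also have "(\<Sum>T\<in>?F. diameter T) \<le> R - (-R)" by (rule sum_diameter_le) (use R in auto)
  finally show ?thesis using R by simp
qed

lemma len_pos: "0 < len"
  using len_ge R by linarith


definition cum :: "real \<Rightarrow> real" where "cum r = (\<Sum>T\<in>{T\<in>adm. hi T < r}. diameter T)"

lemma adm_diameter_nonneg: "T \<in> adm \<Longrightarrow> 0 \<le> diameter T"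
  using diameter_pos[OF adm_Th] less_imp_le by blast

lemma cum_nonneg: "0 \<le> cum r"
  unfolding cum_def using adm_diameter_nonneg by (intro sum_nonneg) auto

lemma cum_mono: "r \<le> r' \<Longrightarrow> cum r \<le> cum r'"
  unfolding cum_def using adm_diameter_nonneg finite_adm by (intro sum_mono2) auto

lemma cum_measurable: "(\<lambda>x. cum (coord x)) \<in> borel_measurable lebesgue"
proof -
  have "mono cum" by (rule monoI) (rule cum_mono)
  then have "cum \<in> borel_measurable borel" by (rule borel_measurable_mono)
  from measurable_compose[OF coord_measurable this] show ?thesis .
qed

text \<open>
  The random cut point: two admissible elements are drawn independently with probability
  proportional to their length, and the cut is the rightmost of their right end points. Two
  draws make the distribution function quadratic (\<open>sum_mu_less\<close>). This is what
  makes the straddling error absorbable: the probability of a cut at \<open>T\<close> is of the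
  order of \<open>diameter T * (cum (hi T) + diameter T) / len\<^sup>2\<close>, and \<open>cum
  / len\<close> is the square root of the weight \<open>theta\<close> with which the energy is
  available.
\<close>

definition mu :: "'a set \<times> 'a set \<Rightarrow> real" where "mu a = diameter (fst a) * diameter (snd a) / len\<^sup>2"
definition rightmost :: "'a set \<times> 'a set \<Rightarrow> real" where "rightmost a = max (hi (fst a)) (hi (snd a))"

lemma mu_nonneg: "a \<in> adm \<times> adm \<Longrightarrow> 0 \<le> mu a"
  using adm_diameter_nonneg by (auto simp: mu_def)

lemma sum_mu_product: "F \<subseteq> adm \<Longrightarrow> (\<Sum>a\<in>F \<times> F. mu a) = (\<Sum>T\<in>F. diameter T)\<^sup>2 / len\<^sup>2"
  unfolding mu_def
  by (simp add: sum_divide_distrib[symmetric] power2_eq_square sum_product sum.cartesian_product case_prod_unfold)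

lemma sum_mu: "(\<Sum>a\<in>adm \<times> adm. mu a) = 1"
  using sum_mu_product[OF subset_refl] len_pos by (simp add: len_def[symmetric])

lemma sum_mu_less: "(\<Sum>a\<in>{a\<in>adm \<times> adm. rightmost a < r}. mu a) = (cum r / len)\<^sup>2"
proof -
  have "{a\<in>adm \<times> adm. rightmost a < r} = {T\<in>adm. hi T < r} \<times> {T\<in>adm. hi T < r}"
    by (auto simp: rightmost_def)
  then show ?thesis using sum_mu_product[of "{T\<in>adm. hi T < r}"] by (simp add: cum_def power_divide)
qed

lemma rightmost_props:
  assumes "a \<in> adm \<times> adm"
  shows rightmost_node: "pt (rightmost a) \<in> nodes" and rightmost_lower: "- 13 / 16 * R < rightmost a" and rightmost_upper: "rightmost a \<le> - 9 / 16 * R"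
proof -
  obtain T where T: "T \<in> adm" "rightmost a = hi T"
    using assms by (cases "hi (fst a) \<le> hi (snd a)") (auto simp: rightmost_def max_def)
  show "pt (rightmost a) \<in> nodes" "- 13 / 16 * R < rightmost a" "rightmost a \<le> - 9 / 16 * R"
    using T elem_nodes(2)[OF adm_Th[OF T(1)]] adm_lo[OF T(1)] adm_hi[OF T(1)] lo_less_hi[OF adm_Th[OF T(1)]] by auto
qed

text \<open>
  A bound for the probability that the cut is the right end of \<open>T\<close>: one of the two
  draws is \<open>T\<close>, and the other one does not lie further to the right.
\<close>

definition om :: "'a set \<Rightarrow> real" where "om T = 2 * diameter T * (cum (hi T) + diameter T) / len\<^sup>2"

lemma om_nonneg: "T \<in> adm \<Longrightarrow> 0 \<le> om T"
  using adm_diameter_nonneg cum_nonneg by (auto simp: om_def)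

lemma cum_closed:
  assumes "T \<in> adm"
  shows "(\<Sum>T'\<in>{T'\<in>adm. hi T' \<le> hi T}. diameter T') = cum (hi T) + diameter T"
proof -
  have "{T'\<in>adm. hi T' \<le> hi T} = insert T {T'\<in>adm. hi T' < hi T}"
  proof
    show "{T'\<in>adm. hi T' \<le> hi T} \<subseteq> insert T {T'\<in>adm. hi T' < hi T}"
    proof
      fix T' assume T': "T' \<in> {T'\<in>adm. hi T' \<le> hi T}"
      then have "T' = T \<or> hi T' < hi T"
        using elem_order[of T' T] adm_Th assms lo_less_hi[OF adm_Th[OF assms]] lo_less_hi[of T'] by force
      then show "T' \<in> insert T {T'\<in>adm. hi T' < hi T}" using T' by blast
    qed
  qed (use assms in auto)
  then show ?thesis using finite_adm by (simp add: cum_def)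
qed

text \<open>
  Every pair of elements is charged to the element that has the rightmost end; ties are charged
  twice.
\<close>

lemma mu_assign:
  fixes F :: "real \<Rightarrow> ennreal"
  shows "(\<Sum>a\<in>adm \<times> adm. ennreal (mu a) * F (rightmost a)) \<le> (\<Sum>T\<in>adm. ennreal (om T) * F (hi T))"
proof -
  let ?I = "\<lambda>T T'. if hi T' \<le> hi T then ennreal (mu (T, T')) * F (hi T) else 0"
  have half: "(\<Sum>T\<in>adm. \<Sum>T'\<in>adm. ?I T T') = (\<Sum>T\<in>adm. ennreal (om T / 2) * F (hi T))"
  proof (rule sum.cong[OF refl])
    fix T assume T: "T \<in> adm"
    have "(\<Sum>T'\<in>adm. ?I T T') = (\<Sum>T'\<in>{T'\<in>adm. hi T' \<le> hi T}. ennreal (mu (T, T')) * F (hi T))"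
      using finite_adm by (simp add: sum.inter_filter)
    also have "\<dots> = (\<Sum>T'\<in>{T'\<in>adm. hi T' \<le> hi T}. ennreal (mu (T, T'))) * F (hi T)"
      by (simp only: sum_distrib_right)
    also have "(\<Sum>T'\<in>{T'\<in>adm. hi T' \<le> hi T}. ennreal (mu (T, T'))) = ennreal (\<Sum>T'\<in>{T'\<in>adm. hi T' \<le> hi T}. mu (T, T'))"
      by (rule sum_ennreal) (use mu_nonneg T in auto)
    also have "(\<Sum>T'\<in>{T'\<in>adm. hi T' \<le> hi T}. mu (T, T')) = om T / 2"
      using cum_closed[OF T] by (simp add: mu_def om_def sum_divide_distrib[symmetric] sum_distrib_left[symmetric])
    finally show "(\<Sum>T'\<in>adm. ?I T T') = ennreal (om T / 2) * F (hi T)" .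
  qed
  have "(\<Sum>a\<in>adm \<times> adm. ennreal (mu a) * F (rightmost a)) = (\<Sum>T\<in>adm. \<Sum>T'\<in>adm. ennreal (mu (T, T')) * F (rightmost (T, T')))"
    by (simp add: sum.cartesian_product)
  also have "\<dots> \<le> (\<Sum>T\<in>adm. \<Sum>T'\<in>adm. ?I T T' + ?I T' T)"
  proof (intro sum_mono)
    fix T T' assume "T \<in> adm" "T' \<in> adm"
    have "mu (T, T') = mu (T', T)" by (simp add: mu_def mult.commute)
    then show "ennreal (mu (T, T')) * F (rightmost (T, T')) \<le> ?I T T' + ?I T' T"
      by (cases "hi T' \<le> hi T") (auto simp: rightmost_def max_def)
  qed
  also have "\<dots> = (\<Sum>T\<in>adm. \<Sum>T'\<in>adm. ?I T T') + (\<Sum>T\<in>adm. \<Sum>T'\<in>adm. ?I T' T)"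
    by (simp only: sum.distrib)
  also have "(\<Sum>T\<in>adm. \<Sum>T'\<in>adm. ?I T' T) = (\<Sum>T\<in>adm. \<Sum>T'\<in>adm. ?I T T')"
    by (rule sum.swap)
  also have "(\<Sum>T\<in>adm. \<Sum>T'\<in>adm. ?I T T') + (\<Sum>T\<in>adm. \<Sum>T'\<in>adm. ?I T T') = (\<Sum>T\<in>adm. ennreal (om T) * F (hi T))"
    unfolding half sum.distrib[symmetric]
  proof (rule sum.cong[OF refl])
    fix T assume T: "T \<in> adm"
    have "ennreal (om T) = ennreal (om T / 2) + ennreal (om T / 2)"
      using om_nonneg[OF T] by (subst ennreal_plus[symmetric]) auto
    then show "ennreal (om T / 2) * F (hi T) + ennreal (om T / 2) * F (hi T) = ennreal (om T) * F (hi T)"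
      by (simp only: distrib_right)
  qed
  finally show ?thesis .
qed

lemma fe_line:
  assumes "w \<in> fe_space \<Omega> Th" "T \<in> Th"
  shows "\<exists>\<alpha> \<beta>. \<forall>x\<in>T. w x = \<alpha> + \<beta> * coord x"
proof -
  obtain a c where ac: "\<And>x. x \<in> T \<Longrightarrow> w x = a \<bullet> x + c" using assms by (auto simp: fe_space_def)
  have "w x = (a \<bullet> x0 + c) + (a \<bullet> b) * coord x" if "x \<in> T" for x
  proof -
    have "a \<bullet> x = a \<bullet> pt (coord x)" by simp
    also have "\<dots> = a \<bullet> x0 + (a \<bullet> b) * coord x" by (simp add: pt_def inner_add_right)
    finally show ?thesis using ac[OF that] by simp
  qed
  then show ?thesis by blast
qed

text \<open>
  Different elements overlap in a null set only, so regions whose second points lie in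
  different elements do not overlap either and their contributions add up.
\<close>

lemma kint_sum_disjoint:
  assumes F: "F \<subseteq> Th" and U: "\<And>T. T \<in> F \<Longrightarrow> U T \<in> sets leb_pair"
    and sub: "\<And>T x y. T \<in> F \<Longrightarrow> (x, y) \<in> U T \<Longrightarrow> y \<in> T \<and> (x, y) \<in> V" and g: "pair_measurable g"
  shows "(\<Sum>T\<in>F. kint s (U T) g) \<le> kint s V g"
proof -
  have fin: "finite F" using F finite_mesh finite_subset by blast
  define N where "N = (\<Union>T\<in>F. \<Union>T'\<in>F - {T}. T \<inter> T')"
  have "negligible N" unfolding N_def
    using fin F elem_inter_negligible by (intro negligible_Union) blast+
  then have "N \<in> null_sets lebesgue" by (simp add: negligible_iff_null_sets)
  then have N: "UNIV \<times> N \<in> null_sets leb_pair"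
    by (intro leb.times_in_null_sets2) auto
  let ?f = "\<lambda>p. ennreal (g (fst p) (snd p) * kern s (fst p) (snd p))"
  have "(\<Sum>T\<in>F. kint s (U T) g) = (\<integral>\<^sup>+p. (\<Sum>T\<in>F. ?f p * indicator (U T) p) \<partial>leb_pair)"
    unfolding kint_def using g U
    by (intro nn_integral_sum[symmetric] borel_measurable_times_ennreal borel_measurable_indicator) auto
  also have "\<dots> \<le> kint s V g"
    unfolding kint_def
  proof (rule nn_integral_mono_AE, rule AE_I'[OF N], rule subsetI, rule ccontr)
    fix p assume p: "p \<in> {p \<in> space leb_pair. \<not> (\<Sum>T\<in>F. ?f p * indicator (U T) p) \<le> ?f p * indicator V p}" "p \<notin> UNIV \<times> N"
    show False
    proof (cases "\<exists>T\<in>F. p \<in> U T")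
      case True
      then obtain T where T: "T \<in> F" "p \<in> U T" by blast
      have sT: "snd p \<in> T" "p \<in> V" using sub[OF T(1), of "fst p" "snd p"] T(2) by auto
      have "p \<notin> U T'" if "T' \<in> F" "T' \<noteq> T" for T'
      proof
        assume "p \<in> U T'"
        then have "snd p \<in> T'" using sub[OF that(1), of "fst p" "snd p"] by auto
        then have "snd p \<in> N" using that T sT unfolding N_def by blast
        then show False using p(2) by (cases p) auto
      qed
      then have "?f p * indicator (U T') p = (if T' = T then ?f p else 0)" if "T' \<in> F" for T'
        using that T by (cases "T' = T") auto
      then have "(\<Sum>T'\<in>F. ?f p * indicator (U T') p) = (\<Sum>T'\<in>F. if T' = T then ?f p else 0)"
        by (rule sum.cong[OF refl])
      also have "\<dots> = ?f p" using T fin by simp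
      finally show False using p(1) sT by auto
    next
      case False
      then have "(\<Sum>T\<in>F. ?f p * indicator (U T) p) = 0" by (intro sum.neutral) auto
      then show False using p by simp
    qed
  qed
  finally show ?thesis .
qed

text \<open>
  Integrating out the right point: it is at distance at least \<open>z - coord x\<close> from
  the left one.
\<close>

lemma kint_cross:
  assumes s: "0 < s" and a: "a \<in> borel_measurable lebesgue" "\<And>x. 0 \<le> a x"
    and U: "\<And>x y. (x, y) \<in> U \<Longrightarrow> x \<in> B1 \<and> coord x < z \<and> z < coord y \<and> g x y \<le> a x"
  shows "kint s U g \<le> (\<integral>\<^sup>+x\<in>{x\<in>B1. coord x < z}. ennreal (a x * (far_C TYPE('a) s * (z - coord x) powr - (2 * s))) \<partial>lebesgue)"
proof -
  let ?X = "{x\<in>B1. coord x < z}" and ?Y = "{y. z < coord y}"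
  have X: "?X \<in> sets lebesgue"
  proof -
    have "{x \<in> space lebesgue. coord x < z} \<in> sets lebesgue" by measurable
    then have "B1 \<inter> {x. coord x < z} \<in> sets lebesgue" using B1_sets(1) by auto
    then show ?thesis by (simp add: Int_def)
  qed
  have Y: "?Y \<in> sets lebesgue"
  proof -
    have "{y \<in> space lebesgue. z < coord y} \<in> sets lebesgue" by measurable
    then show ?thesis by simp
  qed
  have "kint s U g \<le> kint s (?X \<times> ?Y) (\<lambda>x y. a x)"
    by (rule kint_mono) (use U in auto)
  also have "\<dots> = (\<integral>\<^sup>+x\<in>?X. (\<integral>\<^sup>+y\<in>?Y. ennreal (a x * kern s x y) \<partial>lebesgue) \<partial>lebesgue)"
    by (rule kint_fst[OF pair_measurable_fst[OF a(1)] X Y])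
  also have "\<dots> \<le> (\<integral>\<^sup>+x\<in>?X. ennreal (a x * (far_C TYPE('a) s * (z - coord x) powr - (2 * s))) \<partial>lebesgue)"
  proof (rule nn_integral_mono)
    fix x
    show "(\<integral>\<^sup>+y\<in>?Y. ennreal (a x * kern s x y) \<partial>lebesgue) * indicator ?X x
        \<le> ennreal (a x * (far_C TYPE('a) s * (z - coord x) powr - (2 * s))) * indicator ?X x"
    proof (cases "x \<in> ?X")
      case True
      have "(\<integral>\<^sup>+y\<in>?Y. ennreal (a x * kern s x y) \<partial>lebesgue)
          \<le> (\<integral>\<^sup>+y. ennreal (a x) * (ennreal (kern s x y) * indicator (- ball x (z - coord x)) y) \<partial>lebesgue)"
        by (rule nn_integral_mono)
          (use True a(2) in \<open>auto simp: indicator_def ennreal_mult' dist_norm norm_coord\<close>)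
      also have "\<dots> = ennreal (a x) * (\<integral>\<^sup>+y\<in>- ball x (z - coord x). ennreal (kern s x y) \<partial>lebesgue)"
        by (rule nn_integral_cmult) (auto intro!: borel_measurable_times_ennreal borel_measurable_indicator)
      also have "\<dots> \<le> ennreal (a x) * ennreal (far_C TYPE('a) s * (z - coord x) powr - (2 * s))"
        using True by (intro mult_left_mono far_C_le[OF s]) auto
      finally show ?thesis using True a(2) by (simp add: ennreal_mult')
    qed simp
  qed
  finally show ?thesis .
qed

section \<open>Pairs that straddle a cut point\<close>

text \<open>
  The probability that the cut lies to the left of \<open>x\<close>. For such cuts the
  truncation retains the differences of \<open>w\<close> to the right of \<open>x\<close>, so
  \<open>theta x * (w x - w y)\<^sup>2\<close> is controlled by the averaged energy density.
\<close>

definition theta :: "'a \<Rightarrow> real" where "theta x = (cum (coord x) / len)\<^sup>2"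

lemma theta_nonneg: "0 \<le> theta x" by (simp add: theta_def)

lemma theta_measurable: "theta \<in> borel_measurable lebesgue"
  unfolding theta_def using cum_measurable by measurable

definition left_pairs :: "('a \<times> 'a) set" where
  "left_pairs = {p. fst p \<in> B1 \<and> snd p \<in> B1 \<and> coord (fst p) < coord (snd p) \<and> coord (snd p) \<le> - 9 / 16 * R}"

lemma kern_line: "kern s x y = 1 / \<bar>coord x - coord y\<bar> powr (1 + 2 * s)"
  by (simp add: kern_def norm_coord dim1)

lemma weighted_young: "0 < \<delta> \<Longrightarrow> a * t \<le> \<delta> * a\<^sup>2 + t\<^sup>2 / (4 * \<delta>)" for a t \<delta> :: real
proof -
  assume d: "0 < \<delta>"
  have "0 \<le> (2 * \<delta> * a - t)\<^sup>2" by simp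
  then have "4 * \<delta> * (a * t) \<le> 4 * \<delta> * (\<delta> * a\<^sup>2) + t\<^sup>2"
    by (simp add: power2_eq_square algebra_simps)
  also have "\<dots> = 4 * \<delta> * (\<delta> * a\<^sup>2 + t\<^sup>2 / (4 * \<delta>))" using d by (simp add: field_simps)
  finally show ?thesis using d by simp
qed

text \<open>
  Two separated parts of \<open>T\<close>. Pairs of points taken from them have distance
  comparable to the diameter and detect the slope of an affine function on \<open>T\<close>.
\<close>

definition left_eighth :: "'a set \<Rightarrow> 'a set" where "left_eighth T = seg (lo T + diameter T / 8) (lo T + diameter T / 4)"
definition right_eighth :: "'a set \<Rightarrow> 'a set" where "right_eighth T = seg (hi T - diameter T / 4) (hi T - diameter T / 8)"

lemma inside_lower:
  assumes s: "0 < s" and T: "T \<in> adm" and w: "\<And>x. x \<in> T \<Longrightarrow> w x = \<alpha> + \<beta> * coord x"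
  shows "ennreal ((cum (hi T) / len)\<^sup>2 * (\<beta>\<^sup>2 * diameter T powr (3 - 2 * s))) \<le> ennreal 256 * kint s (left_eighth T \<times> right_eighth T) (\<lambda>x y. theta x * (w x - w y)\<^sup>2)"
proof -
  let ?h = "diameter T"
  have Th: "T \<in> Th" by (rule adm_Th[OF T])
  have h: "0 < ?h" "hi T = lo T + ?h" using diameter_pos[OF Th] diameter_elem[OF Th] by auto
  let ?c = "(cum (hi T) / len)\<^sup>2 * \<beta>\<^sup>2 * (?h / 2)\<^sup>2 * ?h powr - (1 + 2 * s)"
  have pt: "?c \<le> theta x * (w x - w y)\<^sup>2 * kern s x y" if x: "x \<in> left_eighth T" and y: "y \<in> right_eighth T" for x y
  proof -
    have xy: "lo T < coord x" "?h / 2 \<le> coord y - coord x" "coord y - coord x \<le> ?h"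
      using x y h by (auto simp: left_eighth_def right_eighth_def seg_def)
    have xT: "x \<in> T" "y \<in> T"
      using x y h by (auto simp: left_eighth_def right_eighth_def seg_def mem_elem[OF Th])
    have "cum (hi T) \<le> cum (coord x)"
      unfolding cum_def
    proof (rule sum_mono2)
      show "{T'\<in>adm. hi T' < hi T} \<subseteq> {T'\<in>adm. hi T' < coord x}"
      proof
        fix T' assume T': "T' \<in> {T'\<in>adm. hi T' < hi T}"
        then have "hi T' \<le> lo T \<or> hi T \<le> lo T'" using elem_order[of T' T] adm_Th Th by auto
        then have "hi T' \<le> lo T" using T' lo_less_hi[of T'] adm_Th[of T'] by auto
        then show "T' \<in> {T'\<in>adm. hi T' < coord x}" using T' xy by auto
      qed
    qed (use finite_adm adm_diameter_nonneg in auto)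
    then have 1: "(cum (hi T) / len)\<^sup>2 \<le> theta x"
      unfolding theta_def using cum_nonneg len_pos by (intro power_mono divide_right_mono) (auto simp: less_imp_le)
    have "w x - w y = \<beta> * (coord x - coord y)" using w xT by (simp add: algebra_simps)
    then have "(w x - w y)\<^sup>2 = \<beta>\<^sup>2 * (coord y - coord x)\<^sup>2" by (simp add: power_mult_distrib power2_commute)
    moreover have "(?h / 2)\<^sup>2 \<le> (coord y - coord x)\<^sup>2" using xy h by (intro power_mono) auto
    ultimately have 2: "\<beta>\<^sup>2 * (?h / 2)\<^sup>2 \<le> (w x - w y)\<^sup>2" by (simp add: mult_left_mono)
    have 3: "?h powr - (1 + 2 * s) \<le> kern s x y"
    proof -
      have p: "0 < \<bar>coord x - coord y\<bar>" "\<bar>coord x - coord y\<bar> \<le> ?h" using xy h by auto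
      then have "\<bar>coord x - coord y\<bar> powr (1 + 2 * s) \<le> ?h powr (1 + 2 * s)" using s by (intro powr_mono2) auto
      then have "1 / ?h powr (1 + 2 * s) \<le> 1 / \<bar>coord x - coord y\<bar> powr (1 + 2 * s)"
        using p h by (intro divide_left_mono mult_pos_pos) auto
      then show ?thesis unfolding kern_line powr_minus_divide .
    qed
    have "((cum (hi T) / len)\<^sup>2 * (\<beta>\<^sup>2 * (?h / 2)\<^sup>2)) * ?h powr - (1 + 2 * s) \<le> (theta x * (w x - w y)\<^sup>2) * kern s x y"
      using 1 2 3 theta_nonneg by (intro mult_mono) auto
    then show ?thesis by (simp only: mult.assoc)
  qed
  have c0: "0 \<le> ?c" by simp
  have eL: "emeasure lebesgue (left_eighth T) = ennreal (?h / 8)"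
    unfolding left_eighth_def using emeasure_seg[of "lo T + ?h / 8" "lo T + ?h / 4"] h by simp
  have eR: "emeasure lebesgue (right_eighth T) = ennreal (?h / 8)"
    unfolding right_eighth_def using emeasure_seg[of "hi T - ?h / 4" "hi T - ?h / 8"] h by simp
  have sets: "left_eighth T \<in> sets lebesgue" "right_eighth T \<in> sets lebesgue" by (simp_all add: left_eighth_def right_eighth_def seg_sets)
  have "ennreal (?c * (?h / 8) * (?h / 8)) = ennreal ?c * (emeasure lebesgue (left_eighth T) * emeasure lebesgue (right_eighth T))"
  proof -
    have "ennreal (?c * ((?h / 8) * (?h / 8))) = ennreal ?c * ennreal ((?h / 8) * (?h / 8))"
      by (rule ennreal_mult[OF c0]) (use h in simp)
    also have "ennreal ((?h / 8) * (?h / 8)) = ennreal (?h / 8) * ennreal (?h / 8)"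
      by (rule ennreal_mult) (use h in simp_all)
    finally show ?thesis unfolding eL eR by (simp only: mult.assoc)
  qed
  also have "\<dots> = ennreal ?c * emeasure leb_pair (left_eighth T \<times> right_eighth T)"
    by (simp only: leb.emeasure_pair_measure_Times[OF sets])
  also have "\<dots> = (\<integral>\<^sup>+p. ennreal ?c * indicator (left_eighth T \<times> right_eighth T) p \<partial>leb_pair)"
    by (rule nn_integral_cmult_indicator[symmetric]) (use sets in auto)
  also have "\<dots> \<le> kint s (left_eighth T \<times> right_eighth T) (\<lambda>x y. theta x * (w x - w y)\<^sup>2)"
    unfolding kint_def
  proof (rule nn_integral_mono)
    fix p :: "'a \<times> 'a"
    have "p \<in> left_eighth T \<times> right_eighth T \<Longrightarrow> ?c \<le> theta (fst p) * (w (fst p) - w (snd p))\<^sup>2 * kern s (fst p) (snd p)"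
      by (rule pt) auto
    from ennreal_leI[OF this]
    show "ennreal ?c * indicator (left_eighth T \<times> right_eighth T) p \<le> ennreal (theta (fst p) * (w (fst p) - w (snd p))\<^sup>2 * kern s (fst p) (snd p)) * indicator (left_eighth T \<times> right_eighth T) p"
      by (cases "p \<in> left_eighth T \<times> right_eighth T") simp_all
  qed
  finally have low: "ennreal (?c * (?h / 8) * (?h / 8)) \<le> kint s (left_eighth T \<times> right_eighth T) (\<lambda>x y. theta x * (w x - w y)\<^sup>2)" .
  have "?h powr (3 - 2 * s) = ?h powr 4 * ?h powr - (1 + 2 * s)"
    by (simp only: powr_add[symmetric]) simp
  also have "?h powr 4 = ?h ^ 4" using h by simp
  finally have "(cum (hi T) / len)\<^sup>2 * (\<beta>\<^sup>2 * ?h powr (3 - 2 * s)) = 256 * (?c * (?h / 8) * (?h / 8))"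
    by (simp add: power2_eq_square eval_nat_numeral)
  then have "ennreal ((cum (hi T) / len)\<^sup>2 * (\<beta>\<^sup>2 * ?h powr (3 - 2 * s))) = ennreal 256 * ennreal (?c * (?h / 8) * (?h / 8))"
    using c0 h by (simp only:) (rule ennreal_mult, auto)
  also have "\<dots> \<le> ennreal 256 * kint s (left_eighth T \<times> right_eighth T) (\<lambda>x y. theta x * (w x - w y)\<^sup>2)"
    by (rule mult_left_mono[OF low]) simp
  finally show ?thesis .
qed

text \<open>
  The contribution of left points in \<open>T\<close> itself is of order \<open>\<beta>\<^sup>2
  * diameter T powr (3 - 2 * s)\<close> times the probability of the cut, where
  \<open>\<beta>\<close> is the slope of \<open>w\<close> on \<open>T\<close>. That probability
  is of order \<open>diameter T * (cum + diameter T)\<close>. Young's inequality turns the part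
  with \<open>cum\<close> into a small multiple of \<open>cum\<^sup>2\<close>, which is the
  energy seen by the two eighths of \<open>T\<close>, and a multiple of \<open>(diameter
  T)\<^sup>2\<close>, which is bounded by the mass.
\<close>

lemma inside_bound:
  assumes s: "0 < s" "s < 1" and w: "w \<in> fe_space \<Omega> Th" and T: "T \<in> adm" and \<delta>: "0 < \<delta>"
  shows "ennreal (om T) * (\<integral>\<^sup>+x\<in>T. ennreal ((w x - w (pt (hi T)))\<^sup>2 * (hi T - coord x) powr - (2 * s)) \<partial>lebesgue)
    \<le> ennreal (512 * \<delta>) * kint s (left_eighth T \<times> right_eighth T) (\<lambda>x y. theta x * (w x - w y)\<^sup>2)
      + ennreal (1024 * (2 + 1 / (2 * \<delta>)) * R powr - (2 * s)) * (ennreal ((elem_max w T)\<^sup>2) * emeasure lebesgue T)"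
proof -
  let ?h = "diameter T"
  have Th: "T \<in> Th" by (rule adm_Th[OF T])
  have h: "0 < ?h" "hi T = lo T + ?h" using diameter_pos[OF Th] diameter_elem[OF Th] by auto
  obtain \<alpha> \<beta> where ab: "\<And>x. x \<in> T \<Longrightarrow> w x = \<alpha> + \<beta> * coord x" using fe_line[OF w Th] by blast
  have ends: "pt (lo T) \<in> T" "pt (hi T) \<in> T" using mem_elem[OF Th] h by auto
  have "T \<inter> ball x0 R \<noteq> {}"
  proof -
    have "pt (hi T) \<in> ball x0 R" unfolding mem_ball_coord using adm_lo[OF T] adm_hi[OF T] h R by auto
    then show ?thesis using ends by blast
  qed
  then have hR: "?h \<le> R" using small[OF Th] h R by auto
  let ?P = "\<beta>\<^sup>2 * ?h powr (3 - 2 * s)"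
  have pw: "(w x - w (pt (hi T)))\<^sup>2 * (hi T - coord x) powr - (2 * s) \<le> \<beta>\<^sup>2 * ?h powr (2 - 2 * s)" if x: "x \<in> T" for x
  proof -
    define t where "t = hi T - coord x"
    have t: "0 \<le> t" "t \<le> ?h" using x mem_elem[OF Th] h by (auto simp: t_def)
    have "w x - w (pt (hi T)) = - (\<beta> * t)" using ab[OF x] ab[OF ends(2)] by (simp add: t_def algebra_simps)
    then have "(w x - w (pt (hi T)))\<^sup>2 * (hi T - coord x) powr - (2 * s) = \<beta>\<^sup>2 * (t\<^sup>2 * t powr - (2 * s))"
      by (simp add: t_def power_mult_distrib)
    also have "t\<^sup>2 * t powr - (2 * s) \<le> ?h powr (2 - 2 * s)"
    proof (cases "t = 0")
      case False
      then have t0: "0 < t" using t by simp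
      have "t\<^sup>2 * t powr - (2 * s) = t powr 2 * t powr - (2 * s)" using t0 by simp
      also have "\<dots> = t powr (2 - 2 * s)" by (simp only: powr_add[symmetric]) simp
      also have "\<dots> \<le> ?h powr (2 - 2 * s)" using t s by (intro powr_mono2) auto
      finally show ?thesis .
    qed simp
    finally show ?thesis by (simp add: mult_left_mono)
  qed
  have "(\<integral>\<^sup>+x\<in>T. ennreal ((w x - w (pt (hi T)))\<^sup>2 * (hi T - coord x) powr - (2 * s)) \<partial>lebesgue)
      \<le> (\<integral>\<^sup>+x. ennreal (\<beta>\<^sup>2 * ?h powr (2 - 2 * s)) * indicator T x \<partial>lebesgue)"
    by (rule nn_integral_mono) (auto simp: indicator_def intro!: ennreal_leI pw)
  also have "\<dots> = ennreal (\<beta>\<^sup>2 * ?h powr (2 - 2 * s)) * ennreal ?h"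
    by (subst nn_integral_cmult_indicator[OF elem_sets[OF Th]]) (simp only: emeasure_elem[OF Th])
  also have "\<dots> = ennreal (\<beta>\<^sup>2 * ?h powr (2 - 2 * s) * ?h)"
    by (rule ennreal_mult[symmetric]) (use h in auto)
  also have "\<beta>\<^sup>2 * ?h powr (2 - 2 * s) * ?h = ?P"
  proof -
    have "?h powr (3 - 2 * s) = ?h powr (2 - 2 * s) * ?h powr 1" by (simp only: powr_add[symmetric]) simp
    then show ?thesis using h by simp
  qed
  finally have "ennreal (om T) * (\<integral>\<^sup>+x\<in>T. ennreal ((w x - w (pt (hi T)))\<^sup>2 * (hi T - coord x) powr - (2 * s)) \<partial>lebesgue) \<le> ennreal (om T) * ennreal ?P"
    by (rule mult_left_mono) simp
  also have "\<dots> = ennreal (om T * ?P)" by (rule ennreal_mult[symmetric]) (use om_nonneg[OF T] in auto)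
  also have "\<dots> \<le> ennreal (2 * \<delta> * ((cum (hi T) / len)\<^sup>2 * ?P) + 1024 * (2 + 1 / (2 * \<delta>)) * R powr - (2 * s) * ((elem_max w T)\<^sup>2 * ?h))"
  proof (rule ennreal_leI)
    let ?c = "cum (hi T)"
    have "?c * ?h \<le> \<delta> * ?c\<^sup>2 + ?h\<^sup>2 / (4 * \<delta>)" by (rule weighted_young[OF \<delta>])
    then have "2 * ?h * (?c + ?h) \<le> 2 * \<delta> * ?c\<^sup>2 + (2 + 1 / (2 * \<delta>)) * ?h\<^sup>2"
      by (simp add: power2_eq_square algebra_simps)
    then have "om T \<le> (2 * \<delta> * ?c\<^sup>2 + (2 + 1 / (2 * \<delta>)) * ?h\<^sup>2) / len\<^sup>2"
      unfolding om_def by (intro divide_right_mono) auto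
    then have "om T * ?P \<le> (2 * \<delta> * ?c\<^sup>2 + (2 + 1 / (2 * \<delta>)) * ?h\<^sup>2) / len\<^sup>2 * ?P"
      by (intro mult_right_mono) auto
    also have "\<dots> = 2 * \<delta> * ((?c / len)\<^sup>2 * ?P) + (2 + 1 / (2 * \<delta>)) * (?h\<^sup>2 * ?P / len\<^sup>2)"
      by (simp add: power_divide add_divide_distrib distrib_right)
    also have "\<dots> \<le> 2 * \<delta> * ((?c / len)\<^sup>2 * ?P) + (2 + 1 / (2 * \<delta>)) * (1024 * R powr - (2 * s) * ((elem_max w T)\<^sup>2 * ?h))"
    proof (intro add_left_mono mult_left_mono)
      have "w (pt (hi T)) - w (pt (lo T)) = \<beta> * ?h" using ab ends h by (simp add: algebra_simps)
      then have "\<bar>\<beta> * ?h\<bar> \<le> 2 * elem_max w T"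
        using elem_max_ge[OF w Th ends(1)] elem_max_ge[OF w Th ends(2)] by linarith
      from power_mono[OF this, of 2] have b2: "\<beta>\<^sup>2 * ?h\<^sup>2 \<le> 4 * (elem_max w T)\<^sup>2"
        by (simp add: power_mult_distrib)
      have "(R / 16)\<^sup>2 \<le> len\<^sup>2" using len_ge R by (intro power_mono) auto
      then have l2: "R\<^sup>2 / 256 \<le> len\<^sup>2" by (simp add: power_divide)
      have "?h powr (3 - 2 * s) = ?h powr (2 - 2 * s) * ?h powr 1" by (simp only: powr_add[symmetric]) simp
      then have "?h\<^sup>2 * ?P = (\<beta>\<^sup>2 * ?h\<^sup>2) * (?h powr (2 - 2 * s) * ?h)" using h by simp
      also have "\<dots> \<le> (4 * (elem_max w T)\<^sup>2) * (R powr (2 - 2 * s) * ?h)"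
      proof (rule mult_mono[OF b2])
        show "?h powr (2 - 2 * s) * ?h \<le> R powr (2 - 2 * s) * ?h"
          using h hR s by (intro mult_right_mono powr_mono2) auto
      qed (use h in auto)
      finally have "?h\<^sup>2 * ?P / len\<^sup>2 \<le> (4 * (elem_max w T)\<^sup>2) * (R powr (2 - 2 * s) * ?h) / (R\<^sup>2 / 256)"
        using l2 R h by (intro frac_le) auto
      also have "R powr (2 - 2 * s) = R\<^sup>2 * R powr - (2 * s)"
      proof -
        have "R powr (2 - 2 * s) = R powr 2 * R powr - (2 * s)" by (simp only: powr_add[symmetric]) simp
        then show ?thesis using R by simp
      qed
      also have "(4 * (elem_max w T)\<^sup>2) * (R\<^sup>2 * R powr - (2 * s) * ?h) / (R\<^sup>2 / 256) = 1024 * R powr - (2 * s) * ((elem_max w T)\<^sup>2 * ?h)"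
        using R by simp
      finally show "?h\<^sup>2 * ?P / len\<^sup>2 \<le> 1024 * R powr - (2 * s) * ((elem_max w T)\<^sup>2 * ?h)" .
    qed (use \<delta> in simp)
    finally show "om T * ?P \<le> 2 * \<delta> * ((?c / len)\<^sup>2 * ?P) + 1024 * (2 + 1 / (2 * \<delta>)) * R powr - (2 * s) * ((elem_max w T)\<^sup>2 * ?h)"
      by (simp only: mult_ac)
  qed
  also have "\<dots> = ennreal (2 * \<delta> * ((cum (hi T) / len)\<^sup>2 * ?P)) + ennreal (1024 * (2 + 1 / (2 * \<delta>)) * R powr - (2 * s) * ((elem_max w T)\<^sup>2 * ?h))"
    by (rule ennreal_plus) (use \<delta> h in auto)
  also have "ennreal (2 * \<delta> * ((cum (hi T) / len)\<^sup>2 * ?P)) = ennreal (2 * \<delta>) * ennreal ((cum (hi T) / len)\<^sup>2 * ?P)"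
    by (rule ennreal_mult) (use \<delta> in auto)
  also have "\<dots> \<le> ennreal (2 * \<delta>) * (ennreal 256 * kint s (left_eighth T \<times> right_eighth T) (\<lambda>x y. theta x * (w x - w y)\<^sup>2))"
    by (rule mult_left_mono[OF inside_lower[OF s(1) T ab]]) auto
  also have "\<dots> = ennreal (512 * \<delta>) * kint s (left_eighth T \<times> right_eighth T) (\<lambda>x y. theta x * (w x - w y)\<^sup>2)"
  proof -
    have "ennreal (2 * \<delta>) * ennreal 256 = ennreal (2 * \<delta> * 256)" by (rule ennreal_mult[symmetric]) (use \<delta> in auto)
    then show ?thesis by (simp only: mult.assoc[symmetric]) (simp add: mult.commute)
  qed
  also have "ennreal (1024 * (2 + 1 / (2 * \<delta>)) * R powr - (2 * s) * ((elem_max w T)\<^sup>2 * ?h))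
      = ennreal (1024 * (2 + 1 / (2 * \<delta>)) * R powr - (2 * s)) * (ennreal ((elem_max w T)\<^sup>2) * emeasure lebesgue T)"
    unfolding emeasure_elem[OF Th] using \<delta> h by (simp only: ennreal_mult[symmetric] zero_le_power2 less_imp_le)
       (rule ennreal_mult, auto)
  finally show ?thesis by (simp add: add_right_mono)
qed

text \<open>
  Between \<open>x\<close> and the right end of \<open>T\<close> there fits no more than the
  length of the gap, except for the element that contains \<open>x\<close>, which may stick out
  to the left. Admissibility of \<open>T\<close> bounds that one by 64 gaps.
\<close>

lemma cum_step:
  assumes T: "T \<in> adm" and x: "x \<in> B1" "coord x < lo T"
  shows "cum (hi T) + diameter T \<le> cum (coord x) + 66 * (hi T - coord x)"
proof -
  have Th: "T \<in> Th" by (rule adm_Th[OF T])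
  \<comment> \<open>Of the elements that contain x the leftmost one is taken, so that an admissible element
      that ends exactly at x does not stick out further.\<close>
  let ?X = "{T'\<in>Th. x \<in> T'}"
  have X: "finite ?X" using finite_mesh by simp
  obtain T0 where "T0 \<in> ?X" using elem_cover[of x] subsetD[OF B1_sub x(1)] by blast
  then have "Min (lo ` ?X) \<in> lo ` ?X" using X by (intro Min_in) auto
  then have "\<exists>Tx\<in>?X. Min (lo ` ?X) = lo Tx" by (simp only: image_iff)
  then obtain Tx where Tx: "Tx \<in> ?X" "Min (lo ` ?X) = lo Tx" ..
  have Tx_min: "lo Tx \<le> lo T'" if "T' \<in> ?X" for T'
    unfolding Tx(2)[symmetric] using X that by (intro Min_le) auto
  from Tx(1) have TxT: "Tx \<in> Th" "x \<in> Tx" by auto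
  have cx: "lo Tx \<le> coord x" "coord x \<le> hi Tx" using mem_elem[OF TxT(1)] TxT(2) by auto
  have "Tx \<noteq> T" using cx x by auto
  then have hT: "hi Tx \<le> lo T" using elem_order[OF TxT(1) Th] cx x lo_less_hi[OF Th] by auto
  have "Tx \<inter> ball x0 R \<noteq> {}" using TxT(2) x B1_sub by blast
  then have dTx: "diameter Tx \<le> 64 * (hi T - hi Tx)" using adm_gap[OF T TxT(1)] hT by blast
  let ?F = "{T'\<in>adm. coord x \<le> hi T' \<and> hi T' < hi T}"
  have sub: "T' \<subseteq> seg (lo Tx) (hi T)" if T': "T' \<in> ?F" for T'
  proof -
    have T'Th: "T' \<in> Th" using T' adm_Th by auto
    have "lo Tx \<le> lo T'"
    proof (cases "T' = Tx \<or> hi Tx \<le> lo T'")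
      case True
      then show ?thesis using lo_less_hi[OF TxT(1)] by auto
    next
      case False
      then have "hi T' \<le> lo Tx" using elem_order[OF T'Th TxT(1)] by auto
      then have "coord x = hi T'" using T' cx by auto
      then have "x \<in> T'" using mem_elem[OF T'Th] lo_less_hi[OF T'Th] by auto
      then show ?thesis using Tx_min T'Th by blast
    qed
    then show ?thesis using T' mem_elem[OF T'Th] by (auto simp: seg_def)
  qed
  have "{T'\<in>adm. hi T' < hi T} = {T'\<in>adm. hi T' < coord x} \<union> ?F"
    using x lo_less_hi[OF Th] by auto
  moreover have "{T'\<in>adm. hi T' < coord x} \<inter> ?F = {}" by auto
  ultimately have "cum (hi T) = cum (coord x) + (\<Sum>T'\<in>?F. diameter T')"
    unfolding cum_def using finite_adm by (simp add: sum.union_disjoint)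
  moreover have "(\<Sum>T'\<in>?F. diameter T') \<le> hi T - lo Tx"
    by (rule sum_diameter_le) (use sub adm_Th hT lo_less_hi[OF Th] lo_less_hi[OF TxT(1)] in auto)
  ultimately show ?thesis
    using diameter_elem[OF Th] diameter_elem[OF TxT(1)] dTx cx x(2) hT by argo
qed

definition right_half :: "'a set \<Rightarrow> 'a set" where "right_half T = seg ((lo T + hi T) / 2) (hi T)"
definition left_of :: "'a set \<Rightarrow> 'a set" where "left_of T = {x\<in>B1. coord x < lo T}"

lemma left_of_sets: "left_of T \<in> sets lebesgue"
proof -
  have "{x \<in> space lebesgue. coord x < lo T} \<in> sets lebesgue" by measurable
  then have "B1 \<inter> {x. coord x < lo T} \<in> sets lebesgue" using B1_sets(1) by auto
  then show ?thesis by (simp add: Int_def left_of_def)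
qed

text \<open>
  The value of an affine function at the end point is controlled by its values on the right
  half of the element.
\<close>

lemma half_elem_average:
  assumes w: "w \<in> fe_space \<Omega> Th" and T: "T \<in> Th"
  shows "ennreal (diameter T * (v - w (pt (hi T)))\<^sup>2) \<le> ennreal 32 * (\<integral>\<^sup>+y\<in>right_half T. ennreal ((v - w y)\<^sup>2) \<partial>lebesgue)"
proof -
  let ?g = "\<lambda>y. w y - v"
  have lh: "lo T < hi T" by (rule lo_less_hi[OF T])
  have sub: "right_half T \<subseteq> T"
  proof
    fix y assume "y \<in> right_half T"
    then have y: "(lo T + hi T) / 2 \<le> coord y" "coord y \<le> hi T" by (auto simp: right_half_def seg_def)
    have "lo T \<le> (lo T + hi T) / 2" using lh by simp
    then have "lo T \<le> coord y" using y(1) by (rule order_trans)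
    then show "y \<in> T" using mem_elem[OF T, of y] y(2) by simp
  qed
  have z: "pt (hi T) \<in> right_half T" using lh by (simp add: right_half_def seg_def)
  obtain a c where ac: "\<And>y. y \<in> T \<Longrightarrow> w y = a \<bullet> y + c" using w T by (auto simp: fe_space_def)
  have cp: "compact (right_half T)" unfolding right_half_def by (rule seg_compact)
  have "continuous_on (right_half T) (\<lambda>y. \<bar>?g y\<bar>)"
  proof -
    have "continuous_on (right_half T) (\<lambda>y. \<bar>a \<bullet> y + c - v\<bar>)" by (intro continuous_intros)
    then show ?thesis
      by (rule continuous_on_eq) (use ac sub in auto)
  qed
  then obtain p where p: "p \<in> right_half T" "\<And>y. y \<in> right_half T \<Longrightarrow> \<bar>?g y\<bar> \<le> \<bar>?g p\<bar>"
    using continuous_attains_sup[OF cp] z by (metis empty_iff)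
  have "ennreal ((?g p)\<^sup>2) * emeasure lebesgue (right_half T) \<le> ennreal (4 ^ Suc DIM('a)) * (\<integral>\<^sup>+y\<in>right_half T. ennreal ((?g y)\<^sup>2) \<partial>lebesgue)"
  proof (rule affine_L2_lower[where g = ?g and a = a and c = "c - v"])
    show "convex (right_half T)" unfolding right_half_def by (rule seg_convex)
  qed (use cp p ac sub in auto)
  moreover have "emeasure lebesgue (right_half T) = ennreal (diameter T / 2)"
    unfolding right_half_def using emeasure_seg[of "(lo T + hi T) / 2" "hi T"] lh diameter_elem[OF T] by (simp add: field_simps)
  ultimately have 1: "ennreal ((?g p)\<^sup>2) * ennreal (diameter T / 2) \<le> ennreal 16 * (\<integral>\<^sup>+y\<in>right_half T. ennreal ((?g y)\<^sup>2) \<partial>lebesgue)"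
    by (simp add: dim1)
  have g2: "(?g (pt (hi T)))\<^sup>2 \<le> (?g p)\<^sup>2" using p(2)[OF z] by (rule abs_le_square_iff[THEN iffD1])
  have "ennreal (diameter T * (v - w (pt (hi T)))\<^sup>2) \<le> ennreal (2 * ((?g p)\<^sup>2 * (diameter T / 2)))"
  proof (rule ennreal_leI)
    have "diameter T * (v - w (pt (hi T)))\<^sup>2 \<le> diameter T * (?g p)\<^sup>2"
      using g2 diameter_pos[OF T] by (intro mult_left_mono) (auto simp: power2_commute)
    then show "diameter T * (v - w (pt (hi T)))\<^sup>2 \<le> 2 * ((?g p)\<^sup>2 * (diameter T / 2))" by (simp add: mult.commute)
  qed
  also have "\<dots> = ennreal 2 * (ennreal ((?g p)\<^sup>2) * ennreal (diameter T / 2))"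
  proof -
    have d: "0 \<le> diameter T / 2" using diameter_pos[OF T] by simp
    have "ennreal (2 * ((?g p)\<^sup>2 * (diameter T / 2))) = ennreal 2 * ennreal ((?g p)\<^sup>2 * (diameter T / 2))"
      by (rule ennreal_mult) (use d in simp_all)
    also have "ennreal ((?g p)\<^sup>2 * (diameter T / 2)) = ennreal ((?g p)\<^sup>2) * ennreal (diameter T / 2)"
      by (rule ennreal_mult[OF _ d]) simp
    finally show ?thesis .
  qed
  also have "\<dots> \<le> ennreal 2 * (ennreal 16 * (\<integral>\<^sup>+y\<in>right_half T. ennreal ((?g y)\<^sup>2) \<partial>lebesgue))"
    by (rule mult_left_mono[OF 1]) simp
  also have "\<dots> = ennreal (2 * 16) * (\<integral>\<^sup>+y\<in>right_half T. ennreal ((?g y)\<^sup>2) \<partial>lebesgue)"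
  proof -
    have "ennreal 2 * ennreal 16 = ennreal (2 * 16)" by (rule ennreal_mult[symmetric]) simp_all
    then show ?thesis by (simp only: mult.assoc[symmetric])
  qed
  finally show ?thesis by (simp add: power2_commute)
qed

text \<open>
  For a left point \<open>x\<close> at distance \<open>t\<close> to the left of the cut,
  \<open>cum_step\<close> and Young's inequality bound the probability of the cut, per unit
  length and multiplied by \<open>t\<close>, by \<open>\<delta> * (cum x)\<^sup>2 + C *
  t\<^sup>2\<close>. The first term is a small multiple of \<open>theta x\<close>. The second
  one cancels the singularity of the kernel. The value of \<open>w\<close> at the cut is then
  replaced by an average over the right half of \<open>T\<close>, at the same distance from
  \<open>x\<close> up to a factor 2.
\<close>

lemma outside_bound:
  assumes s: "0 < s" "s < 1" and w: "w \<in> fe_space \<Omega> Th" and T: "T \<in> adm" and \<delta>: "0 < \<delta>"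
  shows "ennreal (om T) * (\<integral>\<^sup>+x\<in>left_of T. ennreal ((w x - w (pt (hi T)))\<^sup>2 * (hi T - coord x) powr - (2 * s)) \<partial>lebesgue)
    \<le> kint s (left_of T \<times> right_half T) (\<lambda>x y. 64 * (\<delta> * theta x + 4 * (66 + 1 / (4 * \<delta>)) * (norm (x - y))\<^sup>2 / len\<^sup>2) * (w x - w y)\<^sup>2)"
proof -
  let ?C = "66 + 1 / (4 * \<delta>)" and ?h = "diameter T" and ?z = "pt (hi T)"
  let ?G = "\<lambda>x y. 64 * (\<delta> * theta x + 4 * ?C * (norm (x - y))\<^sup>2 / len\<^sup>2) * (w x - w y)\<^sup>2"
  have Th: "T \<in> Th" by (rule adm_Th[OF T])
  have h: "0 < ?h" "hi T = lo T + ?h" using diameter_pos[OF Th] diameter_elem[OF Th] by auto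
  have C: "0 < ?C" using \<delta> by (simp add: add_pos_pos)
  note wm = fe_measurable[OF w]
  note [measurable] = wm theta_measurable
  have Gm: "pair_measurable ?G"
    using pair_measurable_fst[OF wm] pair_measurable_snd[OF wm] pair_measurable_fst[OF theta_measurable] by measurable
  have "ennreal (om T) * (\<integral>\<^sup>+x\<in>left_of T. ennreal ((w x - w ?z)\<^sup>2 * (hi T - coord x) powr - (2 * s)) \<partial>lebesgue)
      = (\<integral>\<^sup>+x. ennreal (om T) * (ennreal ((w x - w ?z)\<^sup>2 * (hi T - coord x) powr - (2 * s)) * indicator (left_of T) x) \<partial>lebesgue)"
    by (rule nn_integral_cmult[symmetric]) (use left_of_sets[of T] in measurable)
  also have "\<dots> \<le> (\<integral>\<^sup>+x\<in>left_of T. (\<integral>\<^sup>+y\<in>right_half T. ennreal (?G x y * kern s x y) \<partial>lebesgue) \<partial>lebesgue)"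
  proof (rule nn_integral_mono)
    fix x
    show "ennreal (om T) * (ennreal ((w x - w ?z)\<^sup>2 * (hi T - coord x) powr - (2 * s)) * indicator (left_of T) x)
        \<le> (\<integral>\<^sup>+y\<in>right_half T. ennreal (?G x y * kern s x y) \<partial>lebesgue) * indicator (left_of T) x"
    proof (cases "x \<in> left_of T")
      case True
      then have x: "x \<in> B1" "coord x < lo T" by (auto simp: left_of_def)
      define t where "t = hi T - coord x"
      have t: "0 < t" "?h < t" using x h by (auto simp: t_def)
      define K where "K = 2 / len\<^sup>2 * (\<delta> * (cum (coord x))\<^sup>2 + ?C * t\<^sup>2) * t powr - (1 + 2 * s)"
      have K0: "0 \<le> K" using \<delta> C by (simp add: K_def)
      have "(cum (hi T) + ?h) * t \<le> (cum (coord x) + 66 * t) * t"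
        using cum_step[OF T x] t by (intro mult_right_mono) (auto simp: t_def)
      also have "\<dots> \<le> \<delta> * (cum (coord x))\<^sup>2 + ?C * t\<^sup>2"
        using weighted_young[OF \<delta>, of "cum (coord x)" t] by (simp add: algebra_simps power2_eq_square)
      finally have ct: "(cum (hi T) + ?h) * t \<le> \<delta> * (cum (coord x))\<^sup>2 + ?C * t\<^sup>2" .
      have tp: "t powr - (2 * s) = t * t powr - (1 + 2 * s)"
      proof -
        have "t powr - (2 * s) = t powr 1 * t powr - (1 + 2 * s)" by (simp only: powr_add[symmetric]) simp
        then show ?thesis using t by simp
      qed
      have "om T * t powr - (2 * s) = 2 / len\<^sup>2 * ((cum (hi T) + ?h) * t) * t powr - (1 + 2 * s) * ?h"
        unfolding tp om_def by simp
      also have "\<dots> \<le> K * ?h"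
        unfolding K_def using ct h by (intro mult_right_mono mult_left_mono) auto
      finally have omK: "om T * t powr - (2 * s) \<le> K * ?h" .
      have "ennreal (om T) * ennreal ((w x - w ?z)\<^sup>2 * (hi T - coord x) powr - (2 * s))
          = ennreal ((om T * t powr - (2 * s)) * (w x - w ?z)\<^sup>2)"
        using om_nonneg[OF T] by (simp add: ennreal_mult'[symmetric] t_def mult_ac)
      also have "\<dots> \<le> ennreal (K * (?h * (w x - w ?z)\<^sup>2))"
        using mult_right_mono[OF omK, of "(w x - w ?z)\<^sup>2"] by (intro ennreal_leI) (simp add: mult.assoc)
      also have "\<dots> = ennreal K * ennreal (?h * (w x - w ?z)\<^sup>2)" by (rule ennreal_mult'[OF K0])
      also have "\<dots> \<le> ennreal K * (ennreal 32 * (\<integral>\<^sup>+y\<in>right_half T. ennreal ((w x - w y)\<^sup>2) \<partial>lebesgue))"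
        by (rule mult_left_mono[OF half_elem_average[OF w Th]]) simp
      also have "\<dots> = ennreal (32 * K) * (\<integral>\<^sup>+y\<in>right_half T. ennreal ((w x - w y)\<^sup>2) \<partial>lebesgue)"
      proof -
        have "ennreal (32 * K) = ennreal K * ennreal 32"
          unfolding mult.commute[of 32 K] by (rule ennreal_mult[OF K0]) simp
        then show ?thesis by (simp only: mult.assoc)
      qed
      also have "\<dots> = (\<integral>\<^sup>+y. ennreal (32 * K) * (ennreal ((w x - w y)\<^sup>2) * indicator (right_half T) y) \<partial>lebesgue)"
        by (rule nn_integral_cmult[symmetric]) (use seg_sets in \<open>simp add: right_half_def\<close>, measurable)
      also have "\<dots> \<le> (\<integral>\<^sup>+y\<in>right_half T. ennreal (?G x y * kern s x y) \<partial>lebesgue)"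
      proof (rule nn_integral_mono)
        fix y
        show "ennreal (32 * K) * (ennreal ((w x - w y)\<^sup>2) * indicator (right_half T) y) \<le> ennreal (?G x y * kern s x y) * indicator (right_half T) y"
        proof (cases "y \<in> right_half T")
          case True
          then have y: "coord y \<le> hi T" "(lo T + hi T) / 2 \<le> coord y" by (auto simp: right_half_def seg_def)
          define r where "r = norm (x - y)"
          have r: "r = coord y - coord x" "0 < r" "r \<le> t" "t \<le> 2 * r"
            using y x h by (auto simp: r_def norm_coord t_def)
          have kr: "kern s x y = r powr - (1 + 2 * s)"
            unfolding kern_def by (simp only: powr_minus_divide r_def dim1 of_nat_1)
          have "t powr - (1 + 2 * s) \<le> r powr - (1 + 2 * s)" using r t s by (intro powr_mono2') auto
          moreover have "t\<^sup>2 \<le> (2 * r)\<^sup>2" using r t by (intro power_mono) auto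
          then have "\<delta> * (cum (coord x))\<^sup>2 + ?C * t\<^sup>2 \<le> \<delta> * (cum (coord x))\<^sup>2 + ?C * (4 * r\<^sup>2)"
            using C by (simp add: power_mult_distrib)
          ultimately have "K \<le> 2 / len\<^sup>2 * (\<delta> * (cum (coord x))\<^sup>2 + ?C * (4 * r\<^sup>2)) * r powr - (1 + 2 * s)"
            unfolding K_def using \<delta> C by (intro mult_mono mult_left_mono) auto
          also have "\<dots> = 2 * (\<delta> * theta x + 4 * ?C * r\<^sup>2 / len\<^sup>2) * kern s x y"
            by (simp add: kr theta_def power_divide add_divide_distrib algebra_simps)
          finally have "32 * K * (w x - w y)\<^sup>2 \<le> 32 * (2 * (\<delta> * theta x + 4 * ?C * r\<^sup>2 / len\<^sup>2) * kern s x y) * (w x - w y)\<^sup>2"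
            by (intro mult_right_mono mult_left_mono) auto
          also have "\<dots> = ?G x y * kern s x y" by (simp add: r_def)
          finally show ?thesis using True K0 by (simp add: ennreal_mult'[symmetric] ennreal_leI)
        qed simp
      qed
      finally show ?thesis using True by simp
    qed simp
  qed
  also have "\<dots> = kint s (left_of T \<times> right_half T) ?G"
    by (rule kint_fst[symmetric, OF Gm left_of_sets]) (simp add: right_half_def seg_sets)
  finally show ?thesis .
qed

lemma adm_in_ball: "T \<in> adm \<Longrightarrow> T \<subseteq> ball x0 R"
proof
  fix x assume T: "T \<in> adm" and x: "x \<in> T"
  have "lo T \<le> coord x" "coord x \<le> hi T" using mem_elem[OF adm_Th[OF T]] x by auto
  then show "x \<in> ball x0 R" unfolding mem_ball_coord using adm_lo[OF T] adm_hi[OF T] R by auto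
qed

lemma adm_mass:
  assumes w: "w \<in> fe_space \<Omega> Th"
  shows "(\<Sum>T\<in>adm. ennreal ((elem_max w T)\<^sup>2) * emeasure lebesgue T) \<le> ennreal (4 ^ Suc DIM('a)) * L2_norm_sq (ball x0 R) w"
proof -
  have "(\<Sum>T\<in>adm. ennreal ((elem_max w T)\<^sup>2) * emeasure lebesgue T)
      \<le> (\<Sum>T\<in>adm. ennreal (4 ^ Suc DIM('a)) * (\<integral>\<^sup>+x\<in>T. ennreal ((w x)\<^sup>2) \<partial>lebesgue))"
    by (intro sum_mono elem_max_L2[OF w] adm_Th)
  also have "\<dots> = ennreal (4 ^ Suc DIM('a)) * (\<Sum>T\<in>adm. \<integral>\<^sup>+x\<in>T. ennreal ((w x)\<^sup>2) \<partial>lebesgue)"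
    by (simp only: sum_distrib_left)
  also have "(\<Sum>T\<in>adm. \<integral>\<^sup>+x\<in>T. ennreal ((w x)\<^sup>2) \<partial>lebesgue) \<le> L2_norm_sq (ball x0 R) w"
    unfolding L2_norm_sq_def using fe_measurable[OF w] adm_Th adm_in_ball by (intro sum_elem_integral_le) auto
  finally show ?thesis by (simp add: mult_left_mono)
qed

lemma mu_point_values:
  assumes w: "w \<in> fe_space \<Omega> Th"
  shows "ennreal (\<Sum>a\<in>adm \<times> adm. mu a * (w (pt (rightmost a)))\<^sup>2) \<le> ennreal (32 / R * 4 ^ Suc DIM('a)) * L2_norm_sq (ball x0 R) w"
proof -
  have "ennreal (\<Sum>a\<in>adm \<times> adm. mu a * (w (pt (rightmost a)))\<^sup>2) = (\<Sum>a\<in>adm \<times> adm. ennreal (mu a * (w (pt (rightmost a)))\<^sup>2))"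
    by (rule sum_ennreal[symmetric]) (use mu_nonneg in auto)
  also have "\<dots> = (\<Sum>a\<in>adm \<times> adm. ennreal (mu a) * ennreal ((w (pt (rightmost a)))\<^sup>2))"
    by (intro sum.cong refl ennreal_mult mu_nonneg) auto
  also have "\<dots> \<le> (\<Sum>T\<in>adm. ennreal (om T) * ennreal ((w (pt (hi T)))\<^sup>2))"
    by (rule mu_assign)
  also have "\<dots> \<le> (\<Sum>T\<in>adm. ennreal (32 / R) * (ennreal ((elem_max w T)\<^sup>2) * emeasure lebesgue T))"
  proof (rule sum_mono)
    fix T assume T: "T \<in> adm"
    note Th = adm_Th[OF T]
    have d: "0 < diameter T" by (rule diameter_pos[OF Th])
    have "cum (hi T) + diameter T \<le> len"
      unfolding cum_closed[OF T, symmetric] len_def using finite_adm adm_diameter_nonneg by (intro sum_mono2) auto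
    then have "om T \<le> 2 * diameter T * len / len\<^sup>2"
      unfolding om_def using d by (intro divide_right_mono mult_left_mono) auto
    also have "\<dots> = 2 * diameter T / len" using len_pos by (simp add: power2_eq_square)
    also have "\<dots> \<le> 2 * diameter T / (R / 16)" using len_ge R d by (intro divide_left_mono mult_pos_pos) auto
    finally have "om T \<le> 32 / R * diameter T" by simp
    moreover have "pt (hi T) \<in> T" using mem_elem[OF Th] lo_less_hi[OF Th] by simp
    then have "\<bar>w (pt (hi T))\<bar> \<le> elem_max w T" by (rule elem_max_ge[OF w Th])
    then have "(w (pt (hi T)))\<^sup>2 \<le> (elem_max w T)\<^sup>2" using power_mono[of "\<bar>w (pt (hi T))\<bar>" "elem_max w T" 2] by simp
    ultimately have "om T * (w (pt (hi T)))\<^sup>2 \<le> 32 / R * diameter T * (elem_max w T)\<^sup>2"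
      using d R om_nonneg[OF T] by (intro mult_mono) auto
    then have "ennreal (om T * (w (pt (hi T)))\<^sup>2) \<le> ennreal (32 / R * ((elem_max w T)\<^sup>2 * diameter T))"
      by (intro ennreal_leI) (simp add: mult_ac)
    also have "\<dots> = ennreal (32 / R) * ennreal ((elem_max w T)\<^sup>2 * diameter T)"
      by (rule ennreal_mult) (use R d in auto)
    also have "ennreal ((elem_max w T)\<^sup>2 * diameter T) = ennreal ((elem_max w T)\<^sup>2) * ennreal (diameter T)"
      by (rule ennreal_mult) (use d in auto)
    also have "ennreal (om T * (w (pt (hi T)))\<^sup>2) = ennreal (om T) * ennreal ((w (pt (hi T)))\<^sup>2)"
      by (rule ennreal_mult) (use om_nonneg[OF T] in auto)
    finally show "ennreal (om T) * ennreal ((w (pt (hi T)))\<^sup>2) \<le> ennreal (32 / R) * (ennreal ((elem_max w T)\<^sup>2) * emeasure lebesgue T)"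
      by (simp only: emeasure_elem[OF Th])
  qed
  also have "\<dots> = ennreal (32 / R) * (\<Sum>T\<in>adm. ennreal ((elem_max w T)\<^sup>2) * emeasure lebesgue T)"
    by (simp only: sum_distrib_left)
  also have "\<dots> \<le> ennreal (32 / R) * (ennreal (4 ^ Suc DIM('a)) * L2_norm_sq (ball x0 R) w)"
    by (rule mult_left_mono[OF adm_mass[OF w]]) simp
  also have "\<dots> = ennreal (32 / R * 4 ^ Suc DIM('a)) * L2_norm_sq (ball x0 R) w"
    by (subst ennreal_mult) (use R in \<open>auto simp: mult.assoc\<close>)
  finally show ?thesis .
qed

lemma left_pairs_sets: "left_pairs \<in> sets leb_pair"
proof -
  have [measurable]: "(\<lambda>p. coord (fst p)) \<in> borel_measurable leb_pair" "(\<lambda>p. coord (snd p)) \<in> borel_measurable leb_pair"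
    using measurable_compose[OF measurable_fst coord_measurable] measurable_compose[OF measurable_snd coord_measurable] by auto
  have "{p \<in> space leb_pair. coord (fst p) < coord (snd p) \<and> coord (snd p) \<le> - 9 / 16 * R} \<in> sets leb_pair" by measurable
  from sets.Int[OF B1_sets(2) this] have "BB \<inter> {p. coord (fst p) < coord (snd p) \<and> coord (snd p) \<le> - 9 / 16 * R} \<in> sets leb_pair"
    by (simp add: space_pair_measure)
  moreover have "BB \<inter> {p. coord (fst p) < coord (snd p) \<and> coord (snd p) \<le> - 9 / 16 * R} = left_pairs"
    by (auto simp: left_pairs_def)
  ultimately show ?thesis by simp
qed

lemma left_zone_in_B1: "T \<in> adm \<Longrightarrow> T \<subseteq> B1"
proof
  fix x assume T: "T \<in> adm" and x: "x \<in> T"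
  have "lo T \<le> coord x" "coord x \<le> hi T" using mem_elem[OF adm_Th[OF T]] x by auto
  then show "x \<in> B1" unfolding B1_def mem_ball_coord using adm_lo[OF T] adm_hi[OF T] R by auto
qed

lemma element_pairs:
  assumes T: "T \<in> adm"
  shows eighths_pairs: "x \<in> left_eighth T \<Longrightarrow> y \<in> right_eighth T \<Longrightarrow> y \<in> T \<and> (x, y) \<in> left_pairs"
    and left_of_right_half_pairs: "x \<in> left_of T \<Longrightarrow> y \<in> right_half T \<Longrightarrow> y \<in> T \<and> (x, y) \<in> left_pairs"
proof -
  note Th = adm_Th[OF T]
  have lh: "lo T < hi T" "diameter T = hi T - lo T" using lo_less_hi[OF Th] diameter_elem[OF Th] by auto
  have zone: "y \<in> B1 \<and> coord y \<le> - 9 / 16 * R" if "y \<in> T" for y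
    using that left_zone_in_B1[OF T] adm_hi[OF T] mem_elem[OF Th, of y] by auto
  {
    assume x: "x \<in> left_eighth T" and y: "y \<in> right_eighth T"
    have q: "lo T + diameter T / 8 \<le> coord x" "coord x \<le> lo T + diameter T / 4"
      "hi T - diameter T / 4 \<le> coord y" "coord y \<le> hi T - diameter T / 8"
      using x y by (auto simp: left_eighth_def right_eighth_def seg_def)
    have "coord x < coord y" using q lh by argo
    moreover have "lo T \<le> coord x" using q lh by argo
    moreover have "coord x \<le> hi T" using q lh by argo
    moreover have "lo T \<le> coord y" using q lh by argo
    moreover have "coord y \<le> hi T" using q lh by argo
    ultimately have "x \<in> T" "y \<in> T" "coord x < coord y" using mem_elem[OF Th] by auto
    then show "y \<in> T \<and> (x, y) \<in> left_pairs" using zone[of x] zone[of y] by (simp add: left_pairs_def)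
  next
    assume x: "x \<in> left_of T" and y: "y \<in> right_half T"
    have 1: "(lo T + hi T) / 2 \<le> coord y" "coord y \<le> hi T" using y by (auto simp: right_half_def seg_def)
    have "lo T \<le> (lo T + hi T) / 2" using lh by simp
    then have "lo T \<le> coord y" using 1 by linarith
    then have "y \<in> T" "coord x < coord y" "x \<in> B1" using mem_elem[OF Th] 1 x by (auto simp: left_of_def)
    then show "y \<in> T \<and> (x, y) \<in> left_pairs" using zone[of y] by (simp add: left_pairs_def)
  }
qed

definition cut_const :: "real \<Rightarrow> real \<Rightarrow> real" where
  "cut_const s \<delta> = far_C TYPE('a) s * (8 * near_C TYPE('a) s * (131072 * (66 + 1 / (4 * \<delta>))) + 1024 * (2 + 1 / (2 * \<delta>)) * 4 ^ Suc DIM('a))"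

text \<open>
  Here the kernel is compensated by the squared distance, so the difference may be split and
  only the mass of \<open>w\<close> remains.
\<close>

lemma remote_pairs_bound:
  assumes s: "0 < s" "s < 1" and w: "w \<in> fe_space \<Omega> Th" and C: "0 \<le> C"
  shows "kint s left_pairs (\<lambda>x y. 256 * C * ((norm (x - y))\<^sup>2 / len\<^sup>2) * (w x - w y)\<^sup>2)
    \<le> ennreal (8 * near_C TYPE('a) s * (131072 * C)) * mass s w"
proof -
  let ?K = "131072 * C"
  have "kint s left_pairs (\<lambda>x y. 256 * C * ((norm (x - y))\<^sup>2 / len\<^sup>2) * (w x - w y)\<^sup>2)
      \<le> ennreal (8 * near_C TYPE('a) s * R powr - (2 * s)) * (\<integral>\<^sup>+x\<in>B1. ennreal (?K * (w x)\<^sup>2) \<partial>lebesgue)"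
  proof (rule kint_lipschitz_weight[OF s R])
    show "(\<lambda>x. ?K * (w x)\<^sup>2) \<in> borel_measurable lebesgue" using fe_measurable[OF w] by measurable
    show "0 \<le> ?K * (w x)\<^sup>2" for x using C by simp
    show "B1 \<in> sets lebesgue" by (rule B1_sets(1))
    fix x y assume xy: "(x, y) \<in> left_pairs"
    then have B: "x \<in> B1" "y \<in> B1" by (auto simp: left_pairs_def)
    have "(R / 16)\<^sup>2 \<le> len\<^sup>2" using len_ge R by (intro power_mono) auto
    then have "(norm (x - y))\<^sup>2 / len\<^sup>2 \<le> (norm (x - y))\<^sup>2 / (R / 16)\<^sup>2"
      using R len_pos by (intro divide_left_mono mult_pos_pos) auto
    also have "\<dots> = 256 * (norm (x - y))\<^sup>2 / R\<^sup>2" by (simp add: power_divide)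
    finally have 1: "(norm (x - y))\<^sup>2 / len\<^sup>2 \<le> 256 * (norm (x - y))\<^sup>2 / R\<^sup>2" .
    have 2: "(w x - w y)\<^sup>2 \<le> 2 * (w x)\<^sup>2 + 2 * (w y)\<^sup>2"
      using zero_le_power2[of "w x + w y"] by (simp add: power2_eq_square algebra_simps)
    have "256 * C * ((norm (x - y))\<^sup>2 / len\<^sup>2) * (w x - w y)\<^sup>2 \<le> 256 * C * (256 * (norm (x - y))\<^sup>2 / R\<^sup>2) * (2 * (w x)\<^sup>2 + 2 * (w y)\<^sup>2)"
      using 1 2 C by (intro mult_mono mult_left_mono) auto
    also have "\<dots> = (?K * (w x)\<^sup>2 + ?K * (w y)\<^sup>2) * (norm (x - y))\<^sup>2 / R\<^sup>2"
      by (simp add: algebra_simps)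
    finally show "x \<in> B1 \<and> y \<in> B1 \<and> norm (x - y) < 2 * R \<and> 256 * C * ((norm (x - y))\<^sup>2 / len\<^sup>2) * (w x - w y)\<^sup>2
        \<le> (?K * (w x)\<^sup>2 + ?K * (w y)\<^sup>2) * (norm (x - y))\<^sup>2 / R\<^sup>2"
      using B B1_dist[OF B] by simp
  qed
  also have "(\<integral>\<^sup>+x\<in>B1. ennreal (?K * (w x)\<^sup>2) \<partial>lebesgue) \<le> (\<integral>\<^sup>+x. ennreal ?K * (ennreal ((w x)\<^sup>2) * indicator (ball x0 R) x) \<partial>lebesgue)"
    by (rule nn_integral_mono) (use B1_sub C in \<open>auto simp: indicator_def ennreal_mult' simp del: mem_ball\<close>)
  also have "\<dots> = ennreal ?K * L2_norm_sq (ball x0 R) w"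
    unfolding L2_norm_sq_def
    by (rule nn_integral_cmult) (use fe_measurable[OF w] in \<open>auto intro!: borel_measurable_times_ennreal borel_measurable_indicator\<close>)
  also have "ennreal (8 * near_C TYPE('a) s * R powr - (2 * s)) * (ennreal ?K * L2_norm_sq (ball x0 R) w)
      = ennreal (8 * near_C TYPE('a) s * ?K) * mass s w"
  proof -
    have n: "0 \<le> 8 * near_C TYPE('a) s" "0 \<le> ?K" "0 \<le> R powr - (2 * s)" using near_C_pos[OF s, where 'a='a] C by auto
    have "ennreal (8 * near_C TYPE('a) s * R powr - (2 * s)) * ennreal ?K = ennreal (8 * near_C TYPE('a) s * R powr - (2 * s) * ?K)"
      by (rule ennreal_mult[symmetric]) (use n in auto)
    also have "8 * near_C TYPE('a) s * R powr - (2 * s) * ?K = 8 * near_C TYPE('a) s * ?K * R powr - (2 * s)" by simp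
    also have "ennreal \<dots> = ennreal (8 * near_C TYPE('a) s * ?K) * ennreal (R powr - (2 * s))"
      by (rule ennreal_mult) (use n in auto)
    finally show ?thesis by (simp only: mass_def mult.assoc[symmetric])
  qed
  finally show ?thesis by (simp add: mult_left_mono)
qed

definition theta_diff :: "('a \<Rightarrow> real) \<Rightarrow> 'a \<Rightarrow> 'a \<Rightarrow> real" where
  "theta_diff w x y = theta x * (w x - w y)\<^sup>2"

lemma theta_diff_measurable:
  assumes "w \<in> borel_measurable lebesgue" shows "pair_measurable (theta_diff w)"
  unfolding theta_diff_def
  using pair_measurable_fst[OF assms] pair_measurable_snd[OF assms] pair_measurable_fst[OF theta_measurable] by measurable

text \<open>
  The regions used for different elements are disjoint up to null sets, so the sum over all
  cuts still costs only one copy of the energy.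
\<close>

lemma adm_sum_bound:
  assumes s: "0 < s" "s < 1" and w: "w \<in> fe_space \<Omega> Th" and \<delta>: "0 < \<delta>"
  shows "(\<Sum>T\<in>adm. ennreal (om T) * (\<integral>\<^sup>+x\<in>{x\<in>B1. coord x < hi T}. ennreal ((w x - w (pt (hi T)))\<^sup>2 * (far_C TYPE('a) s * (hi T - coord x) powr - (2 * s))) \<partial>lebesgue))
    \<le> ennreal (576 * \<delta> * far_C TYPE('a) s) * kint s left_pairs (theta_diff w) + ennreal (cut_const s \<delta>) * mass s w"
proof -
  let ?c = "far_C TYPE('a) s" and ?C = "66 + 1 / (4 * \<delta>)" and ?E = "1024 * (2 + 1 / (2 * \<delta>))"
  have c: "0 < ?c" by (rule far_C_pos[OF s(1)])
  have C: "0 < ?C" using \<delta> by (simp add: add_pos_pos)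
  note wm = fe_measurable[OF w]
  let ?f = "\<lambda>T x. ennreal ((w x - w (pt (hi T)))\<^sup>2 * (hi T - coord x) powr - (2 * s))"
  let ?I = "\<lambda>T. \<integral>\<^sup>+x\<in>T. ?f T x \<partial>lebesgue" and ?J = "\<lambda>T. \<integral>\<^sup>+x\<in>left_of T. ?f T x \<partial>lebesgue"
  let ?G = "\<lambda>x y. 64 * (\<delta> * theta x + 4 * ?C * (norm (x - y))\<^sup>2 / len\<^sup>2) * (w x - w y)\<^sup>2"
  let ?H = "\<lambda>x y. 256 * ?C * ((norm (x - y))\<^sup>2 / len\<^sup>2) * (w x - w y)\<^sup>2"
  let ?m = "\<lambda>T. ennreal ((elem_max w T)\<^sup>2) * emeasure lebesgue T"
  have fm: "?f T \<in> borel_measurable lebesgue" for T using wm by measurable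
  have split: "(\<integral>\<^sup>+x\<in>{x\<in>B1. coord x < hi T}. ennreal ((w x - w (pt (hi T)))\<^sup>2 * (?c * (hi T - coord x) powr - (2 * s))) \<partial>lebesgue) \<le> ennreal ?c * (?I T + ?J T)"
    if T: "T \<in> adm" for T
  proof -
    have "(\<integral>\<^sup>+x\<in>{x\<in>B1. coord x < hi T}. ennreal ((w x - w (pt (hi T)))\<^sup>2 * (?c * (hi T - coord x) powr - (2 * s))) \<partial>lebesgue)
        \<le> (\<integral>\<^sup>+x. ennreal ?c * (?f T x * indicator T x + ?f T x * indicator (left_of T) x) \<partial>lebesgue)"
    proof (rule nn_integral_mono)
      fix x
      have eq: "ennreal ((w x - w (pt (hi T)))\<^sup>2 * (?c * (hi T - coord x) powr - (2 * s))) = ennreal ?c * ?f T x"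
        using c by (simp add: ennreal_mult'[symmetric] mult_ac)
      show "ennreal ((w x - w (pt (hi T)))\<^sup>2 * (?c * (hi T - coord x) powr - (2 * s))) * indicator {x\<in>B1. coord x < hi T} x
          \<le> ennreal ?c * (?f T x * indicator T x + ?f T x * indicator (left_of T) x)"
      proof (cases "x \<in> {x\<in>B1. coord x < hi T}")
        case True
        then have "x \<in> T \<or> x \<in> left_of T" using mem_elem[OF adm_Th[OF T], of x] by (auto simp: left_of_def)
        then have "?f T x \<le> ?f T x * indicator T x + ?f T x * indicator (left_of T) x"
          by (cases "x \<in> T"; cases "x \<in> left_of T") simp_all
        then have "ennreal ?c * ?f T x \<le> ennreal ?c * (?f T x * indicator T x + ?f T x * indicator (left_of T) x)"
          by (rule mult_left_mono) simp
        then show ?thesis unfolding eq using True by simp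
      qed simp
    qed
    also have "\<dots> = ennreal ?c * (\<integral>\<^sup>+x. (?f T x * indicator T x + ?f T x * indicator (left_of T) x) \<partial>lebesgue)"
      by (rule nn_integral_cmult)
        (intro borel_measurable_add borel_measurable_times_ennreal borel_measurable_indicator fm left_of_sets elem_sets adm_Th T)
    also have "(\<integral>\<^sup>+x. (?f T x * indicator T x + ?f T x * indicator (left_of T) x) \<partial>lebesgue) = ?I T + ?J T"
      by (rule nn_integral_add)
        (intro borel_measurable_times_ennreal borel_measurable_indicator fm left_of_sets elem_sets adm_Th T)+
    finally show ?thesis .
  qed
  have each: "ennreal (om T) * (\<integral>\<^sup>+x\<in>{x\<in>B1. coord x < hi T}. ennreal ((w x - w (pt (hi T)))\<^sup>2 * (?c * (hi T - coord x) powr - (2 * s))) \<partial>lebesgue)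
      \<le> ennreal ?c * ((ennreal (512 * \<delta>) * kint s (left_eighth T \<times> right_eighth T) (theta_diff w) + ennreal (?E * R powr - (2 * s)) * ?m T) + kint s (left_of T \<times> right_half T) ?G)"
    if T: "T \<in> adm" for T
  proof -
    have "ennreal (om T) * (\<integral>\<^sup>+x\<in>{x\<in>B1. coord x < hi T}. ennreal ((w x - w (pt (hi T)))\<^sup>2 * (?c * (hi T - coord x) powr - (2 * s))) \<partial>lebesgue)
        \<le> ennreal (om T) * (ennreal ?c * (?I T + ?J T))"
      by (rule mult_left_mono[OF split[OF T]]) simp
    also have "\<dots> = ennreal ?c * (ennreal (om T) * ?I T + ennreal (om T) * ?J T)"
      by (simp only: distrib_left mult.left_commute)
    also have "\<dots> \<le> ennreal ?c * ((ennreal (512 * \<delta>) * kint s (left_eighth T \<times> right_eighth T) (theta_diff w) + ennreal (?E * R powr - (2 * s)) * ?m T) + kint s (left_of T \<times> right_half T) ?G)"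
      unfolding theta_diff_def
      by (intro mult_left_mono add_mono inside_bound[OF s w T \<delta>] outside_bound[OF s w T \<delta>]) simp
    finally show ?thesis .
  qed
  have wthm: "pair_measurable (theta_diff w)" by (rule theta_diff_measurable[OF wm])
  have Gm: "pair_measurable ?G"
    using pair_measurable_fst[OF wm] pair_measurable_snd[OF wm] pair_measurable_fst[OF theta_measurable] by measurable
  have Hm: "pair_measurable ?H"
    using pair_measurable_fst[OF wm] pair_measurable_snd[OF wm] by measurable
  have S1: "(\<Sum>T\<in>adm. kint s (left_eighth T \<times> right_eighth T) (theta_diff w)) \<le> kint s left_pairs (theta_diff w)"
    by (rule kint_sum_disjoint[OF _ _ _ wthm]) (use adm_Th eighths_pairs seg_sets in \<open>auto simp: left_eighth_def[symmetric] right_eighth_def[symmetric] intro!: pair_measureI, auto simp: left_eighth_def right_eighth_def\<close>)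
  have S2: "(\<Sum>T\<in>adm. kint s (left_of T \<times> right_half T) ?G) \<le> kint s left_pairs ?G"
    by (rule kint_sum_disjoint[OF _ _ _ Gm]) (use adm_Th left_of_right_half_pairs left_of_sets seg_sets in \<open>auto intro!: pair_measureI simp: right_half_def[symmetric], auto simp: right_half_def\<close>)
  have S3: "kint s left_pairs ?G \<le> ennreal (64 * \<delta>) * kint s left_pairs (theta_diff w) + ennreal (8 * near_C TYPE('a) s * (131072 * ?C)) * mass s w"
  proof -
    have "kint s left_pairs ?G = kint s left_pairs (\<lambda>x y. 64 * \<delta> * theta_diff w x y + ?H x y)"
      by (rule arg_cong[where f="kint s left_pairs"]) (auto simp: fun_eq_iff theta_diff_def algebra_simps add_divide_distrib)
    also have "\<dots> = kint s left_pairs (\<lambda>x y. 64 * \<delta> * theta_diff w x y) + kint s left_pairs ?H"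
    proof (rule kint_add[OF _ Hm left_pairs_sets])
      show "pair_measurable (\<lambda>x y. 64 * \<delta> * theta_diff w x y)" using wthm by measurable
      show "0 \<le> 64 * \<delta> * theta_diff w x y" for x y using \<delta> theta_nonneg by (simp add: theta_diff_def)
      show "0 \<le> ?H x y" for x y using C by simp
    qed
    also have "kint s left_pairs (\<lambda>x y. 64 * \<delta> * theta_diff w x y) = ennreal (64 * \<delta>) * kint s left_pairs (theta_diff w)"
      by (rule kint_cmult[OF wthm left_pairs_sets]) (use \<delta> in simp)
    finally show ?thesis
      using remote_pairs_bound[OF s w less_imp_le[OF C]] by (simp add: add_left_mono)
  qed
  have S4: "ennreal (?E * R powr - (2 * s)) * (\<Sum>T\<in>adm. ?m T) \<le> ennreal (?E * 4 ^ Suc DIM('a)) * mass s w"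
  proof -
    have E: "0 \<le> ?E" using \<delta> by simp
    have "ennreal (?E * R powr - (2 * s)) * (\<Sum>T\<in>adm. ?m T) \<le> ennreal (?E * R powr - (2 * s)) * (ennreal (4 ^ Suc DIM('a)) * L2_norm_sq (ball x0 R) w)"
      by (rule mult_left_mono[OF adm_mass[OF w]]) simp
    also have "\<dots> = (ennreal (?E * R powr - (2 * s)) * ennreal (4 ^ Suc DIM('a))) * L2_norm_sq (ball x0 R) w"
      by (simp only: mult.assoc)
    also have "ennreal (?E * R powr - (2 * s)) * ennreal (4 ^ Suc DIM('a)) = ennreal (?E * R powr - (2 * s) * 4 ^ Suc DIM('a))"
      by (rule ennreal_mult[symmetric]) (use E in auto)
    also have "?E * R powr - (2 * s) * 4 ^ Suc DIM('a) = ?E * 4 ^ Suc DIM('a) * R powr - (2 * s)" by simp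
    also have "ennreal \<dots> = ennreal (?E * 4 ^ Suc DIM('a)) * ennreal (R powr - (2 * s))"
      by (rule ennreal_mult) (use E in auto)
    finally show ?thesis by (simp only: mass_def mult.assoc)
  qed
  let ?k = "kint s left_pairs (theta_diff w)"
  have "(\<Sum>T\<in>adm. ennreal (om T) * (\<integral>\<^sup>+x\<in>{x\<in>B1. coord x < hi T}. ennreal ((w x - w (pt (hi T)))\<^sup>2 * (?c * (hi T - coord x) powr - (2 * s))) \<partial>lebesgue))
      \<le> (\<Sum>T\<in>adm. ennreal ?c * ((ennreal (512 * \<delta>) * kint s (left_eighth T \<times> right_eighth T) (theta_diff w) + ennreal (?E * R powr - (2 * s)) * ?m T) + kint s (left_of T \<times> right_half T) ?G))"
    by (rule sum_mono[OF each])
  also have "\<dots> = ennreal ?c * ((ennreal (512 * \<delta>) * (\<Sum>T\<in>adm. kint s (left_eighth T \<times> right_eighth T) (theta_diff w)) + ennreal (?E * R powr - (2 * s)) * (\<Sum>T\<in>adm. ?m T)) + (\<Sum>T\<in>adm. kint s (left_of T \<times> right_half T) ?G))"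
    by (simp only: sum_distrib_left[symmetric] sum.distrib)
  also have "\<dots> \<le> ennreal ?c * ((ennreal (512 * \<delta>) * ?k + ennreal (?E * 4 ^ Suc DIM('a)) * mass s w)
      + (ennreal (64 * \<delta>) * ?k + ennreal (8 * near_C TYPE('a) s * (131072 * ?C)) * mass s w))"
    by (intro mult_left_mono add_mono S1 S4 order_trans[OF S2 S3]) simp_all
  also have "\<dots> = ennreal ?c * ((ennreal (512 * \<delta>) + ennreal (64 * \<delta>)) * ?k + (ennreal (8 * near_C TYPE('a) s * (131072 * ?C)) + ennreal (?E * 4 ^ Suc DIM('a))) * mass s w)"
    by (simp only: distrib_left distrib_right add_ac)
  also have "ennreal (512 * \<delta>) + ennreal (64 * \<delta>) = ennreal (576 * \<delta>)"
    using \<delta> by (simp add: ennreal_plus[symmetric] del: ennreal_plus)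
  also have "ennreal (8 * near_C TYPE('a) s * (131072 * ?C)) + ennreal (?E * 4 ^ Suc DIM('a)) = ennreal (8 * near_C TYPE('a) s * (131072 * ?C) + ?E * 4 ^ Suc DIM('a))"
    using \<delta> C near_C_pos[OF s, where 'a='a] by (intro ennreal_plus[symmetric]) auto
  also have "ennreal ?c * (ennreal (576 * \<delta>) * ?k + ennreal (8 * near_C TYPE('a) s * (131072 * ?C) + ?E * 4 ^ Suc DIM('a)) * mass s w)
      = ennreal (576 * \<delta> * ?c) * ?k + ennreal (cut_const s \<delta>) * mass s w"
  proof -
    have "ennreal ?c * ennreal (576 * \<delta>) = ennreal (576 * \<delta> * ?c)"
      unfolding mult.commute[of "576 * \<delta>" ?c] by (rule ennreal_mult[symmetric]) (use \<delta> c in auto)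
    moreover have "ennreal ?c * ennreal (8 * near_C TYPE('a) s * (131072 * ?C) + ?E * 4 ^ Suc DIM('a)) = ennreal (cut_const s \<delta>)"
      unfolding cut_const_def by (rule ennreal_mult[symmetric]) (use \<delta> c C near_C_pos[OF s, where 'a='a] in auto)
    ultimately show ?thesis by (simp only: distrib_left mult.assoc[symmetric])
  qed
  finally show ?thesis .
qed

text \<open>
  The averaged error of the pairs that straddle the cut, measured at their left point.
\<close>

definition cut_err :: "('a \<Rightarrow> real) \<Rightarrow> 'a \<Rightarrow> 'a \<Rightarrow> real" where
  "cut_err w x y = (\<Sum>a\<in>adm \<times> adm. mu a * ((w x - w (pt (rightmost a)))\<^sup>2 * of_bool (coord x < rightmost a \<and> rightmost a < coord y)))"

lemma cut_err_nonneg: "0 \<le> cut_err w x y"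
  unfolding cut_err_def by (intro sum_nonneg mult_nonneg_nonneg mu_nonneg) auto

lemma cut_err_term_measurable:
  assumes w: "w \<in> borel_measurable lebesgue"
  shows "pair_measurable (\<lambda>x y. (w x - w (pt z))\<^sup>2 * of_bool (coord x < z \<and> z < coord y))"
proof -
  have [measurable]: "(\<lambda>p. coord (fst p)) \<in> borel_measurable leb_pair" "(\<lambda>p. coord (snd p)) \<in> borel_measurable leb_pair" "(\<lambda>p. w (fst p)) \<in> borel_measurable leb_pair"
    using measurable_compose[OF measurable_fst coord_measurable] measurable_compose[OF measurable_snd coord_measurable] pair_measurable_fst[OF w] by auto
  show ?thesis by measurable
qed

lemma cut_err_measurable:
  assumes w: "w \<in> borel_measurable lebesgue"
  shows "pair_measurable (cut_err w)"
  unfolding cut_err_def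
  by (intro borel_measurable_sum) (rule borel_measurable_times[OF borel_measurable_const cut_err_term_measurable[OF w]])

text \<open>
  The weight of the energy is proportional to \<open>\<delta>\<close> and can therefore be made
  small; the price is in the mass term.
\<close>

lemma cut_err_bound:
  assumes s: "0 < s" "s < 1" and w: "w \<in> fe_space \<Omega> Th" and \<delta>: "0 < \<delta>"
  shows "kint s BB (cut_err w) \<le> ennreal (576 * \<delta> * far_C TYPE('a) s) * kint s left_pairs (theta_diff w) + ennreal (cut_const s \<delta>) * mass s w"
proof -
  note wm = fe_measurable[OF w]
  let ?t = "\<lambda>a x y. (w x - w (pt (rightmost a)))\<^sup>2 * of_bool (coord x < rightmost a \<and> rightmost a < coord y)"
  let ?F = "\<lambda>z. \<integral>\<^sup>+x\<in>{x\<in>B1. coord x < z}. ennreal ((w x - w (pt z))\<^sup>2 * (far_C TYPE('a) s * (z - coord x) powr - (2 * s))) \<partial>lebesgue"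
  have "kint s BB (cut_err w) = (\<Sum>a\<in>adm \<times> adm. kint s BB (\<lambda>x y. mu a * ?t a x y))"
    unfolding cut_err_def
    by (rule kint_sum) (use finite_adm B1_sets(2) mu_nonneg cut_err_term_measurable[OF wm] in \<open>auto intro!: borel_measurable_times mult_nonneg_nonneg\<close>)
  also have "\<dots> = (\<Sum>a\<in>adm \<times> adm. ennreal (mu a) * kint s BB (?t a))"
    by (intro sum.cong refl kint_cmult cut_err_term_measurable[OF wm] B1_sets(2) mu_nonneg)
  also have "\<dots> \<le> (\<Sum>a\<in>adm \<times> adm. ennreal (mu a) * ?F (rightmost a))"
  proof (intro sum_mono mult_left_mono)
    fix a
    have "kint s BB (?t a) = kint s {p \<in> BB. coord (fst p) < rightmost a \<and> rightmost a < coord (snd p)} (?t a)"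
      unfolding kint_def by (intro nn_integral_cong) (auto simp: indicator_def)
    also have "\<dots> \<le> ?F (rightmost a)"
      by (rule kint_cross[OF s(1)]) (use wm in \<open>auto\<close>)
    finally show "kint s BB (?t a) \<le> ?F (rightmost a)" .
  qed simp
  also have "\<dots> \<le> (\<Sum>T\<in>adm. ennreal (om T) * ?F (hi T))" by (rule mu_assign)
  also have "\<dots> \<le> ennreal (576 * \<delta> * far_C TYPE('a) s) * kint s left_pairs (theta_diff w) + ennreal (cut_const s \<delta>) * mass s w"
    by (rule adm_sum_bound[OF s w \<delta>])
  finally show ?thesis .
qed

end

section \<open>Averaged truncations as test function in dimension one\<close>

lemma weighted_mean_square:
  fixes p d :: "'i \<Rightarrow> real"
  assumes "\<And>i. i \<in> I \<Longrightarrow> 0 \<le> p i" "(\<Sum>i\<in>I. p i) = 1"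
  shows "(\<Sum>i\<in>I. p i * d i)\<^sup>2 \<le> (\<Sum>i\<in>I. p i * (d i)\<^sup>2)"
proof -
  let ?m = "\<Sum>i\<in>I. p i * d i"
  have "0 \<le> (\<Sum>i\<in>I. p i * (d i - ?m)\<^sup>2)"
    by (intro sum_nonneg mult_nonneg_nonneg assms(1)) auto
  also have "(\<Sum>i\<in>I. p i * (d i - ?m)\<^sup>2) = (\<Sum>i\<in>I. p i * (d i)\<^sup>2 - 2 * ?m * (p i * d i) + ?m\<^sup>2 * p i)"
    by (rule sum.cong) (auto simp: power2_eq_square algebra_simps)
  also have "\<dots> = (\<Sum>i\<in>I. p i * (d i)\<^sup>2) - 2 * ?m * ?m + ?m\<^sup>2 * (\<Sum>i\<in>I. p i)"
    by (simp add: sum.distrib sum_subtractf sum_distrib_left)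
  finally show ?thesis using assms(2) by (simp add: power2_eq_square)
qed

lemma sum_product_weights:
  fixes m :: "'i \<Rightarrow> real" and n :: "'j \<Rightarrow> real"
  shows "(\<Sum>q\<in>A \<times> B. m (fst q) * n (snd q) * f (fst q)) = (\<Sum>a\<in>A. m a * f a) * (\<Sum>b\<in>B. n b)"
    and "(\<Sum>q\<in>A \<times> B. m (fst q) * n (snd q) * g (snd q)) = (\<Sum>a\<in>A. m a) * (\<Sum>b\<in>B. n b * g b)"
  unfolding sum_product sum.cartesian_product case_prod_unfold by (auto intro!: sum.cong)

context mesh_line begin

text \<open>
  The affine interpolant of \<open>w\<close> between the two cut points. Its slope is at most
  of order \<open>1/R\<close> times the values at the cuts, since these are at distance at
  least \<open>R\<close>.
\<close>

definition chord :: "('a \<Rightarrow> real) \<Rightarrow> real \<Rightarrow> real \<Rightarrow> 'a \<Rightarrow> real" where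
  "chord w zl zr x = w (pt zl) + (w (pt zr) - w (pt zl)) * ((coord x - zl) / (zr - zl))"

text \<open>
  The truncation is defined by its nodal values, which makes it discrete by construction; that
  it coincides with the sharp truncation of \<open>w - chord\<close> is
  \<open>trunc_eq\<close>.
\<close>

definition nodal_trunc :: "('a \<Rightarrow> real) \<Rightarrow> real \<Rightarrow> real \<Rightarrow> 'a \<Rightarrow> real" where
  "nodal_trunc w zl zr i = (if zl \<le> coord i \<and> coord i \<le> zr then w i - chord w zl zr i else 0)"

definition trunc :: "('a \<Rightarrow> real) \<Rightarrow> real \<Rightarrow> real \<Rightarrow> 'a \<Rightarrow> real" where
  "trunc w zl zr = interp (nodal_trunc w zl zr)"

definition ends_sq :: "('a \<Rightarrow> real) \<Rightarrow> real \<Rightarrow> real \<Rightarrow> real" where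
  "ends_sq w zl zr = (w (pt zl))\<^sup>2 + (w (pt zr))\<^sup>2"

definition cut :: "real \<Rightarrow> real \<Rightarrow> bool" where
  "cut zl zr \<longleftrightarrow> pt zl \<in> nodes \<and> pt zr \<in> nodes \<and> - 13 / 16 * R < zl \<and> zl \<le> - 9 / 16 * R \<and> 9 / 16 * R \<le> zr \<and> zr < 13 / 16 * R"

lemma ends_sq_nonneg: "0 \<le> ends_sq w zl zr" by (simp add: ends_sq_def)

lemma chord_ends: "cut zl zr \<Longrightarrow> chord w zl zr (pt zl) = w (pt zl)" "cut zl zr \<Longrightarrow> chord w zl zr (pt zr) = w (pt zr)"
  using R by (auto simp: chord_def cut_def)

lemma trunc_ends:
  assumes "cut zl zr" "coord i = zl \<or> coord i = zr"
  shows "w i - chord w zl zr i = 0"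
proof -
  have "i = pt zl \<or> i = pt zr" using assms(2) pt_coord[of i] by metis
  then show ?thesis using chord_ends[OF assms(1)] by auto
qed

lemma trunc_eq:
  assumes w: "w \<in> fe_space \<Omega> Th" and c: "cut zl zr" and x: "x \<in> ball x0 R"
  shows "trunc w zl zr x = (if zl \<le> coord x \<and> coord x \<le> zr then w x - chord w zl zr x else 0)"
proof -
  obtain T where T: "T \<in> Th" "x \<in> T" using elem_cover[OF x] by blast
  have xT: "lo T \<le> coord x" "coord x \<le> hi T" using mem_elem[OF T(1)] T(2) by auto
  have v: "coord i = lo T \<or> coord i = hi T" if "i \<in> verts T" for i
    using that verts_lo_hi[OF T(1)] by auto
  have lh: "lo T < hi T" by (rule lo_less_hi[OF T(1)])
  have nl: "pt zl \<in> nodes" "pt zr \<in> nodes" using c by (auto simp: cut_def)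
  have tre: "trunc w zl zr x = (\<Sum>i\<in>verts T. hat i x * nodal_trunc w zl zr i)"
    unfolding trunc_def by (rule interp_elem[OF T])
  consider (ins) "zl \<le> lo T" "hi T \<le> zr" | (left) "hi T \<le> zl" | (right) "zr \<le> lo T"
    using node_in_elem[OF T(1) nl(1)] node_in_elem[OF T(1) nl(2)] by linarith
  then show ?thesis
  proof cases
    case ins
    obtain a d where ac: "\<And>y. y \<in> T \<Longrightarrow> w y = a \<bullet> y + d" using w T(1) by (auto simp: fe_space_def)
    define k where "k = (w (pt zr) - w (pt zl)) / (zr - zl)"
    have "w y - chord w zl zr y = (a - k *\<^sub>R b) \<bullet> y + (d - w (pt zl) + k * (x0 \<bullet> b) + k * zl)" if "y \<in> T" for y
      using ac[OF that] by (simp add: chord_def k_def coord_def inner_diff_left inner_commute[of b] diff_divide_distrib add_divide_distrib algebra_simps)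
    from affine_on_simplex[OF simplex[OF T(1)] T(2), where f="\<lambda>y. w y - chord w zl zr y", OF this]
    have "w x - chord w zl zr x = (\<Sum>i\<in>verts T. hat i x * (w i - chord w zl zr i))"
      by (simp add: hat_eq[OF T])
    also have "\<dots> = (\<Sum>i\<in>verts T. hat i x * nodal_trunc w zl zr i)"
    proof (rule sum.cong[OF refl])
      fix i assume "i \<in> verts T"
      from v[OF this] have "zl \<le> coord i \<and> coord i \<le> zr" using ins lh by auto
      then show "hat i x * (w i - chord w zl zr i) = hat i x * nodal_trunc w zl zr i" by (simp add: nodal_trunc_def)
    qed
    finally show ?thesis using tre ins xT by simp
  next
    case left
    have "nodal_trunc w zl zr i = 0" if "i \<in> verts T" for i
      using v[OF that] left lh trunc_ends[OF c, of i w] by (auto simp: nodal_trunc_def)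
    then have "trunc w zl zr x = 0" using tre by simp
    moreover have "w x - chord w zl zr x = 0" if "zl \<le> coord x"
      by (rule trunc_ends[OF c]) (use that xT left in auto)
    ultimately show ?thesis by auto
  next
    case right
    have "nodal_trunc w zl zr i = 0" if "i \<in> verts T" for i
      using v[OF that] right lh trunc_ends[OF c, of i w] by (auto simp: nodal_trunc_def)
    then have "trunc w zl zr x = 0" using tre by simp
    moreover have "w x - chord w zl zr x = 0" if "coord x \<le> zr"
      by (rule trunc_ends[OF c]) (use that xT right in auto)
    ultimately show ?thesis by auto
  qed
qed

lemma nodal_trunc_zero:
  assumes "cut zl zr" "13 / 16 * R \<le> norm (i - x0)"
  shows "nodal_trunc w zl zr i = 0"
  using assms norm_coord[of i x0] coord_x0 by (auto simp: nodal_trunc_def cut_def)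

lemma trunc_local: "cut zl zr \<Longrightarrow> trunc w zl zr \<in> fe_space_local \<Omega> Th (ball x0 R)"
  and trunc_zero: "cut zl zr \<Longrightarrow> x \<notin> ball x0 (7 / 8 * R) \<Longrightarrow> trunc w zl zr x = 0"
  unfolding trunc_def by (rule interp_local_mem interp_local_zero; simp add: nodal_trunc_zero)+

lemma two_squares: "(a + b')\<^sup>2 \<le> 2 * a\<^sup>2 + 2 * b'\<^sup>2" for a b' :: real
  using zero_le_power2[of "a - b'"] by (simp add: power2_eq_square algebra_simps)

lemma chord_lipschitz:
  assumes c: "cut zl zr"
  shows "(chord w zl zr x - chord w zl zr y)\<^sup>2 \<le> 2 * ends_sq w zl zr * (norm (x - y))\<^sup>2 / R\<^sup>2"
proof -
  let ?l = "w (pt zl)" and ?r = "w (pt zr)"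
  have z: "R \<le> zr - zl" using c R by (simp add: cut_def)
  have "chord w zl zr x - chord w zl zr y = (?r - ?l) * ((coord x - coord y) / (zr - zl))"
    by (simp add: chord_def diff_divide_distrib algebra_simps)
  then have "(chord w zl zr x - chord w zl zr y)\<^sup>2 = (?r - ?l)\<^sup>2 * ((norm (x - y))\<^sup>2 / (zr - zl)\<^sup>2)"
    by (simp add: power_mult_distrib power_divide norm_coord)
  also have "\<dots> \<le> (2 * ends_sq w zl zr) * ((norm (x - y))\<^sup>2 / R\<^sup>2)"
  proof (rule mult_mono)
    show "(?r - ?l)\<^sup>2 \<le> 2 * ends_sq w zl zr" using two_squares[of ?r "- ?l"] by (simp add: ends_sq_def)
    show "(norm (x - y))\<^sup>2 / (zr - zl)\<^sup>2 \<le> (norm (x - y))\<^sup>2 / R\<^sup>2"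
      using z R by (intro divide_left_mono power_mono mult_pos_pos) auto
  qed (use ends_sq_nonneg in auto)
  finally show ?thesis by simp
qed

lemma chord_bound:
  assumes c: "cut zl zr" and x: "zl \<le> coord x" "coord x \<le> zr"
  shows "(chord w zl zr x)\<^sup>2 \<le> 2 * ends_sq w zl zr"
proof -
  let ?l = "w (pt zl)" and ?r = "w (pt zr)"
  define t where "t = (coord x - zl) / (zr - zl)"
  have z: "0 < zr - zl" using c R by (simp add: cut_def)
  have t: "0 \<le> t" "t \<le> 1" using x z by (auto simp: t_def)
  have "chord w zl zr x = (1 - t) * ?l + t * ?r" by (simp add: chord_def t_def algebra_simps)
  then have "(chord w zl zr x)\<^sup>2 \<le> 2 * ((1 - t) * ?l)\<^sup>2 + 2 * (t * ?r)\<^sup>2" by (simp only: two_squares)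
  also have "((1 - t) * ?l)\<^sup>2 \<le> ?l\<^sup>2" unfolding power_mult_distrib using t by (intro mult_left_le_one_le) (auto simp: power_le_one)
  also have "(t * ?r)\<^sup>2 \<le> ?r\<^sup>2" unfolding power_mult_distrib using t by (intro mult_left_le_one_le) (auto simp: power_le_one)
  finally show ?thesis by (simp add: ends_sq_def)
qed

text \<open>
  The two indicator terms account for pairs that straddle a cut point, where the truncation
  drops the part of \<open>w\<close> beyond the cut; the last term accounts for the chord. Only
  the left point occurs in the first term and only the right one in the second, which is the
  form that \<open>cut_err\<close> averages.
\<close>

definition trunc_err :: "('a \<Rightarrow> real) \<Rightarrow> real \<Rightarrow> real \<Rightarrow> 'a \<Rightarrow> 'a \<Rightarrow> real" where
  "trunc_err w zl zr x y = (w x - w (pt zl))\<^sup>2 * of_bool (coord x < zl \<and> zl < coord y)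
     + (w y - w (pt zr))\<^sup>2 * of_bool (coord x < zr \<and> zr < coord y) + ends_sq w zl zr * (norm (x - y))\<^sup>2 / R\<^sup>2"

lemma trunc_err_nonneg: "0 \<le> trunc_err w zl zr x y"
  using ends_sq_nonneg by (simp add: trunc_err_def)

lemma polarisation: "g\<^sup>2 / 2 \<le> w * g + r\<^sup>2 / 2" if "w = g + r" for w g r :: real
proof -
  have "0 \<le> (g + r)\<^sup>2" by simp
  then show ?thesis using that by (simp add: power2_eq_square algebra_simps)
qed

text \<open>
  In each case \<open>\<delta>w = \<delta>g + r\<close> with an error \<open>r\<close>, and
  \<open>\<delta>w \<delta>g\<close> is at least \<open>(\<delta>g)\<^sup>2 / 2 - r\<^sup>2 /
  2\<close>. For two points between the cuts \<open>r\<close> is a difference of the chord. For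
  a straddling pair the inner point is compared with the cut point, where \<open>g\<close>
  vanishes.
\<close>

lemma trunc_pair_ordered:
  assumes w: "w \<in> fe_space \<Omega> Th" and c: "cut zl zr" and x: "x \<in> ball x0 R" and y: "y \<in> ball x0 R" and le: "coord x \<le> coord y"
  shows "(trunc w zl zr x - trunc w zl zr y)\<^sup>2 / 2 \<le> (w x - w y) * (trunc w zl zr x - trunc w zl zr y) + (trunc_err w zl zr x y + trunc_err w zl zr y x)"
proof -
  let ?g = "trunc w zl zr" and ?e = "chord w zl zr" and ?k = "ends_sq w zl zr" and ?n = "(norm (x - y))\<^sup>2"
  note gx = trunc_eq[OF w c x] and gy = trunc_eq[OF w c y]
  have zlr: "zl < zr" using c R by (simp add: cut_def)
  have r2: "?k * ?n / R\<^sup>2 \<le> trunc_err w zl zr y x" "?k * ?n / R\<^sup>2 \<le> trunc_err w zl zr x y"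
    by (auto simp: trunc_err_def norm_minus_commute)
  have kn: "0 \<le> ?k * ?n / R\<^sup>2" using ends_sq_nonneg by simp
  have main: "(?g x - ?g y)\<^sup>2 / 2 \<le> (w x - w y) * (?g x - ?g y) + (trunc_err w zl zr x y + trunc_err w zl zr y x)"
    if "r\<^sup>2 / 2 \<le> trunc_err w zl zr x y + trunc_err w zl zr y x" "w x - w y = (?g x - ?g y) + r" for r
    using polarisation[OF that(2)] that(1) by linarith
  consider (zero) "?g x = 0" "?g y = 0"
    | (both) "zl \<le> coord x" "coord y \<le> zr"
    | (left) "coord x < zl" "zl < coord y" "coord y \<le> zr"
    | (right) "zl \<le> coord x" "coord x < zr" "zr < coord y"
  proof -
    have "?g x = 0" if "\<not> (zl \<le> coord x \<and> coord x \<le> zr)" using gx that by simp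
    moreover have "?g x = 0" if "coord x = zr" using gx zlr trunc_ends[OF c, of x w] that by simp
    moreover have "?g y = 0" if "\<not> (zl \<le> coord y \<and> coord y \<le> zr)" using gy that by simp
    moreover have "?g y = 0" if "coord y = zl" using gy zlr trunc_ends[OF c, of y w] that by simp
    ultimately show ?thesis using that le by fastforce
  qed
  then show ?thesis
  proof cases
    case zero
    then show ?thesis using trunc_err_nonneg[of w zl zr x y] trunc_err_nonneg[of w zl zr y x] by simp
  next
    case both
    show ?thesis
    proof (rule main)
      show "w x - w y = (?g x - ?g y) + (?e x - ?e y)" using gx gy both le by simp
      show "(?e x - ?e y)\<^sup>2 / 2 \<le> trunc_err w zl zr x y + trunc_err w zl zr y x"
        using chord_lipschitz[OF c, of w x y] r2 kn by argo
    qed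
  next
    case left
    show ?thesis
    proof (rule main)
      show "w x - w y = (?g x - ?g y) + ((w x - w (pt zl)) + (?e (pt zl) - ?e y))"
        using gx gy left chord_ends(1)[OF c, of w] by simp
      have "((w x - w (pt zl)) + (?e (pt zl) - ?e y))\<^sup>2 \<le> 2 * (w x - w (pt zl))\<^sup>2 + 2 * (?e (pt zl) - ?e y)\<^sup>2"
        by (rule two_squares)
      moreover have "(?e (pt zl) - ?e y)\<^sup>2 \<le> 2 * (?k * ?n / R\<^sup>2)"
      proof (rule order_trans[OF chord_lipschitz[OF c]])
        have "(norm (pt zl - y))\<^sup>2 \<le> ?n" using left by (intro power_mono) (auto simp: norm_coord)
        then have "?k * (norm (pt zl - y))\<^sup>2 / R\<^sup>2 \<le> ?k * ?n / R\<^sup>2"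
          by (intro divide_right_mono mult_left_mono ends_sq_nonneg) auto
        then show "2 * ?k * (norm (pt zl - y))\<^sup>2 / R\<^sup>2 \<le> 2 * (?k * ?n / R\<^sup>2)" by simp
      qed
      moreover have "trunc_err w zl zr x y = (w x - w (pt zl))\<^sup>2 + ?k * ?n / R\<^sup>2" using left by (simp add: trunc_err_def)
      ultimately show "((w x - w (pt zl)) + (?e (pt zl) - ?e y))\<^sup>2 / 2 \<le> trunc_err w zl zr x y + trunc_err w zl zr y x"
        using r2(1) by argo
    qed
  next
    case right
    show ?thesis
    proof (rule main)
      show "w x - w y = (?g x - ?g y) + (- (w y - w (pt zr)) + (?e x - ?e (pt zr)))"
        using gx gy right chord_ends(2)[OF c, of w] by simp
      have "(- (w y - w (pt zr)) + (?e x - ?e (pt zr)))\<^sup>2 \<le> 2 * (- (w y - w (pt zr)))\<^sup>2 + 2 * (?e x - ?e (pt zr))\<^sup>2"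
        by (rule two_squares)
      moreover have "(- (w y - w (pt zr)))\<^sup>2 = (w y - w (pt zr))\<^sup>2" by (rule power2_minus)
      moreover have "(?e x - ?e (pt zr))\<^sup>2 \<le> 2 * (?k * ?n / R\<^sup>2)"
      proof (rule order_trans[OF chord_lipschitz[OF c]])
        have "(norm (x - pt zr))\<^sup>2 \<le> ?n" using right by (intro power_mono) (auto simp: norm_coord)
        then have "?k * (norm (x - pt zr))\<^sup>2 / R\<^sup>2 \<le> ?k * ?n / R\<^sup>2"
          by (intro divide_right_mono mult_left_mono ends_sq_nonneg) auto
        then show "2 * ?k * (norm (x - pt zr))\<^sup>2 / R\<^sup>2 \<le> 2 * (?k * ?n / R\<^sup>2)" by simp
      qed
      moreover have "trunc_err w zl zr x y = (w y - w (pt zr))\<^sup>2 + ?k * ?n / R\<^sup>2" using right by (simp add: trunc_err_def)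
      ultimately show "(- (w y - w (pt zr)) + (?e x - ?e (pt zr)))\<^sup>2 / 2 \<le> trunc_err w zl zr x y + trunc_err w zl zr y x"
        using r2(1) by argo
    qed
  qed
qed

lemma trunc_pair:
  assumes w: "w \<in> fe_space \<Omega> Th" and c: "cut zl zr" and x: "x \<in> ball x0 R" and y: "y \<in> ball x0 R"
  shows "(trunc w zl zr x - trunc w zl zr y)\<^sup>2 / 2 \<le> (w x - w y) * (trunc w zl zr x - trunc w zl zr y) + (trunc_err w zl zr x y + trunc_err w zl zr y x)"
proof (cases "coord x \<le> coord y")
  case True then show ?thesis by (rule trunc_pair_ordered[OF w c x y])
next
  case False
  then have "(trunc w zl zr y - trunc w zl zr x)\<^sup>2 / 2 \<le> (w y - w x) * (trunc w zl zr y - trunc w zl zr x) + (trunc_err w zl zr y x + trunc_err w zl zr x y)"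
    by (intro trunc_pair_ordered[OF w c y x]) simp
  moreover have "(w y - w x) * (trunc w zl zr y - trunc w zl zr x) = (w x - w y) * (trunc w zl zr x - trunc w zl zr y)" by algebra
  ultimately show ?thesis by (simp add: power2_commute add.commute)
qed

lemma trunc_inside:
  assumes w: "w \<in> fe_space \<Omega> Th" and c: "cut zl zr" and x: "x \<in> ball x0 R" and y: "y \<in> ball x0 R"
    and "zl \<le> coord x" "coord x \<le> zr" "zl \<le> coord y" "coord y \<le> zr"
  shows "(w x - w y)\<^sup>2 \<le> 2 * (trunc w zl zr x - trunc w zl zr y)\<^sup>2 + 4 * ends_sq w zl zr * (norm (x - y))\<^sup>2 / R\<^sup>2"
proof -
  have "w x - w y = (trunc w zl zr x - trunc w zl zr y) + (chord w zl zr x - chord w zl zr y)"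
    using trunc_eq[OF w c x] trunc_eq[OF w c y] assms by simp
  then have "(w x - w y)\<^sup>2 \<le> 2 * (trunc w zl zr x - trunc w zl zr y)\<^sup>2 + 2 * (chord w zl zr x - chord w zl zr y)\<^sup>2"
    by (simp only: two_squares)
  then show ?thesis using chord_lipschitz[OF c, of w x y] by simp
qed

lemma trunc_square:
  assumes w: "w \<in> fe_space \<Omega> Th" and c: "cut zl zr" and x: "x \<in> ball x0 R"
  shows "(trunc w zl zr x)\<^sup>2 \<le> 2 * (w x)\<^sup>2 + 4 * ends_sq w zl zr"
proof (cases "zl \<le> coord x \<and> coord x \<le> zr")
  case True
  then have "trunc w zl zr x = w x + - chord w zl zr x" using trunc_eq[OF w c x] by simp
  then have "(trunc w zl zr x)\<^sup>2 \<le> 2 * (w x)\<^sup>2 + 2 * (- chord w zl zr x)\<^sup>2" by (simp only: two_squares)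
  then show ?thesis using chord_bound[OF c, of x w] True by simp
next
  case False
  have "trunc w zl zr x = 0" unfolding trunc_eq[OF w c x] using False by (rule if_not_P)
  then show ?thesis using ends_sq_nonneg by simp
qed


definition Kline :: "real \<Rightarrow> real" where "Kline s = 512 * near_C TYPE('a) s * 4 ^ Suc DIM('a)"

lemma ends_sq_term_bound:
  assumes s: "0 < s" "s < 1" and k: "0 \<le> k" "ennreal k \<le> ennreal (64 / R * 4 ^ Suc DIM('a)) * L2_norm_sq (ball x0 R) w"
    and c: "0 \<le> c" and U: "\<And>x y. (x, y) \<in> U \<Longrightarrow> x \<in> B1 \<and> y \<in> B1"
  shows "kint s U (\<lambda>x y. c * k * (norm (x - y))\<^sup>2 / R\<^sup>2) \<le> ennreal (c * Kline s) * mass s w"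
proof -
  have n: "0 \<le> near_C TYPE('a) s" using near_C_pos[OF s, where 'a='a] by simp
  have "kint s U (\<lambda>x y. c * k * (norm (x - y))\<^sup>2 / R\<^sup>2)
      \<le> ennreal (8 * near_C TYPE('a) s * R powr - (2 * s)) * (\<integral>\<^sup>+x\<in>B1. ennreal (c * k / 2) \<partial>lebesgue)"
    by (rule kint_lipschitz_weight[OF s R _ _ _ B1_sets(1)]) (use U B1_dist k(1) c in \<open>auto\<close>)
  also have "(\<integral>\<^sup>+x\<in>B1. ennreal (c * k / 2) \<partial>lebesgue) = ennreal (c * k / 2) * emeasure lebesgue B1"
    by (rule nn_integral_cmult_indicator[OF B1_sets(1)])
  also have "emeasure lebesgue B1 \<le> emeasure lebesgue (seg (- R) R)"
    by (rule emeasure_mono[OF _ seg_sets]) (auto simp: B1_def mem_ball_coord seg_def simp del: mem_ball)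
  also have "\<dots> = ennreal (2 * R)" using emeasure_seg[of "- R" R] R by simp
  also have "ennreal (8 * near_C TYPE('a) s * R powr - (2 * s)) * (ennreal (c * k / 2) * ennreal (2 * R))
      = ennreal (8 * near_C TYPE('a) s * R powr - (2 * s) * c * R) * ennreal k"
  proof -
    have "ennreal (c * k / 2) * ennreal (2 * R) = ennreal (c * k / 2 * (2 * R))"
      by (rule ennreal_mult[symmetric]) (use c k R in auto)
    moreover have "ennreal (8 * near_C TYPE('a) s * R powr - (2 * s)) * ennreal (c * k / 2 * (2 * R)) = ennreal (8 * near_C TYPE('a) s * R powr - (2 * s) * (c * k / 2 * (2 * R)))"
      by (rule ennreal_mult[symmetric]) (use n c k R in auto)
    moreover have "8 * near_C TYPE('a) s * R powr - (2 * s) * (c * k / 2 * (2 * R)) = 8 * near_C TYPE('a) s * R powr - (2 * s) * c * R * k" by simp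
    moreover have "ennreal (8 * near_C TYPE('a) s * R powr - (2 * s) * c * R * k) = ennreal (8 * near_C TYPE('a) s * R powr - (2 * s) * c * R) * ennreal k"
      by (rule ennreal_mult) (use n c k R in auto)
    ultimately show ?thesis by (simp only:)
  qed
  also have "\<dots> \<le> ennreal (8 * near_C TYPE('a) s * R powr - (2 * s) * c * R) * (ennreal (64 / R * 4 ^ Suc DIM('a)) * L2_norm_sq (ball x0 R) w)"
    by (rule mult_left_mono[OF k(2)]) simp
  also have "\<dots> = ennreal (c * Kline s) * mass s w"
  proof -
    have "ennreal (8 * near_C TYPE('a) s * R powr - (2 * s) * c * R) * ennreal (64 / R * 4 ^ Suc DIM('a))
        = ennreal (8 * near_C TYPE('a) s * R powr - (2 * s) * c * R * (64 / R * 4 ^ Suc DIM('a)))"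
      by (rule ennreal_mult[symmetric]) (use n c R in auto)
    also have "8 * near_C TYPE('a) s * R powr - (2 * s) * c * R * (64 / R * 4 ^ Suc DIM('a)) = c * Kline s * R powr - (2 * s)"
      using R by (simp add: Kline_def)
    also have "ennreal \<dots> = ennreal (c * Kline s) * ennreal (R powr - (2 * s))"
      by (rule ennreal_mult) (use n c in \<open>auto simp: Kline_def\<close>)
    finally show ?thesis by (simp only: mass_def mult.assoc[symmetric])
  qed
  finally show ?thesis by (simp add: mult_left_mono mult_right_mono)
qed

text \<open>
  Chosen such that the energy coefficient \<open>576 * \<delta> * far_C\<close> in
  \<open>cut_err_bound\<close> equals \<open>1/64\<close>. The error occurs four times and the
  energy enters with a factor 2, which gives the \<open>1/8\<close> of
  \<open>good_test\<close>.
\<close>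

definition young_delta :: "real \<Rightarrow> real" where "young_delta s = 1 / (36864 * far_C TYPE('a) s)"

definition Cline :: "real \<Rightarrow> real" where
  "Cline s = 4 * (1 / 64 * (4 * Kline s) + cut_const s (young_delta s)) + 2 * Kline s + 2 + 4 * Kline s + 512 * 4 ^ Suc DIM('a)"

lemma kint_flip:
  assumes "pair_measurable g"
  shows "kint s BB (\<lambda>x y. g y x) = kint s BB g"
proof -
  have "kint s BB g = kint s ((\<lambda>p. (snd p, fst p)) -` BB) (\<lambda>x y. g y x)"
    by (rule kint_swap[OF assms B1_sets(2)])
  also have "(\<lambda>p. (snd p, fst p)) -` BB = BB" by auto
  finally show ?thesis by simp
qed

lemma pair_measurable_flip:
  assumes "pair_measurable g" shows "pair_measurable (\<lambda>x y. g y x)"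
  using measurable_compose[OF measurable_Pair[OF measurable_snd measurable_fst] assms] by simp

text \<open>
  The right cut is drawn independently of the left one, by the same construction for the
  reversed orientation. The test function is the average of the truncations and
  \<open>e\<close> the average of their squared differences; by linearity the pointwise lower
  bounds for single truncations carry over. Since the cuts lie outside the half ball, every
  truncation has the differences of \<open>w\<close> there, up to the chord.
\<close>

lemma good_test_line:
  assumes s: "0 < s" "s < 1" and w: "w \<in> fe_space \<Omega> Th"
  shows "good_test s (Cline s) w"
proof -
  \<comment> \<open>The right end of the ball is the left end for the opposite orientation.\<close>
  interpret Rt: mesh_line \<Omega> Th x0 R \<sigma> "- b"
    by unfold_locales (use dim1 b in auto)
  have Rcc: "Rt.coord x = - coord x" for x by (simp add: Rt.coord_def coord_def)
  have Rpt: "Rt.pt r = pt (- r)" for r by (simp add: Rt.pt_def pt_def)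
  let ?c = "far_C TYPE('a) s" and ?d = "young_delta s"
  have c: "0 < ?c" by (rule far_C_pos[OF s(1)])
  have d: "0 < ?d" "576 * ?d * ?c = 1 / 64" using c by (auto simp: young_delta_def)
  have n: "0 < near_C TYPE('a) s" by (rule near_C_pos[OF s])
  have K0: "0 \<le> Kline s" using n by (simp add: Kline_def)
  have CN0: "0 \<le> cut_const s ?d" using n c d by (simp add: cut_const_def)
  note wm = fe_measurable[OF w]
  define I where "I = (adm \<times> adm) \<times> (Rt.adm \<times> Rt.adm)"
  define p where "p q = mu (fst q) * Rt.mu (snd q)" for q
  define zl where "zl q = rightmost (fst q)" for q :: "('a set \<times> 'a set) \<times> ('a set \<times> 'a set)"
  define zr where "zr q = - Rt.rightmost (snd q)" for q :: "('a set \<times> 'a set) \<times> ('a set \<times> 'a set)"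
  define g where "g q = trunc w (zl q) (zr q)" for q
  define \<kappa> where "\<kappa> q = ends_sq w (zl q) (zr q)" for q
  have finI: "finite I" using finite_adm Rt.finite_adm by (simp add: I_def)
  have p0: "0 \<le> p q" if "q \<in> I" for q
    using that mu_nonneg Rt.mu_nonneg unfolding I_def p_def by (intro mult_nonneg_nonneg) auto
  have p1: "(\<Sum>q\<in>I. p q) = 1"
    using sum_product_weights(1)[of mu Rt.mu "\<lambda>_. 1" "adm \<times> adm" "Rt.adm \<times> Rt.adm"] sum_mu Rt.sum_mu by (simp add: I_def p_def)
  have pl: "(\<Sum>q\<in>I. p q * f (fst q)) = (\<Sum>a\<in>adm \<times> adm. mu a * f a)" for f
    using sum_product_weights(1)[of mu Rt.mu f "adm \<times> adm" "Rt.adm \<times> Rt.adm"] Rt.sum_mu by (simp add: I_def p_def)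
  have pr: "(\<Sum>q\<in>I. p q * f (snd q)) = (\<Sum>a\<in>Rt.adm \<times> Rt.adm. Rt.mu a * f a)" for f
    using sum_product_weights(2)[of mu Rt.mu f "adm \<times> adm" "Rt.adm \<times> Rt.adm"] sum_mu by (simp add: I_def p_def)
  have cutq: "cut (zl q) (zr q)" if "q \<in> I" for q
  proof -
    have a: "fst q \<in> adm \<times> adm" "snd q \<in> Rt.adm \<times> Rt.adm" using that by (auto simp: I_def)
    show ?thesis
      using rightmost_props[OF a(1)] Rt.rightmost_props[OF a(2)] by (simp add: cut_def zl_def zr_def Rpt)
  qed
  define k where "k = (\<Sum>q\<in>I. p q * \<kappa> q)"
  have \<kappa>0: "0 \<le> \<kappa> q" for q using ends_sq_nonneg by (simp add: \<kappa>_def)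
  have k0: "0 \<le> k" unfolding k_def by (intro sum_nonneg mult_nonneg_nonneg p0 \<kappa>0)
  have kb: "ennreal k \<le> ennreal (64 / R * 4 ^ Suc DIM('a)) * L2_norm_sq (ball x0 R) w"
  proof -
    have "k = (\<Sum>q\<in>I. p q * (w (pt (rightmost (fst q))))\<^sup>2) + (\<Sum>q\<in>I. p q * (w (Rt.pt (Rt.rightmost (snd q))))\<^sup>2)"
      unfolding k_def sum.distrib[symmetric] by (rule sum.cong) (auto simp: \<kappa>_def ends_sq_def zl_def zr_def Rpt distrib_left)
    also have "\<dots> = (\<Sum>a\<in>adm \<times> adm. mu a * (w (pt (rightmost a)))\<^sup>2) + (\<Sum>a\<in>Rt.adm \<times> Rt.adm. Rt.mu a * (w (Rt.pt (Rt.rightmost a)))\<^sup>2)"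
      by (simp only: pl[where f="\<lambda>a. (w (pt (rightmost a)))\<^sup>2"] pr[where f="\<lambda>a. (w (Rt.pt (Rt.rightmost a)))\<^sup>2"])
    finally have kA: "k = (\<Sum>a\<in>adm \<times> adm. mu a * (w (pt (rightmost a)))\<^sup>2) + (\<Sum>a\<in>Rt.adm \<times> Rt.adm. Rt.mu a * (w (Rt.pt (Rt.rightmost a)))\<^sup>2)" .
    have n1: "0 \<le> (\<Sum>a\<in>adm \<times> adm. mu a * (w (pt (rightmost a)))\<^sup>2)"
      by (rule sum_nonneg, rule mult_nonneg_nonneg[OF mu_nonneg]) simp_all
    have n2: "0 \<le> (\<Sum>a\<in>Rt.adm \<times> Rt.adm. Rt.mu a * (w (Rt.pt (Rt.rightmost a)))\<^sup>2)"
      by (rule sum_nonneg, rule mult_nonneg_nonneg[OF Rt.mu_nonneg]) simp_all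
    have "ennreal k \<le> ennreal (32 / R * 4 ^ Suc DIM('a)) * L2_norm_sq (ball x0 R) w + ennreal (32 / R * 4 ^ Suc DIM('a)) * L2_norm_sq (ball x0 R) w"
      unfolding kA ennreal_plus[OF n1 n2] by (rule add_mono[OF mu_point_values[OF w] Rt.mu_point_values[OF w]])
    also have "\<dots> = (ennreal (32 / R * 4 ^ Suc DIM('a)) + ennreal (32 / R * 4 ^ Suc DIM('a))) * L2_norm_sq (ball x0 R) w"
      by (simp only: distrib_right)
    also have "ennreal (32 / R * 4 ^ Suc DIM('a)) + ennreal (32 / R * 4 ^ Suc DIM('a)) = ennreal (32 / R * 4 ^ Suc DIM('a) + 32 / R * 4 ^ Suc DIM('a))"
      by (rule ennreal_plus[symmetric]) (use R in auto)
    also have "32 / R * 4 ^ Suc DIM('a) + 32 / R * 4 ^ Suc DIM('a) = 64 / R * 4 ^ Suc DIM('a)" by simp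
    finally show ?thesis .
  qed
  define \<gamma> where "\<gamma> i = (\<Sum>q\<in>I. p q * nodal_trunc w (zl q) (zr q) i)" for i
  define \<phi> where "\<phi> = interp \<gamma>"
  have \<gamma>0: "\<gamma> i = 0" if "13 / 16 * R \<le> norm (i - x0)" for i
    unfolding \<gamma>_def using nodal_trunc_zero[OF cutq that] by (intro sum.neutral) auto
  have \<phi>: "\<phi> \<in> fe_space_local \<Omega> Th (ball x0 R)" "\<And>x. x \<notin> ball x0 (7 / 8 * R) \<Longrightarrow> \<phi> x = 0"
    unfolding \<phi>_def by (rule interp_local_mem interp_local_zero; simp add: \<gamma>0)+
  have \<phi>_eq: "\<phi> x = (\<Sum>q\<in>I. p q * g q x)" for x
  proof -
    have "\<phi> x = (\<Sum>i\<in>nodes. \<Sum>q\<in>I. p q * (hat i x * nodal_trunc w (zl q) (zr q) i))"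
      unfolding \<phi>_def interp_def \<gamma>_def by (simp add: sum_distrib_left mult_ac)
    also have "\<dots> = (\<Sum>q\<in>I. \<Sum>i\<in>nodes. p q * (hat i x * nodal_trunc w (zl q) (zr q) i))" by (rule sum.swap)
    also have "\<dots> = (\<Sum>q\<in>I. p q * g q x)" by (simp only: g_def trunc_def interp_def sum_distrib_left)
    finally show ?thesis .
  qed
  have gfe: "g q \<in> fe_space \<Omega> Th" if "q \<in> I" for q
    unfolding g_def by (rule fe_local_fe[OF trunc_local[OF cutq[OF that]]])
  note gm = fe_measurable[OF gfe]
  define e where "e x y = (\<Sum>q\<in>I. p q * (g q x - g q y)\<^sup>2)" for x y
  define rem where "rem x y = ((cut_err w x y + cut_err w y x) + (Rt.cut_err w x y + Rt.cut_err w y x)) + 2 * k * (norm (x - y))\<^sup>2 / R\<^sup>2" for x y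
  have e_term_m: "pair_measurable (\<lambda>x y. p q * (g q x - g q y)\<^sup>2)" if "q \<in> I" for q
    by (rule borel_measurable_times[OF borel_measurable_const pair_measurable_diff_sq[OF gm[OF that]]])
  have e_m: "pair_measurable e"
    unfolding e_def by (rule borel_measurable_sum[OF e_term_m])
  note Lm = cut_err_measurable[OF wm] and Rm = Rt.cut_err_measurable[OF wm]
  note Lm' = pair_measurable_flip[OF Lm] and Rm' = pair_measurable_flip[OF Rm]
  have nm: "pair_measurable (\<lambda>x y. 2 * k * (norm (x - y :: 'a))\<^sup>2 / R\<^sup>2)" by measurable
  note LLm = borel_measurable_add[OF Lm Lm'] and RRm = borel_measurable_add[OF Rm Rm']
  have rem_m: "pair_measurable rem"
    unfolding rem_def by (rule borel_measurable_add[OF borel_measurable_add[OF LLm RRm] nm])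
  have e0: "0 \<le> e x y" for x y
    unfolding e_def by (intro sum_nonneg mult_nonneg_nonneg p0) auto
  have rem0: "0 \<le> rem x y" for x y
    using cut_err_nonneg Rt.cut_err_nonneg k0 by (simp add: rem_def)
  have dphi: "\<phi> x - \<phi> y = (\<Sum>q\<in>I. p q * (g q x - g q y))" for x y
    by (simp add: \<phi>_eq sum_subtractf right_diff_distrib)
  have dphi2: "(\<phi> x - \<phi> y)\<^sup>2 \<le> e x y" for x y
    unfolding dphi e_def by (rule weighted_mean_square[OF p0 p1])
  have rem_eq: "(\<Sum>q\<in>I. p q * (trunc_err w (zl q) (zr q) x y + trunc_err w (zl q) (zr q) y x)) = rem x y" for x y
  proof -
    have L: "(\<Sum>q\<in>I. p q * ((w x - w (pt (zl q)))\<^sup>2 * of_bool (coord x < zl q \<and> zl q < coord y))) = cut_err w x y" for x y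
      unfolding cut_err_def zl_def by (rule pl)
    have Rr: "(\<Sum>q\<in>I. p q * ((w y - w (pt (zr q)))\<^sup>2 * of_bool (coord x < zr q \<and> zr q < coord y))) = Rt.cut_err w y x" for x y
    proof -
      have "(\<Sum>q\<in>I. p q * ((w y - w (pt (zr q)))\<^sup>2 * of_bool (coord x < zr q \<and> zr q < coord y)))
          = (\<Sum>q\<in>I. p q * ((w y - w (Rt.pt (Rt.rightmost (snd q))))\<^sup>2 * of_bool (Rt.coord y < Rt.rightmost (snd q) \<and> Rt.rightmost (snd q) < Rt.coord x)))"
        by (rule sum.cong) (auto simp: zr_def Rcc Rpt)
      also have "\<dots> = Rt.cut_err w y x" unfolding Rt.cut_err_def
        by (rule pr[where f="\<lambda>a. (w y - w (Rt.pt (Rt.rightmost a)))\<^sup>2 * of_bool (Rt.coord y < Rt.rightmost a \<and> Rt.rightmost a < Rt.coord x)"])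
      finally show ?thesis .
    qed
    have kk: "(\<Sum>q\<in>I. p q * (\<kappa> q * (norm (x - y))\<^sup>2 / R\<^sup>2)) = k * (norm (x - y))\<^sup>2 / R\<^sup>2" for x y :: 'a
      unfolding k_def by (simp add: sum_distrib_right sum_divide_distrib mult.assoc)
    have "(\<Sum>q\<in>I. p q * (trunc_err w (zl q) (zr q) x y + trunc_err w (zl q) (zr q) y x))
       = ((\<Sum>q\<in>I. p q * ((w x - w (pt (zl q)))\<^sup>2 * of_bool (coord x < zl q \<and> zl q < coord y)))
        + (\<Sum>q\<in>I. p q * ((w y - w (pt (zr q)))\<^sup>2 * of_bool (coord x < zr q \<and> zr q < coord y)))
        + (\<Sum>q\<in>I. p q * (\<kappa> q * (norm (x - y))\<^sup>2 / R\<^sup>2)))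
       + ((\<Sum>q\<in>I. p q * ((w y - w (pt (zl q)))\<^sup>2 * of_bool (coord y < zl q \<and> zl q < coord x)))
        + (\<Sum>q\<in>I. p q * ((w x - w (pt (zr q)))\<^sup>2 * of_bool (coord y < zr q \<and> zr q < coord x)))
        + (\<Sum>q\<in>I. p q * (\<kappa> q * (norm (y - x))\<^sup>2 / R\<^sup>2)))"
      unfolding trunc_err_def \<kappa>_def[symmetric] by (simp only: distrib_left sum.distrib)
    also have "\<dots> = rem x y"
      unfolding L Rr kk rem_def norm_minus_commute[of y x] by simp
    finally show ?thesis .
  qed
  have low: "\<forall>x\<in>B1. \<forall>y\<in>B1. e x y / 2 \<le> (w x - w y) * (\<phi> x - \<phi> y) + rem x y"
  proof (intro ballI)
    fix x y assume "x \<in> B1" "y \<in> B1"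
    then have B: "x \<in> ball x0 R" "y \<in> ball x0 R" using B1_sub by auto
    have "e x y / 2 = (\<Sum>q\<in>I. p q * ((g q x - g q y)\<^sup>2 / 2))" by (simp add: e_def sum_divide_distrib)
    also have "\<dots> \<le> (\<Sum>q\<in>I. p q * ((w x - w y) * (g q x - g q y) + (trunc_err w (zl q) (zr q) x y + trunc_err w (zl q) (zr q) y x)))"
      unfolding g_def by (intro sum_mono mult_left_mono trunc_pair[OF w cutq B] p0)
    also have "\<dots> = (\<Sum>q\<in>I. (w x - w y) * (p q * (g q x - g q y))) + rem x y"
      unfolding rem_eq[symmetric] sum.distrib[symmetric] by (rule sum.cong) (auto simp: algebra_simps)
    also have "\<dots> = (w x - w y) * (\<phi> x - \<phi> y) + rem x y" by (simp only: dphi sum_distrib_left)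
    finally show "e x y / 2 \<le> (w x - w y) * (\<phi> x - \<phi> y) + rem x y" .
  qed
  let ?E = "kint s BB e" and ?M = "mass s w"
  have avg: "(\<Sum>q\<in>I. p q * (2 * (g q x - g q y)\<^sup>2 + 4 * \<kappa> q * (norm (x - y))\<^sup>2 / R\<^sup>2)) = 2 * e x y + 4 * k * (norm (x - y))\<^sup>2 / R\<^sup>2" for x y
  proof -
    have "(\<Sum>q\<in>I. p q * (2 * (g q x - g q y)\<^sup>2 + 4 * \<kappa> q * (norm (x - y))\<^sup>2 / R\<^sup>2))
        = (\<Sum>q\<in>I. 2 * (p q * (g q x - g q y)\<^sup>2)) + (\<Sum>q\<in>I. (p q * \<kappa> q) * (4 * (norm (x - y))\<^sup>2 / R\<^sup>2))"
      unfolding sum.distrib[symmetric] by (rule sum.cong) (auto simp: algebra_simps)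
    also have "\<dots> = 2 * e x y + k * (4 * (norm (x - y))\<^sup>2 / R\<^sup>2)"
      by (simp only: e_def k_def sum_distrib_left sum_distrib_right)
    finally show ?thesis by simp
  qed
  have e2k: "kint s U h \<le> ennreal 2 * ?E + ennreal (4 * Kline s) * ?M"
    if U: "\<And>x y. (x, y) \<in> U \<Longrightarrow> x \<in> B1 \<and> y \<in> B1 \<and> h x y \<le> 2 * e x y + 4 * k * (norm (x - y))\<^sup>2 / R\<^sup>2" for U h
  proof -
    have 4: "pair_measurable (\<lambda>x y. 4 * k * (norm (x - y :: 'a))\<^sup>2 / R\<^sup>2)" by measurable
    have "kint s U h \<le> kint s BB (\<lambda>x y. 2 * e x y + 4 * k * (norm (x - y))\<^sup>2 / R\<^sup>2)"
      by (rule kint_mono) (use U in auto)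
    also have "\<dots> = kint s BB (\<lambda>x y. 2 * e x y) + kint s BB (\<lambda>x y. 4 * k * (norm (x - y))\<^sup>2 / R\<^sup>2)"
      by (rule kint_add[OF borel_measurable_times[OF borel_measurable_const e_m] 4 B1_sets(2)]) (use e0 k0 in auto)
    also have "kint s BB (\<lambda>x y. 2 * e x y) = ennreal 2 * ?E"
      by (rule kint_cmult[OF e_m B1_sets(2)]) simp
    also have "kint s BB (\<lambda>x y. 4 * k * (norm (x - y))\<^sup>2 / R\<^sup>2) \<le> ennreal (4 * Kline s) * ?M"
      by (rule ends_sq_term_bound[OF s k0 kb]) auto
    finally show ?thesis by (simp add: add_left_mono)
  qed
  have left: "kint s left_pairs (theta_diff w) \<le> ennreal 2 * ?E + ennreal (4 * Kline s) * ?M"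
  proof (rule e2k)
    fix x y assume xy: "(x, y) \<in> left_pairs"
    then have B: "x \<in> B1" "y \<in> B1" "coord x < coord y" "coord y \<le> - 9 / 16 * R" by (auto simp: left_pairs_def)
    then have BR: "x \<in> ball x0 R" "y \<in> ball x0 R" using B1_sub by auto
    have "theta_diff w x y = (\<Sum>a\<in>{a\<in>adm \<times> adm. rightmost a < coord x}. mu a) * (w x - w y)\<^sup>2"
      by (simp add: theta_diff_def theta_def sum_mu_less)
    also have "\<dots> = (\<Sum>a\<in>adm \<times> adm. mu a * (of_bool (rightmost a < coord x) * (w x - w y)\<^sup>2))"
      unfolding sum_distrib_right sum.inter_filter[OF finite_cartesian_product[OF finite_adm finite_adm]]
      by (rule sum.cong) auto
    also have "\<dots> = (\<Sum>q\<in>I. p q * (of_bool (rightmost (fst q) < coord x) * (w x - w y)\<^sup>2))"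
      by (rule pl[symmetric])
    also have "\<dots> \<le> (\<Sum>q\<in>I. p q * (2 * (g q x - g q y)\<^sup>2 + 4 * \<kappa> q * (norm (x - y))\<^sup>2 / R\<^sup>2))"
    proof (intro sum_mono mult_left_mono p0)
      fix q assume q: "q \<in> I"
      show "of_bool (rightmost (fst q) < coord x) * (w x - w y)\<^sup>2 \<le> 2 * (g q x - g q y)\<^sup>2 + 4 * \<kappa> q * (norm (x - y))\<^sup>2 / R\<^sup>2"
      proof (cases "rightmost (fst q) < coord x")
        case True
        have "9 / 16 * R \<le> zr q" using cutq[OF q] by (simp add: cut_def)
        then have "coord y \<le> zr q" using B R by linarith
        then show ?thesis
          using True trunc_inside[OF w cutq[OF q] BR] B by (simp add: g_def \<kappa>_def zl_def)
      next
        case False then show ?thesis using \<kappa>0[of q] by simp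
      qed
    qed
    also have "\<dots> = 2 * e x y + 4 * k * (norm (x - y))\<^sup>2 / R\<^sup>2" by (rule avg)
    finally show "x \<in> B1 \<and> y \<in> B1 \<and> theta_diff w x y \<le> 2 * e x y + 4 * k * (norm (x - y))\<^sup>2 / R\<^sup>2" using B by simp
  qed
  have right: "kint s Rt.left_pairs (Rt.theta_diff w) \<le> ennreal 2 * ?E + ennreal (4 * Kline s) * ?M"
  proof (rule e2k)
    fix x y assume xy: "(x, y) \<in> Rt.left_pairs"
    then have B: "x \<in> B1" "y \<in> B1" "coord y < coord x" "9 / 16 * R \<le> coord y" by (auto simp: Rt.left_pairs_def Rcc)
    then have BR: "x \<in> ball x0 R" "y \<in> ball x0 R" using B1_sub by auto
    have "Rt.theta_diff w x y = (\<Sum>a\<in>{a\<in>Rt.adm \<times> Rt.adm. Rt.rightmost a < Rt.coord x}. Rt.mu a) * (w x - w y)\<^sup>2"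
      by (simp add: Rt.theta_diff_def Rt.theta_def Rt.sum_mu_less)
    also have "\<dots> = (\<Sum>a\<in>Rt.adm \<times> Rt.adm. Rt.mu a * (of_bool (Rt.rightmost a < Rt.coord x) * (w x - w y)\<^sup>2))"
      unfolding sum_distrib_right sum.inter_filter[OF finite_cartesian_product[OF Rt.finite_adm Rt.finite_adm]]
      by (rule sum.cong) auto
    also have "\<dots> = (\<Sum>q\<in>I. p q * (of_bool (Rt.rightmost (snd q) < Rt.coord x) * (w x - w y)\<^sup>2))"
      by (rule pr[symmetric])
    also have "\<dots> \<le> (\<Sum>q\<in>I. p q * (2 * (g q x - g q y)\<^sup>2 + 4 * \<kappa> q * (norm (x - y))\<^sup>2 / R\<^sup>2))"
    proof (intro sum_mono mult_left_mono p0)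
      fix q assume q: "q \<in> I"
      show "of_bool (Rt.rightmost (snd q) < Rt.coord x) * (w x - w y)\<^sup>2 \<le> 2 * (g q x - g q y)\<^sup>2 + 4 * \<kappa> q * (norm (x - y))\<^sup>2 / R\<^sup>2"
      proof (cases "Rt.rightmost (snd q) < Rt.coord x")
        case True
        then have "coord x < zr q" by (simp add: zr_def Rcc)
        moreover have "zl q \<le> - 9 / 16 * R" using cutq[OF q] by (simp add: cut_def)
        then have "zl q \<le> coord y" using B R by linarith
        ultimately show ?thesis
          using True trunc_inside[OF w cutq[OF q] BR] B by (simp add: g_def \<kappa>_def)
      next
        case False then show ?thesis using \<kappa>0[of q] by simp
      qed
    qed
    also have "\<dots> = 2 * e x y + 4 * k * (norm (x - y))\<^sup>2 / R\<^sup>2" by (rule avg)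
    finally show "x \<in> B1 \<and> y \<in> B1 \<and> Rt.theta_diff w x y \<le> 2 * e x y + 4 * k * (norm (x - y))\<^sup>2 / R\<^sup>2" using B by simp
  qed
  have RLE: "ennreal (1 / 64) * (ennreal 2 * ?E + ennreal (4 * Kline s) * ?M) + ennreal (cut_const s ?d) * ?M
      = ennreal (1 / 32) * ?E + ennreal (1 / 64 * (4 * Kline s) + cut_const s ?d) * ?M"
  proof -
    have "ennreal (1 / 64) * ennreal 2 = ennreal (1 / 64 * 2)" by (rule ennreal_mult[symmetric]) simp_all
    moreover have "ennreal (1 / 64) * ennreal (4 * Kline s) = ennreal (1 / 64 * (4 * Kline s))"
      by (rule ennreal_mult[symmetric]) (use K0 in auto)
    moreover have "ennreal (1 / 64 * (4 * Kline s) + cut_const s ?d) = ennreal (1 / 64 * (4 * Kline s)) + ennreal (cut_const s ?d)"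
      by (rule ennreal_plus) (use K0 CN0 in auto)
    ultimately show ?thesis by (simp add: distrib_left distrib_right mult.assoc[symmetric] add.assoc del: ennreal_plus)
  qed
  let ?X = "ennreal (1 / 32) * ?E + ennreal (1 / 64 * (4 * Kline s) + cut_const s ?d) * ?M"
  have L: "kint s BB (cut_err w) \<le> ?X"
  proof -
    have "kint s BB (cut_err w) \<le> ennreal (1 / 64) * kint s left_pairs (theta_diff w) + ennreal (cut_const s ?d) * ?M"
      using cut_err_bound[OF s w d(1)] by (simp only: d(2))
    also have "\<dots> \<le> ennreal (1 / 64) * (ennreal 2 * ?E + ennreal (4 * Kline s) * ?M) + ennreal (cut_const s ?d) * ?M"
      by (rule add_right_mono[OF mult_left_mono[OF left]]) simp
    also have "\<dots> = ?X" by (rule RLE)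
    finally show ?thesis .
  qed
  have Rr: "kint s BB (Rt.cut_err w) \<le> ?X"
  proof -
    have "kint s BB (Rt.cut_err w) \<le> ennreal (1 / 64) * kint s Rt.left_pairs (Rt.theta_diff w) + ennreal (cut_const s ?d) * ?M"
      using Rt.cut_err_bound[OF s w d(1)] by (simp only: d(2))
    also have "\<dots> \<le> ennreal (1 / 64) * (ennreal 2 * ?E + ennreal (4 * Kline s) * ?M) + ennreal (cut_const s ?d) * ?M"
      by (rule add_right_mono[OF mult_left_mono[OF right]]) simp
    also have "\<dots> = ?X" by (rule RLE)
    finally show ?thesis .
  qed
  have r1: "kint s BB rem \<le> ennreal (1 / 8) * ?E + ennreal (Cline s) * ?M"
  proof -
    have "kint s BB rem = ((kint s BB (cut_err w) + kint s BB (\<lambda>x y. cut_err w y x)) + (kint s BB (Rt.cut_err w) + kint s BB (\<lambda>x y. Rt.cut_err w y x)))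
        + kint s BB (\<lambda>x y. 2 * k * (norm (x - y))\<^sup>2 / R\<^sup>2)"
    proof -
      have "kint s BB rem = kint s BB (\<lambda>x y. (cut_err w x y + cut_err w y x) + (Rt.cut_err w x y + Rt.cut_err w y x)) + kint s BB (\<lambda>x y. 2 * k * (norm (x - y))\<^sup>2 / R\<^sup>2)"
        unfolding rem_def
        by (rule kint_add[OF borel_measurable_add[OF LLm RRm] nm B1_sets(2)]) (use cut_err_nonneg Rt.cut_err_nonneg k0 in auto)
      also have "kint s BB (\<lambda>x y. (cut_err w x y + cut_err w y x) + (Rt.cut_err w x y + Rt.cut_err w y x)) = kint s BB (\<lambda>x y. cut_err w x y + cut_err w y x) + kint s BB (\<lambda>x y. Rt.cut_err w x y + Rt.cut_err w y x)"
        by (rule kint_add[OF LLm RRm B1_sets(2)]) (use cut_err_nonneg Rt.cut_err_nonneg in auto)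
      also have "kint s BB (\<lambda>x y. cut_err w x y + cut_err w y x) = kint s BB (cut_err w) + kint s BB (\<lambda>x y. cut_err w y x)"
        by (rule kint_add[OF Lm Lm' B1_sets(2)]) (use cut_err_nonneg in auto)
      also have "kint s BB (\<lambda>x y. Rt.cut_err w x y + Rt.cut_err w y x) = kint s BB (Rt.cut_err w) + kint s BB (\<lambda>x y. Rt.cut_err w y x)"
        by (rule kint_add[OF Rm Rm' B1_sets(2)]) (use Rt.cut_err_nonneg in auto)
      finally show ?thesis .
    qed
    also have "\<dots> \<le> ((?X + ?X) + (?X + ?X)) + ennreal (2 * Kline s) * ?M"
      unfolding kint_flip[OF Lm] kint_flip[OF Rm]
      by (intro add_mono L Rr ends_sq_term_bound[OF s k0 kb]) auto
    also have "\<dots> = ennreal 4 * ?X + ennreal (2 * Kline s) * ?M"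
    proof -
      have "((?X + ?X) + (?X + ?X)) = 4 * ?X" by (simp add: mult_2[symmetric] mult.assoc[symmetric])
      then show ?thesis by simp
    qed
    also have "\<dots> = ennreal (1 / 8) * ?E + ennreal (4 * (1 / 64 * (4 * Kline s) + cut_const s ?d) + 2 * Kline s) * ?M"
    proof -
      have "ennreal 4 * ennreal (1 / 32) = ennreal (4 * (1 / 32))" by (rule ennreal_mult[symmetric]) simp_all
      moreover have "ennreal 4 * ennreal (1 / 64 * (4 * Kline s) + cut_const s ?d) = ennreal (4 * (1 / 64 * (4 * Kline s) + cut_const s ?d))"
        by (rule ennreal_mult[symmetric]) (use K0 CN0 in auto)
      moreover have "ennreal (4 * (1 / 64 * (4 * Kline s) + cut_const s ?d) + 2 * Kline s) = ennreal (4 * (1 / 64 * (4 * Kline s) + cut_const s ?d)) + ennreal (2 * Kline s)"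
        by (rule ennreal_plus) (use K0 CN0 in auto)
      ultimately show ?thesis by (simp only: distrib_left distrib_right mult.assoc[symmetric] add.assoc) simp
    qed
    also have "\<dots> \<le> ennreal (1 / 8) * ?E + ennreal (Cline s) * ?M"
      by (intro add_left_mono mult_right_mono ennreal_leI) (use K0 CN0 in \<open>auto simp: Cline_def\<close>)
    finally show ?thesis .
  qed
  have C: "1 \<le> Cline s" "2 \<le> Cline s" "4 * Kline s \<le> Cline s" "2 + 512 * 4 ^ Suc DIM('a) \<le> Cline s"
  proof -
    define P where "P = (4::real) ^ Suc DIM('a)"
    have "0 \<le> P" by (simp add: P_def)
    then show "1 \<le> Cline s" "2 \<le> Cline s" "4 * Kline s \<le> Cline s" "2 + 512 * 4 ^ Suc DIM('a) \<le> Cline s"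
      unfolding Cline_def P_def[symmetric] using K0 CN0 by argo+
  qed
  have r2: "kint s BB (\<lambda>x y. (\<phi> x - \<phi> y)\<^sup>2) \<le> ennreal (Cline s) * (?E + ?M)"
  proof -
    have "kint s BB (\<lambda>x y. (\<phi> x - \<phi> y)\<^sup>2) \<le> kint s BB e" by (rule kint_mono) (use dphi2 in auto)
    also have "\<dots> \<le> ennreal 1 * (?E + ?M)" by simp
    also have "\<dots> \<le> ennreal (Cline s) * (?E + ?M)" by (intro mult_right_mono ennreal_leI C) simp
    finally show ?thesis .
  qed
  have r3: "Hs_seminorm_sq s (ball x0 (R / 2)) w \<le> ennreal (Cline s) * (?E + ?M)"
  proof -
    have "Hs_seminorm_sq s (ball x0 (R / 2)) w = kint s (ball x0 (R / 2) \<times> ball x0 (R / 2)) (\<lambda>x y. (w x - w y)\<^sup>2)"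
      by (rule Hs_seminorm_sq_kint[OF wm]) simp
    also have "\<dots> \<le> ennreal 2 * ?E + ennreal (4 * Kline s) * ?M"
    proof (rule e2k)
      fix x y assume "(x, y) \<in> ball x0 (R / 2) \<times> ball x0 (R / 2)"
      then have xy: "x \<in> ball x0 (R / 2)" "y \<in> ball x0 (R / 2)" by auto
      then have c: "\<bar>coord x\<bar> < R / 2" "\<bar>coord y\<bar> < R / 2" unfolding mem_ball_coord by auto
      have B: "x \<in> B1" "y \<in> B1" using xy R by (auto simp: B1_def)
      then have BR: "x \<in> ball x0 R" "y \<in> ball x0 R" using B1_sub by auto
      have "(w x - w y)\<^sup>2 = (\<Sum>q\<in>I. p q * (w x - w y)\<^sup>2)"
        using p1 by (simp add: sum_distrib_right[symmetric])
      also have "\<dots> \<le> (\<Sum>q\<in>I. p q * (2 * (g q x - g q y)\<^sup>2 + 4 * \<kappa> q * (norm (x - y))\<^sup>2 / R\<^sup>2))"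
      proof (intro sum_mono mult_left_mono p0)
        fix q assume q: "q \<in> I"
        have "zl q \<le> - 9 / 16 * R" "9 / 16 * R \<le> zr q" using cutq[OF q] by (auto simp: cut_def)
        then show "(w x - w y)\<^sup>2 \<le> 2 * (g q x - g q y)\<^sup>2 + 4 * \<kappa> q * (norm (x - y))\<^sup>2 / R\<^sup>2"
          unfolding g_def \<kappa>_def using c R by (intro trunc_inside[OF w cutq[OF q] BR]) linarith+
      qed
      also have "\<dots> = 2 * e x y + 4 * k * (norm (x - y))\<^sup>2 / R\<^sup>2" by (rule avg)
      finally show "x \<in> B1 \<and> y \<in> B1 \<and> (w x - w y)\<^sup>2 \<le> 2 * e x y + 4 * k * (norm (x - y))\<^sup>2 / R\<^sup>2" using B by simp
    qed
    also have "\<dots> \<le> ennreal (Cline s) * ?E + ennreal (Cline s) * ?M"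
      by (intro add_mono mult_right_mono ennreal_leI C) simp_all
    finally show ?thesis by (simp only: distrib_left)
  qed
  have r4: "L2_norm_sq UNIV \<phi> \<le> ennreal (Cline s) * L2_norm_sq (ball x0 R) w"
  proof -
    let ?L = "L2_norm_sq (ball x0 R) w"
    have pt2: "(\<phi> x)\<^sup>2 \<le> 2 * (w x)\<^sup>2 + 4 * k" if x: "x \<in> B1" for x
    proof -
      have xR: "x \<in> ball x0 R" using x B1_sub by blast
      have "(\<phi> x)\<^sup>2 \<le> (\<Sum>q\<in>I. p q * (g q x)\<^sup>2)"
        unfolding \<phi>_eq by (rule weighted_mean_square[OF p0 p1])
      also have "\<dots> \<le> (\<Sum>q\<in>I. p q * (2 * (w x)\<^sup>2 + 4 * \<kappa> q))"
        unfolding g_def \<kappa>_def by (intro sum_mono mult_left_mono p0 trunc_square[OF w cutq xR])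
      also have "\<dots> = (\<Sum>q\<in>I. p q * (2 * (w x)\<^sup>2)) + (\<Sum>q\<in>I. 4 * (p q * \<kappa> q))"
        unfolding sum.distrib[symmetric] by (rule sum.cong) (auto simp: algebra_simps)
      also have "\<dots> = 2 * (w x)\<^sup>2 + 4 * k"
        using p1 by (simp only: sum_distrib_left[symmetric] sum_distrib_right[symmetric] k_def mult_1)
      finally show ?thesis .
    qed
    have "L2_norm_sq UNIV \<phi> \<le> (\<integral>\<^sup>+x. (ennreal 2 * (ennreal ((w x)\<^sup>2) * indicator (ball x0 R) x) + ennreal (4 * k) * indicator B1 x) \<partial>lebesgue)"
      unfolding L2_norm_sq_def
    proof (rule nn_integral_mono)
      fix x
      show "ennreal ((\<phi> x)\<^sup>2) * indicator UNIV x \<le> ennreal 2 * (ennreal ((w x)\<^sup>2) * indicator (ball x0 R) x) + ennreal (4 * k) * indicator B1 x"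
      proof (cases "x \<in> B1")
        case True
        then have xR: "x \<in> ball x0 R" using B1_sub by blast
        have "ennreal ((\<phi> x)\<^sup>2) \<le> ennreal (2 * (w x)\<^sup>2 + 4 * k)" by (rule ennreal_leI[OF pt2[OF True]])
        also have "\<dots> = ennreal (2 * (w x)\<^sup>2) + ennreal (4 * k)" by (rule ennreal_plus) (use k0 in auto)
        also have "ennreal (2 * (w x)\<^sup>2) = ennreal 2 * ennreal ((w x)\<^sup>2)" by (rule ennreal_mult) auto
        finally show ?thesis using True xR by simp
      next
        case False
        have "ball x0 (7 / 8 * R) \<subseteq> B1" unfolding B1_def using R by (intro subset_ball) simp
        then have "\<phi> x = 0" using False \<phi>(2) by blast
        then show ?thesis by simp
      qed
    qed
    also have "\<dots> = (\<integral>\<^sup>+x. ennreal 2 * (ennreal ((w x)\<^sup>2) * indicator (ball x0 R) x) \<partial>lebesgue) + (\<integral>\<^sup>+x. ennreal (4 * k) * indicator B1 x \<partial>lebesgue)"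
      by (rule nn_integral_add)
        (use wm B1_sets(1) in \<open>auto intro!: borel_measurable_times_ennreal borel_measurable_indicator\<close>)
    also have "(\<integral>\<^sup>+x. ennreal 2 * (ennreal ((w x)\<^sup>2) * indicator (ball x0 R) x) \<partial>lebesgue) = ennreal 2 * ?L"
      unfolding L2_norm_sq_def
      by (rule nn_integral_cmult) (use wm in \<open>auto intro!: borel_measurable_times_ennreal borel_measurable_indicator\<close>)
    also have "(\<integral>\<^sup>+x. ennreal (4 * k) * indicator B1 x \<partial>lebesgue) = ennreal (4 * k) * emeasure lebesgue B1"
      by (rule nn_integral_cmult_indicator[OF B1_sets(1)])
    also have "\<dots> \<le> ennreal (4 * k) * ennreal (2 * R)"
    proof (rule mult_left_mono)
      have "emeasure lebesgue B1 \<le> emeasure lebesgue (seg (- R) R)"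
        by (rule emeasure_mono[OF _ seg_sets]) (auto simp: B1_def mem_ball_coord seg_def simp del: mem_ball)
      also have "\<dots> = ennreal (2 * R)" using emeasure_seg[of "- R" R] R by simp
      finally show "emeasure lebesgue B1 \<le> ennreal (2 * R)" .
    qed simp
    also have "\<dots> = ennreal (8 * R) * ennreal k"
    proof -
      have "ennreal (4 * k) * ennreal (2 * R) = ennreal (4 * k * (2 * R))" by (rule ennreal_mult[symmetric]) (use k0 R in auto)
      also have "4 * k * (2 * R) = 8 * R * k" by simp
      also have "ennreal \<dots> = ennreal (8 * R) * ennreal k" by (rule ennreal_mult) (use k0 R in auto)
      finally show ?thesis .
    qed
    also have "\<dots> \<le> ennreal (8 * R) * (ennreal (64 / R * 4 ^ Suc DIM('a)) * ?L)"
      by (rule mult_left_mono[OF kb]) simp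
    also have "\<dots> = ennreal (512 * 4 ^ Suc DIM('a)) * ?L"
    proof -
      have "ennreal (8 * R) * ennreal (64 / R * 4 ^ Suc DIM('a)) = ennreal (8 * R * (64 / R * 4 ^ Suc DIM('a)))"
        by (rule ennreal_mult[symmetric]) (use R in auto)
      also have "8 * R * (64 / R * 4 ^ Suc DIM('a)) = 512 * 4 ^ Suc DIM('a)" using R by simp
      finally show ?thesis by (simp only: mult.assoc[symmetric])
    qed
    also have "ennreal 2 * ?L + ennreal (512 * 4 ^ Suc DIM('a)) * ?L = ennreal (2 + 512 * 4 ^ Suc DIM('a)) * ?L"
      by (subst ennreal_plus) (simp_all add: distrib_right)
    also have "\<dots> \<le> ennreal (Cline s) * ?L" by (intro mult_right_mono ennreal_leI C) simp
    finally show ?thesis by (simp add: add_left_mono)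
  qed
  have r5: "?E < \<infinity>"
  proof -
    have "?E = (\<Sum>q\<in>I. kint s BB (\<lambda>x y. p q * (g q x - g q y)\<^sup>2))"
      unfolding e_def by (rule kint_sum[OF finI e_term_m B1_sets(2)]) (use p0 in auto)
    also have "\<dots> = (\<Sum>q\<in>I. ennreal (p q) * kint s BB (\<lambda>x y. (g q x - g q y)\<^sup>2))"
      by (intro sum.cong refl kint_cmult pair_measurable_diff_sq gm B1_sets(2) p0)
    also have "\<dots> < \<infinity>"
      using fe_energy_finite[OF s gfe] finI by (simp add: ennreal_mult_less_top)
    finally show ?thesis .
  qed
  show ?thesis
    unfolding good_test_def
    by (rule exI[of _ \<phi>], rule exI[of _ e], rule exI[of _ rem]) (use \<phi> e_m rem_m e0 rem0 low r1 r2 r3 r4 r5 in blast)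
qed

end

section \<open>Pairing with the far field\<close>

lemma ennreal_young:
  fixes a b :: ennreal
  assumes c: "0 < c"
  shows "a * b \<le> ennreal c * a\<^sup>2 + ennreal (1 / c) * b\<^sup>2"
proof (cases "a = \<infinity> \<or> b = \<infinity>")
  case True
  then have "ennreal c * a\<^sup>2 = \<infinity> \<or> ennreal (1 / c) * b\<^sup>2 = \<infinity>"
    using c by (auto simp: ennreal_mult_eq_top_iff power2_eq_square)
  then have "ennreal c * a\<^sup>2 + ennreal (1 / c) * b\<^sup>2 = top"
    by (metis add_top_left_ennreal add_top_right_ennreal infinity_ennreal_def)
  then show ?thesis by (simp only: top_greatest)
next
  case False
  then obtain x y where xy: "a = ennreal x" "0 \<le> x" "b = ennreal y" "0 \<le> y"
    by (cases a; cases b) auto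
  have "x * y \<le> c * x\<^sup>2 + 1 / c * y\<^sup>2"
  proof -
    have "x * y \<le> c * x\<^sup>2 + y\<^sup>2 / (4 * c)"
    proof -
      have "0 \<le> (2 * c * x - y)\<^sup>2" by simp
      then have "4 * c * (x * y) \<le> 4 * c * (c * x\<^sup>2) + y\<^sup>2"
        by (simp add: power2_eq_square algebra_simps)
      also have "\<dots> = 4 * c * (c * x\<^sup>2 + y\<^sup>2 / (4 * c))" using c by (simp add: field_simps)
      finally show ?thesis using c by simp
    qed
    also have "y\<^sup>2 / (4 * c) \<le> 1 / c * y\<^sup>2" using c by (simp add: field_simps)
    finally show ?thesis by simp
  qed
  then have "ennreal (x * y) \<le> ennreal (c * x\<^sup>2 + 1 / c * y\<^sup>2)" by (rule ennreal_leI)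
  also have "\<dots> = ennreal (c * x\<^sup>2) + ennreal (1 / c * y\<^sup>2)" by (rule ennreal_plus) (use c in auto)
  also have "ennreal (c * x\<^sup>2) = ennreal c * ennreal (x\<^sup>2)" by (rule ennreal_mult) (use c in auto)
  also have "ennreal (1 / c * y\<^sup>2) = ennreal (1 / c) * ennreal (y\<^sup>2)" by (rule ennreal_mult) (use c in auto)
  also have "ennreal (x * y) = ennreal x * ennreal y" by (rule ennreal_mult) (use xy in auto)
  finally show ?thesis using xy by (simp add: ennreal_power)
qed

text \<open>
  Extracts an inequality for nonnegative integrals, where infinite values are harmless, from a
  vanishing signed integral.
\<close>

lemma nn_integral_le_of_integral_zero:
  fixes H g st :: "'b \<Rightarrow> real"
  assumes H: "integrable M H" "integral\<^sup>L M H = 0"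
    and g: "g \<in> borel_measurable M" "\<And>p. 0 \<le> g p" and st: "st \<in> borel_measurable M" "\<And>p. 0 \<le> st p"
    and le: "\<And>p. p \<in> space M \<Longrightarrow> g p \<le> - H p + st p"
  shows "(\<integral>\<^sup>+p. ennreal (g p) \<partial>M) \<le> (\<integral>\<^sup>+p. ennreal (st p) \<partial>M)"
proof (cases "(\<integral>\<^sup>+p. ennreal (st p) \<partial>M) = \<infinity>")
  case False
  then have "(\<integral>\<^sup>+p. ennreal (norm (st p)) \<partial>M) < \<infinity>" using st by (simp add: less_top)
  then have sti: "integrable M st" using st by (intro integrableI_bounded)
  have dom: "integrable M (\<lambda>p. - H p + st p)" using H(1) sti by auto
  have gi: "integrable M g"
    by (rule Bochner_Integration.integrable_bound[OF dom g(1)])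
      (rule AE_I2, use le g(2) in \<open>fastforce\<close>)
  have "integral\<^sup>L M g \<le> integral\<^sup>L M (\<lambda>p. - H p + st p)"
    by (rule integral_mono[OF gi dom le])
  also have "\<dots> = integral\<^sup>L M st" using H sti by simp
  finally have "ennreal (integral\<^sup>L M g) \<le> ennreal (integral\<^sup>L M st)" by (rule ennreal_leI)
  then show ?thesis
    using nn_integral_eq_integral[OF gi] nn_integral_eq_integral[OF sti] g(2) st(2) by simp
qed simp

lemma kint_sq_add_finite:
  assumes v: "v \<in> borel_measurable lebesgue" and w: "w \<in> borel_measurable lebesgue" and U: "U \<in> sets leb_pair"
  shows "kint s U (\<lambda>x y. ((v x + c * w x) - (v y + c * w y))\<^sup>2)
    \<le> ennreal 2 * kint s U (\<lambda>x y. (v x - v y)\<^sup>2) + ennreal (2 * c\<^sup>2) * kint s U (\<lambda>x y. (w x - w y)\<^sup>2)"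
proof -
  note vm = pair_measurable_diff_sq[OF v] and wm = pair_measurable_diff_sq[OF w]
  have "kint s U (\<lambda>x y. ((v x + c * w x) - (v y + c * w y))\<^sup>2)
      \<le> kint s U (\<lambda>x y. 2 * (v x - v y)\<^sup>2 + 2 * c\<^sup>2 * (w x - w y)\<^sup>2)"
  proof (rule kint_mono)
    fix x y assume "(x, y) \<in> U"
    have sq: "(a + b)\<^sup>2 \<le> 2 * a\<^sup>2 + 2 * b\<^sup>2" for a b :: real
      using zero_le_power2[of "a - b"] by (simp add: power2_eq_square algebra_simps)
    have "((v x - v y) + c * (w x - w y))\<^sup>2 \<le> 2 * (v x - v y)\<^sup>2 + 2 * (c * (w x - w y))\<^sup>2"
      by (rule sq)
    moreover have "(v x + c * w x) - (v y + c * w y) = (v x - v y) + c * (w x - w y)" by (simp add: algebra_simps)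
    ultimately show "(x, y) \<in> U \<and> ((v x + c * w x) - (v y + c * w y))\<^sup>2 \<le> 2 * (v x - v y)\<^sup>2 + 2 * c\<^sup>2 * (w x - w y)\<^sup>2"
      using \<open>(x, y) \<in> U\<close> by (simp only: power_mult_distrib mult.assoc simp_thms)
  qed
  also have "\<dots> = kint s U (\<lambda>x y. 2 * (v x - v y)\<^sup>2) + kint s U (\<lambda>x y. 2 * c\<^sup>2 * (w x - w y)\<^sup>2)"
    by (rule kint_add[OF borel_measurable_times[OF borel_measurable_const vm] borel_measurable_times[OF borel_measurable_const wm] U]) auto
  also have "kint s U (\<lambda>x y. 2 * (v x - v y)\<^sup>2) = ennreal 2 * kint s U (\<lambda>x y. (v x - v y)\<^sup>2)"
    by (rule kint_cmult[OF vm U]) simp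
  also have "kint s U (\<lambda>x y. 2 * c\<^sup>2 * (w x - w y)\<^sup>2) = ennreal (2 * c\<^sup>2) * kint s U (\<lambda>x y. (w x - w y)\<^sup>2)"
    by (rule kint_cmult[OF wm U]) simp
  finally show ?thesis .
qed

lemma frac_const_pos:
  assumes "0 < s" "s < 1" shows "0 < frac_const TYPE('a::euclidean_space) s"
  unfolding frac_const_def using assms
  by (intro divide_pos_pos mult_pos_pos Gamma_real_pos) (auto simp: add_pos_pos)

context local_mesh begin

definition cross_const :: "real \<Rightarrow> real \<Rightarrow> real" where
  "cross_const s C = far_C TYPE('a) s * 16 powr (2 * s) * (2 + C) + 8 powr (real DIM('a) + 2 * s) * (unit_ball_vol (real DIM('a)) * C + 1)"

definition tail :: "real \<Rightarrow> ('a \<Rightarrow> real) \<Rightarrow> ennreal" where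
  "tail s F = (\<integral>\<^sup>+x\<in>- ball x0 R. ennreal (\<bar>F x\<bar> / norm (x - x0) powr (real DIM('a) + 2 * s)) \<partial>lebesgue)"

definition tail_sq :: "real \<Rightarrow> ('a \<Rightarrow> real) \<Rightarrow> ennreal" where
  "tail_sq s F = ennreal (R powr (real DIM('a) + 2 * s)) * (tail s F)\<^sup>2"

lemma ball_sep:
  assumes "x \<in> ball x0 (7 / 8 * R)" "y \<notin> B1"
  shows "R / 16 \<le> norm (x - y)"
proof -
  have "norm (x - x0) < 7 / 8 * R" "15 / 16 * R \<le> norm (y - x0)"
    using assms by (auto simp: B1_def dist_norm norm_minus_commute)
  moreover have "norm (y - x0) \<le> norm (y - x) + norm (x - x0)" using norm_triangle_ineq[of "y - x" "x - x0"] by simp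
  ultimately show ?thesis by (simp add: norm_minus_commute)
qed

text \<open>
  The kernel is at most a multiple of \<open>norm (y - x0) powr - (d + 2 * s)\<close>, so the
  double integral splits into a product of the \<open>L\<^sup>1\<close> norm of
  \<open>\<phi>\<close> and the tail. Young's inequality with weight \<open>R powr - (d + 2 *
  s)\<close> and the Cauchy-Schwarz inequality give the right powers of \<open>R\<close>.
\<close>

lemma tail_pairing:
  assumes s: "0 < s" "s < 1" and F: "F \<in> borel_measurable lebesgue" and \<phi>: "\<phi> \<in> borel_measurable lebesgue"
  shows "kint s (ball x0 (7 / 8 * R) \<times> - ball x0 R) (\<lambda>x y. \<bar>\<phi> x\<bar> * \<bar>F y\<bar>)
    \<le> ennreal (8 powr (real DIM('a) + 2 * s)) * (ennreal (unit_ball_vol (real DIM('a))) * (ennreal (R powr - (2 * s)) * L2_norm_sq UNIV \<phi>) + tail_sq s F)"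
proof -
  let ?S = "ball x0 (7 / 8 * R)" and ?p = "real DIM('a) + 2 * s" and ?w = "unit_ball_vol (real DIM('a))"
  let ?a = "\<integral>\<^sup>+x\<in>?S. ennreal \<bar>\<phi> x\<bar> \<partial>lebesgue" and ?b = "tail s F"
  note [measurable] = F \<phi>
  have "(\<lambda>y. norm (y - x0) powr ?p) \<in> borel_measurable lebesgue"
    by (intro measurable_completion) measurable
  then have tailm: "(\<lambda>y. ennreal (\<bar>F y\<bar> / norm (y - x0) powr ?p)) \<in> borel_measurable lebesgue"
    by measurable
  have m: "pair_measurable (\<lambda>x y. \<bar>\<phi> x\<bar> * \<bar>F y\<bar>)"
    using pair_measurable_fst[OF \<phi>] pair_measurable_snd[OF F] by measurable
  have "kint s (?S \<times> - ball x0 R) (\<lambda>x y. \<bar>\<phi> x\<bar> * \<bar>F y\<bar>)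
      = (\<integral>\<^sup>+x\<in>?S. (\<integral>\<^sup>+y\<in>- ball x0 R. ennreal (\<bar>\<phi> x\<bar> * \<bar>F y\<bar> * kern s x y) \<partial>lebesgue) \<partial>lebesgue)"
    by (rule kint_fst[OF m]) auto
  also have "\<dots> \<le> (\<integral>\<^sup>+x. (ennreal (8 powr ?p) * ?b) * (ennreal \<bar>\<phi> x\<bar> * indicator ?S x) \<partial>lebesgue)"
  proof (rule nn_integral_mono)
    fix x
    show "(\<integral>\<^sup>+y\<in>- ball x0 R. ennreal (\<bar>\<phi> x\<bar> * \<bar>F y\<bar> * kern s x y) \<partial>lebesgue) * indicator ?S x
        \<le> (ennreal (8 powr ?p) * ?b) * (ennreal \<bar>\<phi> x\<bar> * indicator ?S x)"
    proof (cases "x \<in> ?S")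
      case True
      have "(\<integral>\<^sup>+y\<in>- ball x0 R. ennreal (\<bar>\<phi> x\<bar> * \<bar>F y\<bar> * kern s x y) \<partial>lebesgue)
          \<le> (\<integral>\<^sup>+y. ennreal (\<bar>\<phi> x\<bar> * 8 powr ?p) * (ennreal (\<bar>F y\<bar> / norm (y - x0) powr ?p) * indicator (- ball x0 R) y) \<partial>lebesgue)"
      proof (rule nn_integral_mono)
        fix y
        show "ennreal (\<bar>\<phi> x\<bar> * \<bar>F y\<bar> * kern s x y) * indicator (- ball x0 R) y
            \<le> ennreal (\<bar>\<phi> x\<bar> * 8 powr ?p) * (ennreal (\<bar>F y\<bar> / norm (y - x0) powr ?p) * indicator (- ball x0 R) y)"
        proof (cases "y \<in> - ball x0 R")
          case y: True
          have 1: "norm (x - x0) < 7 / 8 * R" "R \<le> norm (y - x0)"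
            using True y by (auto simp: dist_norm norm_minus_commute)
          have "norm (y - x0) \<le> norm (y - x) + norm (x - x0)" using norm_triangle_ineq[of "y - x" "x - x0"] by simp
          then have "norm (y - x0) \<le> 8 * norm (x - y)" using 1 by (simp add: norm_minus_commute)
          moreover have "0 < norm (y - x0)" using 1 R by linarith
          ultimately have "kern s x y \<le> 8 powr ?p * norm (y - x0) powr - ?p"
            using s by (intro kern_le) auto
          then have "\<bar>\<phi> x\<bar> * \<bar>F y\<bar> * kern s x y \<le> \<bar>\<phi> x\<bar> * \<bar>F y\<bar> * (8 powr ?p * norm (y - x0) powr - ?p)"
            by (intro mult_left_mono) auto
          also have "\<dots> = \<bar>\<phi> x\<bar> * 8 powr ?p * (\<bar>F y\<bar> / norm (y - x0) powr ?p)"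
            unfolding powr_minus_divide by simp
          finally have "ennreal (\<bar>\<phi> x\<bar> * \<bar>F y\<bar> * kern s x y) \<le> ennreal (\<bar>\<phi> x\<bar> * 8 powr ?p * (\<bar>F y\<bar> / norm (y - x0) powr ?p))"
            by (rule ennreal_leI)
          also have "\<dots> = ennreal (\<bar>\<phi> x\<bar> * 8 powr ?p) * ennreal (\<bar>F y\<bar> / norm (y - x0) powr ?p)"
            by (rule ennreal_mult) auto
          finally show ?thesis using y by simp
        qed simp
      qed
      also have "\<dots> = ennreal (\<bar>\<phi> x\<bar> * 8 powr ?p) * ?b"
        unfolding tail_def
        by (rule nn_integral_cmult, rule borel_measurable_times_ennreal[OF tailm borel_measurable_indicator]) simp
      also have "ennreal (\<bar>\<phi> x\<bar> * 8 powr ?p) = ennreal \<bar>\<phi> x\<bar> * ennreal (8 powr ?p)" by (rule ennreal_mult) auto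
      finally show ?thesis using True by (simp add: mult_ac)
    qed simp
  qed
  also have "\<dots> = (ennreal (8 powr ?p) * ?b) * ?a"
    by (rule nn_integral_cmult, rule borel_measurable_times_ennreal[OF _ borel_measurable_indicator]) (measurable, simp)
  also have "\<dots> = ennreal (8 powr ?p) * (?a * ?b)" by (simp only: mult_ac)
  also have "?a * ?b \<le> ennreal (R powr - ?p) * ?a\<^sup>2 + ennreal (1 / R powr - ?p) * ?b\<^sup>2"
    by (rule ennreal_young) (use R in simp)
  also have "ennreal (1 / R powr - ?p) * ?b\<^sup>2 = tail_sq s F"
    unfolding tail_sq_def powr_minus_divide by (simp only: divide_divide_eq_right mult_1 div_by_1)
  also have "ennreal (R powr - ?p) * ?a\<^sup>2 \<le> ennreal ?w * (ennreal (R powr - (2 * s)) * L2_norm_sq UNIV \<phi>)"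
  proof -
    have "?a\<^sup>2 \<le> (\<integral>\<^sup>+x. (ennreal \<bar>\<phi> x\<bar>)\<^sup>2 \<partial>lebesgue) * (\<integral>\<^sup>+x. (indicator ?S x)\<^sup>2 \<partial>lebesgue)"
      by (rule Cauchy_Schwarz_nn_integral[OF _ borel_measurable_indicator]) (measurable, simp)
    also have "(\<integral>\<^sup>+x. (ennreal \<bar>\<phi> x\<bar>)\<^sup>2 \<partial>lebesgue) = L2_norm_sq UNIV \<phi>"
      unfolding L2_norm_sq_def by (simp add: ennreal_power)
    also have "(\<integral>\<^sup>+x. (indicator ?S x :: ennreal)\<^sup>2 \<partial>lebesgue) = (\<integral>\<^sup>+x. indicator ?S x \<partial>lebesgue)"
      by (rule nn_integral_cong) (auto simp: indicator_def)
    also have "\<dots> = emeasure lebesgue ?S" by (rule nn_integral_indicator) simp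
    also have "\<dots> \<le> emeasure lebesgue (ball x0 R)" using R by (intro emeasure_mono subset_ball) auto
    also have "\<dots> = ennreal (?w * R ^ DIM('a))" by (rule emeasure_lebesgue_ball) (use R in simp)
    finally have "?a\<^sup>2 \<le> L2_norm_sq UNIV \<phi> * ennreal (?w * R ^ DIM('a))" by (simp add: mult_left_mono)
    then have "ennreal (R powr - ?p) * ?a\<^sup>2 \<le> ennreal (R powr - ?p) * (L2_norm_sq UNIV \<phi> * ennreal (?w * R ^ DIM('a)))"
      by (rule mult_left_mono) simp
    also have "\<dots> = (ennreal (R powr - ?p) * ennreal (?w * R ^ DIM('a))) * L2_norm_sq UNIV \<phi>" by (simp only: mult_ac)
    also have "ennreal (R powr - ?p) * ennreal (?w * R ^ DIM('a)) = ennreal (R powr - ?p * (?w * R ^ DIM('a)))"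
      by (rule ennreal_mult[symmetric]) (use R in auto)
    also have "R powr - ?p * (?w * R ^ DIM('a)) = ?w * R powr - (2 * s)"
    proof -
      have "R powr - ?p * R ^ DIM('a) = R powr - ?p * R powr (real DIM('a))" using R by (simp add: powr_realpow)
      also have "\<dots> = R powr - (2 * s)" by (simp only: powr_add[symmetric]) simp
      finally show ?thesis by simp
    qed
    also have "ennreal (?w * R powr - (2 * s)) = ennreal ?w * ennreal (R powr - (2 * s))"
      by (rule ennreal_mult) auto
    finally show ?thesis by (simp only: mult.assoc)
  qed
  finally show ?thesis by (simp add: mult_left_mono add_right_mono)
qed

text \<open>
  The second point is either in the ball of radius \<open>R\<close>, where the far kernel leads
  to masses, or outside, where the value of \<open>F\<close> leads to the tail.
\<close>

lemma cross_bound: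
  assumes s: "0 < s" "s < 1" and F: "F \<in> borel_measurable lebesgue" and \<phi>: "\<phi> \<in> borel_measurable lebesgue"
    and \<phi>0: "\<And>x. x \<notin> ball x0 (7 / 8 * R) \<Longrightarrow> \<phi> x = 0"
    and \<phi>L: "L2_norm_sq UNIV \<phi> \<le> ennreal C * L2_norm_sq (ball x0 R) w" and C: "0 \<le> C"
  shows "kint s (ball x0 (7 / 8 * R) \<times> - B1) (\<lambda>x y. \<bar>F x - F y\<bar> * \<bar>\<phi> x\<bar>)
    \<le> ennreal (cross_const s C) * (mass s F + mass s w + tail_sq s F)"
proof -
  let ?S = "ball x0 (7 / 8 * R)" and ?A = "ball x0 R - B1" and ?p = "real DIM('a) + 2 * s" and ?w = "unit_ball_vol (real DIM('a))"
  let ?q = "far_C TYPE('a) s * 16 powr (2 * s)"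
  let ?Lp = "ennreal (R powr - (2 * s)) * L2_norm_sq UNIV \<phi>"
  note [measurable] = F \<phi>
  have q: "0 \<le> ?q" using far_C_pos[OF s(1), where 'a='a] by simp
  have Ssub: "?S \<subseteq> ball x0 R" using R by (intro subset_ball) simp
  have Sm: "?S \<in> sets lebesgue" and Am: "?A \<in> sets lebesgue" using B1_sets(1) by auto
  have Bm: "- B1 \<in> sets lebesgue" unfolding B1_def by simp
  have U: "?S \<times> - B1 \<in> sets leb_pair" "?S \<times> ?A \<in> sets leb_pair" "?S \<times> - ball x0 R \<in> sets leb_pair"
    using Sm Am Bm by (auto intro!: pair_measureI)
  have farq: "ennreal (far_C TYPE('a) s * (R / 16) powr - (2 * s)) = ennreal ?q * ennreal (R powr - (2 * s))"
  proof -
    have "(R / 16) powr - (2 * s) = 16 powr (2 * s) * R powr - (2 * s)"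
      using R by (simp add: powr_divide powr_minus_divide)
    then have eq: "far_C TYPE('a) s * (R / 16) powr - (2 * s) = ?q * R powr - (2 * s)" by (simp only: mult.assoc)
    show ?thesis unfolding eq by (rule ennreal_mult[OF q]) simp
  qed
  have sqm: "(\<lambda>x. ennreal ((v x)\<^sup>2)) \<in> borel_measurable lebesgue" if "v \<in> borel_measurable lebesgue" for v :: "'a \<Rightarrow> real"
    using that by measurable
  have m1: "pair_measurable (\<lambda>x y. (F x)\<^sup>2 + (\<phi> x)\<^sup>2)"
    using pair_measurable_fst[OF F] pair_measurable_fst[OF \<phi>] by measurable
  have m2: "pair_measurable (\<lambda>x y. (F y)\<^sup>2)"
    using pair_measurable_snd[OF F] by measurable
  have m3: "pair_measurable (\<lambda>x y. \<bar>\<phi> x\<bar> * \<bar>F y\<bar>)"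
    using pair_measurable_fst[OF \<phi>] pair_measurable_snd[OF F] by measurable
  have p1: "\<bar>F x - F y\<bar> * \<bar>\<phi> x\<bar> \<le> ((F x)\<^sup>2 + (\<phi> x)\<^sup>2) + (F y)\<^sup>2" for x y
  proof -
    have "0 \<le> (\<bar>F x\<bar> - \<bar>\<phi> x\<bar>)\<^sup>2" "0 \<le> (\<bar>F y\<bar> - \<bar>\<phi> x\<bar>)\<^sup>2" by simp_all
    then have "2 * (\<bar>F x\<bar> * \<bar>\<phi> x\<bar>) \<le> (F x)\<^sup>2 + (\<phi> x)\<^sup>2" "2 * (\<bar>F y\<bar> * \<bar>\<phi> x\<bar>) \<le> (F y)\<^sup>2 + (\<phi> x)\<^sup>2"
      by (simp_all add: power2_diff)
    moreover have "\<bar>F x - F y\<bar> * \<bar>\<phi> x\<bar> \<le> (\<bar>F x\<bar> + \<bar>F y\<bar>) * \<bar>\<phi> x\<bar>" by (intro mult_right_mono) auto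
    moreover have "0 \<le> (F x)\<^sup>2" "0 \<le> (F y)\<^sup>2" by simp_all
    ultimately show ?thesis by (simp only: distrib_right)
  qed
  have p2: "\<bar>F x - F y\<bar> * \<bar>\<phi> x\<bar> \<le> ((F x)\<^sup>2 + (\<phi> x)\<^sup>2) + \<bar>\<phi> x\<bar> * \<bar>F y\<bar>" for x y
  proof -
    have "0 \<le> (\<bar>F x\<bar> - \<bar>\<phi> x\<bar>)\<^sup>2" by simp
    then have "2 * (\<bar>F x\<bar> * \<bar>\<phi> x\<bar>) \<le> (F x)\<^sup>2 + (\<phi> x)\<^sup>2" by (simp add: power2_diff)
    moreover have "\<bar>F x - F y\<bar> * \<bar>\<phi> x\<bar> \<le> (\<bar>F x\<bar> + \<bar>F y\<bar>) * \<bar>\<phi> x\<bar>" by (intro mult_right_mono) auto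
    moreover have "0 \<le> \<bar>F x\<bar> * \<bar>\<phi> x\<bar>" by simp
    ultimately show ?thesis by (simp only: distrib_right mult.commute[of "\<bar>\<phi> x\<bar>" "\<bar>F y\<bar>"])
  qed
  let ?g = "\<lambda>x y. \<bar>F x - F y\<bar> * \<bar>\<phi> x\<bar>"
  have gm: "pair_measurable ?g"
    using pair_measurable_fst[OF F] pair_measurable_snd[OF F] pair_measurable_fst[OF \<phi>] by measurable
  have far1: "kint s V (\<lambda>x y. (F x)\<^sup>2 + (\<phi> x)\<^sup>2) \<le> ennreal ?q * (mass s F + ?Lp)" if V: "V \<subseteq> ?S \<times> - B1" for V
  proof -
    have "kint s V (\<lambda>x y. (F x)\<^sup>2 + (\<phi> x)\<^sup>2) \<le> ennreal (far_C TYPE('a) s * (R / 16) powr - (2 * s)) * (\<integral>\<^sup>+x\<in>?S. ennreal ((F x)\<^sup>2 + (\<phi> x)\<^sup>2) \<partial>lebesgue)"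
      by (rule kint_far_fst[OF s(1) _ _ Sm]) (use R V ball_sep in auto)
    also have "(\<integral>\<^sup>+x\<in>?S. ennreal ((F x)\<^sup>2 + (\<phi> x)\<^sup>2) \<partial>lebesgue) \<le> (\<integral>\<^sup>+x. (ennreal ((F x)\<^sup>2) * indicator (ball x0 R) x + ennreal ((\<phi> x)\<^sup>2) * indicator UNIV x) \<partial>lebesgue)"
      by (rule nn_integral_mono) (use Ssub in \<open>auto simp: indicator_def simp del: mem_ball\<close>)
    also have "\<dots> = L2_norm_sq (ball x0 R) F + L2_norm_sq UNIV \<phi>"
      unfolding L2_norm_sq_def by (intro nn_integral_add borel_measurable_times_ennreal borel_measurable_indicator sqm F \<phi>) simp_all
    finally have "kint s V (\<lambda>x y. (F x)\<^sup>2 + (\<phi> x)\<^sup>2) \<le> (ennreal ?q * ennreal (R powr - (2 * s))) * (L2_norm_sq (ball x0 R) F + L2_norm_sq UNIV \<phi>)"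
      unfolding farq by (simp add: mult_left_mono)
    then show ?thesis by (simp only: mass_def mult.assoc distrib_left)
  qed
  have far2: "kint s (?S \<times> ?A) (\<lambda>x y. (F y)\<^sup>2) \<le> ennreal ?q * mass s F"
  proof -
    have "kint s (?S \<times> ?A) (\<lambda>x y. (F y)\<^sup>2) = kint s ((\<lambda>p. (snd p, fst p)) -` (?S \<times> ?A)) (\<lambda>x y. (F x)\<^sup>2)"
      by (rule kint_swap[OF m2 U(2)])
    also have "\<dots> \<le> ennreal (far_C TYPE('a) s * (R / 16) powr - (2 * s)) * (\<integral>\<^sup>+x\<in>?A. ennreal ((F x)\<^sup>2) \<partial>lebesgue)"
    proof (rule kint_far_fst[OF s(1) _ _ Am])
      fix x y assume "(x, y) \<in> (\<lambda>p. (snd p, fst p)) -` (?S \<times> ?A)"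
      then have "y \<in> ?S" "x \<in> ?A" "x \<notin> B1" by auto
      then show "x \<in> ?A \<and> R / 16 \<le> norm (x - y) \<and> (F x)\<^sup>2 \<le> (F x)\<^sup>2"
        using ball_sep[of y x] by (simp add: norm_minus_commute)
    qed (use R in auto)
    also have "(\<integral>\<^sup>+x\<in>?A. ennreal ((F x)\<^sup>2) \<partial>lebesgue) \<le> L2_norm_sq (ball x0 R) F"
      unfolding L2_norm_sq_def by (rule nn_integral_mono) (auto simp: indicator_def)
    finally have "kint s (?S \<times> ?A) (\<lambda>x y. (F y)\<^sup>2) \<le> (ennreal ?q * ennreal (R powr - (2 * s))) * L2_norm_sq (ball x0 R) F"
      unfolding farq by (simp add: mult_left_mono)
    then show ?thesis by (simp only: mass_def mult.assoc)
  qed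
  have d: "?S \<times> - B1 = ?S \<times> ?A \<union> ?S \<times> - ball x0 R" using B1_sub by auto
  have "kint s (?S \<times> ?A) ?g \<le> kint s (?S \<times> ?A) (\<lambda>x y. ((F x)\<^sup>2 + (\<phi> x)\<^sup>2) + (F y)\<^sup>2)"
    by (rule kint_mono) (use p1 in auto)
  also have "\<dots> = kint s (?S \<times> ?A) (\<lambda>x y. (F x)\<^sup>2 + (\<phi> x)\<^sup>2) + kint s (?S \<times> ?A) (\<lambda>x y. (F y)\<^sup>2)"
    by (rule kint_add[OF m1 m2 U(2)]) auto
  finally have gA: "kint s (?S \<times> ?A) ?g \<le> kint s (?S \<times> ?A) (\<lambda>x y. (F x)\<^sup>2 + (\<phi> x)\<^sup>2) + kint s (?S \<times> ?A) (\<lambda>x y. (F y)\<^sup>2)" .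
  have "kint s (?S \<times> - ball x0 R) ?g \<le> kint s (?S \<times> - ball x0 R) (\<lambda>x y. ((F x)\<^sup>2 + (\<phi> x)\<^sup>2) + \<bar>\<phi> x\<bar> * \<bar>F y\<bar>)"
    by (rule kint_mono) (use p2 in auto)
  also have "\<dots> = kint s (?S \<times> - ball x0 R) (\<lambda>x y. (F x)\<^sup>2 + (\<phi> x)\<^sup>2) + kint s (?S \<times> - ball x0 R) (\<lambda>x y. \<bar>\<phi> x\<bar> * \<bar>F y\<bar>)"
    by (rule kint_add[OF m1 m3 U(3)]) auto
  finally have gB: "kint s (?S \<times> - ball x0 R) ?g \<le> kint s (?S \<times> - ball x0 R) (\<lambda>x y. (F x)\<^sup>2 + (\<phi> x)\<^sup>2) + kint s (?S \<times> - ball x0 R) (\<lambda>x y. \<bar>\<phi> x\<bar> * \<bar>F y\<bar>)" .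
  have "kint s (?S \<times> ?A) (\<lambda>x y. (F x)\<^sup>2 + (\<phi> x)\<^sup>2) + kint s (?S \<times> - ball x0 R) (\<lambda>x y. (F x)\<^sup>2 + (\<phi> x)\<^sup>2) = kint s (?S \<times> - B1) (\<lambda>x y. (F x)\<^sup>2 + (\<phi> x)\<^sup>2)"
  proof -
    have "kint s (?S \<times> - B1) (\<lambda>x y. (F x)\<^sup>2 + (\<phi> x)\<^sup>2)
        = (\<integral>\<^sup>+p. (ennreal (((F (fst p))\<^sup>2 + (\<phi> (fst p))\<^sup>2) * kern s (fst p) (snd p)) * indicator (?S \<times> ?A) p
            + ennreal (((F (fst p))\<^sup>2 + (\<phi> (fst p))\<^sup>2) * kern s (fst p) (snd p)) * indicator (?S \<times> - ball x0 R) p) \<partial>leb_pair)"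
      unfolding kint_def d by (rule nn_integral_cong) (auto simp: indicator_def)
    also have "\<dots> = kint s (?S \<times> ?A) (\<lambda>x y. (F x)\<^sup>2 + (\<phi> x)\<^sup>2) + kint s (?S \<times> - ball x0 R) (\<lambda>x y. (F x)\<^sup>2 + (\<phi> x)\<^sup>2)"
      unfolding kint_def
      by (rule nn_integral_add) (use m1 U in \<open>auto intro!: borel_measurable_times_ennreal borel_measurable_indicator\<close>)
    finally show ?thesis ..
  qed
  note joined = this
  have Lp: "?Lp \<le> ennreal C * mass s w"
    unfolding mass_def using mult_left_mono[OF \<phi>L, of "ennreal (R powr - (2 * s))"] by (simp add: mult_ac)
  let ?F = "mass s F" and ?M = "mass s w" and ?T = "tail_sq s F"
  have "kint s (?S \<times> - B1) ?g \<le> kint s (?S \<times> ?A) ?g + kint s (?S \<times> - ball x0 R) ?g"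
    unfolding d by (rule kint_Un_le[OF gm U(2,3)])
  also have "\<dots> \<le> (kint s (?S \<times> ?A) (\<lambda>x y. (F x)\<^sup>2 + (\<phi> x)\<^sup>2) + kint s (?S \<times> ?A) (\<lambda>x y. (F y)\<^sup>2))
      + (kint s (?S \<times> - ball x0 R) (\<lambda>x y. (F x)\<^sup>2 + (\<phi> x)\<^sup>2) + kint s (?S \<times> - ball x0 R) (\<lambda>x y. \<bar>\<phi> x\<bar> * \<bar>F y\<bar>))"
    by (rule add_mono[OF gA gB])
  also have "\<dots> = kint s (?S \<times> - B1) (\<lambda>x y. (F x)\<^sup>2 + (\<phi> x)\<^sup>2) + kint s (?S \<times> ?A) (\<lambda>x y. (F y)\<^sup>2) + kint s (?S \<times> - ball x0 R) (\<lambda>x y. \<bar>\<phi> x\<bar> * \<bar>F y\<bar>)"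
    unfolding joined[symmetric] by (simp only: add_ac)
  also have "\<dots> \<le> ennreal ?q * (?F + ?Lp) + ennreal ?q * ?F + ennreal (8 powr ?p) * (ennreal ?w * ?Lp + ?T)"
    by (rule add_mono[OF add_mono[OF far1[OF subset_refl] far2] tail_pairing[OF s F \<phi>]])
  also have "\<dots> \<le> ennreal ?q * (?F + ennreal C * ?M) + ennreal ?q * ?F + ennreal (8 powr ?p) * (ennreal ?w * (ennreal C * ?M) + ?T)"
    by (intro add_mono mult_left_mono Lp order_refl) simp_all
  also have "\<dots> \<le> ennreal (cross_const s C) * (?F + ?M + ?T)"
  proof -
    have wC: "0 \<le> ?w * C" using C by simp
    have e1: "ennreal (2 + C) = 2 + ennreal C" using C by (simp add: ennreal_plus)
    have e2: "ennreal (?w * C + 1) = ennreal ?w * ennreal C + 1"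
      using C by (simp add: ennreal_plus ennreal_mult)
    have cross_const: "ennreal (cross_const s C) = ennreal ?q * ennreal (2 + C) + ennreal (8 powr ?p) * ennreal (?w * C + 1)"
    proof -
      have "ennreal (cross_const s C) = ennreal (?q * (2 + C)) + ennreal (8 powr ?p * (?w * C + 1))"
        unfolding cross_const_def by (rule ennreal_plus) (use q C wC in auto)
      also have "ennreal (?q * (2 + C)) = ennreal ?q * ennreal (2 + C)" by (rule ennreal_mult) (use q C in auto)
      also have "ennreal (8 powr ?p * (?w * C + 1)) = ennreal (8 powr ?p) * ennreal (?w * C + 1)" by (rule ennreal_mult) (use wC in auto)
      finally show ?thesis .
    qed
    let ?Z = "?F + ?M + ?T"
    have Z: "?F \<le> ?Z" "?M \<le> ?Z" "?T \<le> ?Z" by (auto simp: add_increasing add_increasing2)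
    have "ennreal ?q * (?F + ennreal C * ?M) + ennreal ?q * ?F + ennreal (8 powr ?p) * (ennreal ?w * (ennreal C * ?M) + ?T)
        \<le> ennreal ?q * (?Z + ennreal C * ?Z) + ennreal ?q * ?Z + ennreal (8 powr ?p) * (ennreal ?w * (ennreal C * ?Z) + ?Z)"
      by (intro add_mono mult_left_mono Z) simp_all
    also have "\<dots> = (ennreal ?q * (2 + ennreal C) + ennreal (8 powr ?p) * (ennreal ?w * ennreal C + 1)) * ?Z"
    proof -
      have alg: "a * (z + c * z) + a * z + b * (d * (c * z) + z) = (a * (2 + c) + b * (d * c + 1)) * z" for a b c d z :: ennreal
        by (simp add: distrib_left distrib_right mult_2_right mult_2 add_ac mult_ac)
      show ?thesis by (rule alg)
    qed
    also have "\<dots> = ennreal (cross_const s C) * ?Z" unfolding cross_const e1 e2 ..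
    finally show ?thesis .
  qed
  finally show ?thesis .
qed

end

section \<open>The Caccioppoli argument\<close>

lemma ennreal_scale_add:
  "0 \<le> a \<Longrightarrow> 0 \<le> b \<Longrightarrow> ennreal a * z + ennreal b * z = ennreal (a + b) * z"
  by (simp add: distrib_right)

lemma ennreal_scale_scale: "0 \<le> a \<Longrightarrow> ennreal a * (ennreal b * z) = ennreal (a * b) * z"
  by (simp add: ennreal_mult' mult.assoc)

lemma ennreal_absorb_quarter:
  assumes fin: "E < \<infinity>" and le: "ennreal (1 / 2) * E \<le> ennreal (1 / 4) * E + Z"
  shows "E \<le> ennreal 4 * Z"
proof (cases Z)
  case (real z)
  from fin obtain e where e: "E = ennreal e" "0 \<le> e" by (cases E) auto
  have "ennreal (1 / 2 * e) = ennreal (1 / 2) * ennreal e" by (rule ennreal_mult) (use e in auto)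
  also have "\<dots> \<le> ennreal (1 / 4) * ennreal e + ennreal z" using le unfolding e(1) real(2) .
  also have "ennreal (1 / 4) * ennreal e = ennreal (1 / 4 * e)" by (rule ennreal_mult[symmetric]) (use e in auto)
  also have "ennreal (1 / 4 * e) + ennreal z = ennreal (1 / 4 * e + z)" by (rule ennreal_plus[symmetric]) (use e real in auto)
  finally have "ennreal (1 / 2 * e) \<le> ennreal (1 / 4 * e + z)" .
  moreover have "0 \<le> 1 / 4 * e + z" using e real by simp
  ultimately have "1 / 2 * e \<le> 1 / 4 * e + z" by (simp only: ennreal_le_iff)
  then have "e \<le> 4 * z" by simp
  then have "ennreal e \<le> ennreal (4 * z)" by (rule ennreal_leI)
  also have "\<dots> = ennreal 4 * ennreal z" by (rule ennreal_mult) (use real in auto)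
  finally show ?thesis using e real by simp
next
  case top
  then show ?thesis by (simp add: ennreal_mult_top)
qed

lemma L2_norm_sq_diff_le:
  fixes f F :: "'a::euclidean_space \<Rightarrow> real"
  assumes [measurable]: "f \<in> borel_measurable lebesgue" "F \<in> borel_measurable lebesgue" and D: "D \<in> sets lebesgue"
  shows "L2_norm_sq D (\<lambda>x. f x - F x) \<le> ennreal 2 * L2_norm_sq D f + ennreal 2 * L2_norm_sq D F"
proof -
  have sq: "(a - b)\<^sup>2 \<le> 2 * a\<^sup>2 + 2 * b\<^sup>2" for a b :: real
    using zero_le_power2[of "a + b"] by (simp add: power2_eq_square algebra_simps)
  have m: "(\<lambda>x. ennreal ((v x)\<^sup>2) * indicator D x) \<in> borel_measurable lebesgue" if "v \<in> borel_measurable lebesgue" for v :: "'a \<Rightarrow> real"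
    using that D by (intro borel_measurable_times_ennreal borel_measurable_indicator) measurable
  have "L2_norm_sq D (\<lambda>x. f x - F x)
      \<le> (\<integral>\<^sup>+x. ennreal 2 * (ennreal ((f x)\<^sup>2) * indicator D x) + ennreal 2 * (ennreal ((F x)\<^sup>2) * indicator D x) \<partial>lebesgue)"
    unfolding L2_norm_sq_def
  proof (rule nn_integral_mono)
    fix x
    have "ennreal ((f x - F x)\<^sup>2) \<le> ennreal (2 * (f x)\<^sup>2 + 2 * (F x)\<^sup>2)" by (rule ennreal_leI[OF sq])
    also have "\<dots> = ennreal 2 * ennreal ((f x)\<^sup>2) + ennreal 2 * ennreal ((F x)\<^sup>2)"
      by (simp add: ennreal_mult')
    finally show "ennreal ((f x - F x)\<^sup>2) * indicator D x
        \<le> ennreal 2 * (ennreal ((f x)\<^sup>2) * indicator D x) + ennreal 2 * (ennreal ((F x)\<^sup>2) * indicator D x)"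
      by (simp add: indicator_def)
  qed
  also have "\<dots> = (\<integral>\<^sup>+x. ennreal 2 * (ennreal ((f x)\<^sup>2) * indicator D x) \<partial>lebesgue) + (\<integral>\<^sup>+x. ennreal 2 * (ennreal ((F x)\<^sup>2) * indicator D x) \<partial>lebesgue)"
    by (intro nn_integral_add borel_measurable_times_ennreal borel_measurable_const m assms)
  also have "(\<integral>\<^sup>+x. ennreal 2 * (ennreal ((f x)\<^sup>2) * indicator D x) \<partial>lebesgue) = ennreal 2 * L2_norm_sq D f"
    unfolding L2_norm_sq_def by (intro nn_integral_cmult m assms)
  also have "(\<integral>\<^sup>+x. ennreal 2 * (ennreal ((F x)\<^sup>2) * indicator D x) \<partial>lebesgue) = ennreal 2 * L2_norm_sq D F"
    unfolding L2_norm_sq_def by (intro nn_integral_cmult m assms)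
  finally show ?thesis .
qed

text \<open>
  The form is an iterated integral; since both energies are finite, the integrand is dominated
  by the sum of the two energy densities and Fubini's theorem applies.
\<close>

lemma Hs_form_product_integral:
  fixes F \<phi> :: "'a::euclidean_space \<Rightarrow> real" and s :: real
  defines "H \<equiv> \<lambda>p. (F (fst p) - F (snd p)) * (\<phi> (fst p) - \<phi> (snd p)) * kern s (fst p) (snd p)"
  assumes F: "F \<in> borel_measurable lebesgue" "kint s UNIV (\<lambda>x y. (F x - F y)\<^sup>2) < \<infinity>"
    and \<phi>: "\<phi> \<in> borel_measurable lebesgue" "kint s UNIV (\<lambda>x y. (\<phi> x - \<phi> y)\<^sup>2) < \<infinity>"
  shows "integrable leb_pair H" "Hs_form s F \<phi> = frac_const TYPE('a) s / 2 * integral\<^sup>L leb_pair H"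
proof -
  have Hm: "H \<in> borel_measurable leb_pair"
    unfolding H_def
    using pair_measurable_fst[OF F(1)] pair_measurable_snd[OF F(1)] pair_measurable_fst[OF \<phi>(1)] pair_measurable_snd[OF \<phi>(1)]
    by measurable
  show int: "integrable leb_pair H"
  proof (rule integrableI_bounded[OF Hm])
    have "(\<integral>\<^sup>+p. ennreal (norm (H p)) \<partial>leb_pair) \<le> kint s UNIV (\<lambda>x y. (F x - F y)\<^sup>2 + (\<phi> x - \<phi> y)\<^sup>2)"
      unfolding kint_def
    proof (rule nn_integral_mono)
      fix p :: "'a \<times> 'a"
      have "2 * \<bar>a * b\<bar> \<le> a\<^sup>2 + b\<^sup>2" for a b :: real
        using zero_le_power2[of "\<bar>a\<bar> - \<bar>b\<bar>"] by (simp add: power2_diff abs_mult)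
      then have "\<bar>a * b\<bar> \<le> a\<^sup>2 + b\<^sup>2" for a b :: real
        by (smt (verit) abs_ge_zero)
      then have "norm (H p) \<le> ((F (fst p) - F (snd p))\<^sup>2 + (\<phi> (fst p) - \<phi> (snd p))\<^sup>2) * kern s (fst p) (snd p)"
        unfolding H_def real_norm_def abs_mult[of _ "kern _ _ _"] by (simp add: mult_right_mono)
      then show "ennreal (norm (H p)) \<le> ennreal (((F (fst p) - F (snd p))\<^sup>2 + (\<phi> (fst p) - \<phi> (snd p))\<^sup>2) * kern s (fst p) (snd p)) * indicator UNIV p"
        by (simp add: ennreal_leI)
    qed
    also have "\<dots> = kint s UNIV (\<lambda>x y. (F x - F y)\<^sup>2) + kint s UNIV (\<lambda>x y. (\<phi> x - \<phi> y)\<^sup>2)"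
      by (rule kint_add[OF pair_measurable_diff_sq[OF F(1)] pair_measurable_diff_sq[OF \<phi>(1)]])
        (use sets.top[of leb_pair] in \<open>auto simp: space_pair_measure\<close>)
    also have "\<dots> < \<infinity>" using F(2) \<phi>(2) by simp
    finally show "(\<integral>\<^sup>+p. ennreal (norm (H p)) \<partial>leb_pair) < \<infinity>" .
  qed
  show "Hs_form s F \<phi> = frac_const TYPE('a) s / 2 * integral\<^sup>L leb_pair H"
    unfolding Hs_form_def leb2.integral_fst'[OF int, symmetric] by (simp add: H_def kern_def)
qed

context local_mesh begin

definition final_const :: "real \<Rightarrow> real \<Rightarrow> real" where
  "final_const s C = 2 + 2 * C * (16 * C + 3 + 24 * cross_const s C)"

lemma good_test_mono:
  assumes "good_test s C w" "C \<le> C'"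
  shows "good_test s C' w"
proof -
  have le: "ennreal C * z \<le> ennreal C' * z" for z by (intro mult_right_mono ennreal_leI assms(2)) simp
  from assms(1) obtain \<phi> e rem where
    1: "\<phi> \<in> fe_space_local \<Omega> Th (ball x0 R) \<and> (\<forall>x. x \<notin> ball x0 (7 / 8 * R) \<longrightarrow> \<phi> x = 0) \<and>
       pair_measurable e \<and> pair_measurable rem \<and> (\<forall>x y. 0 \<le> e x y) \<and> (\<forall>x y. 0 \<le> rem x y) \<and>
       (\<forall>x\<in>B1. \<forall>y\<in>B1. e x y / 2 \<le> (w x - w y) * (\<phi> x - \<phi> y) + rem x y)"
    and 2: "kint s BB rem \<le> ennreal (1 / 8) * kint s BB e + ennreal C * mass s w"
      "kint s BB (\<lambda>x y. (\<phi> x - \<phi> y)\<^sup>2) \<le> ennreal C * (kint s BB e + mass s w)"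
      "Hs_seminorm_sq s (ball x0 (R / 2)) w \<le> ennreal C * (kint s BB e + mass s w)"
      "L2_norm_sq UNIV \<phi> \<le> ennreal C * L2_norm_sq (ball x0 R) w"
    and 3: "kint s BB e < \<infinity>"
    unfolding good_test_def by (elim exE conjE) blast
  show ?thesis
    unfolding good_test_def
    by (rule exI[of _ \<phi>], rule exI[of _ e], rule exI[of _ rem])
      (use 1 3 2(1)[THEN order_trans[OF _ add_left_mono[OF le]]] 2(2-4)[THEN order_trans[OF _ le]] in blast)
qed

lemma cross_const_nonneg: "0 < s \<Longrightarrow> 0 \<le> C \<Longrightarrow> 0 \<le> cross_const s C"
  unfolding cross_const_def using far_C_pos[of s, where 'a='a] by (intro add_nonneg_nonneg mult_nonneg_nonneg) auto

text \<open>
  Pairs with both points in \<open>B1\<close> are treated by the test inequality and Young's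
  inequality; the constants \<open>1 / (8 * C)\<close> and \<open>2 * C\<close> make the
  \<open>\<phi>\<close> term another eighth of the energy. Any other pair has at least one
  point where \<open>\<phi>\<close> vanishes; it contributes only if the other point lies in
  the support of \<open>\<phi>\<close>, and then it is a cross pair in one of the two orders.
\<close>

lemma galerkin_energy_bound:
  assumes C: "0 < C"
    and F: "F \<in> borel_measurable lebesgue" and f: "f \<in> borel_measurable lebesgue"
    and \<phi>: "\<phi> \<in> borel_measurable lebesgue" and \<phi>0: "\<And>x. x \<notin> ball x0 (7 / 8 * R) \<Longrightarrow> \<phi> x = 0"
    and e: "pair_measurable e" "\<And>x y. 0 \<le> e x y" and rem: "pair_measurable rem" "\<And>x y. 0 \<le> rem x y"
    and test: "\<And>x y. x \<in> B1 \<Longrightarrow> y \<in> B1 \<Longrightarrow> e x y / 2 \<le> (w x - w y) * (\<phi> x - \<phi> y) + rem x y"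
    and split: "\<And>x. F x = f x - w x"
    and H: "integrable leb_pair (\<lambda>p. (F (fst p) - F (snd p)) * (\<phi> (fst p) - \<phi> (snd p)) * kern s (fst p) (snd p))"
      "integral\<^sup>L leb_pair (\<lambda>p. (F (fst p) - F (snd p)) * (\<phi> (fst p) - \<phi> (snd p)) * kern s (fst p) (snd p)) = 0"
  shows "ennreal (1 / 2) * kint s BB e \<le> kint s BB rem + ennreal (1 / (8 * C)) * kint s BB (\<lambda>x y. (\<phi> x - \<phi> y)\<^sup>2)
      + ennreal (2 * C) * kint s BB (\<lambda>x y. (f x - f y)\<^sup>2)
      + ennreal 2 * kint s (ball x0 (7 / 8 * R) \<times> - B1) (\<lambda>x y. \<bar>F x - F y\<bar> * \<bar>\<phi> x\<bar>)"
proof -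
  let ?S = "ball x0 (7 / 8 * R)"
  let ?V = "?S \<times> - B1" and ?W = "(- B1) \<times> ?S"
  let ?H = "\<lambda>p. (F (fst p) - F (snd p)) * (\<phi> (fst p) - \<phi> (snd p)) * kern s (fst p) (snd p)"
  let ?b = "\<lambda>x y. \<bar>F x - F y\<bar> * \<bar>\<phi> x\<bar>" and ?c = "\<lambda>x y. \<bar>F x - F y\<bar> * \<bar>\<phi> y\<bar>"
  let ?q = "\<lambda>x y. 1 / (8 * C) * (\<phi> x - \<phi> y)\<^sup>2" and ?r = "\<lambda>x y. 2 * C * (f x - f y)\<^sup>2"
  let ?a = "\<lambda>x y. (rem x y + ?q x y) + ?r x y"
  \<comment> \<open>A pair in none of the three regions has no point in the ball of radius 7/8 R, so the test
      function vanishes at both of its points.\<close>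
  let ?st = "\<lambda>x y. if (x, y) \<in> BB then ?a x y else if (x, y) \<in> ?V then ?b x y else if (x, y) \<in> ?W then ?c x y else 0"
  let ?g = "\<lambda>x y. if (x, y) \<in> BB then 1 / 2 * e x y else 0"
  note pF = pair_measurable_fst[OF F] pair_measurable_snd[OF F] and p\<phi> = pair_measurable_fst[OF \<phi>] pair_measurable_snd[OF \<phi>]
  have Sm: "?S \<in> sets lebesgue" "- B1 \<in> sets lebesgue" unfolding B1_def by simp_all
  then have V: "?V \<in> sets leb_pair" and W: "?W \<in> sets leb_pair" by (auto intro!: pair_measureI)
  have SB: "?S \<subseteq> B1" unfolding B1_def using R by (intro subset_ball) simp
  have qm: "pair_measurable (\<lambda>x y. (\<phi> x - \<phi> y)\<^sup>2)" and rm: "pair_measurable (\<lambda>x y. (f x - f y)\<^sup>2)"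
    by (rule pair_measurable_diff_sq[OF \<phi>], rule pair_measurable_diff_sq[OF f])
  have qm': "pair_measurable ?q" and rm': "pair_measurable ?r"
    using qm rm by (auto intro!: borel_measurable_times borel_measurable_const)
  have rqm: "pair_measurable (\<lambda>x y. rem x y + ?q x y)" by (rule borel_measurable_add[OF rem(1) qm'])
  have am: "pair_measurable ?a" by (rule borel_measurable_add[OF rqm rm'])
  have bm: "pair_measurable ?b" and cm: "pair_measurable ?c" using pF p\<phi> by measurable
  have a0: "0 \<le> ?a x y" for x y using rem(2)[of x y] C by simp
  have set: "{p \<in> space leb_pair. p \<in> U} \<in> sets leb_pair" if "U \<in> sets leb_pair" for U :: "('a \<times> 'a) set"
    using that by (simp add: space_pair_measure)
  have stm: "pair_measurable ?st"
    unfolding prod.collapse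
    by (intro measurable_If am bm cm borel_measurable_const set B1_sets(2) V W)
  have gm: "pair_measurable ?g"
    unfolding prod.collapse
    by (intro measurable_If borel_measurable_times borel_measurable_const e(1) set B1_sets(2))
  have st0: "0 \<le> ?st x y" for x y using a0[of x y] by simp
  have pt: "?g x y \<le> - ((F x - F y) * (\<phi> x - \<phi> y)) + ?st x y" for x y
  proof (cases "(x, y) \<in> BB")
    case True
    have dF: "F x - F y = (f x - f y) - (w x - w y)" by (simp add: split)
    have young: "(f x - f y) * (\<phi> x - \<phi> y) \<le> ?q x y + ?r x y"
    proof -
      define a b where "a = f x - f y" and "b = \<phi> x - \<phi> y"
      have "0 \<le> (4 * C * a - b)\<^sup>2" by simp
      then have "8 * C * (a * b) \<le> b\<^sup>2 + 8 * C * (2 * C * a\<^sup>2)" by (simp add: power2_eq_square algebra_simps)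
      also have "\<dots> = 8 * C * (1 / (8 * C) * b\<^sup>2 + 2 * C * a\<^sup>2)" using C by (simp add: field_simps)
      finally have "a * b \<le> 1 / (8 * C) * b\<^sup>2 + 2 * C * a\<^sup>2" using C by simp
      then show ?thesis by (simp only: a_def b_def)
    qed
    have "e x y / 2 \<le> (w x - w y) * (\<phi> x - \<phi> y) + rem x y" using test True by blast
    moreover have "- ((F x - F y) * (\<phi> x - \<phi> y)) = (w x - w y) * (\<phi> x - \<phi> y) - (f x - f y) * (\<phi> x - \<phi> y)"
      unfolding dF by (simp add: algebra_simps)
    ultimately have "1 / 2 * e x y \<le> - ((F x - F y) * (\<phi> x - \<phi> y)) + ?a x y" using young by linarith
    then show ?thesis using True by (simp only: if_True)
  next
    case False
    then have "x \<notin> ?S \<or> y \<notin> ?S" using SB by blast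
    then consider "x \<notin> ?S" "y \<notin> ?S" | "x \<in> ?S" "y \<notin> ?S" | "x \<notin> ?S" "y \<in> ?S" by blast
    then have "(F x - F y) * (\<phi> x - \<phi> y) \<le> ?st x y"
    proof cases
      case 1
      then have "(F x - F y) * (\<phi> x - \<phi> y) = 0" by (simp add: \<phi>0)
      then show ?thesis using st0[of x y] by linarith
    next
      case 2
      then have i: "(x, y) \<in> ?V" using False SB by blast
      have "(F x - F y) * (\<phi> x - \<phi> y) = (F x - F y) * \<phi> x" using \<phi>0[OF 2(2)] by simp
      also have "\<dots> \<le> ?b x y" unfolding abs_mult[symmetric] by (rule abs_ge_self)
      finally show ?thesis using False i by (simp only: if_True if_False)
    next
      case 3
      then have i: "(x, y) \<in> ?W" "(x, y) \<notin> ?V" using False SB by blast+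
      have "(F x - F y) * (\<phi> x - \<phi> y) = - ((F x - F y) * \<phi> y)" using \<phi>0[OF 3(1)] by simp
      also have "\<dots> \<le> ?c x y" unfolding abs_mult[symmetric] by (rule abs_ge_minus_self)
      finally show ?thesis using False i by (simp only: if_True if_False)
    qed
    then show ?thesis using False by (simp only: if_False)
  qed
  have k: "pair_measurable (\<lambda>x y. h x y * kern s x y)" if "pair_measurable h" for h :: "'a \<Rightarrow> 'a \<Rightarrow> real"
    by (rule borel_measurable_times[OF that kern_measurable])
  have main: "(\<integral>\<^sup>+p. ennreal (?g (fst p) (snd p) * kern s (fst p) (snd p)) \<partial>leb_pair)
      \<le> (\<integral>\<^sup>+p. ennreal (?st (fst p) (snd p) * kern s (fst p) (snd p)) \<partial>leb_pair)"
  proof (rule nn_integral_le_of_integral_zero[OF H])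
    fix p :: "'a \<times> 'a"
    show "0 \<le> ?g (fst p) (snd p) * kern s (fst p) (snd p)" using e(2)[of "fst p" "snd p"] by (intro mult_nonneg_nonneg) auto
    show "0 \<le> ?st (fst p) (snd p) * kern s (fst p) (snd p)" by (rule mult_nonneg_nonneg[OF st0 kern_nonneg])
    have "?g (fst p) (snd p) * kern s (fst p) (snd p)
        \<le> (- ((F (fst p) - F (snd p)) * (\<phi> (fst p) - \<phi> (snd p))) + ?st (fst p) (snd p)) * kern s (fst p) (snd p)"
      by (rule mult_right_mono[OF pt kern_nonneg])
    then show "?g (fst p) (snd p) * kern s (fst p) (snd p) \<le> - ?H p + ?st (fst p) (snd p) * kern s (fst p) (snd p)"
      by (simp only: distrib_right mult_minus_left)
  qed (rule k[OF gm], rule k[OF stm])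
  have "ennreal (1 / 2) * kint s BB e = kint s BB (\<lambda>x y. 1 / 2 * e x y)"
    by (rule kint_cmult[OF e(1) B1_sets(2), symmetric]) simp
  also have "\<dots> = (\<integral>\<^sup>+p. ennreal (?g (fst p) (snd p) * kern s (fst p) (snd p)) \<partial>leb_pair)"
    unfolding kint_def by (rule nn_integral_cong) (auto simp: indicator_def)
  also note main
  also have "(\<integral>\<^sup>+p. ennreal (?st (fst p) (snd p) * kern s (fst p) (snd p)) \<partial>leb_pair)
      \<le> (\<integral>\<^sup>+p. (ennreal (?a (fst p) (snd p) * kern s (fst p) (snd p)) * indicator BB p
          + ennreal (?b (fst p) (snd p) * kern s (fst p) (snd p)) * indicator ?V p)
          + ennreal (?c (fst p) (snd p) * kern s (fst p) (snd p)) * indicator ?W p \<partial>leb_pair)"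
  proof (rule nn_integral_mono)
    fix p :: "'a \<times> 'a"
    obtain x y where p: "p = (x, y)" by (cases p)
    have inc: "a \<le> a + z" "a \<le> z + (a + z')" "a \<le> z + (z' + a)" for a z z' :: ennreal
      by (simp_all add: add_increasing add_increasing2)
    consider "p \<in> BB" | "p \<notin> BB" "p \<in> ?V" | "p \<notin> BB" "p \<notin> ?V" "p \<in> ?W" | "p \<notin> BB" "p \<notin> ?V" "p \<notin> ?W" by blast
    then show "ennreal (?st (fst p) (snd p) * kern s (fst p) (snd p))
        \<le> (ennreal (?a (fst p) (snd p) * kern s (fst p) (snd p)) * indicator BB p
          + ennreal (?b (fst p) (snd p) * kern s (fst p) (snd p)) * indicator ?V p)
          + ennreal (?c (fst p) (snd p) * kern s (fst p) (snd p)) * indicator ?W p"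
      by cases (simp_all only: p fst_conv snd_conv if_True if_False indicator_simps mult_1_right mult_zero_right
          add_0_left add_0_right order_refl mult_zero_left ennreal_0 inc zero_le add.assoc)
  qed
  also have "\<dots> = (kint s BB ?a + kint s ?V ?b) + kint s ?W ?c"
  proof -
    have i: "(\<lambda>p. ennreal (h (fst p) (snd p) * kern s (fst p) (snd p)) * indicator U p) \<in> borel_measurable leb_pair"
      if "pair_measurable h" "U \<in> sets leb_pair" for h :: "'a \<Rightarrow> 'a \<Rightarrow> real" and U
      by (rule borel_measurable_times_ennreal[OF measurable_compose[OF k[OF that(1)] measurable_ennreal] borel_measurable_indicator[OF that(2)]])
    show ?thesis
      unfolding kint_def
      by (simp only: nn_integral_add borel_measurable_add i[OF am B1_sets(2)] i[OF bm V] i[OF cm W])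
  qed
  also have "kint s ?W ?c = kint s ?V ?b"
  proof -
    have "kint s ?W ?c = kint s ((\<lambda>p. (snd p, fst p)) -` ?W) (\<lambda>x y. ?c y x)" by (rule kint_swap[OF cm W])
    also have "(\<lambda>p. (snd p, fst p)) -` ?W = ?V" by auto
    finally show ?thesis by (simp only: abs_minus_commute)
  qed
  also have "kint s BB ?a = kint s BB (\<lambda>x y. rem x y + ?q x y) + kint s BB ?r"
    by (rule kint_add[OF rqm rm' B1_sets(2)]) (use C rem(2) in auto)
  also have "kint s BB (\<lambda>x y. rem x y + ?q x y) = kint s BB rem + kint s BB ?q"
    by (rule kint_add[OF rem(1) qm' B1_sets(2)]) (use C rem(2) in auto)
  also have "kint s BB ?q = ennreal (1 / (8 * C)) * kint s BB (\<lambda>x y. (\<phi> x - \<phi> y)\<^sup>2)"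
    by (rule kint_cmult[OF qm B1_sets(2)]) (use C in simp)
  also have "kint s BB ?r = ennreal (2 * C) * kint s BB (\<lambda>x y. (f x - f y)\<^sup>2)"
    by (rule kint_cmult[OF rm B1_sets(2)]) (use C in simp)
  finally have "ennreal (1 / 2) * kint s BB e \<le> kint s BB rem + ennreal (1 / (8 * C)) * kint s BB (\<lambda>x y. (\<phi> x - \<phi> y)\<^sup>2)
      + ennreal (2 * C) * kint s BB (\<lambda>x y. (f x - f y)\<^sup>2) + kint s ?V ?b + kint s ?V ?b" .
  then show ?thesis by (simp only: add.assoc mult_2[symmetric] ennreal_numeral)
qed

text \<open>
  All quantities are bounded by multiples of the sum \<open>Z\<close> of the right-hand side:
  the mass of \<open>w\<close> by the triangle inequality, the cross term by
  \<open>cross_bound\<close>, and then the energy by absorption.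
\<close>

theorem local_energy_estimate:
  assumes s: "0 < s" "s < 1" and C: "0 < C"
    and u: "u \<in> Hs_space s" and uh: "uh \<in> fe_space \<Omega> Th" and vh: "vh \<in> fe_space \<Omega> Th"
    and galerkin: "\<And>\<phi>. \<phi> \<in> fe_space_local \<Omega> Th (ball x0 R) \<Longrightarrow> Hs_form s (\<lambda>x. u x - uh x) \<phi> = 0"
    and good: "good_test s C (\<lambda>x. uh x - vh x)"
  shows "Hs_seminorm_sq s (ball x0 (R / 2)) (\<lambda>x. u x - uh x)
    \<le> ennreal (final_const s C) * (Hs_seminorm_sq s (ball x0 R) (\<lambda>x. u x - vh x) + mass s (\<lambda>x. u x - vh x)
        + mass s (\<lambda>x. u x - uh x) + tail_sq s (\<lambda>x. u x - uh x))"
proof -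
  define F where "F = (\<lambda>x. u x - uh x)"
  define f where "f = (\<lambda>x. u x - vh x)"
  define w where "w = (\<lambda>x. uh x - vh x)"
  have um: "u \<in> borel_measurable lebesgue" using u by (simp add: Hs_space_def)
  note uhm = fe_measurable[OF uh] and vhm = fe_measurable[OF vh]
  have Fm: "F \<in> borel_measurable lebesgue" unfolding F_def by (rule borel_measurable_diff[OF um uhm])
  have fm: "f \<in> borel_measurable lebesgue" unfolding f_def by (rule borel_measurable_diff[OF um vhm])
  have wm: "w \<in> borel_measurable lebesgue" unfolding w_def by (rule borel_measurable_diff[OF uhm vhm])
  have UN: "(UNIV :: ('a \<times> 'a) set) \<in> sets leb_pair" using sets.top[of leb_pair] by (simp add: space_pair_measure)
  have Ffin: "kint s UNIV (\<lambda>x y. (F x - F y)\<^sup>2) < \<infinity>"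
  proof -
    have "kint s UNIV (\<lambda>x y. (u x - u y)\<^sup>2) = Hs_seminorm_sq s UNIV u"
      using Hs_seminorm_sq_kint[OF um, of UNIV s] by simp
    also have "\<dots> < \<infinity>" using u by (simp add: Hs_space_def)
    finally have 1: "kint s UNIV (\<lambda>x y. (u x - u y)\<^sup>2) < \<infinity>" .
    have "kint s UNIV (\<lambda>x y. (F x - F y)\<^sup>2) \<le> ennreal 2 * kint s UNIV (\<lambda>x y. (u x - u y)\<^sup>2) + ennreal (2 * (- 1)\<^sup>2) * kint s UNIV (\<lambda>x y. (uh x - uh y)\<^sup>2)"
      using kint_sq_add_finite[OF um uhm UN, of s "- 1"] by (simp add: F_def)
    also have "\<dots> < \<infinity>" using 1 fe_energy_global[OF s uh] by (simp add: ennreal_mult_less_top)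
    finally show ?thesis .
  qed
  from good obtain \<phi> e rem where
    1: "\<phi> \<in> fe_space_local \<Omega> Th (ball x0 R) \<and> (\<forall>x. x \<notin> ball x0 (7 / 8 * R) \<longrightarrow> \<phi> x = 0) \<and>
       pair_measurable e \<and> pair_measurable rem \<and> (\<forall>x y. 0 \<le> e x y) \<and> (\<forall>x y. 0 \<le> rem x y) \<and>
       (\<forall>x\<in>B1. \<forall>y\<in>B1. e x y / 2 \<le> (w x - w y) * (\<phi> x - \<phi> y) + rem x y)"
    and krem: "kint s BB rem \<le> ennreal (1 / 8) * kint s BB e + ennreal C * mass s w"
    and k\<phi>: "kint s BB (\<lambda>x y. (\<phi> x - \<phi> y)\<^sup>2) \<le> ennreal C * (kint s BB e + mass s w)"
    and kw: "Hs_seminorm_sq s (ball x0 (R / 2)) w \<le> ennreal C * (kint s BB e + mass s w)"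
    and \<phi>L: "L2_norm_sq UNIV \<phi> \<le> ennreal C * L2_norm_sq (ball x0 R) w" and Efin: "kint s BB e < \<infinity>"
    unfolding good_test_def w_def[symmetric] by (elim exE conjE) blast
  from 1 have \<phi>: "\<phi> \<in> fe_space_local \<Omega> Th (ball x0 R)" and \<phi>0: "\<And>x. x \<notin> ball x0 (7 / 8 * R) \<Longrightarrow> \<phi> x = 0"
    and e: "pair_measurable e" "\<And>x y. 0 \<le> e x y" and rem: "pair_measurable rem" "\<And>x y. 0 \<le> rem x y"
    and test: "\<And>x y. x \<in> B1 \<Longrightarrow> y \<in> B1 \<Longrightarrow> e x y / 2 \<le> (w x - w y) * (\<phi> x - \<phi> y) + rem x y"
    by blast+
  note \<phi>fe = fe_local_fe[OF \<phi>]
  note \<phi>m = fe_measurable[OF \<phi>fe]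
  let ?H = "\<lambda>p. (F (fst p) - F (snd p)) * (\<phi> (fst p) - \<phi> (snd p)) * kern s (fst p) (snd p)"
  note Hint = Hs_form_product_integral[OF Fm Ffin \<phi>m fe_energy_global[OF s \<phi>fe]]
  have H0: "integral\<^sup>L leb_pair ?H = 0"
    using galerkin[OF \<phi>] Hint(2) frac_const_pos[OF s, where 'a='a] unfolding F_def[symmetric] by simp
  define E where "E = kint s BB e"
  define X where "X = kint s (ball x0 (7 / 8 * R) \<times> - B1) (\<lambda>x y. \<bar>F x - F y\<bar> * \<bar>\<phi> x\<bar>)"
  define A where "A = Hs_seminorm_sq s (ball x0 R) f"
  define M where "M = mass s w"
  define Z where "Z = A + mass s f + mass s F + tail_sq s F"
  have cross_const: "0 \<le> cross_const s C" by (rule cross_const_nonneg) (use s C in auto)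
  have ball: "ball x0 r \<in> sets lebesgue" for r :: real by simp
  have MZ: "M \<le> ennreal 2 * Z"
  proof -
    have "L2_norm_sq (ball x0 R) w \<le> ennreal 2 * L2_norm_sq (ball x0 R) f + ennreal 2 * L2_norm_sq (ball x0 R) F"
      using L2_norm_sq_diff_le[OF fm Fm ball[of R]] by (simp add: f_def F_def w_def)
    then have "M \<le> ennreal (R powr - (2 * s)) * (ennreal 2 * L2_norm_sq (ball x0 R) f + ennreal 2 * L2_norm_sq (ball x0 R) F)"
      unfolding M_def mass_def by (rule mult_left_mono) simp
    also have "\<dots> = ennreal 2 * (mass s f + mass s F)"
      unfolding mass_def by (simp only: distrib_left mult.left_commute)
    also have "mass s f + mass s F \<le> Z"
      unfolding Z_def add.assoc by (intro add_increasing[OF zero_le] add_left_mono add_increasing2[OF zero_le] order_refl)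
    finally show ?thesis by (simp add: mult_left_mono)
  qed
  have XZ: "X \<le> ennreal (3 * cross_const s C) * Z"
  proof -
    have "X \<le> ennreal (cross_const s C) * (mass s F + M + tail_sq s F)"
      unfolding X_def M_def by (rule cross_bound[OF s Fm \<phi>m \<phi>0 \<phi>L]) (use C in auto)
    also have "mass s F + M + tail_sq s F = M + (mass s F + tail_sq s F)" by (simp only: add_ac)
    also have "\<dots> \<le> ennreal 2 * Z + ennreal 1 * Z"
    proof (rule add_mono[OF MZ])
      show "mass s F + tail_sq s F \<le> ennreal 1 * Z"
        unfolding Z_def add.assoc ennreal_1 mult_1 by (intro add_increasing[OF zero_le] order_refl)
    qed
    also have "\<dots> = ennreal 3 * Z" by (subst ennreal_scale_add) simp_all
    finally have "X \<le> ennreal (cross_const s C) * (ennreal 3 * Z)" by (simp add: mult_left_mono)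
    also have "\<dots> = ennreal (3 * cross_const s C) * Z" using ennreal_scale_scale[OF cross_const, of 3 Z] by (simp only: mult.commute)
    finally show ?thesis .
  qed
  have AZ: "A \<le> Z" unfolding Z_def add.assoc by (intro add_increasing2[OF zero_le] order_refl)
  have kA: "kint s (D \<times> D) (\<lambda>x y. (f x - f y)\<^sup>2) \<le> A" if "D \<subseteq> ball x0 R" for D
    unfolding A_def Hs_seminorm_sq_kint[OF fm ball] by (rule kint_mono) (use that in auto)
  have EZ: "E \<le> ennreal (16 * C + 1 + 24 * cross_const s C) * Z"
  proof -
    have "ennreal (1 / 2) * E \<le> kint s BB rem + ennreal (1 / (8 * C)) * kint s BB (\<lambda>x y. (\<phi> x - \<phi> y)\<^sup>2)
        + ennreal (2 * C) * kint s BB (\<lambda>x y. (f x - f y)\<^sup>2) + ennreal 2 * X"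
      unfolding E_def X_def
      by (rule galerkin_energy_bound[where w=w, OF C Fm fm \<phi>m \<phi>0 e rem test _ Hint(1) H0])
        (simp_all add: F_def f_def w_def)
    also have "\<dots> \<le> (ennreal (1 / 8) * E + ennreal C * M) + ennreal (1 / (8 * C)) * (ennreal C * (E + M)) + ennreal (2 * C) * Z + ennreal 2 * (ennreal (3 * cross_const s C) * Z)"
      unfolding E_def M_def
      by (intro add_mono mult_left_mono krem k\<phi> XZ order_trans[OF kA[OF B1_sub] AZ]) simp_all
    also have "ennreal (1 / (8 * C)) * (ennreal C * (E + M)) = ennreal (1 / 8) * (E + M)"
      using C by (subst ennreal_scale_scale) auto
    also have "ennreal 2 * (ennreal (3 * cross_const s C) * Z) = ennreal (6 * cross_const s C) * Z"
      by (subst ennreal_scale_scale) auto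
    also have "(ennreal (1 / 8) * E + ennreal C * M) + ennreal (1 / 8) * (E + M) + ennreal (2 * C) * Z + ennreal (6 * cross_const s C) * Z
        = (ennreal (1 / 8) * E + ennreal (1 / 8) * E) + ((ennreal C * M + ennreal (1 / 8) * M) + ennreal (2 * C) * Z + ennreal (6 * cross_const s C) * Z)"
      by (simp only: distrib_left add_ac)
    also have "ennreal (1 / 8) * E + ennreal (1 / 8) * E = ennreal (1 / 4) * E" by (subst ennreal_scale_add) simp_all
    also have "ennreal C * M + ennreal (1 / 8) * M = ennreal (C + 1 / 8) * M" by (rule ennreal_scale_add) (use C in auto)
    also have "ennreal (C + 1 / 8) * M \<le> ennreal (C + 1 / 8) * (ennreal 2 * Z)" by (rule mult_left_mono[OF MZ]) simp
    also have "\<dots> = ennreal (2 * C + 1 / 4) * Z"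
      using ennreal_scale_scale[of "C + 1 / 8" 2 Z] C by (simp add: algebra_simps)
    also have "ennreal (2 * C + 1 / 4) * Z + ennreal (2 * C) * Z = ennreal (4 * C + 1 / 4) * Z"
      using ennreal_scale_add[of "2 * C + 1 / 4" "2 * C" Z] C by simp
    also have "ennreal (4 * C + 1 / 4) * Z + ennreal (6 * cross_const s C) * Z = ennreal (4 * C + 1 / 4 + 6 * cross_const s C) * Z"
      by (rule ennreal_scale_add) (use C cross_const in auto)
    finally have le: "ennreal (1 / 2) * E \<le> ennreal (1 / 4) * E + ennreal (4 * C + 1 / 4 + 6 * cross_const s C) * Z"
      by (simp add: add_left_mono add_right_mono)
    have "E \<le> ennreal 4 * (ennreal (4 * C + 1 / 4 + 6 * cross_const s C) * Z)"
      by (rule ennreal_absorb_quarter[OF _ le]) (use Efin in \<open>simp add: E_def\<close>)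
    also have "\<dots> = ennreal (4 * (4 * C + 1 / 4 + 6 * cross_const s C)) * Z" by (rule ennreal_scale_scale) simp
    also have "4 * (4 * C + 1 / 4 + 6 * cross_const s C) = 16 * C + 1 + 24 * cross_const s C" by simp
    finally show ?thesis .
  qed
  have "Hs_seminorm_sq s (ball x0 (R / 2)) F \<le> ennreal 2 * A + ennreal 2 * Hs_seminorm_sq s (ball x0 (R / 2)) w"
  proof -
    have "kint s (ball x0 (R / 2) \<times> ball x0 (R / 2)) (\<lambda>x y. (F x - F y)\<^sup>2)
        \<le> ennreal 2 * kint s (ball x0 (R / 2) \<times> ball x0 (R / 2)) (\<lambda>x y. (f x - f y)\<^sup>2)
          + ennreal (2 * (- 1)\<^sup>2) * kint s (ball x0 (R / 2) \<times> ball x0 (R / 2)) (\<lambda>x y. (w x - w y)\<^sup>2)"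
    proof -
      have "F x = f x + (- 1) * w x" for x by (simp add: F_def f_def w_def)
      then show ?thesis
        using kint_sq_add_finite[OF fm wm, of "ball x0 (R / 2) \<times> ball x0 (R / 2)" s "- 1"] by simp
    qed
    also have "\<dots> \<le> ennreal 2 * A + ennreal (2 * (- 1)\<^sup>2) * kint s (ball x0 (R / 2) \<times> ball x0 (R / 2)) (\<lambda>x y. (w x - w y)\<^sup>2)"
      by (intro add_right_mono mult_left_mono kA subset_ball) (use R in auto)
    finally show ?thesis by (simp add: Hs_seminorm_sq_kint[OF Fm ball] Hs_seminorm_sq_kint[OF wm ball])
  qed
  also have "\<dots> \<le> ennreal 2 * Z + ennreal 2 * (ennreal C * (ennreal (16 * C + 1 + 24 * cross_const s C) * Z + ennreal 2 * Z))"
    by (intro add_mono mult_left_mono AZ order_trans[OF kw] EZ[unfolded E_def] MZ[unfolded M_def]) simp_all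
  also have "ennreal (16 * C + 1 + 24 * cross_const s C) * Z + ennreal 2 * Z = ennreal (16 * C + 3 + 24 * cross_const s C) * Z"
    using ennreal_scale_add[of "16 * C + 1 + 24 * cross_const s C" 2 Z] C cross_const by (simp add: add_ac)
  also have "ennreal C * (ennreal (16 * C + 3 + 24 * cross_const s C) * Z) = ennreal (C * (16 * C + 3 + 24 * cross_const s C)) * Z"
    by (rule ennreal_scale_scale) (use C in simp)
  also have "ennreal 2 * (ennreal (C * (16 * C + 3 + 24 * cross_const s C)) * Z) = ennreal (2 * (C * (16 * C + 3 + 24 * cross_const s C))) * Z"
    by (rule ennreal_scale_scale) simp
  also have "ennreal 2 * Z + ennreal (2 * (C * (16 * C + 3 + 24 * cross_const s C))) * Z = ennreal (2 + 2 * (C * (16 * C + 3 + 24 * cross_const s C))) * Z"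
    by (rule ennreal_scale_add) (use C cross_const in auto)
  finally show ?thesis by (simp only: final_const_def Z_def A_def F_def f_def mult.assoc)
qed

end

section \<open>The local energy estimate\<close>

lemma shape_const_bound:
  assumes "shape_const \<T> = ereal \<sigma>" "Th \<in> \<T>" "T \<in> Th" and T: "int DIM('a) simplex (T :: 'a::euclidean_space set)"
  shows "diameter T \<le> \<sigma> * inball_diameter T"
proof -
  have "ereal (diameter T / inball_diameter T) \<le> ereal \<sigma>"
    unfolding assms(1)[symmetric] shape_const_def using assms(2,3) by (meson SUP_upper2 SUP_upper)
  then show ?thesis using inball_diameter_pos[OF T] by (simp add: pos_divide_le_eq)
qed

lemma local_mesh_size_bound:
  assumes "finite Th" "16 * local_mesh_size Th B \<le> R" "T \<in> Th" "T \<inter> B \<noteq> {}"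
  shows "16 * diameter T \<le> R"
proof -
  have "diameter T \<le> local_mesh_size Th B"
    unfolding local_mesh_size_def using assms by (intro Max_ge) auto
  then show ?thesis using assms(2) by linarith
qed

lemma fe_space_diff:
  assumes v: "v \<in> fe_space \<Omega> Th" and w: "w \<in> fe_space \<Omega> Th"
  shows "(\<lambda>x. v x - w x) \<in> fe_space \<Omega> Th"
proof -
  have "\<exists>a c. \<forall>x\<in>T. v x - w x = a \<bullet> x + c" if "T \<in> Th" for T
  proof -
    have ac: "\<exists>a c. \<forall>x\<in>T. z x = a \<bullet> x + c" if "z \<in> fe_space \<Omega> Th" for z
      using that \<open>T \<in> Th\<close> by (simp add: fe_space_def)
    from ac[OF v] obtain a c where "\<forall>x\<in>T. v x = a \<bullet> x + c" by blast
    moreover from ac[OF w] obtain a' c' where "\<forall>x\<in>T. w x = a' \<bullet> x + c'" by blast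
    ultimately have "\<forall>x\<in>T. v x - w x = (a - a') \<bullet> x + (c - c')" by (simp add: inner_diff_left)
    then show ?thesis by blast
  qed
  then show ?thesis using v w by (auto simp: fe_space_def intro: continuous_on_diff)
qed

theorem theorem5p1:
  fixes s \<sigma> :: real
  assumes "0 < s" and "s < 1"
  shows "\<exists>C>0. \<forall>(\<Omega> :: 'a::euclidean_space set) \<T> Th x0 R u uh.
    open \<Omega> \<and> connected \<Omega> \<and> bounded \<Omega> \<and>
    (\<forall>Th'\<in>\<T>. mesh \<Omega> Th') \<and> shape_const \<T> = ereal \<sigma> \<and> Th \<in> \<T> \<and>
    x0 \<in> \<Omega> \<and> 0 < R \<and> ball x0 R \<subseteq> \<Omega> \<and>
    u \<in> Hs_tilde s \<Omega> \<and> uh \<in> fe_space \<Omega> Th \<and>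
    (\<forall>vh\<in>fe_space_local \<Omega> Th (ball x0 R). Hs_form s (\<lambda>x. u x - uh x) vh = 0) \<and>
    16 * local_mesh_size Th (ball x0 R) \<le> R
    \<longrightarrow> (\<forall>vh\<in>fe_space \<Omega> Th.
      Hs_seminorm_sq s (ball x0 (R / 2)) (\<lambda>x. u x - uh x)
        \<le> ennreal C * Hs_seminorm_sq s (ball x0 R) (\<lambda>x. u x - vh x)
        + ennreal (C / R powr (2 * s)) * L2_norm_sq (ball x0 R) (\<lambda>x. u x - vh x)
        + ennreal (C * R powr (real DIM('a) + 2 * s)) *
            (\<integral>\<^sup>+x\<in>- ball x0 R. ennreal (\<bar>u x - vh x\<bar> / norm (x - x0) powr (real DIM('a) + 2 * s)) \<partial>lebesgue)\<^sup>2
        + ennreal (C / R powr (2 * s)) * L2_norm_sq (ball x0 R) (\<lambda>x. u x - uh x)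
        + ennreal (C * R powr (real DIM('a) + 2 * s)) *
            (\<integral>\<^sup>+x\<in>- ball x0 R. ennreal (\<bar>u x - uh x\<bar> / norm (x - x0) powr (real DIM('a) + 2 * s)) \<partial>lebesgue)\<^sup>2)"
proof -
  \<comment> \<open>The constant is fixed before the mesh: it depends only on the dimension, s and the shape
      constant.\<close>
  define C0 where "C0 = max 1 (if DIM('a) = 1 then mesh_line.Cline TYPE('a) s else local_mesh.Cmulti TYPE('a) \<sigma> s)"
  define C where "C = max 1 (local_mesh.final_const TYPE('a) s C0)"
  show ?thesis
  proof (intro exI[of _ C] conjI allI impI ballI)
    show "0 < C" by (simp add: C_def)
    fix \<Omega> :: "'a set" and \<T> Th x0 R u uh vh
    assume hyps: "open \<Omega> \<and> connected \<Omega> \<and> bounded \<Omega> \<and>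
      (\<forall>Th'\<in>\<T>. mesh \<Omega> Th') \<and> shape_const \<T> = ereal \<sigma> \<and> Th \<in> \<T> \<and>
      x0 \<in> \<Omega> \<and> 0 < R \<and> ball x0 R \<subseteq> \<Omega> \<and>
      u \<in> Hs_tilde s \<Omega> \<and> uh \<in> fe_space \<Omega> Th \<and>
      (\<forall>vh\<in>fe_space_local \<Omega> Th (ball x0 R). Hs_form s (\<lambda>x. u x - uh x) vh = 0) \<and>
      16 * local_mesh_size Th (ball x0 R) \<le> R" and vh: "vh \<in> fe_space \<Omega> Th"
    then have mesh: "mesh \<Omega> Th" and op: "open \<Omega>" and R: "0 < R" and sub: "ball x0 R \<subseteq> \<Omega>"
      and sh: "shape_const \<T> = ereal \<sigma>" "Th \<in> \<T>" and sz: "16 * local_mesh_size Th (ball x0 R) \<le> R"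
      and u: "u \<in> Hs_space s" and uh: "uh \<in> fe_space \<Omega> Th"
      and gal: "\<And>\<phi>. \<phi> \<in> fe_space_local \<Omega> Th (ball x0 R) \<Longrightarrow> Hs_form s (\<lambda>x. u x - uh x) \<phi> = 0"
      by (auto simp: Hs_tilde_def)
    have fin: "finite Th" and simp: "\<And>T. T \<in> Th \<Longrightarrow> int DIM('a) simplex T"
      using mesh by (auto simp: mesh_def triangulation_def)
    interpret local_mesh \<Omega> Th x0 R \<sigma>
    proof
      fix T assume "T \<in> Th"
      then show "diameter T \<le> \<sigma> * inball_diameter T" by (intro shape_const_bound[OF sh] simp)
      assume "T \<inter> ball x0 R \<noteq> {}"
      then show "16 * diameter T \<le> R" by (rule local_mesh_size_bound[OF fin sz \<open>T \<in> Th\<close>])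
    qed (use mesh op R sub in auto)
    let ?w = "\<lambda>x. uh x - vh x"
    have w: "?w \<in> fe_space \<Omega> Th" by (rule fe_space_diff[OF uh vh])
    have "good_test s C0 ?w"
    proof (cases "DIM('a) = 1")
      case True
      obtain b :: 'a where b: "b \<in> Basis" using nonempty_Basis by blast
      have "mesh_line \<Omega> Th x0 R \<sigma> b"
        by (intro mesh_line.intro local_mesh_axioms mesh_line_axioms.intro) (rule True, rule norm_Basis[OF b])
      from mesh_line.good_test_line[OF this assms w] show ?thesis
        by (rule good_test_mono) (simp only: C0_def True if_True max.cobounded2 refl)
    next
      case False
      then have "2 \<le> DIM('a)" using DIM_positive[where 'a='a] by linarith
      from good_test_multi[OF assms this w] show ?thesis
        by (rule good_test_mono) (simp only: C0_def False if_False max.cobounded2)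
    qed
    then have "Hs_seminorm_sq s (ball x0 (R / 2)) (\<lambda>x. u x - uh x)
      \<le> ennreal (final_const s C0) * (Hs_seminorm_sq s (ball x0 R) (\<lambda>x. u x - vh x) + mass s (\<lambda>x. u x - vh x)
        + mass s (\<lambda>x. u x - uh x) + tail_sq s (\<lambda>x. u x - uh x))"
      by (intro local_energy_estimate[OF assms _ u uh vh gal]) (auto simp: C0_def)
    also have "\<dots> \<le> ennreal C * (Hs_seminorm_sq s (ball x0 R) (\<lambda>x. u x - vh x) + mass s (\<lambda>x. u x - vh x)
        + mass s (\<lambda>x. u x - uh x) + tail_sq s (\<lambda>x. u x - uh x))"
      by (intro mult_right_mono ennreal_leI) (auto simp: C_def)
    also have "\<dots> = ennreal C * Hs_seminorm_sq s (ball x0 R) (\<lambda>x. u x - vh x)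
        + ennreal (C / R powr (2 * s)) * L2_norm_sq (ball x0 R) (\<lambda>x. u x - vh x)
        + ennreal (C / R powr (2 * s)) * L2_norm_sq (ball x0 R) (\<lambda>x. u x - uh x)
        + ennreal (C * R powr (real DIM('a) + 2 * s)) * (tail s (\<lambda>x. u x - uh x))\<^sup>2"
    proof -
      have C0: "0 \<le> C" by (simp add: C_def)
      have m: "ennreal C * mass s v = ennreal (C / R powr (2 * s)) * L2_norm_sq (ball x0 R) v" for v
        unfolding mass_def powr_minus_divide ennreal_scale_scale[OF C0] by simp
      have t: "ennreal C * tail_sq s v = ennreal (C * R powr (real DIM('a) + 2 * s)) * (tail s v)\<^sup>2" for v
        unfolding tail_sq_def by (rule ennreal_scale_scale[OF C0])
      show ?thesis by (simp only: distrib_left m t)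
    qed
    finally show "Hs_seminorm_sq s (ball x0 (R / 2)) (\<lambda>x. u x - uh x)
        \<le> ennreal C * Hs_seminorm_sq s (ball x0 R) (\<lambda>x. u x - vh x)
        + ennreal (C / R powr (2 * s)) * L2_norm_sq (ball x0 R) (\<lambda>x. u x - vh x)
        + ennreal (C * R powr (real DIM('a) + 2 * s)) *
            (\<integral>\<^sup>+x\<in>- ball x0 R. ennreal (\<bar>u x - vh x\<bar> / norm (x - x0) powr (real DIM('a) + 2 * s)) \<partial>lebesgue)\<^sup>2
        + ennreal (C / R powr (2 * s)) * L2_norm_sq (ball x0 R) (\<lambda>x. u x - uh x)
        + ennreal (C * R powr (real DIM('a) + 2 * s)) *
            (\<integral>\<^sup>+x\<in>- ball x0 R. ennreal (\<bar>u x - uh x\<bar> / norm (x - x0) powr (real DIM('a) + 2 * s)) \<partial>lebesgue)\<^sup>2"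
      unfolding tail_def
      by (rule order_trans) (intro add_right_mono add_increasing2[OF zero_le] order_refl)
  qed
qed

end
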